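(* Suppose $V$ is a finite signed Borel measure on $\mathbb R$ which is supported in $[-R_0,R_0]$ for some $R_0>0$. Fix $\chi\in C_0^\infty(\mathbb R;[0,1])$ such that $\chi=1$ near $[-R_0,R_0]$, and fix $\lambda_0>0$. There exist $C,\varepsilon_0>0$ so that for all $\lambda\in\mathbb C$ with $|\mathrm{Re}\,\lambda|\ge\lambda_0$ and $|\mathrm{Im}\,\lambda|\le\varepsilon_0$, $$\|\chi(-\partial_x^2+V-\lambda^2)^{-1}\chi\|_{L^2(\mathbb R)\to H^k(\mathbb R)}\le C|\mathrm{Re}\,\lambda|^{k-1},\qquad k=0,1\quad(H^0(\mathbb R)=L^2(\mathbb R)),$$ and $$\|\chi(-\partial_x^2+V-\lambda^2)^{-1}\chi\|_{L^2(\mathbb R)\to\mathcal D}\le C(|\mathrm{Re}\,\lambda|+1),$$ where $\mathcal D$ is equipped with the graph norm $\|u\|_{\mathcal D}=\big(\|(-\partial_x^2+V)u\|_{L^2}^2+\|u\|_{L^2}^2\big)^{1/2}$, and $\chi(-\partial_x^2+V-\lambda^2)^{-1}\chi$ denotes the meromorphically continued cutoff resolvent (in particular it has no poles in this region).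
   Context: For $u\in H^1(\mathbb R)$ with bounded continuous representative $u_c$, set $(-\partial_x^2+V)u=-u''+u_cV$ in the sense of distributions. The operator $H=-\partial_x^2+V$ is self-adjoint on $L^2(\mathbb R)$ with domain $\mathcal D=\{u\in H^1(\mathbb R):u'\in L^\infty(\mathbb R),\ -u''+u_cV\in L^2(\mathbb R)\}$. In $\mathrm{Im}\,\lambda>0$ the resolvent $(H-\lambda^2)^{-1}:L^2(\mathbb R)\to\mathcal D$ is meromorphic, with poles exactly at those $\lambda$ for which $\lambda^2<0$ is an eigenvalue of $H$. For $\chi\in C_0^\infty(\mathbb R;[0,1])$ with $\chi=1$ near $[-R_0,R_0]$, the cutoff resolvent $\chi(H-\lambda^2)^{-1}\chi:L^2(\mathbb R)\to\mathcal D$ continues meromorphically from $\mathrm{Im}\,\lambda>0$ to all of $\mathbb C$; for $\mathrm{Im}\,\lambda\le 0$ the notation $\chi(-\partial_x^2+V-\lambda^2)^{-1}\chi$ refers to this continuation. *)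

theory Defs
  imports "HOL-Analysis.Analysis"
begin

section \<open>Finite signed Borel measures on the line\<close>

text \<open>Only the values on Borel sets are meaningful.\<close>

definition signed_borel_measure :: "(real set \<Rightarrow> real) \<Rightarrow> bool" where
  "signed_borel_measure V \<longleftrightarrow>
     V {} = 0 \<and>
     (\<forall>A :: nat \<Rightarrow> real set. range A \<subseteq> sets borel \<longrightarrow> disjoint_family A \<longrightarrow>
        (\<lambda>i. V (A i)) sums V (\<Union>i. A i))"

definition measure_supported_in :: "(real set \<Rightarrow> real) \<Rightarrow> real set \<Rightarrow> bool" where
  "measure_supported_in V K \<longleftrightarrow> (\<forall>A \<in> sets borel. A \<inter> K = {} \<longrightarrow> V A = 0)"

text \<open>
  The upper variation \<open>V\<^sup>+(A) = sup {V(B). B \<subseteq> A Borel}\<close>; the coercion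
  \<open>ennreal\<close> sends negative reals to \<open>0\<close>, which does not change the supremum because
  \<open>B = {}\<close> is admitted. The integral against \<open>V\<close> is taken along the Jordan decomposition
  \<open>V = V\<^sup>+ - V\<^sup>-\<close>.
\<close>

definition upper_variation :: "(real set \<Rightarrow> real) \<Rightarrow> real measure" where
  "upper_variation V =
     measure_of UNIV (sets borel) (\<lambda>A. SUP B \<in> {B \<in> sets borel. B \<subseteq> A}. ennreal (V B))"

definition signed_integral :: "(real set \<Rightarrow> real) \<Rightarrow> (real \<Rightarrow> complex) \<Rightarrow> complex" where
  "signed_integral V f =
     integral\<^sup>L (upper_variation V) f - integral\<^sup>L (upper_variation (\<lambda>A. - V A)) f"


section \<open>Test functions, $L^2$ and Sobolev spaces\<close>

definition nderiv :: "nat \<Rightarrow> (real \<Rightarrow> 'a::real_normed_vector) \<Rightarrow> real \<Rightarrow> 'a" where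
  "nderiv n f = ((\<lambda>g x. vector_derivative g (at x)) ^^ n) f"

definition test_function :: "(real \<Rightarrow> 'a::real_normed_vector) \<Rightarrow> bool" where
  "test_function \<phi> \<longleftrightarrow>
     (\<forall>n x. nderiv n \<phi> differentiable (at x)) \<and> compact (closure {x. \<phi> x \<noteq> 0})"

text \<open>
  Elements of $L^2(\mathbb{R})$ are represented by Borel functions; everything below depends
  only on classes modulo equality almost everywhere.
\<close>

definition ae_eq :: "(real \<Rightarrow> complex) \<Rightarrow> (real \<Rightarrow> complex) \<Rightarrow> bool" where
  "ae_eq f g \<longleftrightarrow> (AE x in lborel. f x = g x)"

definition L2 :: "(real \<Rightarrow> complex) set" where
  "L2 = {f \<in> borel_measurable borel. integrable lborel (\<lambda>x. (cmod (f x))\<^sup>2)}"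

definition L2_norm :: "(real \<Rightarrow> complex) \<Rightarrow> real" where
  "L2_norm f = sqrt (\<integral>x. (cmod (f x))\<^sup>2 \<partial>lborel)"

definition ess_bounded :: "(real \<Rightarrow> complex) \<Rightarrow> bool" where
  "ess_bounded f \<longleftrightarrow> f \<in> borel_measurable borel \<and> (\<exists>B. AE x in lborel. cmod (f x) \<le> B)"

definition has_weak_deriv :: "nat \<Rightarrow> (real \<Rightarrow> complex) \<Rightarrow> (real \<Rightarrow> complex) \<Rightarrow> bool" where
  "has_weak_deriv j u v \<longleftrightarrow> u \<in> L2 \<and> v \<in> L2 \<and>
     (\<forall>\<phi> :: real \<Rightarrow> complex. test_function \<phi> \<longrightarrow>
        (\<integral>x. u x * nderiv j \<phi> x \<partial>lborel) = (-1) ^ j * (\<integral>x. v x * \<phi> x \<partial>lborel))"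

definition weak_deriv :: "nat \<Rightarrow> (real \<Rightarrow> complex) \<Rightarrow> real \<Rightarrow> complex" where
  "weak_deriv j u = (SOME v. has_weak_deriv j u v)"

definition sobolev :: "nat \<Rightarrow> (real \<Rightarrow> complex) set" where
  "sobolev k = {u. \<forall>j\<le>k. \<exists>v. has_weak_deriv j u v}"

text \<open>Norms on subspaces of $L^2$ are extended by \<open>\<infinity>\<close> to functions outside the subspace.\<close>

definition sobolev_norm :: "nat \<Rightarrow> (real \<Rightarrow> complex) \<Rightarrow> ennreal" where
  "sobolev_norm k u =
     (if u \<in> sobolev k then ennreal (sqrt (\<Sum>j\<le>k. (L2_norm (weak_deriv j u))\<^sup>2)) else \<infinity>)"

definition cont_rep :: "(real \<Rightarrow> complex) \<Rightarrow> real \<Rightarrow> complex" where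
  "cont_rep u = (THE w. continuous_on UNIV w \<and> bounded (range w) \<and> ae_eq w u)"


section \<open>The operator $H = -\partial_x^2 + V$\<close>

definition schrodinger_dist ::
    "(real set \<Rightarrow> real) \<Rightarrow> (real \<Rightarrow> complex) \<Rightarrow> (real \<Rightarrow> complex) \<Rightarrow> complex" where
  "schrodinger_dist V u \<phi> =
     - (\<integral>x. u x * nderiv 2 \<phi> x \<partial>lborel) + signed_integral V (\<lambda>x. cont_rep u x * \<phi> x)"

definition has_schrodinger ::
    "(real set \<Rightarrow> real) \<Rightarrow> (real \<Rightarrow> complex) \<Rightarrow> (real \<Rightarrow> complex) \<Rightarrow> bool" where
  "has_schrodinger V u g \<longleftrightarrow> g \<in> L2 \<and>
     (\<forall>\<phi>. test_function \<phi> \<longrightarrow> schrodinger_dist V u \<phi> = (\<integral>x. g x * \<phi> x \<partial>lborel))"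

definition op_domain :: "(real set \<Rightarrow> real) \<Rightarrow> (real \<Rightarrow> complex) set" where
  "op_domain V =
     {u \<in> sobolev 1. ess_bounded (weak_deriv 1 u) \<and> (\<exists>g. has_schrodinger V u g)}"

definition schrodinger :: "(real set \<Rightarrow> real) \<Rightarrow> (real \<Rightarrow> complex) \<Rightarrow> real \<Rightarrow> complex" where
  "schrodinger V u = (SOME g. has_schrodinger V u g)"

definition graph_norm :: "(real set \<Rightarrow> real) \<Rightarrow> (real \<Rightarrow> complex) \<Rightarrow> ennreal" where
  "graph_norm V u =
     (if u \<in> op_domain V
      then ennreal (sqrt ((L2_norm (schrodinger V u))\<^sup>2 + (L2_norm u)\<^sup>2)) else \<infinity>)"

definition op_eigenvalue :: "(real set \<Rightarrow> real) \<Rightarrow> complex \<Rightarrow> bool" where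
  "op_eigenvalue V z \<longleftrightarrow>
     (\<exists>u \<in> op_domain V. \<not> ae_eq u (\<lambda>x. 0) \<and> ae_eq (schrodinger V u) (\<lambda>x. z * u x))"

definition resolvent :: "(real set \<Rightarrow> real) \<Rightarrow> complex \<Rightarrow> (real \<Rightarrow> complex) \<Rightarrow> real \<Rightarrow> complex" where
  "resolvent V z f =
     (SOME u. u \<in> op_domain V \<and> ae_eq (\<lambda>x. schrodinger V u x - z * u x) f)"


section \<open>Meromorphic families of operators\<close>

type_synonym operator = "(real \<Rightarrow> complex) \<Rightarrow> real \<Rightarrow> complex"

text \<open>
  Operators from $L^2$ to the space \<open>{u. N u < \<infinity>}\<close> normed by \<open>N\<close>.
\<close>

definition op_norm :: "((real \<Rightarrow> complex) \<Rightarrow> ennreal) \<Rightarrow> operator \<Rightarrow> ennreal" where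
  "op_norm N T = (SUP f \<in> {f \<in> L2. L2_norm f \<le> 1}. N (T f))"

definition bounded_op :: "((real \<Rightarrow> complex) \<Rightarrow> ennreal) \<Rightarrow> operator \<Rightarrow> bool" where
  "bounded_op N T \<longleftrightarrow>
     (\<forall>f\<in>L2. \<forall>g\<in>L2. ae_eq f g \<longrightarrow> ae_eq (T f) (T g)) \<and>
     (\<forall>f\<in>L2. \<forall>g\<in>L2. \<forall>c. ae_eq (T (\<lambda>x. c * f x + g x)) (\<lambda>x. c * T f x + T g x)) \<and>
     op_norm N T < \<infinity>"

definition holomorphic_family ::
    "((real \<Rightarrow> complex) \<Rightarrow> ennreal) \<Rightarrow> complex set \<Rightarrow> (complex \<Rightarrow> operator) \<Rightarrow> bool" where
  "holomorphic_family N S A \<longleftrightarrow>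
     (\<forall>z\<in>S. bounded_op N (A z) \<and>
        (\<exists>A'. bounded_op N A' \<and>
           ((\<lambda>w. op_norm N (\<lambda>f x. (A w f x - A z f x) / (w - z) - A' f x)) \<longlongrightarrow> 0)
             (at z within S)))"

definition regular_at ::
    "((real \<Rightarrow> complex) \<Rightarrow> ennreal) \<Rightarrow> (complex \<Rightarrow> operator) \<Rightarrow> complex \<Rightarrow> bool" where
  "regular_at N A z \<longleftrightarrow> (\<exists>r>0. holomorphic_family N (ball z r) A)"

definition pole_at ::
    "((real \<Rightarrow> complex) \<Rightarrow> ennreal) \<Rightarrow> (complex \<Rightarrow> operator) \<Rightarrow> complex \<Rightarrow> bool" where
  "pole_at N A z \<longleftrightarrow>
     (\<exists>r>0. \<exists>n>0. \<exists>B. holomorphic_family N (ball z r) B \<and>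
        \<not> (\<forall>f\<in>L2. ae_eq (B z f) (\<lambda>x. 0)) \<and>
        (\<forall>w \<in> ball z r - {z}. \<forall>f\<in>L2. ae_eq (A w f) (\<lambda>x. B w f x / (w - z) ^ n)))"

text \<open>Removable singularities are required to have been removed; the value at a pole is arbitrary.\<close>

definition meromorphic_family ::
    "((real \<Rightarrow> complex) \<Rightarrow> ennreal) \<Rightarrow> (complex \<Rightarrow> operator) \<Rightarrow> bool" where
  "meromorphic_family N A \<longleftrightarrow> (\<forall>z. regular_at N A z \<or> pole_at N A z)"


section \<open>The continued cutoff resolvent\<close>

definition continues_cutoff_resolvent ::
    "(real set \<Rightarrow> real) \<Rightarrow> (real \<Rightarrow> real) \<Rightarrow> (complex \<Rightarrow> operator) \<Rightarrow> bool" where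
  "continues_cutoff_resolvent V \<psi> A \<longleftrightarrow>
     meromorphic_family (graph_norm V) A \<and>
     (\<forall>\<mu>. Im \<mu> > 0 \<longrightarrow> \<not> op_eigenvalue V (\<mu>\<^sup>2) \<longrightarrow>
        (\<forall>f\<in>L2. ae_eq (A \<mu> f)
           (\<lambda>x. \<psi> x * resolvent V (\<mu>\<^sup>2) (\<lambda>y. \<psi> y * f y) x)))"

text \<open>
  By the identity theorem the continuation is unique away from its poles, modulo equality almost
  everywhere, so the choice is immaterial there.
\<close>

definition cutoff_resolvent ::
    "(real set \<Rightarrow> real) \<Rightarrow> (real \<Rightarrow> real) \<Rightarrow> complex \<Rightarrow> operator" where
  "cutoff_resolvent V \<psi> = (SOME A. continues_cutoff_resolvent V \<psi> A)"

end

theory Submission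
  imports Defs "HOL-Complex_Analysis.Complex_Analysis"
begin

text \<open>
  On the left of the support of \<open>V\<close> the Jost solution \<open>em\<close> equals \<open>e\<^bsup>- i \<lambda> x\<^esup>\<close>; it solves a
  Volterra integral equation and hence is entire in \<open>\<lambda>\<close>. So is the solution \<open>pv\<close> of
  \<open>- u'' + V u = \<lambda>\<^sup>2 u + f\<close> that vanishes on the far left. Exactly one multiple of \<open>em\<close>,
  with denominator the Wronskian \<open>W(\<lambda>)\<close> of the two Jost solutions, makes \<open>pv\<close> outgoing on
  the right as well. The cut-off resolvent is thus an entire family divided by \<open>W(\<lambda>)\<close>: for
  \<open>Im \<lambda> > 0\<close> because outgoing solutions decay, so that uniqueness in the domain applies, and
  elsewhere by the identity theorem.

  In a strip the Volterra equation gives solutions bounded uniformly in \<open>\<lambda>\<close> and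
  \<open>W(\<lambda>) = 2 i \<lambda> + O(1)\<close>, which settles large \<open>|Re \<lambda>|\<close>. For the remaining compact part
  \<open>W\<close> has no zero on \<open>\<real> - {0}\<close>: at a zero, \<open>em\<close> satisfies the Lippmann-Schwinger equation, and
  the imaginary part of that equation integrated against \<open>cnj em V\<close> shows that the outgoing waves
  of \<open>em\<close> have amplitude zero on both sides. By continuity \<open>W\<close> has no zero near \<open>\<real> - {0}\<close> either.
\<close>

section \<open>Smooth functions and test functions\<close>

text \<open>Weak derivatives, \<open>schrodinger\<close>, \<open>resolvent\<close> and
  \<open>cutoff_resolvent\<close> are \<open>SOME\<close> choices, determined at best almost
  everywhere. The proof therefore works with explicit witnesses (\<open>Hdata\<close>) and returns
  to the chosen objects through uniqueness. Atoms of the measure shape the rest: derivatives jump at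
  them, so the equation is treated in integrated form with a continuous kernel, not as an ordinary
  differential equation. The power \<open>k - 1\<close> has two origins: the causal kernel is sin(l
  t)/l, and in the strip the Wronskian is bounded below by a multiple of |l|. A solution is then
  O(1/|l|), its derivative O(1), and the operator applied to it O(|l|) through the term l^2 u. The
  pointwise bounds on the cut-off solutions are uniform over the unit ball of \<open>L2\<close> and
  confined to a bounded interval; Cauchy estimates in l turn them into holomorphy in operator norm.
  Finally, \<open>pole_at\<close> demands a nonzero leading coefficient, so at every zero of the
  Wronskian a source with nonvanishing response has to be exhibited.\<close>

definition smooth :: "(real \<Rightarrow> 'a::real_normed_vector) \<Rightarrow> bool" where
  "smooth f \<longleftrightarrow> (\<forall>n x. nderiv n f differentiable (at x))"

lemma nderiv_0 [simp]: "nderiv 0 f = f"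
  by (simp add: nderiv_def)

definition vderiv :: "(real \<Rightarrow> 'a::real_normed_vector) \<Rightarrow> real \<Rightarrow> 'a" where
  "vderiv f = (\<lambda>x. vector_derivative f (at x))"

text \<open>Peels off the innermost derivative, so that inductions on the order generalize over the
  function.\<close>

lemma nderiv_Suc [simp]: "nderiv (Suc n) f = nderiv n (vderiv f)"
  unfolding nderiv_def vderiv_def funpow_Suc_right o_apply ..

lemma nderiv_1 [simp]: "nderiv 1 f = vderiv f"
  by simp

lemma nderiv_2 [simp]: "nderiv 2 f = vderiv (vderiv f)"
  by (simp add: numeral_2_eq_2)

lemma vderiv_eq: "(\<And>x. (f has_vector_derivative f' x) (at x)) \<Longrightarrow> vderiv f = f'"
  by (auto simp: vderiv_def vector_derivative_at)

lemma smooth_imp_deriv: "smooth f \<Longrightarrow> (f has_vector_derivative vderiv f x) (at x)"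
  unfolding smooth_def vderiv_def by (metis nderiv_0 vector_derivative_works)

lemma smooth_vderiv: "smooth f \<Longrightarrow> smooth (vderiv f)"
  unfolding smooth_def using nderiv_Suc by metis

text \<open>Smoothness as a greatest fixed point: a family closed under differentiation consists of
  smooth functions. Each closure property below then only needs a family that contains the function
  in question and is stable under one derivative.\<close>

lemma smooth_coinduct:
  assumes "f \<in> F" "\<And>f. f \<in> F \<Longrightarrow> \<exists>f'\<in>F. \<forall>x. (f has_vector_derivative f' x) (at x)"
  shows "smooth f"
proof -
  have "\<forall>f\<in>F. \<forall>x. nderiv n f differentiable (at x)" for n
  proof (induction n)
    case 0
    then show ?case
      using assms(2) by (fastforce dest: differentiableI_vector)
  next
    case (Suc n)
    show ?case
    proof (intro ballI allI)
      fix f x assume "f \<in> F"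
      with assms(2) obtain f' where f': "f' \<in> F" "\<And>x. (f has_vector_derivative f' x) (at x)"
        by blast
      then show "nderiv (Suc n) f differentiable (at x)"
        using Suc by (simp add: vderiv_eq [OF f'(2)])
    qed
  qed
  then show ?thesis using assms(1) by (auto simp: smooth_def)
qed

lemma smooth_from_deriv:
  assumes "smooth f" "\<And>x. (g has_vector_derivative f x) (at x)"
  shows "smooth g"
proof (rule smooth_coinduct)
  show "g \<in> insert g {f. smooth f}" by simp
next
  fix h assume "h \<in> insert g {f. smooth f}"
  then show "\<exists>f'\<in>insert g {f. smooth f}. \<forall>x. (h has_vector_derivative f' x) (at x)"
    using assms smooth_imp_deriv [of h] smooth_vderiv [of h] by (cases "h = g") auto
qed

lemma smooth_add:
  assumes "smooth f" "smooth g"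
  shows "smooth (\<lambda>x. f x + g x)"
proof (rule smooth_coinduct)
  show "(\<lambda>x. f x + g x) \<in> {h. \<exists>f g. smooth f \<and> smooth g \<and> h = (\<lambda>x. f x + g x)}"
    using assms by blast
next
  fix h :: "real \<Rightarrow> 'a"
  assume "h \<in> {h. \<exists>f g. smooth f \<and> smooth g \<and> h = (\<lambda>x. f x + g x)}"
  then obtain f g where h: "smooth f" "smooth g" "h = (\<lambda>x. f x + g x)" by blast
  show "\<exists>f'\<in>{h. \<exists>f g. smooth f \<and> smooth g \<and> h = (\<lambda>x. f x + g x)}.
          \<forall>x. (h has_vector_derivative f' x) (at x)"
    using h by (intro bexI [of _ "\<lambda>x. vderiv f x + vderiv g x"])
      (auto intro!: has_vector_derivative_add smooth_imp_deriv smooth_vderiv)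
qed

lemma smooth_bounded_linear:
  assumes T: "bounded_linear T" and "smooth f"
  shows "smooth (\<lambda>x. T (f x))"
proof (rule smooth_coinduct)
  show "(\<lambda>x. T (f x)) \<in> {h. \<exists>f. smooth f \<and> h = (\<lambda>x. T (f x))}"
    using assms by blast
next
  fix h assume "h \<in> {h. \<exists>f. smooth f \<and> h = (\<lambda>x. T (f x))}"
  then obtain f where h: "smooth f" "h = (\<lambda>x. T (f x))" by blast
  show "\<exists>f'\<in>{h. \<exists>f. smooth f \<and> h = (\<lambda>x. T (f x))}. \<forall>x. (h has_vector_derivative f' x) (at x)"
    using h by (intro bexI [of _ "\<lambda>x. T (vderiv f x)"])
      (auto intro!: bounded_linear.has_vector_derivative [OF T] smooth_imp_deriv smooth_vderiv)
qed

text \<open>Products of smooth functions are not stable under differentiation, but finite sums of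
  products are; the lists of pairs encode these sums.\<close>

lemma smooth_mult:
  fixes f g :: "real \<Rightarrow> 'a::real_normed_algebra"
  assumes "smooth f" "smooth g"
  shows "smooth (\<lambda>x. f x * g x)"
proof -
  define F :: "(real \<Rightarrow> 'a) set" where
    "F = {h. \<exists>ps. (\<forall>(f, g)\<in>set ps. smooth f \<and> smooth g) \<and> h = (\<lambda>x. \<Sum>(f, g)\<leftarrow>ps. f x * g x)}"
  have F_one: "(\<lambda>x. f x * g x) \<in> F" if "smooth f" "smooth g" for f g
    unfolding F_def using that by (auto intro!: exI [of _ "[(f, g)]"])
  have F_add: "(\<lambda>x. h x + k x) \<in> F" if hk: "h \<in> F" "k \<in> F" for h k
  proof -
    obtain ps qs where "\<forall>(f, g)\<in>set ps. smooth f \<and> smooth g" "h = (\<lambda>x. \<Sum>(f, g)\<leftarrow>ps. f x * g x)"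
      "\<forall>(f, g)\<in>set qs. smooth f \<and> smooth g" "k = (\<lambda>x. \<Sum>(f, g)\<leftarrow>qs. f x * g x)"
      using hk unfolding F_def by blast
    then show ?thesis unfolding F_def by (auto intro!: exI [of _ "ps @ qs"])
  qed
  have "\<exists>h'\<in>F. \<forall>x. ((\<lambda>x. \<Sum>(f, g)\<leftarrow>ps. f x * g x) has_vector_derivative h' x) (at x)"
    if "\<forall>(f, g)\<in>set ps. smooth f \<and> smooth g" for ps
    using that
  proof (induction ps)
    case Nil
    have "(\<lambda>_. 0) \<in> F" unfolding F_def by (auto intro!: exI [of _ "[]"])
    then show ?case by (auto intro!: bexI [of _ "\<lambda>_. 0"])
  next
    case (Cons p ps)
    obtain f g where p: "p = (f, g)" by fastforce
    with Cons obtain h' where h': "h' \<in> F"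
      "\<And>x. ((\<lambda>x. \<Sum>(f, g)\<leftarrow>ps. f x * g x) has_vector_derivative h' x) (at x)" by auto
    have fg: "smooth f" "smooth g" using Cons p by auto
    have "((\<lambda>x. f x * g x + (\<Sum>(f, g)\<leftarrow>ps. f x * g x)) has_vector_derivative
            (f x * vderiv g x + vderiv f x * g x) + h' x) (at x)" for x
      by (intro has_vector_derivative_add has_vector_derivative_mult smooth_imp_deriv fg h')
    moreover have "(\<lambda>x. (f x * vderiv g x + vderiv f x * g x) + h' x) \<in> F"
      by (intro F_add F_one fg smooth_vderiv h')
    ultimately show ?case using p by (auto intro!: bexI)
  qed
  then have "\<exists>f'\<in>F. \<forall>x. (f has_vector_derivative f' x) (at x)" if "f \<in> F" for f
    using that unfolding F_def by blast
  then show ?thesis using F_one [OF assms] by (rule smooth_coinduct[rotated])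
qed

lemma smooth_const [simp]: "smooth (\<lambda>_. c)"
  by (rule smooth_coinduct [of _ "{(\<lambda>_. c), (\<lambda>_. 0)}"]) auto

lemma smooth_diff:
  assumes "smooth f" "smooth g" shows "smooth (\<lambda>x. f x - g x)"
  using smooth_add [OF assms(1) smooth_bounded_linear [OF _ assms(2), of uminus]]
  by (simp add: bounded_linear_minus bounded_linear_ident)

text \<open>The factor \<open>a\<close> produced by the chain rule is absorbed into the profile,
  which keeps the family of rescaled smooth functions stable under differentiation.\<close>

lemma smooth_affine:
  assumes "smooth f"
  shows "smooth (\<lambda>x. f (a * (x - b)))"
proof (rule smooth_coinduct)
  show "(\<lambda>x. f (a * (x - b))) \<in> {h. \<exists>f. smooth f \<and> h = (\<lambda>x. f (a * (x - b)))}"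
    using assms by blast
next
  fix h :: "real \<Rightarrow> 'a"
  assume "h \<in> {h. \<exists>f. smooth f \<and> h = (\<lambda>x. f (a * (x - b)))}"
  then obtain f where h: "smooth f" "h = (\<lambda>x. f (a * (x - b)))" by blast
  have "((\<lambda>x. f (a * (x - b))) has_vector_derivative a *\<^sub>R vderiv f (a * (x - b))) (at x)" for x
  proof -
    have "((\<lambda>x. a * (x - b)) has_real_derivative a) (at x)"
      by (auto intro!: derivative_eq_intros)
    from vector_diff_chain_at [OF this[unfolded has_real_derivative_iff_has_vector_derivative]
        smooth_imp_deriv [OF h(1)]] show ?thesis by (simp add: o_def)
  qed
  moreover have "smooth (\<lambda>x. a *\<^sub>R vderiv f x)"
    by (intro smooth_bounded_linear [OF bounded_linear_scaleR_right] smooth_vderiv h)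
  ultimately show "\<exists>f'\<in>{h. \<exists>f. smooth f \<and> h = (\<lambda>x. f (a * (x - b)))}.
                     \<forall>x. (h has_vector_derivative f' x) (at x)"
    using h(2) by (intro bexI [of _ "\<lambda>x. a *\<^sub>R vderiv f (a * (x - b))"])
      (auto intro!: exI [of _ "\<lambda>x. a *\<^sub>R vderiv f x"])
qed

lemma has_vector_derivative_exp_linear:
  "((\<lambda>x. exp (c * complex_of_real x)) has_vector_derivative c * exp (c * complex_of_real x)) (at x)"
  by (rule has_vector_derivative_real_field)
    (auto intro!: derivative_eq_intros)

lemma smooth_exp: "smooth (\<lambda>x. exp (c * complex_of_real x))"
proof (rule smooth_coinduct)
  show "(\<lambda>x. exp (c * complex_of_real x)) \<in> {h. \<exists>k. h = (\<lambda>x. k * exp (c * complex_of_real x))}"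
    by (auto intro!: exI [of _ 1])
next
  fix h assume "h \<in> {h. \<exists>k. h = (\<lambda>x. k * exp (c * complex_of_real x))}"
  then obtain k where h: "h = (\<lambda>x. k * exp (c * complex_of_real x))" by blast
  show "\<exists>f'\<in>{h. \<exists>k. h = (\<lambda>x. k * exp (c * complex_of_real x))}.
          \<forall>x. (h has_vector_derivative f' x) (at x)"
    unfolding h
    by (rule bexI [of _ "\<lambda>x. k * (c * exp (c * complex_of_real x))"])
      (auto intro!: has_vector_derivative_mult_right has_vector_derivative_exp_linear exI [of _ "k * c"])
qed

lemma smooth_continuous: "smooth f \<Longrightarrow> continuous_on A f"
  by (meson continuous_at_imp_continuous_on has_vector_derivative_continuous smooth_imp_deriv)

section \<open>Test functions as smooth functions of bounded support\<close>

lemma test_function_iff: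
  "test_function \<phi> \<longleftrightarrow> smooth \<phi> \<and> (\<exists>B>0. \<forall>x. \<bar>x\<bar> > B \<longrightarrow> \<phi> x = 0)"
proof -
  have "(\<exists>B>0. \<forall>x. \<bar>x\<bar> > B \<longrightarrow> \<phi> x = 0) \<longleftrightarrow> bounded {x. \<phi> x \<noteq> 0}"
    unfolding bounded_pos by (auto simp: not_less [symmetric])
  then show ?thesis by (auto simp: test_function_def smooth_def compact_closure)
qed

lemma test_function_smooth: "test_function \<phi> \<Longrightarrow> smooth \<phi>"
  by (simp add: test_function_iff)

lemma test_function_deriv: "test_function \<phi> \<Longrightarrow> (\<phi> has_vector_derivative vderiv \<phi> x) (at x)"
  by (simp add: test_function_smooth smooth_imp_deriv)

lemma test_function_support:
  assumes "test_function \<phi>" obtains B where "B > 0" "\<And>x. \<bar>x\<bar> > B \<Longrightarrow> \<phi> x = 0"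
  using assms test_function_iff by blast

lemma vanishing_vderiv:
  assumes "\<And>x. \<bar>x\<bar> > B \<Longrightarrow> f x = 0" "\<bar>x\<bar> > B"
  shows "vderiv f x = 0"
proof -
  have "((\<lambda>_. 0) has_vector_derivative 0) (at x)" by simp
  moreover have "open {x::real. \<bar>x\<bar> > B}" by (intro open_Collect_less continuous_intros)
  ultimately have "(f has_vector_derivative 0) (at x)"
    by (rule has_vector_derivative_transform_within_open) (use assms in auto)
  then show ?thesis by (simp add: vderiv_def vector_derivative_at)
qed

lemma test_function_vderiv:
  assumes "test_function \<phi>" shows "test_function (vderiv \<phi>)"
  using assms unfolding test_function_iff by (metis smooth_vderiv vanishing_vderiv)

lemma test_function_nderiv: "test_function \<phi> \<Longrightarrow> test_function (nderiv n \<phi>)"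
  by (induction n arbitrary: \<phi>) (auto simp: test_function_vderiv)

lemma test_function_add:
  assumes "test_function f" "test_function g"
  shows "test_function (\<lambda>x. f x + g x)"
proof -
  obtain A where A: "A > 0" "\<And>x. \<bar>x\<bar> > A \<Longrightarrow> f x = 0" using assms test_function_support by blast
  obtain B where B: "B > 0" "\<And>x. \<bar>x\<bar> > B \<Longrightarrow> g x = 0" using assms test_function_support by blast
  show ?thesis using assms A B unfolding test_function_iff
    by (auto intro!: smooth_add exI [of _ "max A B"])
qed

lemma test_function_smooth_mult:
  fixes f g :: "real \<Rightarrow> 'a::real_normed_algebra"
  assumes "smooth f" "test_function g" shows "test_function (\<lambda>x. f x * g x)"
  using assms unfolding test_function_iff by (metis smooth_mult mult_zero_right)

lemma test_function_mult:
  fixes f g :: "real \<Rightarrow> 'a::real_normed_algebra"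
  shows "test_function f \<Longrightarrow> test_function g \<Longrightarrow> test_function (\<lambda>x. f x * g x)"
  by (simp add: test_function_smooth test_function_smooth_mult)

lemma test_function_cmult:
  fixes f :: "real \<Rightarrow> 'a::real_normed_algebra"
  shows "test_function f \<Longrightarrow> test_function (\<lambda>x. c * f x)"
  by (intro test_function_smooth_mult) auto

lemma test_function_of_real: "test_function f \<Longrightarrow> test_function (\<lambda>x. complex_of_real (f x))"
  unfolding test_function_iff by (metis bounded_linear_of_real of_real_0 smooth_bounded_linear)

lemma test_function_continuous: "test_function \<phi> \<Longrightarrow> continuous_on A \<phi>"
  by (simp add: smooth_continuous test_function_smooth)

lemma continuous_UNIV_borel:
  "continuous_on UNIV f \<Longrightarrow> f \<in> borel_measurable (borel :: real measure)"
  by (simp add: borel_measurable_continuous_onI)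

lemma test_function_borel [measurable_dest]: "test_function \<phi> \<Longrightarrow> \<phi> \<in> borel_measurable borel"
  by (simp add: continuous_UNIV_borel test_function_continuous)

lemma test_function_bounded:
  assumes "test_function \<phi>"
  obtains B where "B > 0" "\<And>x. norm (\<phi> x) \<le> B"
proof -
  obtain A where A: "A > 0" "\<And>x. \<bar>x\<bar> > A \<Longrightarrow> \<phi> x = 0" using assms test_function_support by blast
  have "bounded (\<phi> ` {-A..A})"
    by (intro compact_imp_bounded compact_continuous_image test_function_continuous assms) auto
  then obtain B where B: "B > 0" "\<And>x. x \<in> {-A..A} \<Longrightarrow> norm (\<phi> x) \<le> B" by (auto simp: bounded_pos)
  have "norm (\<phi> x) \<le> B" for x
  proof (cases "\<bar>x\<bar> > A")
    case False
    then have "x \<in> {-A..A}" by auto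
    then show ?thesis by (rule B)
  qed (simp add: A B less_imp_le)
  with B(1) show ?thesis using that by blast
qed

lemma test_function_dominated:
  assumes "test_function (\<phi> :: real \<Rightarrow> 'a::real_normed_vector)"
  obtains A B where "A > 0" "B > 0" "\<And>x. norm (\<phi> x) \<le> B * indicator {-A..A} x"
proof -
  obtain A where A: "A > 0" "\<And>x. \<bar>x\<bar> > A \<Longrightarrow> \<phi> x = 0" using assms test_function_support by blast
  obtain B where B: "B > 0" "\<And>x. norm (\<phi> x) \<le> B" using assms test_function_bounded by blast
  have "norm (\<phi> x) \<le> B * indicator {-A..A} x" for x using A(2) [of x] B(2) [of x] by (auto simp: indicator_def)
  with A B that show ?thesis by blast
qed

section \<open>Weak derivatives\<close>

lemma ftc_line:
  fixes F f :: "real \<Rightarrow> complex"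
  assumes "\<And>x. (F has_vector_derivative f x) (at x)" "continuous_on UNIV f"
    and "\<And>x. \<bar>x\<bar> > B \<Longrightarrow> F x = 0" "\<And>x. \<bar>x\<bar> > B \<Longrightarrow> f x = 0"
  shows "(\<integral>x. f x \<partial>lborel) = 0"
proof -
  define A where "A = \<bar>B\<bar> + 1"
  have "(\<integral>x. indicator {-A..A} x *\<^sub>R f x \<partial>lborel) = F A - F (-A)"
    by (rule integral_FTC_atLeastAtMost)
      (auto simp: A_def intro: has_vector_derivative_at_within assms continuous_on_subset [OF assms(2)])
  also have "\<dots> = 0" using assms(3) by (simp add: A_def)
  also have "(\<lambda>x. indicator {-A..A} x *\<^sub>R f x) = f"
    using assms(4) by (force simp: indicator_def A_def)
  finally show ?thesis .
qed

text \<open>The half-line \<open>{y<..}\<close> is where the causal kernels live. In the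
  applications the boundary term \<open>- F y\<close> is either zero or a point evaluation of the
  test function.\<close>

lemma ftc_right:
  fixes F f :: "real \<Rightarrow> complex"
  assumes "\<And>x. (F has_vector_derivative f x) (at x)" "continuous_on UNIV f"
    and "\<And>x. x > B \<Longrightarrow> F x = 0" "\<And>x. x > B \<Longrightarrow> f x = 0"
  shows "(\<integral>x. indicator {y<..} x *\<^sub>R f x \<partial>lborel) = - F y"
proof -
  define A where "A = \<bar>B\<bar> + \<bar>y\<bar> + 1"
  have "(\<integral>x. indicator {y..A} x *\<^sub>R f x \<partial>lborel) = F A - F y"
    by (rule integral_FTC_atLeastAtMost)
      (auto simp: A_def intro: has_vector_derivative_at_within assms continuous_on_subset [OF assms(2)])
  also have "\<dots> = - F y" using assms(3) by (simp add: A_def)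
  also have "(\<integral>x. indicator {y..A} x *\<^sub>R f x \<partial>lborel) = (\<integral>x. indicator {y<..} x *\<^sub>R f x \<partial>lborel)"
  proof (rule integral_cong_AE)
    show "AE x in lborel. indicator {y..A} x *\<^sub>R f x = indicator {y<..} x *\<^sub>R f x"
      using AE_lborel_singleton [of y]
    proof eventually_elim
      case (elim x)
      then show ?case using assms(4) [of x] by (force simp: indicator_def A_def)
    qed
  qed (use continuous_UNIV_borel [OF assms(2)] in measurable)
  finally show ?thesis .
qed

lemma primitive_ex:
  fixes \<phi> :: "real \<Rightarrow> 'a::euclidean_space"
  assumes "test_function \<phi>"
  obtains F B where "B > 0" "\<And>x. (F has_vector_derivative \<phi> x) (at x)"
    "\<And>x. x < -B \<Longrightarrow> F x = 0" "\<And>x. x > B \<Longrightarrow> F x = (\<integral>x. \<phi> x \<partial>lborel)"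
proof -
  obtain B where B: "B > 0" "\<And>x. \<bar>x\<bar> > B \<Longrightarrow> \<phi> x = 0" using assms test_function_support by blast
  \<comment> \<open>The base point lies strictly to the left of the support. Near a point left of
    \<open>- B\<close> the primitive is constant, and every other point is interior to an interval
    that starts at the base point.\<close>
  define F where "F x = integral {-B-1..x} \<phi>" for x
  have F0: "F x = 0" if "x < -B" for x
  proof -
    have "F x = integral {-B-1..x} (\<lambda>_. 0)"
      unfolding F_def by (rule Henstock_Kurzweil_Integration.integral_cong) (use B that in auto)
    then show ?thesis by simp
  qed
  have deriv: "(F has_vector_derivative \<phi> x) (at x)" for x
  proof (cases "x < -B")
    case True
    have "((\<lambda>_. 0) has_vector_derivative \<phi> x) (at x)" using B True by auto
    then show ?thesis
      by (rule has_vector_derivative_transform_within_open [of _ _ _ "{..<-B}"]) (use True F0 in auto)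
  next
    case False
    have "(F has_vector_derivative \<phi> x) (at x within {-B-1..x+1})"
      unfolding F_def
      by (rule integral_has_vector_derivative) (use False test_function_continuous [OF assms] in auto)
    then have "(F has_vector_derivative \<phi> x) (at x within {-B-1<..<x+1})"
      by (rule has_vector_derivative_within_subset) auto
    then show ?thesis using False by (subst (asm) has_vector_derivative_within_open) auto
  qed
  have "F x = (\<integral>x. \<phi> x \<partial>lborel)" if "x > B" for x
  proof -
    have "(\<integral>t. indicator {-x..x} t *\<^sub>R \<phi> t \<partial>lborel) = F x - F (-x)"
      by (rule integral_FTC_atLeastAtMost)
        (use that B in \<open>auto intro: has_vector_derivative_at_within deriv test_function_continuous assms\<close>)
    also have "(\<lambda>t. indicator {-x..x} t *\<^sub>R \<phi> t) = \<phi>"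
      using B that by (fastforce simp: indicator_def)
    finally show ?thesis using F0 [of "-x"] that by simp
  qed
  with B(1) deriv F0 show ?thesis using that by blast
qed

text \<open>Zero mean is what makes the primitive vanish to the right of the support as well, so
  that it is again a test function.\<close>

lemma test_function_primitive:
  fixes \<phi> :: "real \<Rightarrow> 'a::euclidean_space"
  assumes "test_function \<phi>" "(\<integral>x. \<phi> x \<partial>lborel) = 0"
  obtains \<theta> where "test_function \<theta>" "vderiv \<theta> = \<phi>"
proof -
  obtain F B where F: "B > 0" "\<And>x. (F has_vector_derivative \<phi> x) (at x)"
    "\<And>x. x < -B \<Longrightarrow> F x = 0" "\<And>x. x > B \<Longrightarrow> F x = 0"
    using primitive_ex [OF assms(1)] assms(2) by metis
  have "test_function F" unfolding test_function_iff
    using F smooth_from_deriv [OF test_function_smooth [OF assms(1)] F(2)]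
    by (auto intro!: exI [of _ B] simp: abs_if split: if_splits)
  with vderiv_eq [OF F(2)] that show ?thesis by blast
qed

subsection \<open>Locally integrable functions\<close>

definition loc_integrable :: "(real \<Rightarrow> complex) \<Rightarrow> bool" where
  "loc_integrable h \<longleftrightarrow> h \<in> borel_measurable borel \<and>
     (\<forall>N. integrable lborel (\<lambda>x. indicator {-N..N} x *\<^sub>R h x))"

lemma loc_integrable_borel [measurable_dest]: "loc_integrable h \<Longrightarrow> h \<in> borel_measurable borel"
  by (simp add: loc_integrable_def)

lemma integrable_loc_integrable_bounded:
  assumes h: "loc_integrable h" and [measurable]: "\<phi> \<in> borel_measurable borel"
    and "\<And>x. cmod (\<phi> x) \<le> B * indicator {-N..N} x"
  shows "integrable lborel (\<lambda>x. h x * \<phi> x)"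
proof (rule Bochner_Integration.integrable_bound)
  show "integrable lborel (\<lambda>x. B * norm (indicator {-N..N} x *\<^sub>R h x))"
    using h by (intro integrable_mult_right integrable_norm) (auto simp: loc_integrable_def)
  show "(\<lambda>x. h x * \<phi> x) \<in> borel_measurable lborel" using h by measurable
  show "AE x in lborel. norm (h x * \<phi> x) \<le> norm (B * norm (indicator {-N..N} x *\<^sub>R h x))"
  proof (intro AE_I2)
    fix x
    have "norm (h x * \<phi> x) \<le> norm (h x) * (B * indicator {-N..N} x)"
      unfolding norm_mult by (intro mult_left_mono assms) auto
    also have "\<dots> \<le> norm (B * norm (indicator {-N..N} x *\<^sub>R h x))"
      by (auto simp: abs_mult indicator_def mult_ac intro!: mult_right_mono)
    finally show "norm (h x * \<phi> x) \<le> norm (B * norm (indicator {-N..N} x *\<^sub>R h x))" .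
  qed
qed

lemma integrable_loc_integrable_test:
  assumes "loc_integrable h" "test_function \<phi>"
  shows "integrable lborel (\<lambda>x. h x * \<phi> x)"
proof -
  obtain A B where "\<And>x. norm (\<phi> x) \<le> B * indicator {-A..A} x"
    using test_function_dominated [OF assms(2)] by metis
  then show ?thesis
    by (intro integrable_loc_integrable_bounded assms test_function_borel)
qed

lemma loc_integrable_bounded:
  assumes [measurable]: "h \<in> borel_measurable borel"
    and "\<And>N. \<exists>B. \<forall>x. \<bar>x\<bar> \<le> N \<longrightarrow> cmod (h x) \<le> B"
  shows "loc_integrable h"
  unfolding loc_integrable_def
proof (intro conjI allI)
  fix N :: real
  obtain B where B: "\<And>x. \<bar>x\<bar> \<le> N \<Longrightarrow> cmod (h x) \<le> B" using assms(2) by meson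
  show "integrable lborel (\<lambda>x. indicator {-N..N} x *\<^sub>R h x)"
  proof (rule integrableI_bounded_set_indicator [of _ _ _ B])
    show "AE x in lborel. x \<in> {-N..N} \<longrightarrow> norm (h x) \<le> B"
      using B by (auto simp: abs_le_iff)
  qed (auto simp: emeasure_lborel_Icc_eq)
qed simp

lemma loc_integrable_continuous:
  assumes "continuous_on UNIV h" shows "loc_integrable h"
proof (rule loc_integrable_bounded)
  show "\<exists>B. \<forall>x. \<bar>x\<bar> \<le> N \<longrightarrow> cmod (h x) \<le> B" for N
  proof -
    have "bounded (h ` {-N..N})"
      by (intro compact_imp_bounded compact_continuous_image continuous_on_subset [OF assms]) auto
    then obtain B where "\<And>x. x \<in> {-N..N} \<Longrightarrow> cmod (h x) \<le> B" unfolding bounded_iff by blast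
    then show ?thesis by (intro exI [of _ B]) (auto simp: abs_le_iff minus_le_iff)
  qed
qed (simp add: continuous_UNIV_borel assms)

lemma loc_integrable_add:
  assumes "loc_integrable f" "loc_integrable g" shows "loc_integrable (\<lambda>x. f x + g x)"
  using assms unfolding loc_integrable_def by (auto simp: scaleR_right_distrib)

lemma loc_integrable_mult:
  assumes f: "loc_integrable f" and g: "continuous_on UNIV g"
  shows "loc_integrable (\<lambda>x. f x * g x)"
  unfolding loc_integrable_def
proof (intro conjI allI)
  show "(\<lambda>x. f x * g x) \<in> borel_measurable borel"
    using loc_integrable_borel [OF f] continuous_UNIV_borel [OF g] by measurable
  fix N :: real
  have "bounded (g ` {-N..N})"
    by (intro compact_imp_bounded compact_continuous_image continuous_on_subset [OF g]) auto
  then obtain B where B: "\<And>x. x \<in> {-N..N} \<Longrightarrow> cmod (g x) \<le> B"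
    unfolding bounded_iff by blast
  have "integrable lborel (\<lambda>x. f x * (indicator {-N..N} x *\<^sub>R g x))"
  proof (rule integrable_loc_integrable_bounded [OF f, of _ B N])
    show "cmod (indicator {- N..N} x *\<^sub>R g x) \<le> B * indicator {- N..N} x" for x
      using B by (auto simp: indicator_def)
  qed (use continuous_UNIV_borel [OF g] in measurable)
  then show "integrable lborel (\<lambda>x. indicator {-N..N} x *\<^sub>R (f x * g x))"
    by simp
qed

lemma loc_integrable_cmult: "loc_integrable f \<Longrightarrow> loc_integrable (\<lambda>x. c * f x)"
  using loc_integrable_mult [of f "\<lambda>_. c"] by (simp add: mult.commute)

lemma loc_integrable_diff:
  assumes "loc_integrable f" "loc_integrable g" shows "loc_integrable (\<lambda>x. f x - g x)"
  using loc_integrable_add [OF assms(1) loc_integrable_cmult [OF assms(2), of "-1"]] by simp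

section \<open>Square-integrable functions\<close>

lemma L2_borel [measurable_dest]: "f \<in> L2 \<Longrightarrow> f \<in> borel_measurable borel"
  by (simp add: L2_def)

lemma L2_integrable: "f \<in> L2 \<Longrightarrow> integrable lborel (\<lambda>x. (cmod (f x))\<^sup>2)"
  by (simp add: L2_def)

text \<open>Stands in for the Cauchy-Schwarz inequality: applied pointwise it makes products of
  square-integrable functions integrable and, against the constant 1, bounds |g| by 1 +
  |g|^2.\<close>

lemma two_mult_le_squares: "2 * (a * b) \<le> a\<^sup>2 + (b::real)\<^sup>2"
  using zero_le_power2 [of "a - b"] by (simp add: power2_diff)

lemma L2_integrable_mult:
  assumes "f \<in> L2" "g \<in> L2"
  shows "integrable lborel (\<lambda>x. f x * g x)"
proof (rule Bochner_Integration.integrable_bound)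
  show "integrable lborel (\<lambda>x. (cmod (f x))\<^sup>2 + (cmod (g x))\<^sup>2)"
    using assms by (auto intro: L2_integrable)
  show "(\<lambda>x. f x * g x) \<in> borel_measurable lborel" using assms by measurable
  show "AE x in lborel. norm (f x * g x) \<le> norm ((cmod (f x))\<^sup>2 + (cmod (g x))\<^sup>2)"
  proof (intro AE_I2)
    fix x
    have "0 \<le> cmod (f x) * cmod (g x)" by simp
    with two_mult_le_squares [of "cmod (f x)" "cmod (g x)"]
    have "cmod (f x) * cmod (g x) \<le> (cmod (f x))\<^sup>2 + (cmod (g x))\<^sup>2" by linarith
    then show "norm (f x * g x) \<le> norm ((cmod (f x))\<^sup>2 + (cmod (g x))\<^sup>2)"
      by (simp add: norm_mult)
  qed
qed

lemma L2_bounded_support: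
  assumes [measurable]: "f \<in> borel_measurable borel"
    and "\<And>x. cmod (f x) \<le> B * indicator {-N..N} x"
  shows "f \<in> L2"
proof -
  have "integrable lborel (\<lambda>x. B\<^sup>2 * indicator {-N..N} x :: real)"
    by (intro integrable_mult_right) (auto simp: emeasure_lborel_Icc_eq)
  then have "integrable lborel (\<lambda>x. (cmod (f x))\<^sup>2)"
  proof (rule Bochner_Integration.integrable_bound)
    show "AE x in lborel. norm ((cmod (f x))\<^sup>2) \<le> norm (B\<^sup>2 * indicator {-N..N} x :: real)"
    proof (intro AE_I2)
      fix x show "norm ((cmod (f x))\<^sup>2) \<le> norm (B\<^sup>2 * indicator {-N..N} x :: real)"
        using power_mono [OF assms(2) [of x], of 2] by (auto simp: indicator_def split: if_splits)
    qed
  qed auto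
  then show ?thesis by (simp add: L2_def)
qed

lemma L2_loc_integrable:
  assumes "f \<in> L2" shows "loc_integrable f"
  unfolding loc_integrable_def
proof (intro conjI allI)
  show "f \<in> borel_measurable borel" using assms by measurable
  fix N :: real
  have "(\<lambda>x. indicator {-N..N} x :: complex) \<in> L2"
    by (rule L2_bounded_support [of _ 1 N]) (auto simp: indicator_def)
  from L2_integrable_mult [OF this assms]
  show "integrable lborel (\<lambda>x. indicator {-N..N} x *\<^sub>R f x)"
    by (rule Bochner_Integration.integrable_cong [THEN iffD1, rotated 2]) (auto simp: indicator_def)
qed

lemma L2_add:
  assumes "f \<in> L2" "g \<in> L2" shows "(\<lambda>x. f x + g x) \<in> L2"
proof -
  have "integrable lborel (\<lambda>x. 2 * (cmod (f x))\<^sup>2 + 2 * (cmod (g x))\<^sup>2)"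
    by (intro Bochner_Integration.integrable_add integrable_mult_right L2_integrable assms)
  then have "integrable lborel (\<lambda>x. (cmod (f x + g x))\<^sup>2)"
  proof (rule Bochner_Integration.integrable_bound)
    show "(\<lambda>x. (cmod (f x + g x))\<^sup>2) \<in> borel_measurable lborel" using assms by measurable
    show "AE x in lborel. norm ((cmod (f x + g x))\<^sup>2) \<le> norm (2 * (cmod (f x))\<^sup>2 + 2 * (cmod (g x))\<^sup>2)"
    proof (intro AE_I2)
      fix x
      have "(cmod (f x + g x))\<^sup>2 \<le> (cmod (f x) + cmod (g x))\<^sup>2"
        by (intro power_mono norm_triangle_ineq) auto
      then show "norm ((cmod (f x + g x))\<^sup>2) \<le> norm (2 * (cmod (f x))\<^sup>2 + 2 * (cmod (g x))\<^sup>2)"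
        using two_mult_le_squares [of "cmod (f x)" "cmod (g x)"] by (simp add: power2_sum)
    qed
  qed
  moreover have "(\<lambda>x. f x + g x) \<in> borel_measurable borel" using assms by measurable
  ultimately show ?thesis by (simp add: L2_def)
qed

lemma L2_cmult: "f \<in> L2 \<Longrightarrow> (\<lambda>x. c * f x) \<in> L2"
  by (auto simp: L2_def norm_mult power_mult_distrib)

lemma L2_diff: "f \<in> L2 \<Longrightarrow> g \<in> L2 \<Longrightarrow> (\<lambda>x. f x - g x) \<in> L2"
  using L2_add [OF _ L2_cmult, of f g "-1"] by simp

lemma L2_zero: "(\<lambda>_. 0) \<in> L2" by (simp add: L2_def)

lemma L2_bounded_mult:
  assumes "f \<in> L2" and [measurable]: "g \<in> borel_measurable borel" and g: "\<And>x. cmod (g x) \<le> B"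
  shows "(\<lambda>x. g x * f x) \<in> L2"
proof -
  have "integrable lborel (\<lambda>x. B\<^sup>2 * (cmod (f x))\<^sup>2)"
    using assms by (auto intro: L2_integrable)
  then have "integrable lborel (\<lambda>x. (cmod (g x * f x))\<^sup>2)"
  proof (rule Bochner_Integration.integrable_bound)
    show "(\<lambda>x. (cmod (g x * f x))\<^sup>2) \<in> borel_measurable lborel" using assms by measurable
    show "AE x in lborel. norm ((cmod (g x * f x))\<^sup>2) \<le> norm (B\<^sup>2 * (cmod (f x))\<^sup>2)"
    proof (intro AE_I2)
      fix x
      show "norm ((cmod (g x * f x))\<^sup>2) \<le> norm (B\<^sup>2 * (cmod (f x))\<^sup>2)"
        using power_mono [OF g [of x], of 2]
        by (auto simp: norm_mult power_mult_distrib intro!: mult_right_mono)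
    qed
  qed
  moreover have "(\<lambda>x. g x * f x) \<in> borel_measurable borel" using assms by measurable
  ultimately show ?thesis by (simp add: L2_def)
qed

lemma L2_test_function: "test_function \<phi> \<Longrightarrow> \<phi> \<in> L2"
  by (metis L2_bounded_support test_function_borel test_function_dominated)

lemma L2_cnj: "f \<in> L2 \<Longrightarrow> (\<lambda>x. cnj (f x)) \<in> L2"
  using borel_measurable_continuous_onI [OF continuous_on_cnj [OF continuous_on_id]]
  by (auto simp: L2_def intro: measurable_compose [of f])

subsection \<open>The fundamental lemma of the calculus of variations\<close>

text \<open>
  No smooth bump has to be constructed: the cutoff function of the theorem serves as one.
\<close>

locale bump =
  fixes \<psi> :: "real \<Rightarrow> real"
  assumes bump_test: "test_function \<psi>" and bump_nonneg: "\<And>x. 0 \<le> \<psi> x" and bump_0: "\<psi> 0 > 0"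
begin

lemma bump_integral_pos: "(\<integral>x. \<psi> x \<partial>lborel) > 0"
proof -
  obtain d where d: "d > 0" "\<And>x. \<bar>x\<bar> < d \<Longrightarrow> \<psi> x > \<psi> 0 / 2"
  proof -
    have "isCont \<psi> 0" using test_function_continuous [OF bump_test, of UNIV]
      by (simp add: continuous_on_eq_continuous_at)
    then have "\<exists>d>0. \<forall>x. dist x 0 < d \<longrightarrow> dist (\<psi> x) (\<psi> 0) < \<psi> 0 / 2"
      unfolding continuous_at_eps_delta using bump_0 by (metis half_gt_zero)
    then obtain d where "d > 0" "\<And>x. \<bar>x\<bar> < d \<Longrightarrow> \<bar>\<psi> x - \<psi> 0\<bar> < \<psi> 0 / 2"
      by (auto simp: dist_real_def)
    then show ?thesis using that by (smt (verit) field_sum_of_halves)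
  qed
  have d': "\<psi> 0 / 2 \<le> \<psi> x" if "x \<in> {-d/2..d/2}" for x
    using d(2) [of x] d(1) that by (force simp: abs_less_iff)
  have int: "integrable lborel \<psi>"
  proof -
    obtain A B where AB: "\<And>x. norm (\<psi> x) \<le> B * indicator {-A..A} x"
      using test_function_dominated [OF bump_test] by metis
    have "integrable lborel (\<lambda>x. B * indicator {-A..A} x :: real)"
      by (intro integrable_mult_right) (auto simp: emeasure_lborel_Icc_eq)
    then show ?thesis by (rule Bochner_Integration.integrable_bound)
      (use test_function_borel [OF bump_test] in \<open>auto intro: order_trans [OF AB abs_ge_self, simplified]\<close>)
  qed
  have "0 < (\<psi> 0 / 2) * d" using d bump_0 by simp
  also have "\<dots> = (\<integral>x. (\<psi> 0 / 2) * indicator {-d/2..d/2} x \<partial>lborel)"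
    using d by (simp add: measure_def)
  also have "\<dots> \<le> (\<integral>x. \<psi> x \<partial>lborel)"
  proof (rule integral_mono [OF _ int])
    show "integrable lborel (\<lambda>x. (\<psi> 0 / 2) * indicator {-d/2..d/2} x :: real)"
      by (intro integrable_mult_right) (auto simp: emeasure_lborel_Icc_eq)
    show "\<psi> 0 / 2 * indicator {- d / 2..d / 2} x \<le> \<psi> x" for x
      using d' [of x] bump_nonneg [of x] by (auto simp: indicator_def)
  qed
  finally show ?thesis .
qed

text \<open>With \<open>F\<close> the primitive of the bump and \<open>c\<close> its mass, the test
  functions F(n(x-a)) - F(n(x-b)) are uniformly bounded, have a common bounded support and tend to
  \<open>c\<close> times the indicator of the interval away from its endpoints. Dominated
  convergence carries the vanishing over to the limit.\<close>

lemma variations_interval: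
  fixes h :: "real \<Rightarrow> complex"
  assumes h: "loc_integrable h" and zero: "\<And>\<phi>. test_function \<phi> \<Longrightarrow> (\<integral>x. h x * \<phi> x \<partial>lborel) = 0"
    and "a \<le> b"
  shows "(\<integral>x. indicator {a<..<b} x *\<^sub>R h x \<partial>lborel) = 0"
proof -
  define c where "c = (\<integral>x. \<psi> x \<partial>lborel)"
  obtain F B where F: "B > 0" "\<And>x. (F has_vector_derivative \<psi> x) (at x)"
    "\<And>x. x < -B \<Longrightarrow> F x = 0" "\<And>x. x > B \<Longrightarrow> F x = c"
    using primitive_ex [OF bump_test] c_def by metis
  have smF: "smooth F" by (rule smooth_from_deriv [OF test_function_smooth [OF bump_test] F(2)])
  obtain K where K: "K > 0" "\<And>x. \<bar>F x\<bar> \<le> K"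
  proof -
    have "bounded (F ` {-B..B})"
      by (intro compact_imp_bounded compact_continuous_image smooth_continuous smF) auto
    then obtain K where K: "K > 0" "\<And>x. x \<in> {-B..B} \<Longrightarrow> \<bar>F x\<bar> \<le> K" by (auto simp: bounded_pos)
    have "\<bar>F x\<bar> \<le> K + \<bar>c\<bar>" for x
      using K(1) K(2) [of x] F(3) [of x] F(4) [of x] by fastforce
    with K(1) show ?thesis by (intro that [of "K + \<bar>c\<bar>"]) auto
  qed
  define \<Phi> where "\<Phi> n x = complex_of_real (F (real (Suc n) * (x - a)) - F (real (Suc n) * (x - b)))" for n x
  define N where "N = \<bar>a\<bar> + \<bar>b\<bar> + B"
  have N0: "\<Phi> n x = 0" if "\<bar>x\<bar> > N" for n x
  proof -
    have big: "real (Suc n) * t > B" if "t > B" for t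
      using that F(1) mult_mono [of 1 "real (Suc n)" B t] mult_strict_mono' [of 1 "real (Suc n)" B t]
      by (smt (verit, best) mult_left_le_imp_le mult_le_cancel_right1 of_nat_0_le_iff of_nat_Suc)
    show ?thesis
    proof (cases "x > 0")
      case True
      then have "x - a > B" "x - b > B" using that by (auto simp: N_def)
      then show ?thesis using big F(4) unfolding \<Phi>_def by (metis diff_self of_real_0)
    next
      case False
      then have "- (x - a) > B" "- (x - b) > B" using that by (auto simp: N_def)
      then have "real (Suc n) * (x - a) < -B" "real (Suc n) * (x - b) < -B" using big
        by (smt (verit) mult_minus_right)+
      then show ?thesis using F(3) unfolding \<Phi>_def by (metis diff_self of_real_0)
    qed
  qed
  have test: "test_function (\<Phi> n)" for n
  proof -
    have "smooth (\<lambda>x. F (real (Suc n) * (x - a)) - F (real (Suc n) * (x - b)))"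
      by (intro smooth_diff smooth_affine smF)
    then have "smooth (\<Phi> n)" unfolding \<Phi>_def by (intro smooth_bounded_linear [OF bounded_linear_of_real])
    moreover have "N > 0" using F(1) by (simp add: N_def)
    ultimately show ?thesis using N0 unfolding test_function_iff by blast
  qed
  have bound: "cmod (\<Phi> n x) \<le> 2 * K * indicator {-N..N} x" for n x
  proof (cases "\<bar>x\<bar> > N")
    case False
    have "cmod (\<Phi> n x) \<le> 2 * K"
      unfolding \<Phi>_def norm_of_real using K(2) [of "real (Suc n) * (x - a)"] K(2) [of "real (Suc n) * (x - b)"]
      by linarith
    then show ?thesis using False by (auto simp: indicator_def abs_le_iff)
  qed (simp add: N0 K less_imp_le)
  have large: "eventually (\<lambda>n. real (Suc n) * t > B) sequentially" if "t > 0" for t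
  proof -
    have "filterlim (\<lambda>n. real (Suc n) * t) at_top sequentially"
      using that by real_asymp
    then show ?thesis by (simp add: filterlim_at_top_dense)
  qed
  have lim: "(\<lambda>n. \<Phi> n x) \<longlonglongrightarrow> of_real c * indicator {a<..<b} x" if "x \<noteq> a" "x \<noteq> b" for x
  proof -
    have 1: "eventually (\<lambda>n. F (real (Suc n) * t) = c) sequentially" if "t > 0" for t
      using large [OF that] by eventually_elim (use F(4) in auto)
    have 2: "eventually (\<lambda>n. F (real (Suc n) * t) = 0) sequentially" if "t < 0" for t
      using large [of "-t"] that by (auto elim!: eventually_mono intro!: F(3))
    have "eventually (\<lambda>n. \<Phi> n x = of_real c * indicator {a<..<b} x) sequentially"
    proof -
      consider "x < a" "x < b" | "a < x" "x < b" | "a < x" "b < x"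
        using \<open>a \<le> b\<close> \<open>x \<noteq> a\<close> \<open>x \<noteq> b\<close> by force
      then show ?thesis
      proof cases
        case 1
        then show ?thesis using eventually_conj [OF 2 [of "x - a"] 2 [of "x - b"]]
          by (auto elim!: eventually_mono simp: \<Phi>_def)
      next
        case 2
        then show ?thesis using eventually_conj [OF 1 [of "x - a"] \<open>\<And>t. t < 0 \<Longrightarrow> _\<close> [of "x - b"]]
          by (auto elim!: eventually_mono simp: \<Phi>_def)
      next
        case 3
        then show ?thesis using eventually_conj [OF 1 [of "x - a"] 1 [of "x - b"]]
          by (auto elim!: eventually_mono simp: \<Phi>_def)
      qed
    qed
    then show ?thesis by (rule tendsto_eventually)
  qed
  have "(\<lambda>n. \<integral>x. h x * \<Phi> n x \<partial>lborel) \<longlonglongrightarrow> (\<integral>x. h x * (of_real c * indicator {a<..<b} x) \<partial>lborel)"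
  proof (rule integral_dominated_convergence)
    show "integrable lborel (\<lambda>x. 2 * K * norm (indicator {-N..N} x *\<^sub>R h x))"
      using h by (intro integrable_mult_right integrable_norm) (auto simp: loc_integrable_def)
    show "(\<lambda>x. h x * (of_real c * indicator {a<..<b} x)) \<in> borel_measurable lborel"
      using loc_integrable_borel [OF h] by measurable
    show "(\<lambda>x. h x * \<Phi> n x) \<in> borel_measurable lborel" for n
      using loc_integrable_borel [OF h] test_function_borel [OF test [of n]] by measurable
    show "AE x in lborel. (\<lambda>n. h x * \<Phi> n x) \<longlonglongrightarrow> h x * (of_real c * indicator {a<..<b} x)"
      using AE_lborel_singleton [of a] AE_lborel_singleton [of b]
      by eventually_elim (auto intro!: tendsto_intros lim)
    show "AE x in lborel. norm (h x * \<Phi> n x) \<le> 2 * K * norm (indicator {-N..N} x *\<^sub>R h x)" for n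
    proof (intro AE_I2)
      fix x show "norm (h x * \<Phi> n x) \<le> 2 * K * norm (indicator {-N..N} x *\<^sub>R h x)"
        using mult_left_mono [OF bound [of n x], of "norm (h x)"] by (auto simp: norm_mult mult_ac)
    qed
  qed
  then have "(\<integral>x. h x * (of_real c * indicator {a<..<b} x) \<partial>lborel) = 0"
    by (simp add: zero [OF test] LIMSEQ_const_iff)
  also have "(\<lambda>x. h x * (of_real c * indicator {a<..<b} x)) = (\<lambda>x. of_real c * (indicator {a<..<b} x *\<^sub>R h x))"
    by (auto simp: indicator_def)
  finally have "of_real c * (\<integral>x. indicator {a<..<b} x *\<^sub>R h x \<partial>lborel) = 0"
    by (simp only: integral_mult_right_zero)
  then show ?thesis using bump_integral_pos by (simp add: c_def)
qed

text \<open>Open intervals form an intersection-stable generator of the Borel sets, so the vanishing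
  of the integrals spreads from intervals to all Borel sets. The restriction to (-N, N) makes the
  function integrable, which is what complements and countable unions require.\<close>

lemma variations:
  fixes h :: "real \<Rightarrow> complex"
  assumes h: "loc_integrable h" and zero: "\<And>\<phi>. test_function \<phi> \<Longrightarrow> (\<integral>x. h x * \<phi> x \<partial>lborel) = 0"
  shows "AE x in lborel. h x = 0"
proof -
  have borel_ivl: "sets borel = sigma_sets UNIV (range (\<lambda>(a, b). {a<..<b::real}))"
  proof -
    have "(\<lambda>(a, b). box a b) = (\<lambda>(a, b). {a<..<b::real})" by (auto simp: box_real)
    then have "(borel :: real measure) = sigma UNIV (range (\<lambda>(a, b). {a<..<b}))"
      using borel_eq_box [where 'a = real] by simp
    then have "sets (borel :: real measure) = sets (sigma UNIV (range (\<lambda>(a, b). {a<..<b})))" by (rule arg_cong)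
    then show ?thesis by (simp only: sets_measure_of Pow_UNIV subset_UNIV)
  qed
  have "AE x in lborel. indicator {-real N<..<real N} x *\<^sub>R h x = 0" for N
  proof (rule sigma_finite_measure.density_zero [OF lborel.sigma_finite_measure_axioms])
    let ?J = "{-real N<..<real N}" and ?F = "\<lambda>x. indicator {-real N<..<real N} x *\<^sub>R h x"
    have hm [measurable]: "h \<in> borel_measurable borel" using h by measurable
    have "integrable lborel (\<lambda>x. indicator ?J x *\<^sub>R (indicator {-real N..real N} x *\<^sub>R h x))"
      using h integrable_mult_indicator [of ?J lborel "\<lambda>x. indicator {-real N..real N} x *\<^sub>R h x"]
      unfolding loc_integrable_def by auto
    then show int: "integrable lborel ?F"
      by (rule Bochner_Integration.integrable_cong [THEN iffD1, rotated 2]) (auto simp: indicator_def)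
    have ivl: "(\<integral>x. indicator {a<..<b} x *\<^sub>R ?F x \<partial>lborel) = 0" for a b
    proof -
      have eq: "(\<lambda>x. indicator {a<..<b} x *\<^sub>R ?F x) = (\<lambda>x. indicator {max a (-real N)<..<min b N} x *\<^sub>R h x)"
        by (auto simp: indicator_def)
      show ?thesis
        unfolding eq using variations_interval [OF h zero]
        by (cases "max a (-real N) \<le> min b N") auto
    qed
    have tot: "(\<integral>x. ?F x \<partial>lborel) = 0"
      using variations_interval [OF h zero, of "-real N" "real N"] by simp
    have "(\<integral>x. indicator A x *\<^sub>R ?F x \<partial>lborel) = 0"
      if "A \<in> sigma_sets UNIV (range (\<lambda>(a, b). {a<..<b::real}))" for A
    proof (rule sigma_sets_induct_disjoint [OF _ _ that])
      show "Int_stable (range (\<lambda>(a, b). {a<..<b::real}))"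
      proof (rule Int_stableI_image)
        fix p q :: "real \<times> real"
        show "\<exists>r\<in>UNIV. (case p of (a, b) \<Rightarrow> {a<..<b}) \<inter> (case q of (a, b) \<Rightarrow> {a<..<b}) = (case r of (a, b) \<Rightarrow> {a<..<b})"
          by (intro bexI [of _ "(max (fst p) (fst q), min (snd p) (snd q))"]) (auto split: prod.splits)
      qed
    next
      fix A :: "real set"
      assume "A \<in> sigma_sets UNIV (range (\<lambda>(a, b). {a<..<b}))"
      then have [measurable]: "A \<in> sets borel" by (simp add: borel_ivl)
      assume A: "(\<integral>x. indicator A x *\<^sub>R ?F x \<partial>lborel) = 0"
      have "(\<lambda>x. indicator (UNIV - A) x *\<^sub>R ?F x) = (\<lambda>x. ?F x - indicator A x *\<^sub>R ?F x)"
        by (auto simp: indicator_def)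
      then show "(\<integral>x. indicator (UNIV - A) x *\<^sub>R ?F x \<partial>lborel) = 0"
        using int A tot by (simp add: integrable_mult_indicator del: scaleR_scaleR)
    next
      fix A :: "nat \<Rightarrow> real set"
      assume A: "disjoint_family A" "range A \<subseteq> sigma_sets UNIV (range (\<lambda>(a, b). {a<..<b}))"
        "\<And>i. (\<integral>x. indicator (A i) x *\<^sub>R ?F x \<partial>lborel) = 0"
      have [measurable]: "A i \<in> sets borel" for i
        using A(2) by (auto simp: borel_ivl)
      have "(LINT x:(\<Union>i. A i)|lborel. ?F x) = (\<Sum>i. LINT x:A i|lborel. ?F x)"
      proof (rule lebesgue_integral_countable_add)
        show "A i \<inter> A j = {}" if "i \<noteq> j" for i j
          using A(1) that by (auto simp: disjoint_family_on_def)
        show "set_integrable lborel (\<Union>i. A i) ?F"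
          unfolding set_integrable_def by (intro integrable_mult_indicator int) auto
      qed auto
      then show "(\<integral>x. indicator (\<Union>i. A i) x *\<^sub>R ?F x \<partial>lborel) = 0"
        unfolding set_lebesgue_integral_def A(3) by simp
    qed (use ivl in auto)
    then show "set_lebesgue_integral lborel A ?F = 0" if "A \<in> sets lborel" for A
      using that by (simp add: set_lebesgue_integral_def borel_ivl del: scaleR_scaleR)
  qed
  then have "AE x in lborel. \<forall>N::nat. indicator {-real N<..<real N} x *\<^sub>R h x = 0"
    unfolding AE_all_countable by blast
  then show ?thesis
  proof eventually_elim
    case (elim x)
    obtain N :: nat where "\<bar>x\<bar> < real N" using reals_Archimedean2 by blast
    with elim show ?case by (auto simp: indicator_def abs_less_iff minus_less_iff dest!: spec [of _ N])
  qed
qed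

lemma variations_eq:
  assumes "loc_integrable f" "loc_integrable g"
    and "\<And>\<phi>. test_function \<phi> \<Longrightarrow> (\<integral>x. f x * \<phi> x \<partial>lborel) = (\<integral>x. g x * \<phi> x \<partial>lborel)"
  shows "ae_eq f g"
proof -
  have "AE x in lborel. f x - g x = 0"
  proof (rule variations)
    show "(\<integral>x. (f x - g x) * \<phi> x \<partial>lborel) = 0" if "test_function \<phi>" for \<phi>
      using assms that by (simp add: left_diff_distrib integrable_loc_integrable_test)
  qed (intro loc_integrable_diff assms)
  then show ?thesis by (simp add: ae_eq_def)
qed

text \<open>Subtracting from a test function its mean times the fixed \<open>\<phi>0\<close> of mean
  one leaves a derivative of a test function, on which \<open>h\<close> vanishes. Hence
  \<open>h\<close> acts as \<open>c\<close> times the mean.\<close>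

lemma du_bois_reymond:
  assumes h: "loc_integrable h"
    and zero: "\<And>\<phi>. test_function \<phi> \<Longrightarrow> (\<integral>x. h x * vderiv \<phi> x \<partial>lborel) = 0"
  obtains c where "ae_eq h (\<lambda>_. c)"
proof -
  define \<phi>0 where "\<phi>0 x = complex_of_real (\<psi> x) / (\<integral>x. complex_of_real (\<psi> x) \<partial>lborel)" for x
  have t0: "test_function \<phi>0"
    using test_function_cmult [OF test_function_of_real [OF bump_test],
        of "1 / (\<integral>x. complex_of_real (\<psi> x) \<partial>lborel)"] by (simp add: \<phi>0_def [abs_def])
  have int0: "(\<integral>x. \<phi>0 x \<partial>lborel) = 1"
    using bump_integral_pos by (simp add: \<phi>0_def)
  define c where "c = (\<integral>x. h x * \<phi>0 x \<partial>lborel)"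
  have const: "loc_integrable (\<lambda>_. k)" for k by (simp add: loc_integrable_continuous)
  have "ae_eq h (\<lambda>_. c)"
  proof (rule variations_eq [OF h const])
    fix \<phi> :: "real \<Rightarrow> complex" assume t: "test_function \<phi>"
    define k where "k = (\<integral>x. \<phi> x \<partial>lborel)"
    have i: "integrable lborel \<phi>" if "test_function \<phi>" for \<phi> :: "real \<Rightarrow> complex"
      using integrable_loc_integrable_test [OF const that, of 1] by simp
    have t1: "test_function (\<lambda>x. \<phi> x + (- k) * \<phi>0 x)"
      by (intro test_function_add test_function_cmult t t0)
    have "(\<integral>x. \<phi> x + (- k) * \<phi>0 x \<partial>lborel) = k + (- k) * 1"
      by (subst Bochner_Integration.integral_add [OF i [OF t] integrable_mult_right [OF i [OF t0]]])
         (simp add: int0 k_def)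
    then obtain \<theta> where "test_function \<theta>" "vderiv \<theta> = (\<lambda>x. \<phi> x + (- k) * \<phi>0 x)"
      using test_function_primitive [OF t1] by auto
    with zero have "(\<integral>x. h x * (\<phi> x + (- k) * \<phi>0 x) \<partial>lborel) = 0" by metis
    moreover have "(\<integral>x. h x * (\<phi> x + (- k) * \<phi>0 x) \<partial>lborel) =
        (\<integral>x. h x * \<phi> x - k * (h x * \<phi>0 x) \<partial>lborel)" by (simp add: algebra_simps)
    moreover have "\<dots> = (\<integral>x. h x * \<phi> x \<partial>lborel) - k * c"
      by (subst Bochner_Integration.integral_diff)
         (auto intro!: integrable_mult_right integrable_loc_integrable_test h t t0 simp: c_def)
    ultimately show "(\<integral>x. h x * \<phi> x \<partial>lborel) = (\<integral>x. c * \<phi> x \<partial>lborel)"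
      by (simp add: k_def)
  qed
  then show ?thesis by (rule that)
qed

end

text \<open>Serves both for Lebesgue measure and for the measures that make up the potential. The
  dominating function is a product of an indicator in x and |r| in y, which is integrable over the
  product space.\<close>

lemma fubini_kernel:
  fixes M :: "real measure" and K :: "real \<Rightarrow> real \<Rightarrow> complex" and r \<phi> :: "real \<Rightarrow> complex"
  assumes M: "sigma_finite_measure M" "sets M = sets borel" and r: "integrable M r"
    and K: "case_prod K \<in> borel_measurable (borel \<Otimes>\<^sub>M borel)"
    and \<phi> [measurable]: "\<phi> \<in> borel_measurable borel"
    and bound: "\<And>x y. cmod (K x y * \<phi> x * r y) \<le> D * indicator {-A..A} x * cmod (r y)"
  shows "(\<integral>x. (\<integral>y. K x y * r y \<partial>M) * \<phi> x \<partial>lborel) = (\<integral>y. (\<integral>x. K x y * \<phi> x \<partial>lborel) * r y \<partial>M)"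
proof -
  interpret M: sigma_finite_measure M by fact
  interpret pair_sigma_finite lborel M ..
  have [measurable_cong]: "sets M = sets borel" by fact
  have [measurable]: "case_prod K \<in> borel_measurable (borel \<Otimes>\<^sub>M borel)" by fact
  have [measurable]: "r \<in> borel_measurable borel"
    using borel_measurable_integrable [OF r] by (simp cong: measurable_cong_sets add: M)
  have 1: "integrable (lborel \<Otimes>\<^sub>M M) (\<lambda>(x, y). D * indicator {-A..A} x * cmod (r y))"
  proof (rule Fubini_integrable)
    have "integrable lborel (\<lambda>x. \<bar>D\<bar> * (indicator {-A..A} x * (\<integral>y. cmod (r y) \<partial>M)) :: real)"
      by (intro integrable_mult_right integrable_mult_left) (auto simp: emeasure_lborel_Icc_eq)
    then show "integrable lborel (\<lambda>x. \<integral>y. norm (case (x, y) of (x, y) \<Rightarrow> D * indicator {-A..A} x * cmod (r y)) \<partial>M)"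
      by (simp add: abs_mult mult.assoc)
    show "AE x in lborel. integrable M (\<lambda>y. case (x, y) of (x, y) \<Rightarrow> D * indicator {-A..A} x * cmod (r y))"
      using r by (auto intro!: integrable_mult_right)
  qed measurable
  have "integrable (lborel \<Otimes>\<^sub>M M) (\<lambda>(x, y). K x y * \<phi> x * r y)"
  proof (rule Bochner_Integration.integrable_bound [OF 1])
    show "(\<lambda>(x, y). K x y * \<phi> x * r y) \<in> borel_measurable (lborel \<Otimes>\<^sub>M M)" by measurable
    show "AE x in lborel \<Otimes>\<^sub>M M. norm (case x of (x, y) \<Rightarrow> K x y * \<phi> x * r y)
        \<le> norm (case x of (x, y) \<Rightarrow> D * indicator {-A..A} x * cmod (r y))"
      by (intro AE_I2) (auto intro: order_trans [OF bound abs_ge_self] split: prod.split)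
  qed
  from Fubini_integral [OF this] show ?thesis by (simp add: mult_ac flip: integral_mult_left_zero integral_mult_right_zero)
qed

section \<open>Equality almost everywhere and continuous representatives\<close>

lemma L2_norm_cong: "ae_eq f g \<Longrightarrow> f \<in> borel_measurable borel \<Longrightarrow> g \<in> borel_measurable borel \<Longrightarrow> L2_norm f = L2_norm g"
  unfolding L2_norm_def ae_eq_def
  by (intro arg_cong [where f = sqrt] integral_cong_AE) (auto elim!: eventually_mono)

lemma ae_eq_refl [simp]: "ae_eq f f" by (simp add: ae_eq_def)

lemma ae_eq_sym: "ae_eq f g \<Longrightarrow> ae_eq g f"
  by (auto simp: ae_eq_def elim!: eventually_mono)

lemma ae_eq_trans [trans]: "ae_eq f g \<Longrightarrow> ae_eq g h \<Longrightarrow> ae_eq f h"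
  unfolding ae_eq_def by (auto elim: eventually_elim2)

lemma ae_eq_integral_mult:
  assumes "ae_eq f g" "f \<in> borel_measurable borel" "g \<in> borel_measurable borel" "h \<in> borel_measurable borel"
  shows "(\<integral>x. f x * h x \<partial>lborel) = (\<integral>x. g x * h x \<partial>lborel)"
  using assms unfolding ae_eq_def by (intro integral_cong_AE) (auto elim!: eventually_mono)

text \<open>The set where two continuous functions differ is open; if nonempty it contains an
  interval of positive length and cannot be null.\<close>

lemma ae_eq_continuous_imp_eq:
  fixes v w :: "real \<Rightarrow> complex"
  assumes "continuous_on UNIV v" "continuous_on UNIV w" "ae_eq v w"
  shows "v = w"
proof (rule ccontr)
  assume "v \<noteq> w"
  have op: "open {x. v x \<noteq> w x}" by (intro open_Collect_neq assms)
  have "AE x in lborel. x \<notin> {x. v x \<noteq> w x}" using assms(3) by (simp add: ae_eq_def)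
  then have "emeasure lborel {x. v x \<noteq> w x} = 0"
    using op by (subst (asm) AE_iff_null) (auto simp: null_sets_def)
  moreover obtain x where "x \<in> {x. v x \<noteq> w x}" using \<open>v \<noteq> w\<close> by auto
  with op obtain e where "e > 0" "cball x e \<subseteq> {x. v x \<noteq> w x}" by (meson open_contains_cball)
  then have "emeasure lborel (cball x e) \<le> emeasure lborel {x. v x \<noteq> w x}"
    using op by (intro emeasure_mono) auto
  moreover have "cball x e = {x-e..x+e}" by (auto simp: dist_real_def)
  ultimately show False using \<open>e > 0\<close> by simp
qed

lemma cont_rep_eq:
  assumes "continuous_on UNIV w" "bounded (range w)" "ae_eq w u"
  shows "cont_rep u = w"
  unfolding cont_rep_def
proof (rule the_equality)
  show "v = w" if "continuous_on UNIV v \<and> bounded (range v) \<and> ae_eq v u" for v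
    using that assms ae_eq_continuous_imp_eq ae_eq_sym ae_eq_trans by metis
qed (use assms in auto)

lemma cont_rep_cong: "ae_eq u v \<Longrightarrow> cont_rep u = cont_rep v"
  unfolding cont_rep_def using ae_eq_sym ae_eq_trans by metis

text \<open>Stated as an equality of predicates so that the \<open>SOME\<close> in
  \<open>weak_deriv\<close> selects literally the same function for both representatives.\<close>

lemma has_weak_deriv_cong:
  assumes "ae_eq u u'" "u \<in> L2" "u' \<in> L2"
  shows "has_weak_deriv j u = has_weak_deriv j u'"
proof -
  have "(\<integral>x. u x * nderiv j \<phi> x \<partial>lborel) = (\<integral>x. u' x * nderiv j \<phi> x \<partial>lborel)"
    if "test_function \<phi>" for \<phi>
    using assms that by (intro ae_eq_integral_mult) (auto intro: L2_borel test_function_borel test_function_nderiv)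
  with assms show ?thesis by (auto simp: has_weak_deriv_def fun_eq_iff)
qed

lemma has_weak_deriv_0: "u \<in> L2 \<Longrightarrow> has_weak_deriv 0 u u"
  by (simp add: has_weak_deriv_def)

section \<open>Uniqueness of weak derivatives and the one-dimensional Sobolev embedding\<close>

context bump
begin

lemma has_weak_deriv_unique: "has_weak_deriv j u v \<Longrightarrow> has_weak_deriv j u v' \<Longrightarrow> ae_eq v v'"
  by (intro variations_eq L2_loc_integrable) (auto simp: has_weak_deriv_def)

lemma weak_deriv_ae:
  assumes "has_weak_deriv j u v"
  shows "has_weak_deriv j u (weak_deriv j u)" "ae_eq (weak_deriv j u) v"
proof -
  show "has_weak_deriv j u (weak_deriv j u)"
    unfolding weak_deriv_def using assms by (rule someI [where P = "has_weak_deriv j u"])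
  then show "ae_eq (weak_deriv j u) v" using assms by (rule has_weak_deriv_unique)
qed

lemma L2_norm_weak_deriv:
  assumes "has_weak_deriv j u v"
  shows "L2_norm (weak_deriv j u) = L2_norm v"
  using weak_deriv_ae [OF assms] assms
  by (intro L2_norm_cong) (auto simp: has_weak_deriv_def intro: L2_borel)

text \<open>A primitive of \<open>v\<close> is continuous and differs from \<open>u\<close> by a
  constant, by the lemma of du Bois-Reymond. Boundedness follows from square-integrability of the
  representative together with a uniform bound on its growth over unit intervals.\<close>

lemma sobolev_embedding:
  assumes uv: "has_weak_deriv 1 u v"
  obtains w where "continuous_on UNIV w" "bounded (range w)" "ae_eq w u"
proof -
  have u: "u \<in> L2" and v: "v \<in> L2" using uv by (auto simp: has_weak_deriv_def)
  have [measurable]: "u \<in> borel_measurable borel" "v \<in> borel_measurable borel" using u v by measurable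
  \<comment> \<open>The signed indicator of the interval between 0 and x: integrating it against
    \<open>v\<close> gives the primitive based at 0, and integration by parts becomes an application
    of Fubini.\<close>
  define K :: "real \<Rightarrow> real \<Rightarrow> complex" where "K x y = of_bool (y < x) - of_bool (y < 0)" for x y
  define w0 where "w0 x = (\<integral>y. K x y * v y \<partial>lborel)" for x
  have Km [measurable]: "case_prod K \<in> borel_measurable (borel \<Otimes>\<^sub>M borel)"
    unfolding K_def by measurable
  have Kle: "cmod (K x y) \<le> 1" for x y by (auto simp: K_def)
  have K0: "K x y = 0" if "\<bar>x\<bar> \<le> N" "\<bar>y\<bar> > N" for x y N using that by (auto simp: K_def)
  have intv: "integrable lborel (\<lambda>y. v y * g y)" if "g \<in> borel_measurable borel"
     "\<And>x. cmod (g x) \<le> indicator {-N..N} x" for g N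
    by (rule integrable_loc_integrable_bounded [OF L2_loc_integrable [OF v], of _ 1 N]) (use that in auto)
  have intK: "integrable lborel (\<lambda>y. K x y * v y)" for x
  proof -
    have "integrable lborel (\<lambda>y. v y * K x y)"
    proof (rule intv [of _ "\<bar>x\<bar>"])
      show "cmod (K x y) \<le> indicator {-\<bar>x\<bar>..\<bar>x\<bar>} y" for y by (auto simp: K_def)
    qed simp
    then show ?thesis by (simp add: mult.commute)
  qed
  have cont: "continuous_on UNIV w0"
  proof -
    have "isCont w0 x" for x
      unfolding continuous_at_sequentially comp_def
    proof (intro allI impI)
      fix X assume X: "X \<longlonglongrightarrow> x"
      obtain N where N: "\<And>n. \<bar>X n\<bar> \<le> N"
        using convergent_imp_Bseq [OF convergentI [OF X]] by (auto simp: Bseq_def)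
      have N': "\<bar>x\<bar> \<le> N" using N tendsto_rabs [OF X] by (meson LIMSEQ_le_const2)
      show "(\<lambda>n. w0 (X n)) \<longlonglongrightarrow> w0 x"
        unfolding w0_def
      proof (rule integral_dominated_convergence)
        show "integrable lborel (\<lambda>y. norm (v y * indicator {-N..N} y))"
          by (intro integrable_norm intv [of _ N]) (auto simp: indicator_def)
        show "AE y in lborel. (\<lambda>n. K (X n) y * v y) \<longlonglongrightarrow> K x y * v y"
          using AE_lborel_singleton [of x]
        proof eventually_elim
          case (elim y)
          then consider "y < x" | "x < y" by linarith
          then have "eventually (\<lambda>n. K (X n) y * v y = K x y * v y) sequentially"
          proof cases
            case 1
            from order_tendstoD(1) [OF X 1] show ?thesis by eventually_elim (simp add: K_def 1)
          next
            case 2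
            from order_tendstoD(2) [OF X 2] show ?thesis by eventually_elim (use 2 in \<open>simp add: K_def\<close>)
          qed
          then show ?case by (rule tendsto_eventually)
        qed
        show "AE y in lborel. norm (K (X n) y * v y) \<le> norm (v y * indicator {- N..N} y)" for n
        proof (intro AE_I2)
          fix y show "norm (K (X n) y * v y) \<le> norm (v y * indicator {- N..N} y)"
            using Kle [of "X n" y] K0 [OF N [of n], of y]
            by (cases "y \<in> {-N..N}")
              (auto simp: norm_mult mult.commute abs_if intro!: mult_left_le split: if_splits)
        qed
      qed measurable
    qed
    then show ?thesis by (simp add: continuous_on_eq_continuous_at)
  qed
  have ibp: "(\<integral>x. w0 x * vderiv \<phi> x \<partial>lborel) = - (\<integral>x. v x * \<phi> x \<partial>lborel)" if t: "test_function \<phi>" for \<phi>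
  proof -
    note t' = test_function_vderiv [OF t]
    obtain A where A: "A > 0" "\<And>x. \<bar>x\<bar> > A \<Longrightarrow> \<phi> x = 0" using t test_function_support by blast
    note A' = vanishing_vderiv [of A \<phi>, OF A(2)]
    obtain B where B: "B > 0" "\<And>x. norm (vderiv \<phi> x) \<le> B" using test_function_bounded [OF t'] by blast
    \<comment> \<open>\<open>v\<close> is only square-integrable. Cutting it to [-A, A] makes it
      integrable and leaves the integrals unchanged, because for |x| at most A the kernel vanishes
      when |y| exceeds A.\<close>
    define r where "r y = indicator {-A..A} y *\<^sub>R v y" for y
    have "(\<integral>x. w0 x * vderiv \<phi> x \<partial>lborel) = (\<integral>x. (\<integral>y. K x y * r y \<partial>lborel) * vderiv \<phi> x \<partial>lborel)"
    proof (rule Bochner_Integration.integral_cong)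
      fix x
      show "w0 x * vderiv \<phi> x = (\<integral>y. K x y * r y \<partial>lborel) * vderiv \<phi> x"
      proof (cases "\<bar>x\<bar> > A")
        case False
        then have "K x y * v y = K x y * r y" for y
          using K0 [of x A y] by (cases "y \<in> {-A..A}") (auto simp: r_def abs_if split: if_splits)
        then show ?thesis by (simp only: w0_def)
      qed (simp add: A')
    qed simp
    also have "\<dots> = (\<integral>y. (\<integral>x. K x y * vderiv \<phi> x \<partial>lborel) * r y \<partial>lborel)"
    proof (rule fubini_kernel [where D = B and A = A])
      show "integrable lborel r"
        using L2_loc_integrable [OF v] by (simp add: r_def [abs_def] loc_integrable_def)
      show "cmod (K x y * vderiv \<phi> x * r y) \<le> B * indicator {- A..A} x * cmod (r y)" for x y
      proof -
        have "cmod (K x y) * cmod (vderiv \<phi> x) \<le> B * indicator {- A..A} x"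
          using A' [of x] mult_mono [OF Kle [of x y] B(2) [of x]] B(1) by (cases "\<bar>x\<bar> > A") (auto simp: indicator_def)
        then show ?thesis by (simp add: norm_mult mult_right_mono)
      qed
    qed (use lborel.sigma_finite_measure_axioms test_function_borel [OF t'] in auto)
    also have "(\<lambda>y. \<integral>x. K x y * vderiv \<phi> x \<partial>lborel) = (\<lambda>y. - \<phi> y)"
    proof
      fix y
      have i: "integrable lborel (vderiv \<phi>)"
        using integrable_loc_integrable_test [OF loc_integrable_continuous t', of "\<lambda>_. 1"] by simp
      have i': "integrable lborel (\<lambda>x. indicator {y<..} x *\<^sub>R vderiv \<phi> x)"
        by (intro integrable_mult_indicator i) auto
      have 1: "(\<integral>x. indicator {y<..} x *\<^sub>R vderiv \<phi> x \<partial>lborel) = - \<phi> y"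
        by (rule ftc_right [of \<phi> "vderiv \<phi>" A])
           (use A A' test_function_deriv [OF t] test_function_continuous [OF t'] in auto)
      have 2: "(\<integral>x. vderiv \<phi> x \<partial>lborel) = 0"
        by (rule ftc_line [of \<phi> "vderiv \<phi>" A])
           (use A A' test_function_deriv [OF t] test_function_continuous [OF t'] in auto)
      have "(\<lambda>x. K x y * vderiv \<phi> x) =
          (\<lambda>x. indicator {y<..} x *\<^sub>R vderiv \<phi> x - of_bool (y < 0) * vderiv \<phi> x)"
        by (auto simp: K_def indicator_def algebra_simps)
      then show "(\<integral>x. K x y * vderiv \<phi> x \<partial>lborel) = - \<phi> y"
        using i i' 1 2 by simp
    qed
    also have "(\<integral>y. - \<phi> y * r y \<partial>lborel) = (\<integral>y. - (v y * \<phi> y) \<partial>lborel)"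
    proof (rule Bochner_Integration.integral_cong)
      fix y show "- \<phi> y * r y = - (v y * \<phi> y)"
        using A(2) [of y] by (cases "\<bar>y\<bar> > A") (auto simp: r_def indicator_def abs_le_iff)
    qed simp
    finally show ?thesis by simp
  qed
  obtain c where c: "ae_eq (\<lambda>x. u x - w0 x) (\<lambda>_. c)"
  proof (rule du_bois_reymond)
    show lw: "loc_integrable (\<lambda>x. u x - w0 x)"
      by (intro loc_integrable_diff L2_loc_integrable u loc_integrable_continuous cont)
    fix \<phi> :: "real \<Rightarrow> complex" assume t: "test_function \<phi>"
    have "(\<integral>x. u x * vderiv \<phi> x \<partial>lborel) = - (\<integral>x. v x * \<phi> x \<partial>lborel)"
      using uv t by (simp add: has_weak_deriv_def)
    with ibp [OF t] show "(\<integral>x. (u x - w0 x) * vderiv \<phi> x \<partial>lborel) = 0"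
      using integrable_loc_integrable_test [OF L2_loc_integrable [OF u] test_function_vderiv [OF t]]
        integrable_loc_integrable_test [OF loc_integrable_continuous [OF cont] test_function_vderiv [OF t]]
      by (simp add: left_diff_distrib)
  qed
  define w where "w x = w0 x + c" for x
  have wcont: "continuous_on UNIV w" unfolding w_def by (intro continuous_intros cont)
  have wu: "ae_eq w u" using c unfolding ae_eq_def w_def by (auto elim!: eventually_mono)
  have [measurable]: "w \<in> borel_measurable borel" by (rule continuous_UNIV_borel [OF wcont])
  have iw: "integrable lborel (\<lambda>x. (cmod (w x))\<^sup>2)"
  proof (rule integrable_cong_AE_imp [OF L2_integrable [OF u]])
    show "AE x in lborel. (cmod (u x))\<^sup>2 = (cmod (w x))\<^sup>2" using wu by (auto simp: ae_eq_def elim!: eventually_mono)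
  qed measurable
  \<comment> \<open>Bounds the integral of |v| over any interval of length at most 1, since |v| is
    at most 1 + |v|^2.\<close>
  define Q where "Q = 1 + (\<integral>y. (cmod (v y))\<^sup>2 \<partial>lborel)"
  have step: "cmod (w x) \<le> cmod (w y) + Q" if "x \<le> y" "y \<le> x + 1" for x y
  proof -
    have "w y - w x = (\<integral>t. (K y t - K x t) * v t \<partial>lborel)"
      unfolding w_def w0_def using intK by (simp add: left_diff_distrib)
    also have "\<dots> = (\<integral>t. v t * indicator {x..<y} t \<partial>lborel)"
      by (rule Bochner_Integration.integral_cong) (use that in \<open>auto simp: K_def indicator_def\<close>)
    finally have "cmod (w y - w x) \<le> (\<integral>t. cmod (v t * indicator {x..<y} t) \<partial>lborel)"
      using integral_norm_bound by metis
    also have "\<dots> \<le> (\<integral>t. indicator {x..x+1} t + (cmod (v t))\<^sup>2 \<partial>lborel)"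
    proof (rule integral_mono)
      show "integrable lborel (\<lambda>t. cmod (v t * indicator {x..<y} t))"
        by (intro integrable_norm intv [of _ "\<bar>x\<bar> + \<bar>y\<bar>"]) (auto simp: indicator_def)
      show "integrable lborel (\<lambda>t. indicator {x..x+1} t + (cmod (v t))\<^sup>2)"
        by (intro Bochner_Integration.integrable_add L2_integrable v) (auto simp: emeasure_lborel_Icc_eq)
      fix t
      have "cmod (v t) \<le> 1 + (cmod (v t))\<^sup>2"
        using two_mult_le_squares [of "cmod (v t)" 1] norm_ge_zero [of "v t"] by (simp, linarith)
      then show "cmod (v t * indicator {x..<y} t) \<le> indicator {x..x+1} t + (cmod (v t))\<^sup>2"
        using that by (auto simp: indicator_def norm_mult)
    qed
    also have "\<dots> = Q"
      unfolding Q_def using L2_integrable [OF v]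
      by (subst Bochner_Integration.integral_add) (auto simp: emeasure_lborel_Icc_eq)
    finally show ?thesis by (metis add.commute add_le_cancel_left norm_minus_commute norm_triangle_sub order_trans)
  qed
  have "cmod (w x) \<le> (\<integral>y. (cmod (w y))\<^sup>2 \<partial>lborel) + (1 + Q)" for x
  proof -
    have "cmod (w x) = (\<integral>y. indicator {x..x+1} y * cmod (w x) \<partial>lborel)" by simp
    also have "\<dots> \<le> (\<integral>y. (cmod (w y))\<^sup>2 + indicator {x..x+1} y * (1 + Q) \<partial>lborel)"
    proof (rule integral_mono)
      show "integrable lborel (\<lambda>y. indicator {x..x+1} y * cmod (w x))"
        by (intro integrable_mult_left) (auto simp: emeasure_lborel_Icc_eq)
      show "integrable lborel (\<lambda>y. (cmod (w y))\<^sup>2 + indicator {x..x+1} y * (1 + Q))"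
        by (intro Bochner_Integration.integrable_add iw integrable_mult_left) (auto simp: emeasure_lborel_Icc_eq)
      fix y
      have "cmod (w y) \<le> 1 + (cmod (w y))\<^sup>2"
        using two_mult_le_squares [of "cmod (w y)" 1] norm_ge_zero [of "w y"] by (simp, linarith)
      then show "indicator {x..x+1} y * cmod (w x) \<le> (cmod (w y))\<^sup>2 + indicator {x..x+1} y * (1 + Q)"
        using step [of x y] by (auto simp: indicator_def)
    qed
    also have "\<dots> = (\<integral>y. (cmod (w y))\<^sup>2 \<partial>lborel) + (1 + Q)"
      by (subst Bochner_Integration.integral_add [OF iw integrable_mult_left])
         (auto simp: emeasure_lborel_Icc_eq)
    finally show ?thesis .
  qed
  then have "bounded (range w)" by (auto simp: bounded_iff)
  from that [OF wcont this wu] show ?thesis .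
qed

end

section \<open>Holomorphic dependence on a parameter\<close>

text \<open>Cauchy's inequality on the disc of radius r/4 about \<open>v\<close>, which stays inside
  the ball because \<open>v\<close> lies in its inner half.\<close>

lemma holomorphic_deriv_bound:
  assumes f: "f holomorphic_on ball w r" and G: "\<And>v. v \<in> ball w r \<Longrightarrow> cmod (f v) \<le> G"
    and v: "v \<in> ball w (r/2)" and "r > 0"
  shows "cmod (deriv f v) \<le> 4 * G / r"
proof -
  have sub: "cball v (r/4) \<subseteq> ball w r"
  proof
    fix u assume "u \<in> cball v (r/4)"
    with v \<open>r > 0\<close> show "u \<in> ball w r"
      using dist_triangle [of w u v] by (simp)
  qed
  have "norm ((deriv ^^ 1) f v) \<le> fact 1 * G / (r/4) ^ 1"
  proof (rule Cauchy_inequality)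
    show "f holomorphic_on ball v (r/4)" using sub by (intro holomorphic_on_subset [OF f]) auto
    show "continuous_on (cball v (r/4)) f" using sub holomorphic_on_imp_continuous_on [OF f]
      by (rule continuous_on_subset [rotated])
    show "norm (f x) \<le> G" if "norm (v - x) = r/4" for x
      using that sub by (intro G) (auto simp: dist_norm)
  qed (use \<open>r > 0\<close> in auto)
  then show ?thesis by (simp add: field_simps)
qed

lemma holomorphic_lipschitz:
  assumes f: "f holomorphic_on ball w r" and G: "\<And>v. v \<in> ball w r \<Longrightarrow> cmod (f v) \<le> G"
    and v: "v \<in> ball w (r/2)" and "r > 0"
  shows "cmod (f v - f w) \<le> 4 * G / r * cmod (v - w)"
proof (rule field_differentiable_bound)
  show "(f has_field_derivative deriv f z) (at z within ball w (r/2))" if "z \<in> ball w (r/2)" for z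
  proof -
    have "z \<in> ball w r" using that \<open>r > 0\<close> by simp
    from holomorphic_derivI [OF f open_ball this] show ?thesis by (rule has_field_derivative_at_within)
  qed
  show "cmod (deriv f z) \<le> 4 * G / r" if "z \<in> ball w (r/2)" for z
    by (rule holomorphic_deriv_bound [OF f G that \<open>r > 0\<close>])
qed (use v \<open>r > 0\<close> in auto)

text \<open>First-order Taylor expansion. The second derivative is bounded by two applications of
  the Cauchy inequality, on radius r and then r/2, whence 4 (4 G / r) / (r/2) = 32 G / r^2.\<close>

lemma holomorphic_quotient_bound:
  assumes f: "f holomorphic_on ball w r" and G: "\<And>v. v \<in> ball w r \<Longrightarrow> cmod (f v) \<le> G"
    and v: "v \<in> ball w (r/4)" "v \<noteq> w" and "r > 0"
  shows "cmod ((f v - f w) / (v - w) - deriv f w) \<le> 32 * G / r\<^sup>2 * cmod (v - w)"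
proof -
  have f': "deriv f holomorphic_on ball w (r/2)"
    using \<open>r > 0\<close> by (intro holomorphic_deriv holomorphic_on_subset [OF f]) auto
  have "cmod ((deriv ^^ 0) f v - (\<Sum>i\<le>1. (deriv ^^ i) f w * (v - w) ^ i / fact i))
      \<le> 4 * (4 * G / r) / (r/2) * cmod (v - w) ^ Suc 1 / fact 1"
  proof (rule complex_Taylor [where f = "\<lambda>i. (deriv ^^ i) f"])
    show "((deriv ^^ i) f has_field_derivative
        (deriv ^^ (Suc i)) f x) (at x within ball w (r/4))"
      if "x \<in> ball w (r/4)" "i \<le> 1" for i x
    proof (cases i)
      case 0
      then show ?thesis using that \<open>r > 0\<close> has_field_derivative_at_within [OF holomorphic_derivI [OF f open_ball, of x]] by auto
    next
      case (Suc n)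
      then have "i = 1" using that by simp
      then show ?thesis using that \<open>r > 0\<close> has_field_derivative_at_within [OF holomorphic_derivI [OF f' open_ball, of x]] by auto
    qed
    show "cmod ((deriv ^^ (Suc 1)) f x) \<le> 4 * (4 * G / r) / (r / 2)"
      if "x \<in> ball w (r/4)" for x
      using holomorphic_deriv_bound [OF f' holomorphic_deriv_bound [OF f G _ \<open>r > 0\<close>], of x] that \<open>r > 0\<close>
      by simp
  qed (use v \<open>r > 0\<close> in auto)
  then have "cmod (f v - f w - deriv f w * (v - w)) \<le> 32 * G / r\<^sup>2 * cmod (v - w) * cmod (v - w)"
    by (simp add: power2_eq_square field_simps diff_diff_eq)
  moreover have "f v - f w - deriv f w * (v - w) = ((f v - f w) / (v - w) - deriv f w) * (v - w)"
    using v by (simp add: field_simps)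
  ultimately have "cmod ((f v - f w) / (v - w) - deriv f w) * cmod (v - w) \<le> 32 * G / r\<^sup>2 * cmod (v - w) * cmod (v - w)"
    by (simp add: norm_mult)
  from mult_right_le_imp_le [OF this] v show ?thesis by simp
qed

text \<open>A bound on the integrand alone dominates the difference quotients too, by the Cauchy
  inequality; dominated convergence along sequences then differentiates under the integral.\<close>

lemma holomorphic_integral:
  fixes F :: "complex \<Rightarrow> 'a \<Rightarrow> complex"
  assumes meas: "\<And>l. l \<in> ball z r \<Longrightarrow> F l \<in> borel_measurable M"
    and hol: "AE y in M. (\<lambda>l. F l y) holomorphic_on ball z r"
    and bound: "AE y in M. \<forall>l\<in>ball z r. cmod (F l y) \<le> G y" and G: "integrable M G"
  shows "(\<lambda>l. \<integral>y. F l y \<partial>M) holomorphic_on ball z r"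
proof (rule holomorphic_onI)
  fix w assume w: "w \<in> ball z r"
  define \<rho> where "\<rho> = r - dist z w"
  have \<rho>: "\<rho> > 0" and sub: "ball w \<rho> \<subseteq> ball z r"
    using w by (auto simp: \<rho>_def) (smt (verit) dist_triangle)
  have int: "integrable M (F l)" if "l \<in> ball z r" for l
    by (rule Bochner_Integration.integrable_bound [OF G meas [OF that]])
       (use bound that in \<open>auto elim!: eventually_mono intro: order_trans [OF _ abs_ge_self]\<close>)
  have hol': "AE y in M. (\<lambda>l. F l y) holomorphic_on ball w \<rho>"
    using hol by eventually_elim (rule holomorphic_on_subset [OF _ sub])
  have quot: "AE y in M. (\<lambda>i. (F (X i) y - F w y) / (X i - w)) \<longlonglongrightarrow> deriv (\<lambda>l. F l y) w"
    if X: "\<And>i. X i \<noteq> w" "X \<longlonglongrightarrow> w" for X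
    using hol'
  proof eventually_elim
    case (elim y)
    then have "((\<lambda>l. F l y) has_field_derivative deriv (\<lambda>l. F l y) w) (at w)"
      by (rule holomorphic_derivI) (use \<rho> in auto)
    then have "((\<lambda>l. (F l y - F w y) / (l - w)) \<longlongrightarrow> deriv (\<lambda>l. F l y) w) (at w)"
      by (simp add: has_field_derivative_iff)
    moreover have "filterlim X (at w) sequentially"
      using X by (simp add: filterlim_at)
    ultimately show ?case by (rule filterlim_compose)
  qed
  have m: "(\<lambda>y. (F v y - F w y) / (v - w)) \<in> borel_measurable M" if "v \<in> ball z r" for v
    using meas [OF that] meas [OF w] by simp
  define Y where "Y i = w + of_real (\<rho> / (4 * real (Suc i)))" for i
  have Y: "Y i \<noteq> w" "Y i \<in> ball z r" for i
  proof -
    have "\<rho> / (4 * real (Suc i)) < \<rho>" using \<rho> by (simp add: divide_less_eq)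
    then have "Y i \<in> ball w \<rho>" using \<rho> by (simp add: Y_def dist_norm norm_divide norm_mult del: of_nat_Suc)
    then show "Y i \<in> ball z r" using sub by auto
    show "Y i \<noteq> w" using \<rho> by (simp add: Y_def del: of_nat_Suc)
  qed
  have Ylim: "Y \<longlonglongrightarrow> w"
  proof -
    have "(\<lambda>i. \<rho> / (4 * real (Suc i))) \<longlonglongrightarrow> 0" by real_asymp
    from tendsto_add [OF tendsto_const [of w] tendsto_of_real [OF this]] show ?thesis
      by (simp add: Y_def [abs_def])
  qed
  \<comment> \<open>The derivative in the parameter need not be measurable, as \<open>hol\<close> only holds almost everywhere.\<close>
  define D where "D y = lim (\<lambda>i. (F (Y i) y - F w y) / (Y i - w))" for y
  have D: "D \<in> borel_measurable M"
    unfolding D_def using m [OF Y(2)] by (rule borel_measurable_lim_metric)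
  have "((\<lambda>v. ((\<integral>y. F v y \<partial>M) - (\<integral>y. F w y \<partial>M)) / (v - w)) \<longlongrightarrow> (\<integral>y. D y \<partial>M)) (at w within ball w (\<rho>/2))"
    unfolding tendsto_at_iff_sequentially comp_def
  proof (intro allI impI)
    fix X :: "nat \<Rightarrow> complex"
    assume "\<forall>i. X i \<in> ball w (\<rho>/2) - {w}" and Xw: "X \<longlonglongrightarrow> w"
    then have X: "X i \<in> ball w (\<rho>/2)" "X i \<noteq> w" for i by auto
    have X': "X i \<in> ball z r" for i using X(1) [of i] sub \<rho> by (force simp: subset_iff)
    have "(\<lambda>i. \<integral>y. (F (X i) y - F w y) / (X i - w) \<partial>M) \<longlonglongrightarrow> (\<integral>y. D y \<partial>M)"
    proof (rule integral_dominated_convergence)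
      show "integrable M (\<lambda>y. 4 * G y / \<rho>)" using G by simp
      show "AE y in M. (\<lambda>i. (F (X i) y - F w y) / (X i - w)) \<longlonglongrightarrow> D y"
        using quot [OF X(2) Xw] quot [OF Y(1) Ylim] by eventually_elim (simp add: D_def limI)
      show "AE y in M. norm ((F (X i) y - F w y) / (X i - w)) \<le> 4 * G y / \<rho>" for i
        using hol' bound
      proof eventually_elim
        case (elim y)
        have "cmod (F (X i) y - F w y) \<le> 4 * G y / \<rho> * cmod (X i - w)"
          by (rule holomorphic_lipschitz [OF elim(1) _ X(1) \<rho>]) (use elim(2) sub in auto)
        then show ?case using X(2) [of i] by (simp add: norm_divide divide_le_eq)
      qed
    qed (use m [OF X'] D in auto)
    then show "(\<lambda>i. ((\<integral>y. F (X i) y \<partial>M) - (\<integral>y. F w y \<partial>M)) / (X i - w)) \<longlonglongrightarrow> (\<integral>y. D y \<partial>M)"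
      using int [OF X'] int [OF w] by simp
  qed
  then have "((\<lambda>v. ((\<integral>y. F v y \<partial>M) - (\<integral>y. F w y \<partial>M)) / (v - w)) \<longlongrightarrow> (\<integral>y. D y \<partial>M)) (at w)"
    using \<rho> by (simp add: at_within_open [of w "ball w (\<rho>/2)"])
  then have "((\<lambda>l. \<integral>y. F l y \<partial>M) has_field_derivative (\<integral>y. D y \<partial>M)) (at w)"
    by (simp only: has_field_derivative_iff)
  then have "((\<lambda>l. \<integral>y. F l y \<partial>M) has_field_derivative (\<integral>y. D y \<partial>M)) (at w within ball z r)"
    by (rule has_field_derivative_at_within)
  then show "(\<lambda>l. \<integral>y. F l y \<partial>M) field_differentiable at w within ball z r"
    unfolding field_differentiable_def ..
qed

section \<open>Integration against a finite signed measure\<close>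

lemma signed_measure_add:
  assumes V: "signed_borel_measure V" and "A \<in> sets borel" "B \<in> sets borel" "A \<inter> B = {}"
  shows "V (A \<union> B) = V A + V B"
proof -
  have "(\<lambda>i. V (binaryset A B i)) sums V (\<Union>i. binaryset A B i)"
  proof -
    have "range (binaryset A B) \<subseteq> sets borel" using assms by (auto simp: range_binaryset_eq)
    moreover have "disjoint_family (binaryset A B)"
      using assms(4) by (auto simp: disjoint_family_on_def binaryset_def)
    ultimately show ?thesis using V by (simp add: signed_borel_measure_def)
  qed
  moreover have "(\<lambda>i. V (binaryset A B i)) sums (\<Sum>i\<in>{0,1}. V (binaryset A B i))"
    using V by (intro sums_finite) (auto simp: binaryset_def signed_borel_measure_def)
  ultimately show ?thesis
    by (simp add: binaryset_def UN_binaryset_eq sums_iff)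
qed

text \<open>If \<open>V\<close> were unbounded, one could split off again and again a set of
  absolute value at least 1 and keep a remainder on whose subsets \<open>V\<close> is still
  unbounded. The pieces are disjoint, so the series of their values would have to converge, yet its
  terms do not tend to 0.\<close>

lemma signed_measure_bounded:
  assumes V: "signed_borel_measure V"
  obtains B where "\<And>A. A \<in> sets borel \<Longrightarrow> \<bar>V A\<bar> \<le> B"
proof (rule ccontr)
  assume notB: "\<not> thesis"
  define bad where "bad E \<longleftrightarrow> E \<in> sets borel \<and> (\<forall>K. \<exists>A\<in>sets borel. A \<subseteq> E \<and> \<bar>V A\<bar> > K)" for E
  have "bad UNIV" using notB that by (auto simp: bad_def not_le [symmetric])
  have split: "bad A \<or> bad (E - A)" if E: "bad E" and A: "A \<in> sets borel" "A \<subseteq> E" for A E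
  proof (rule ccontr)
    assume "\<not> ?thesis"
    with E A obtain K K' where K: "\<And>B. B \<in> sets borel \<Longrightarrow> B \<subseteq> A \<Longrightarrow> \<bar>V B\<bar> \<le> K"
      "\<And>B. B \<in> sets borel \<Longrightarrow> B \<subseteq> E - A \<Longrightarrow> \<bar>V B\<bar> \<le> K'"
      unfolding bad_def by (metis not_le sets.Diff)
    have "\<bar>V B\<bar> \<le> K + K'" if B: "B \<in> sets borel" "B \<subseteq> E" for B
    proof -
      have "V B = V (B \<inter> A) + V (B - A)"
        using signed_measure_add [OF V, of "B \<inter> A" "B - A"] A B by (auto simp: Int_Diff_Un)
      then show ?thesis using K(1) [of "B \<inter> A"] K(2) [of "B - A"] A B by fastforce
    qed
    with E show False unfolding bad_def by (metis not_le)
  qed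
  have "\<exists>E'. bad E' \<and> E' \<subseteq> E \<and> \<bar>V (E - E')\<bar> \<ge> 1" if E: "bad E" for E
  proof -
    \<comment> \<open>The margin beyond \<open>V E\<close> makes both \<open>A\<close> and
      \<open>E - A\<close> have absolute value at least 1; whichever of the two is bad becomes the
      remainder and the other one is split off.\<close>
    obtain A where A: "A \<in> sets borel" "A \<subseteq> E" "\<bar>V A\<bar> > \<bar>V E\<bar> + 1" using E bad_def by metis
    have "V E = V A + V (E - A)"
      using signed_measure_add [OF V, of A "E - A"] A E by (auto simp: bad_def Un_absorb1)
    then have "\<bar>V (E - A)\<bar> \<ge> 1" using A(3) by linarith
    moreover have "E - (E - A) = A" using A by auto
    moreover have "\<bar>V A\<bar> \<ge> 1" using A(3) by linarith
    ultimately show ?thesis using split [OF E A(1,2)] A(2) Diff_subset by metis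
  qed
  then obtain \<sigma> where nx: "\<And>E. bad E \<Longrightarrow> bad (\<sigma> E) \<and> \<sigma> E \<subseteq> E \<and> \<bar>V (E - \<sigma> E)\<bar> \<ge> 1" by metis
  define E where "E n = (\<sigma> ^^ n) UNIV" for n
  have bE: "bad (E n)" for n by (induction n) (use nx \<open>bad UNIV\<close> in \<open>auto simp: E_def\<close>)
  have E_Suc: "E (Suc n) \<subseteq> E n" "\<bar>V (E n - E (Suc n))\<bar> \<ge> 1" for n using nx [OF bE [of n]] by (auto simp: E_def)
  have mono: "E n \<subseteq> E m" if "m \<le> n" for m n 
    using that lift_Suc_antimono_le [of E, OF E_Suc(1)] by blast
  define D where "D n = E n - E (Suc n)" for n
  have "disjoint_family D"
    unfolding disjoint_family_on_def
  proof (intro ballI impI)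
    fix m n :: nat assume "m \<noteq> n"
    then show "D m \<inter> D n = {}"
      using mono [of "Suc m" n] mono [of "Suc n" m] by (cases m n rule: linorder_cases) (auto simp: D_def)
  qed
  moreover have "range D \<subseteq> sets borel" using bE by (auto simp: D_def bad_def)
  ultimately have "(\<lambda>n. V (D n)) sums V (\<Union>n. D n)" using V by (simp add: signed_borel_measure_def)
  then have "(\<lambda>n. V (D n)) \<longlonglongrightarrow> 0" by (intro summable_LIMSEQ_zero) (rule sums_summable)
  then have "eventually (\<lambda>n. \<bar>V (D n)\<bar> < 1) sequentially"
    by (drule_tac tendstoD [of _ _ _ 1]) (auto simp: dist_real_def)
  then show False using E_Suc(2) by (auto simp: D_def not_less [symmetric] eventually_sequentially)
qed

text \<open>\<open>measure_of\<close> returns either the given set function or the zero measure, so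
  the supremum bounds the value in both cases. Finiteness and the location of the support are read
  off from this inequality.\<close>

lemma emeasure_upper_variation:
  assumes "A \<in> sets borel"
  shows "emeasure (upper_variation V) A \<le> (SUP B\<in>{B \<in> sets borel. B \<subseteq> A}. ennreal (V B))"
proof -
  have "sigma_sets UNIV (sets borel) = sets (borel :: real measure)"
    by (metis sets.sigma_sets_eq space_borel)
  then show ?thesis unfolding upper_variation_def
    by (subst emeasure_measure_of_conv) auto
qed

lemma sets_upper_variation [simp]: "sets (upper_variation V) = sets borel"
  unfolding upper_variation_def by (simp add: sets_measure_of) (metis sets.sigma_sets_eq space_borel)

lemma space_upper_variation [simp]: "space (upper_variation V) = UNIV"
  unfolding upper_variation_def by (simp add: space_measure_of)

lemma finite_measure_upper_variation:
  assumes V: "signed_borel_measure V"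
  shows "finite_measure (upper_variation V)"
proof
  obtain B where B: "\<And>A. A \<in> sets borel \<Longrightarrow> \<bar>V A\<bar> \<le> B" using signed_measure_bounded [OF V] by blast
  have "emeasure (upper_variation V) UNIV \<le> (SUP B\<in>{B \<in> sets borel. B \<subseteq> UNIV}. ennreal (V B))"
    by (rule emeasure_upper_variation) simp
  also have "\<dots> \<le> ennreal B"
    using B by (intro SUP_least ennreal_leI) (auto simp: abs_le_iff)
  finally show "emeasure (upper_variation V) (space (upper_variation V)) \<noteq> \<infinity>"
    by (simp add: top_unique) (metis ennreal_neq_top top_unique)
qed

lemma upper_variation_support:
  assumes "measure_supported_in V K" "K \<in> sets borel"
  shows "emeasure (upper_variation V) (- K) = 0"
proof -
  have "emeasure (upper_variation V) (- K) \<le> (SUP B\<in>{B \<in> sets borel. B \<subseteq> - K}. ennreal (V B))"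
    using assms by (intro emeasure_upper_variation) auto
  also have "\<dots> \<le> 0"
    using assms by (intro SUP_least) (auto simp: measure_supported_in_def)
  finally show ?thesis by simp
qed

lemma signed_borel_measure_uminus: "signed_borel_measure V \<Longrightarrow> signed_borel_measure (\<lambda>A. - V A)"
  by (auto simp: signed_borel_measure_def intro: sums_minus)

lemma measure_supported_in_uminus: "measure_supported_in V K \<Longrightarrow> measure_supported_in (\<lambda>A. - V A) K"
  by (auto simp: measure_supported_in_def)

section \<open>Finite measures concentrated on a compact interval\<close>

locale compact_measure = finite_measure m for m :: "real measure" +
  fixes R :: real
  assumes sets_eq [measurable_cong, simp]: "sets m = sets borel"
    and supp: "emeasure m (- {-R..R}) = 0" and R_pos: "R > 0"
begin

lemma space_eq [simp]: "space m = UNIV"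
  using sets_eq_imp_space_eq [OF sets_eq] by simp

lemma AE_supp: "AE y in m. \<bar>y\<bar> \<le> R"
proof (rule AE_I')
  show "- {-R..R} \<in> null_sets m" using supp by (auto simp: null_sets_def)
qed (auto simp: abs_le_iff)

lemma integrable_supp:
  assumes [measurable]: "k \<in> borel_measurable borel" and B: "\<And>y. \<bar>y\<bar> \<le> R \<Longrightarrow> cmod (k y) \<le> B"
  shows "integrable m k"
  using AE_supp by (intro integrable_const_bound [of _ B]) (auto elim!: eventually_mono intro: B)

lemma norm_integral_le:
  assumes B: "\<And>y. \<bar>y\<bar> \<le> R \<Longrightarrow> cmod (k y) \<le> B"
  shows "cmod (\<integral>y. k y \<partial>m) \<le> measure m UNIV * B"
proof (cases "integrable m k")
  case True
  have "cmod (\<integral>y. k y \<partial>m) \<le> (\<integral>y. cmod (k y) \<partial>m)" by (rule integral_norm_bound)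
  also have "\<dots> \<le> (\<integral>y. B \<partial>m)"
    by (rule integral_mono_AE) (use True AE_supp B in \<open>auto elim!: eventually_mono\<close>)
  finally show ?thesis by simp
next
  case False
  have "0 \<le> B" using order_trans [OF norm_ge_zero B [of 0]] R_pos by simp
  then show ?thesis using False by (simp add: not_integrable_integral_eq)
qed

lemma integral_cong_supp:
  assumes "k \<in> borel_measurable borel" "k' \<in> borel_measurable borel" "\<And>y. \<bar>y\<bar> \<le> R \<Longrightarrow> k y = k' y"
  shows "(\<integral>y. k y \<partial>m) = (\<integral>y. k' y \<partial>m :: complex)"
  using assms AE_supp by (intro integral_cong_AE) (auto elim!: eventually_mono)

lemma integral_lim_supp:
  fixes k :: "nat \<Rightarrow> real \<Rightarrow> complex"
  assumes "\<And>n. k n \<in> borel_measurable borel" "k' \<in> borel_measurable borel"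
    and "\<And>n y. \<bar>y\<bar> \<le> R \<Longrightarrow> cmod (k n y) \<le> B"
    and "AE y in m. (\<lambda>n. k n y) \<longlonglongrightarrow> k' y"
  shows "(\<lambda>n. \<integral>y. k n y \<partial>m) \<longlonglongrightarrow> (\<integral>y. k' y \<partial>m)"
proof (rule integral_dominated_convergence [where w = "\<lambda>_. B"])
  show "AE y in m. norm (k n y) \<le> B" for n
    using AE_supp by eventually_elim (rule assms)
qed (use assms in auto)

lemma holomorphic_integral_supp:
  assumes "\<And>l. l \<in> ball z r \<Longrightarrow> F l \<in> borel_measurable borel"
    and "\<And>y. (\<lambda>l. F l y) holomorphic_on ball z r"
    and "\<And>l y. l \<in> ball z r \<Longrightarrow> \<bar>y\<bar> \<le> R \<Longrightarrow> cmod (F l y) \<le> B"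
  shows "(\<lambda>l. \<integral>y. F l y \<partial>m) holomorphic_on ball z r"
  using assms AE_supp
  by (intro holomorphic_integral [where G = "\<lambda>_. B"]) (auto elim!: eventually_mono)

lemma integral_measurable:
  fixes K :: "real \<Rightarrow> real \<Rightarrow> complex"
  assumes "case_prod K \<in> borel_measurable (borel \<Otimes>\<^sub>M borel)"
  shows "(\<lambda>x. \<integral>y. K x y \<partial>m) \<in> borel_measurable borel"
proof (rule borel_measurable_lebesgue_integral)
  show "case_prod K \<in> borel_measurable (borel \<Otimes>\<^sub>M m)"
    using assms by (simp cong: measurable_cong_sets sets_pair_measure_cong)
qed

lemma fubini_supp:
  fixes K :: "real \<Rightarrow> real \<Rightarrow> complex"
  assumes "case_prod K \<in> borel_measurable (borel \<Otimes>\<^sub>M borel)"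
    and "\<phi> \<in> borel_measurable borel"
    and "\<And>x y. \<bar>y\<bar> \<le> R \<Longrightarrow> cmod (K x y * \<phi> x) \<le> D * indicator {-A..A} x"
  shows "(\<integral>x. (\<integral>y. K x y \<partial>m) * \<phi> x \<partial>lborel) = (\<integral>y. (\<integral>x. K x y * \<phi> x \<partial>lborel) \<partial>m)"
proof -
  \<comment> \<open>The kernel is bounded only for |y| at most R. The indicator moves this
    restriction into the weight and leaves integrals against \<open>m\<close> unchanged.\<close>
  define r :: "real \<Rightarrow> complex" where "r y = indicator {-R..R} y" for y
  have [measurable]: "case_prod K \<in> borel_measurable (borel \<Otimes>\<^sub>M borel)" "\<phi> \<in> borel_measurable borel" by fact+
  have [measurable]: "r \<in> borel_measurable borel" unfolding r_def by measurable
  have "(\<integral>x. (\<integral>y. K x y * r y \<partial>m) * \<phi> x \<partial>lborel) = (\<integral>y. (\<integral>x. K x y * \<phi> x \<partial>lborel) * r y \<partial>m)"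
  proof (rule fubini_kernel [where D = D and A = A])
    show "integrable m r" by (rule integrable_supp [of _ 1]) (auto simp: r_def indicator_def)
    show "cmod (K x y * \<phi> x * r y) \<le> D * indicator {- A..A} x * cmod (r y)" for x y
      using assms(3) [of y x] by (cases "y \<in> {-R..R}") (auto simp: r_def norm_mult)
  qed (auto intro: sigma_finite_measure_axioms)
  also have "(\<integral>y. (\<integral>x. K x y * \<phi> x \<partial>lborel) * r y \<partial>m) = (\<integral>y. (\<integral>x. K x y * \<phi> x \<partial>lborel) \<partial>m)"
    by (intro integral_cong_supp) (auto simp: r_def indicator_def abs_le_iff minus_le_iff)
  also have "(\<lambda>x. \<integral>y. K x y * r y \<partial>m) = (\<lambda>x. \<integral>y. K x y \<partial>m)"
    by (intro ext integral_cong_supp) (auto simp: r_def indicator_def abs_le_iff minus_le_iff)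
  finally show ?thesis .
qed

end

lemma compact_measure_swap:
  fixes K :: "real \<Rightarrow> real \<Rightarrow> complex"
  assumes "compact_measure m R" "compact_measure m' R"
    and K: "case_prod K \<in> borel_measurable (borel \<Otimes>\<^sub>M borel)"
    and B: "\<And>x y. \<bar>x\<bar> \<le> R \<Longrightarrow> \<bar>y\<bar> \<le> R \<Longrightarrow> cmod (K x y) \<le> B"
  shows "(\<integral>x. (\<integral>y. K x y \<partial>m') \<partial>m) = (\<integral>y. (\<integral>x. K x y \<partial>m) \<partial>m')"
proof -
  interpret m: compact_measure m R by fact
  interpret m': compact_measure m' R by fact
  interpret pair_sigma_finite m m' ..
  define K' where "K' x y = K x y * indicator {-R..R} x * indicator {-R..R} y" for x y
  have [measurable]: "case_prod K \<in> borel_measurable (borel \<Otimes>\<^sub>M borel)" by fact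
  have [measurable]: "case_prod K' \<in> borel_measurable (borel \<Otimes>\<^sub>M borel)" unfolding K'_def by measurable
  interpret P: finite_measure "m \<Otimes>\<^sub>M m'" by (intro finite_measure_pair_measure m.finite_measure_axioms m'.finite_measure_axioms)
  have "0 \<le> B" using order_trans [OF norm_ge_zero B [of 0 0]] m.R_pos by simp
  have "integrable (m \<Otimes>\<^sub>M m') (case_prod K')"
  proof (rule P.integrable_const_bound [of _ B])
    show "AE p in m \<Otimes>\<^sub>M m'. norm (case_prod K' p) \<le> B"
      using B \<open>0 \<le> B\<close> by (intro AE_I2) (auto simp: K'_def norm_mult indicator_def split: prod.split)
  qed measurable
  then have "(\<integral>y. (\<integral>x. K' x y \<partial>m) \<partial>m') = (\<integral>x. (\<integral>y. K' x y \<partial>m') \<partial>m)" by (rule Fubini_integral)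
  also have "(\<integral>y. (\<integral>x. K' x y \<partial>m) \<partial>m') = (\<integral>y. (\<integral>x. K x y \<partial>m) \<partial>m')"
    by (intro m'.integral_cong_supp m.integral_cong_supp) (auto simp: K'_def indicator_def abs_le_iff minus_le_iff)
  also have "(\<integral>x. (\<integral>y. K' x y \<partial>m') \<partial>m) = (\<integral>x. (\<integral>y. K x y \<partial>m') \<partial>m)"
    by (intro m'.integral_cong_supp m.integral_cong_supp) (auto simp: K'_def indicator_def abs_le_iff minus_le_iff)
  finally show ?thesis ..
qed

section \<open>Integration against a difference of two finite measures\<close>

locale signed_pair = P: compact_measure m1 R + N: compact_measure m2 R
  for m1 m2 :: "real measure" and R :: real
begin

text \<open>In the final instantiation \<open>m1\<close> and \<open>m2\<close> are the upper
  variations of \<open>V\<close> and of \<open>- V\<close>, and \<open>I\<close> is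
  \<open>signed_integral V\<close>. The potential enters the analysis through this
  functional.\<close>

definition I :: "(real \<Rightarrow> complex) \<Rightarrow> complex" where
  "I k = (\<integral>y. k y \<partial>m1) - (\<integral>y. k y \<partial>m2)"

text \<open>The admissible integrands: a bound on [-R, R] already gives integrability for both
  measures and hence linearity of \<open>I\<close>.\<close>

definition bmeas :: "(real \<Rightarrow> complex) \<Rightarrow> bool" where
  "bmeas k \<longleftrightarrow> k \<in> borel_measurable borel \<and> (\<exists>B. \<forall>y. \<bar>y\<bar> \<le> R \<longrightarrow> cmod (k y) \<le> B)"

text \<open>The summand 1 keeps this bound on the total variation positive for the zero potential
  too, so that it can be divided by.\<close>

definition mass :: real where
  "mass = 1 + measure m1 UNIV + measure m2 UNIV"

lemma mass_pos: "mass > 0" by (simp add: mass_def add_pos_nonneg)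

lemma R_pos: "R > 0" by (rule P.R_pos)

lemma bmeas_borel [measurable_dest]: "bmeas k \<Longrightarrow> k \<in> borel_measurable borel"
  by (simp add: bmeas_def)

lemma bmeasI: "k \<in> borel_measurable borel \<Longrightarrow> (\<And>y. \<bar>y\<bar> \<le> R \<Longrightarrow> cmod (k y) \<le> B) \<Longrightarrow> bmeas k"
  by (auto simp: bmeas_def)

lemma bmeas_integrable: "bmeas k \<Longrightarrow> integrable m1 k" "bmeas k \<Longrightarrow> integrable m2 k"
  unfolding bmeas_def by (auto intro: P.integrable_supp N.integrable_supp)

lemma continuous_bounded_on_interval:
  fixes k :: "real \<Rightarrow> complex"
  assumes "continuous_on UNIV k"
  obtains B where "B \<ge> 0" "\<And>y. \<bar>y\<bar> \<le> S \<Longrightarrow> cmod (k y) \<le> B"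
proof -
  have "bounded (k ` {-S..S})"
    by (intro compact_imp_bounded compact_continuous_image continuous_on_subset [OF assms]) auto
  then obtain B where B: "\<And>x. x \<in> {-S..S} \<Longrightarrow> cmod (k x) \<le> B" unfolding bounded_iff by blast
  show ?thesis
  proof (rule that [of "\<bar>B\<bar>"])
    fix y :: real assume "\<bar>y\<bar> \<le> S"
    then have "y \<in> {-S..S}" by auto
    from B [OF this] show "cmod (k y) \<le> \<bar>B\<bar>" by simp
  qed simp
qed

lemma bmeas_continuous: "continuous_on UNIV k \<Longrightarrow> bmeas k"
  by (metis bmeasI continuous_bounded_on_interval continuous_UNIV_borel)

lemma bmeas_mult:
  assumes "bmeas k" "bmeas l" shows "bmeas (\<lambda>y. k y * l y)"
proof -
  obtain A where A: "\<And>y. \<bar>y\<bar> \<le> R \<Longrightarrow> cmod (k y) \<le> A" using assms bmeas_def by blast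
  obtain B where B: "\<And>y. \<bar>y\<bar> \<le> R \<Longrightarrow> cmod (l y) \<le> B" using assms bmeas_def by blast
  show ?thesis
  proof (rule bmeasI [of _ "A * B"])
    show "cmod (k y * l y) \<le> A * B" if "\<bar>y\<bar> \<le> R" for y
      unfolding norm_mult using A [OF that] B [OF that] by (intro mult_mono order_trans [OF _ A [OF that]]) auto
  qed (use assms in measurable)
qed

lemma bmeas_const: "bmeas (\<lambda>_. c)" by (simp add: bmeas_continuous)

lemma bmeas_cmult: "bmeas k \<Longrightarrow> bmeas (\<lambda>y. c * k y)" by (intro bmeas_mult bmeas_const)

lemma bmeas_add:
  assumes "bmeas k" "bmeas l" shows "bmeas (\<lambda>y. k y + l y)"
proof -
  obtain A where A: "\<And>y. \<bar>y\<bar> \<le> R \<Longrightarrow> cmod (k y) \<le> A" using assms bmeas_def by blast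
  obtain B where B: "\<And>y. \<bar>y\<bar> \<le> R \<Longrightarrow> cmod (l y) \<le> B" using assms bmeas_def by blast
  show ?thesis
    by (rule bmeasI [of _ "A + B"]) (use assms A B in \<open>auto intro: norm_triangle_mono\<close>)
qed

lemma I_add: "bmeas k \<Longrightarrow> bmeas l \<Longrightarrow> I (\<lambda>y. k y + l y) = I k + I l"
  by (simp add: I_def bmeas_integrable)

lemma I_diff: "bmeas k \<Longrightarrow> bmeas l \<Longrightarrow> I (\<lambda>y. k y - l y) = I k - I l"
  by (simp add: I_def bmeas_integrable)

lemma I_cmult: "I (\<lambda>y. c * k y) = c * I k"
  by (simp add: I_def right_diff_distrib)

lemma I_cnj: "I (\<lambda>y. cnj (k y)) = cnj (I k)"
  by (simp add: I_def)

lemma I_cong: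
  assumes "k \<in> borel_measurable borel" "k' \<in> borel_measurable borel" "\<And>y. \<bar>y\<bar> \<le> R \<Longrightarrow> k y = k' y"
  shows "I k = I k'"
  using P.integral_cong_supp [OF assms] N.integral_cong_supp [OF assms] by (simp add: I_def)

lemma I_0 [simp]: "I (\<lambda>_. 0) = 0" by (simp add: I_def)

lemma norm_I_le:
  assumes B: "\<And>y. \<bar>y\<bar> \<le> R \<Longrightarrow> cmod (k y) \<le> B"
  shows "cmod (I k) \<le> mass * B"
proof -
  have "0 \<le> B" using order_trans [OF norm_ge_zero B [of 0]] R_pos by simp
  have "cmod (I k) \<le> measure m1 UNIV * B + measure m2 UNIV * B"
    unfolding I_def using P.norm_integral_le [OF B] N.norm_integral_le [OF B]
    by (intro order_trans [OF norm_triangle_ineq4] add_mono)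
  also have "\<dots> \<le> mass * B" using \<open>0 \<le> B\<close> by (simp add: mass_def algebra_simps)
  finally show ?thesis .
qed

lemma I_lim:
  fixes k :: "nat \<Rightarrow> real \<Rightarrow> complex"
  assumes "\<And>n. k n \<in> borel_measurable borel" "k' \<in> borel_measurable borel"
    and "\<And>n y. \<bar>y\<bar> \<le> R \<Longrightarrow> cmod (k n y) \<le> B"
    and lim: "\<And>y. \<bar>y\<bar> \<le> R \<Longrightarrow> (\<lambda>n. k n y) \<longlonglongrightarrow> k' y"
  shows "(\<lambda>n. I (k n)) \<longlonglongrightarrow> I k'"
  unfolding I_def
  using P.AE_supp N.AE_supp assms
  by (intro tendsto_diff P.integral_lim_supp [where B = B] N.integral_lim_supp [where B = B])
    (auto elim!: eventually_mono)

lemma I_holomorphic: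
  assumes "\<And>l. l \<in> ball z r \<Longrightarrow> F l \<in> borel_measurable borel"
    and "\<And>y. (\<lambda>l. F l y) holomorphic_on ball z r"
    and "\<And>l y. l \<in> ball z r \<Longrightarrow> \<bar>y\<bar> \<le> R \<Longrightarrow> cmod (F l y) \<le> B"
  shows "(\<lambda>l. I (F l)) holomorphic_on ball z r"
  unfolding I_def
  by (intro holomorphic_on_diff P.holomorphic_integral_supp [where B = B] N.holomorphic_integral_supp [where B = B] assms)

lemma I_measurable:
  fixes K :: "real \<Rightarrow> real \<Rightarrow> complex"
  assumes "case_prod K \<in> borel_measurable (borel \<Otimes>\<^sub>M borel)"
  shows "(\<lambda>x. I (K x)) \<in> borel_measurable borel"
  unfolding I_def using P.integral_measurable [OF assms] N.integral_measurable [OF assms] by measurable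

lemma I_fubini:
  fixes K :: "real \<Rightarrow> real \<Rightarrow> complex"
  assumes K: "case_prod K \<in> borel_measurable (borel \<Otimes>\<^sub>M borel)"
    and \<phi>: "\<phi> \<in> borel_measurable borel" "\<And>x. cmod (\<phi> x) \<le> D * indicator {-A..A} x"
    and B: "\<And>x y. \<bar>x\<bar> \<le> A \<Longrightarrow> \<bar>y\<bar> \<le> R \<Longrightarrow> cmod (K x y) \<le> B" and "A > 0"
  shows "(\<integral>x. I (\<lambda>y. K x y) * \<phi> x \<partial>lborel) = I (\<lambda>y. \<integral>x. K x y * \<phi> x \<partial>lborel)"
proof -
  have "0 \<le> B" using order_trans [OF norm_ge_zero B [of 0 0]] R_pos \<open>A > 0\<close> by simp
  have "0 \<le> D" using order_trans [OF norm_ge_zero \<phi>(2) [of 0]] \<open>A > 0\<close> by simp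
  have bound: "cmod (K x y * \<phi> x) \<le> (B * D) * indicator {-A..A} x" if "\<bar>y\<bar> \<le> R" for x y
  proof (cases "x \<in> {-A..A}")
    case True
    have "cmod (K x y) * cmod (\<phi> x) \<le> B * D"
      using True that \<phi>(2) [of x] \<open>0 \<le> B\<close> by (intro mult_mono B) auto
    then show ?thesis using True by (simp add: norm_mult)
  qed (use \<phi>(2) [of x] in auto)
  have m: "(\<lambda>x. (\<integral>y. K x y \<partial>m)) \<in> borel_measurable borel" if "compact_measure m R" for m
    by (rule compact_measure.integral_measurable [OF that K])
  have int: "integrable lborel (\<lambda>x. (\<integral>y. K x y \<partial>m) * \<phi> x)" if "compact_measure m R" for m
  proof (rule Bochner_Integration.integrable_bound)
    show "integrable lborel (\<lambda>x. (measure m UNIV * B * D) * indicator {-A..A} x :: real)"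
      by (intro integrable_mult_right) (auto simp: emeasure_lborel_Icc_eq)
    show "(\<lambda>x. (\<integral>y. K x y \<partial>m) * \<phi> x) \<in> borel_measurable lborel"
      using m [OF that] \<phi>(1) by simp
    show "AE x in lborel. norm ((\<integral>y. K x y \<partial>m) * \<phi> x) \<le> norm ((measure m UNIV * B * D) * indicator {-A..A} x :: real)"
    proof (intro AE_I2)
      fix x
      show "norm ((\<integral>y. K x y \<partial>m) * \<phi> x) \<le> norm ((measure m UNIV * B * D) * indicator {-A..A} x :: real)"
      proof (cases "x \<in> {-A..A}")
        case True
        then have "cmod (\<integral>y. K x y \<partial>m) \<le> measure m UNIV * B"
          by (intro compact_measure.norm_integral_le [OF that] B) auto
        then have "cmod (\<integral>y. K x y \<partial>m) * cmod (\<phi> x) \<le> (measure m UNIV * B) * D"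
          using \<phi>(2) [of x] True \<open>0 \<le> B\<close> by (intro mult_mono) auto
        then show ?thesis using True by (simp add: norm_mult abs_mult \<open>0 \<le> B\<close> \<open>0 \<le> D\<close>)
      qed (use \<phi>(2) [of x] in auto)
    qed
  qed
  show ?thesis
    unfolding I_def left_diff_distrib
    using P.fubini_supp [OF K \<phi>(1) bound] N.fubini_supp [OF K \<phi>(1) bound] int [OF P.compact_measure_axioms] int [OF N.compact_measure_axioms]
    by simp
qed

lemma I_swap:
  fixes K :: "real \<Rightarrow> real \<Rightarrow> complex"
  assumes K: "case_prod K \<in> borel_measurable (borel \<Otimes>\<^sub>M borel)"
    and B: "\<And>x y. \<bar>x\<bar> \<le> R \<Longrightarrow> \<bar>y\<bar> \<le> R \<Longrightarrow> cmod (K x y) \<le> B"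
  shows "I (\<lambda>x. I (\<lambda>y. K x y)) = I (\<lambda>y. I (\<lambda>x. K x y))"
proof -
  have Kt: "(\<lambda>(x, y). K y x) \<in> borel_measurable (borel \<Otimes>\<^sub>M borel)"
    using measurable_compose [OF measurable_pair_swap' K] by (simp add: case_prod_beta')
  have 1: "bmeas (\<lambda>x. \<integral>y. K x y \<partial>m)" if "compact_measure m R" for m
    by (rule bmeasI [OF compact_measure.integral_measurable [OF that K] compact_measure.norm_integral_le [OF that B]])
  have 2: "bmeas (\<lambda>y. \<integral>x. K x y \<partial>m)" if "compact_measure m R" for m
    by (rule bmeasI [OF compact_measure.integral_measurable [OF that Kt] compact_measure.norm_integral_le [OF that B]])
  note PP = P.compact_measure_axioms and NN = N.compact_measure_axioms
  note sw = compact_measure_swap [OF _ _ K B]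
  show ?thesis
    unfolding I_def
    using 1 [OF PP] 1 [OF NN] 2 [OF PP] 2 [OF NN] sw [OF PP PP] sw [OF PP NN] sw [OF NN PP] sw [OF NN NN]
    by (simp add: bmeas_integrable)
qed

end

section \<open>The kernels of the free equation\<close>

text \<open>The entire function sin z / z; it keeps the free kernel sin(l t)/l holomorphic across l
  = 0.\<close>

definition csinc :: "complex \<Rightarrow> complex" where
  "csinc z = (if z = 0 then 1 else sin z / z)"

lemma csinc_holomorphic: "csinc holomorphic_on UNIV"
proof -
  have "deriv sin (0::complex) = 1"
    using DERIV_imp_deriv [OF DERIV_sin [of "0::complex"]] by simp
  then have "csinc = (\<lambda>z. if z = 0 then deriv sin 0 else (sin z - sin 0) / (z - 0))"
    by (auto simp: csinc_def fun_eq_iff)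
  then show ?thesis using pole_lemma_open [of sin UNIV 0] by (simp add: holomorphic_on_sin)
qed

lemma mult_csinc: "z * csinc z = sin z" by (simp add: csinc_def)

lemma norm_exp_ii_mult: "cmod (exp (\<i> * z)) \<le> exp \<bar>Im z\<bar>" "cmod (exp (- (\<i> * z))) \<le> exp \<bar>Im z\<bar>"
  by (simp_all add: norm_exp_eq_Re abs_le_iff)

lemma norm_cos_le: "cmod (cos z) \<le> exp \<bar>Im z\<bar>"
proof -
  have "cmod (exp (\<i> * z) + exp (- (\<i> * z))) \<le> 2 * exp \<bar>Im z\<bar>"
    using norm_triangle_ineq [of "exp (\<i> * z)" "exp (- (\<i> * z))"] norm_exp_ii_mult [of z] by linarith
  then show ?thesis by (simp add: cos_exp_eq norm_divide)
qed

lemma norm_sin_le: "cmod (sin z) \<le> exp \<bar>Im z\<bar>"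
proof -
  have "cmod (exp (\<i> * z) - exp (- (\<i> * z))) \<le> 2 * exp \<bar>Im z\<bar>"
    using norm_triangle_ineq4 [of "exp (\<i> * z)" "exp (- (\<i> * z))"] norm_exp_ii_mult [of z] by linarith
  then show ?thesis by (simp add: sin_exp_eq norm_divide norm_mult)
qed

text \<open>The strip of points whose |Im| is at most that of \<open>z\<close> is convex and
  contains 0 and \<open>z\<close>; the mean value inequality for sin with derivative cos gives the
  bound there.\<close>

lemma norm_csinc_le: "cmod (csinc z) \<le> exp \<bar>Im z\<bar>"
proof (cases "z = 0")
  case False
  let ?S = "{w. \<bar>Im w\<bar> \<le> \<bar>Im z\<bar>}"
  have S: "?S = {w. Im w \<le> \<bar>Im z\<bar>} \<inter> {w. Im w \<ge> - \<bar>Im z\<bar>}" by (auto simp: abs_le_iff)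
  have "convex ?S" unfolding S by (intro convex_Int convex_halfspace_Im_le convex_halfspace_Im_ge)
  then have "cmod (sin z - sin 0) \<le> exp \<bar>Im z\<bar> * cmod (z - 0)"
  proof (rule field_differentiable_bound)
    show "(sin has_field_derivative cos w) (at w within ?S)" for w
      by (rule has_field_derivative_at_within [OF DERIV_sin])
    show "cmod (cos w) \<le> exp \<bar>Im z\<bar>" if "w \<in> ?S" for w
      using norm_cos_le [of w] that by (auto intro: order_trans)
  qed auto
  then show ?thesis using False by (simp add: csinc_def norm_divide divide_le_eq)
qed (simp add: csinc_def)

text \<open>The function sin(l t)/l: the solution of u'' + l^2 u = 0 with u(0) = 0 and u'(0) = 1,
  entire in l.\<close>

definition Sk :: "complex \<Rightarrow> real \<Rightarrow> complex" where
  "Sk l t = of_real t * csinc (l * of_real t)"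

text \<open>The causal fundamental solution of u'' + l^2 u. It is continuous because
  \<open>Sk\<close> vanishes at 0.\<close>

definition Sp :: "complex \<Rightarrow> real \<Rightarrow> complex" where
  "Sp l t = Sk l (max 0 t)"

text \<open>The derivative of \<open>Sp\<close> in t, with a jump at 0 and the value 0
  there.\<close>

definition Cp :: "complex \<Rightarrow> real \<Rightarrow> complex" where
  "Cp l t = of_bool (t > 0) * cos (l * of_real t)"

lemma mult_Sk: "l * Sk l t = sin (l * of_real t)"
  using mult_csinc [of "l * of_real t"] by (simp add: Sk_def mult_ac)

lemma Sk_0 [simp]: "Sk l 0 = 0" by (simp add: Sk_def)

lemma Sk_deriv: "((\<lambda>x. Sk l (x - y)) has_vector_derivative cos (l * of_real (x - y))) (at x)"
proof (cases "l = 0")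
  case True
  then have "(\<lambda>x. Sk l (x - y)) = (\<lambda>x. of_real (x - y))" by (simp add: Sk_def csinc_def)
  then show ?thesis using True by (auto intro!: derivative_eq_intros has_vector_derivative_real_field)
next
  case False
  have "((\<lambda>z. sin (l * (z - of_real y)) / l) has_field_derivative cos (l * (of_real x - of_real y))) (at (of_real x))"
    using False by (auto intro!: derivative_eq_intros)
  from has_vector_derivative_real_field [OF this]
  have "((\<lambda>x. sin (l * (of_real x - of_real y)) / l) has_vector_derivative cos (l * (of_real x - of_real y))) (at x)" .
  moreover have "Sk l (x - y) = sin (l * (of_real x - of_real y)) / l" for x
    using mult_Sk [of l "x - y"] False by (simp add: field_simps)
  ultimately show ?thesis by simp
qed

lemma cos_deriv: "((\<lambda>x. cos (l * of_real (x - y))) has_vector_derivative - (l\<^sup>2 * Sk l (x - y))) (at x)"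
proof -
  have "((\<lambda>z. cos (l * (z - of_real y))) has_field_derivative - (l * sin (l * (of_real x - of_real y)))) (at (of_real x))"
    by (auto intro!: derivative_eq_intros)
  from has_vector_derivative_real_field [OF this]
  show ?thesis using mult_Sk [of l "x - y"] by (simp add: power2_eq_square mult.assoc)
qed

lemma continuous_Sk: "continuous_on A (Sk l)"
  using Sk_deriv [of l 0] by (auto intro!: continuous_at_imp_continuous_on has_vector_derivative_continuous)

lemma continuous_Sp: "continuous_on UNIV (Sp l)"
  unfolding Sp_def by (intro continuous_on_compose2 [OF continuous_Sk [of UNIV]] continuous_intros) auto

lemma Sp_borel [measurable]: "Sp l \<in> borel_measurable borel"
  by (simp add: continuous_UNIV_borel continuous_Sp)

lemma Cp_borel [measurable]: "Cp l \<in> borel_measurable borel"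
proof -
  have [measurable]: "(\<lambda>t. cos (l * complex_of_real t)) \<in> borel_measurable borel"
    by (intro continuous_UNIV_borel continuous_intros)
  show ?thesis unfolding Cp_def by measurable
qed

lemma norm_Sp_le: "cmod (Sp l t) \<le> max 0 t * exp (\<bar>Im l\<bar> * max 0 t)"
  using norm_csinc_le [of "l * of_real (max 0 t)"]
  by (auto simp: Sp_def Sk_def norm_mult abs_mult intro!: mult_left_mono)

lemma norm_mult_Sp_le: "cmod l * cmod (Sp l t) \<le> exp (\<bar>Im l\<bar> * max 0 t)"
  using norm_sin_le [of "l * of_real (max 0 t)"] mult_Sk [of l "max 0 t"]
  by (simp add: Sp_def norm_mult [symmetric] abs_mult)

lemma norm_Cp_le: "cmod (Cp l t) \<le> exp (\<bar>Im l\<bar> * max 0 t)"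
  using norm_cos_le [of "l * of_real t"] by (auto simp: Cp_def abs_mult norm_mult)

subsection \<open>Entire families of functions\<close>

text \<open>Holomorphic in the parameter at each point, with a bound that is locally uniform in
  parameter and position jointly. This joint bound is the domination needed to integrate over
  bounded sets, so that convolutions and the Volterra series stay within the class.\<close>

definition ent :: "(complex \<Rightarrow> real \<Rightarrow> complex) \<Rightarrow> bool" where
  "ent h \<longleftrightarrow> (\<forall>y. (\<lambda>l. h l y) holomorphic_on UNIV) \<and> (\<forall>l. h l \<in> borel_measurable borel) \<and>
     (\<forall>B. \<exists>H. \<forall>l y. cmod l \<le> B \<longrightarrow> \<bar>y\<bar> \<le> B \<longrightarrow> cmod (h l y) \<le> H)"

lemma ent_holomorphic: "ent h \<Longrightarrow> (\<lambda>l. h l y) holomorphic_on A"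
  unfolding ent_def using holomorphic_on_subset by blast

lemma ent_borel [measurable_dest]: "ent h \<Longrightarrow> h l \<in> borel_measurable borel"
  by (simp add: ent_def)

lemma ent_bound:
  assumes "ent h" obtains H where "H \<ge> 0" "\<And>l y. cmod l \<le> B \<Longrightarrow> \<bar>y\<bar> \<le> B \<Longrightarrow> cmod (h l y) \<le> H"
proof -
  obtain H where "\<And>l y. cmod l \<le> B \<Longrightarrow> \<bar>y\<bar> \<le> B \<Longrightarrow> cmod (h l y) \<le> H" using assms ent_def by meson
  then show ?thesis by (intro that [of "\<bar>H\<bar>"]) (auto intro!: order_trans [OF _ abs_ge_self])
qed

lemma ent_add:
  assumes "ent h" "ent k" shows "ent (\<lambda>l y. h l y + k l y)"
proof -
  have "\<exists>H. \<forall>l y. cmod l \<le> B \<longrightarrow> \<bar>y\<bar> \<le> B \<longrightarrow> cmod (h l y + k l y) \<le> H" for B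
  proof -
    obtain H where H: "\<And>l y. cmod l \<le> B \<Longrightarrow> \<bar>y\<bar> \<le> B \<Longrightarrow> cmod (h l y) \<le> H" using ent_bound [OF assms(1)] by metis
    obtain H' where H': "\<And>l y. cmod l \<le> B \<Longrightarrow> \<bar>y\<bar> \<le> B \<Longrightarrow> cmod (k l y) \<le> H'" using ent_bound [OF assms(2)] by metis
    show ?thesis using H H' by (intro exI [of _ "H + H'"]) (auto intro: norm_triangle_mono)
  qed
  then show ?thesis using assms unfolding ent_def by (auto intro: holomorphic_on_add borel_measurable_add)
qed

lemma ent_mult:
  assumes "ent h" "ent k" shows "ent (\<lambda>l y. h l y * k l y)"
proof -
  have "\<exists>H. \<forall>l y. cmod l \<le> B \<longrightarrow> \<bar>y\<bar> \<le> B \<longrightarrow> cmod (h l y * k l y) \<le> H" for B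
  proof -
    obtain H where H: "H \<ge> 0" "\<And>l y. cmod l \<le> B \<Longrightarrow> \<bar>y\<bar> \<le> B \<Longrightarrow> cmod (h l y) \<le> H" using ent_bound [OF assms(1)] by metis
    obtain H' where H': "\<And>l y. cmod l \<le> B \<Longrightarrow> \<bar>y\<bar> \<le> B \<Longrightarrow> cmod (k l y) \<le> H'" using ent_bound [OF assms(2)] by metis
    show ?thesis using H H' by (intro exI [of _ "H * H'"]) (auto simp: norm_mult intro: mult_mono)
  qed
  then show ?thesis using assms unfolding ent_def by (auto intro: holomorphic_on_mult borel_measurable_times)
qed

lemma ent_scalar:
  assumes "g holomorphic_on UNIV" shows "ent (\<lambda>l _. g l)"
proof -
  have "\<exists>H. \<forall>l::complex. cmod l \<le> B \<longrightarrow> cmod (g l) \<le> H" for B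
  proof -
    have "bounded (g ` cball 0 B)"
      by (intro compact_imp_bounded compact_continuous_image holomorphic_on_imp_continuous_on
          holomorphic_on_subset [OF assms]) auto
    then obtain H where "\<And>l. l \<in> cball 0 B \<Longrightarrow> cmod (g l) \<le> H" unfolding bounded_iff by blast
    then show ?thesis by (intro exI [of _ H]) auto
  qed
  then show ?thesis using assms unfolding ent_def by fastforce
qed

lemma ent_continuous:
  assumes "continuous_on UNIV \<phi>" shows "ent (\<lambda>_. \<phi>)"
proof -
  have "\<exists>H. \<forall>y. \<bar>y\<bar> \<le> B \<longrightarrow> cmod (\<phi> y) \<le> H" for B
  proof -
    have "bounded (\<phi> ` {-B..B})"
      by (intro compact_imp_bounded compact_continuous_image continuous_on_subset [OF assms]) auto
    then obtain H where "\<And>y. y \<in> {-B..B} \<Longrightarrow> cmod (\<phi> y) \<le> H" unfolding bounded_iff by blast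
    then show ?thesis by (intro exI [of _ H]) (auto simp: abs_le_iff minus_le_iff)
  qed
  then show ?thesis unfolding ent_def by (auto intro!: continuous_UNIV_borel assms)
qed

lemma abs_Im_mult_max_le:
  assumes "cmod l \<le> B" "\<bar>t\<bar> \<le> B" shows "\<bar>Im l\<bar> * max 0 t \<le> B * B"
  using assms abs_Im_le_cmod [of l] by (intro mult_mono) auto

lemma ent_Sp: "ent Sp"
  unfolding ent_def
proof (intro conjI allI)
  show "(\<lambda>l. Sp l y) holomorphic_on UNIV" for y
  proof -
    have "(csinc \<circ> (\<lambda>l. l * of_real (max 0 y))) holomorphic_on UNIV"
      by (rule holomorphic_on_compose_gen [OF _ csinc_holomorphic]) (auto intro!: holomorphic_intros)
    then show ?thesis unfolding Sp_def Sk_def o_def by (intro holomorphic_on_mult) auto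
  qed
  show "\<exists>H. \<forall>l y. cmod l \<le> B \<longrightarrow> \<bar>y\<bar> \<le> B \<longrightarrow> cmod (Sp l y) \<le> H" for B
  proof (intro exI allI impI)
    fix l y assume "cmod l \<le> B" "\<bar>y\<bar> \<le> B"
    then show "cmod (Sp l y) \<le> B * exp (B * B)"
      by (intro order_trans [OF norm_Sp_le] mult_mono) (auto intro: abs_Im_mult_max_le)
  qed
qed simp

lemma ent_Cp: "ent Cp"
  unfolding ent_def
proof (intro conjI allI)
  show "(\<lambda>l. Cp l y) holomorphic_on UNIV" for y
    unfolding Cp_def by (intro holomorphic_intros)
  show "\<exists>H. \<forall>l y. cmod l \<le> B \<longrightarrow> \<bar>y\<bar> \<le> B \<longrightarrow> cmod (Cp l y) \<le> H" for B
  proof (intro exI allI impI)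
    fix l y assume "cmod l \<le> B" "\<bar>y\<bar> \<le> B"
    then show "cmod (Cp l y) \<le> exp (B * B)"
      by (intro order_trans [OF norm_Cp_le]) (auto intro: abs_Im_mult_max_le)
  qed
qed simp

lemma ent_exp: "ent (\<lambda>l y. exp (c * l * of_real y))"
  unfolding ent_def
proof (intro conjI allI)
  show "(\<lambda>l. exp (c * l * of_real y)) holomorphic_on UNIV" for y
    by (intro holomorphic_intros)
  show "(\<lambda>y. exp (c * l * complex_of_real y)) \<in> borel_measurable borel" for l
    by (intro continuous_UNIV_borel continuous_intros)
  show "\<exists>H. \<forall>l y. cmod l \<le> B \<longrightarrow> \<bar>y\<bar> \<le> B \<longrightarrow> cmod (exp (c * l * of_real y)) \<le> H" for B
  proof (intro exI allI impI)
    fix l y assume ly: "cmod l \<le> B" "\<bar>y\<bar> \<le> B"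
    have "cmod (exp (c * l * of_real y)) \<le> exp (cmod (c * l * of_real y))"
      by (rule norm_exp)
    also have "cmod (c * l * of_real y) = cmod c * (cmod l * \<bar>y\<bar>)" by (simp add: norm_mult)
    also have "\<dots> \<le> cmod c * (B * B)" using ly by (intro mult_left_mono mult_mono) auto
    finally show "cmod (exp (c * l * of_real y)) \<le> exp (cmod c * (B * B))" by simp
  qed
qed

lemma holomorphic_on_UNIV_balls:
  assumes "\<And>r. r > 0 \<Longrightarrow> f holomorphic_on ball 0 r" shows "f holomorphic_on UNIV"
proof -
  have "f holomorphic_on (\<Union>r\<in>{0<..}. ball 0 r)"
    by (rule holomorphic_on_UN_open) (auto intro: assms)
  moreover have "(\<Union>r\<in>{0<..}. ball (0::complex) r) = UNIV"
  proof -
    have "z \<in> ball 0 (cmod z + 1) \<and> cmod z + 1 > 0" for z :: complex by (simp add: add_nonneg_pos)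
    then show ?thesis by fast
  qed
  ultimately show ?thesis by simp
qed

section \<open>Integrable sources of bounded support\<close>

definition source :: "real \<Rightarrow> (real \<Rightarrow> complex) \<Rightarrow> bool" where
  "source L f \<longleftrightarrow> f \<in> borel_measurable borel \<and> integrable lborel f \<and> (\<forall>y. \<bar>y\<bar> > L \<longrightarrow> f y = 0)"

lemma source_borel [measurable_dest]: "source L f \<Longrightarrow> f \<in> borel_measurable borel"
  by (simp add: source_def)

lemma source_integrable_mult:
  assumes f: "source L f" and [measurable]: "k \<in> borel_measurable borel"
    and B: "\<And>y. \<bar>y\<bar> \<le> L \<Longrightarrow> cmod (k y) \<le> B"
  shows "integrable lborel (\<lambda>y. k y * f y)"
    "cmod (\<integral>y. k y * f y \<partial>lborel) \<le> B * (\<integral>y. cmod (f y) \<partial>lborel)"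
proof -
  have le: "norm (k y * f y) \<le> B * cmod (f y)" for y
  proof (cases "\<bar>y\<bar> \<le> L")
    case True
    then show ?thesis using B [of y] by (simp add: norm_mult mult_right_mono)
  next
    case False
    then show ?thesis using f by (simp add: source_def)
  qed
  have i: "integrable lborel (\<lambda>y. B * cmod (f y))"
    using f by (intro integrable_mult_right integrable_norm) (simp add: source_def)
  then show int: "integrable lborel (\<lambda>y. k y * f y)"
    by (rule Bochner_Integration.integrable_bound)
       (use f le in \<open>auto intro: order_trans [OF le abs_ge_self]\<close>)
  have "cmod (\<integral>y. k y * f y \<partial>lborel) \<le> (\<integral>y. norm (k y * f y) \<partial>lborel)" by (rule integral_norm_bound)
  also have "\<dots> \<le> (\<integral>y. B * cmod (f y) \<partial>lborel)"
    by (intro integral_mono integrable_norm int i le)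
  finally show "cmod (\<integral>y. k y * f y \<partial>lborel) \<le> B * (\<integral>y. cmod (f y) \<partial>lborel)" by simp
qed

lemma ent_source_holomorphic:
  assumes f: "source L f" and k: "ent k"
  shows "(\<lambda>l. \<integral>y. k l y * f y \<partial>lborel) holomorphic_on UNIV"
proof (rule holomorphic_on_UNIV_balls)
  fix r :: real assume "r > 0"
  obtain H where H: "\<And>l y. cmod l \<le> max r L \<Longrightarrow> \<bar>y\<bar> \<le> max r L \<Longrightarrow> cmod (k l y) \<le> H" using ent_bound [OF k] by metis
  show "(\<lambda>l. \<integral>y. k l y * f y \<partial>lborel) holomorphic_on ball 0 r"
  proof (rule holomorphic_integral)
    show "integrable lborel (\<lambda>y. H * cmod (f y))"
      using f by (intro integrable_mult_right integrable_norm) (simp add: source_def)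
    show "AE y in lborel. \<forall>l\<in>ball 0 r. cmod (k l y * f y) \<le> H * cmod (f y)"
    proof (intro AE_I2 ballI)
      fix y l assume "l \<in> ball (0::complex) r"
      then show "cmod (k l y * f y) \<le> H * cmod (f y)"
        using f H [of l y] by (cases "\<bar>y\<bar> \<le> L") (auto simp: norm_mult source_def intro!: mult_right_mono)
    qed
    show "AE y in lborel. (\<lambda>l. k l y * f y) holomorphic_on ball 0 r"
      by (intro AE_I2 holomorphic_intros ent_holomorphic k)
  qed (use k f in measurable)
qed

lemma ent_shift_holomorphic:
  assumes "ent k" shows "ent (\<lambda>l y. k l (x - y))"
proof -
  have "\<exists>H. \<forall>l y. cmod l \<le> B \<longrightarrow> \<bar>y\<bar> \<le> B \<longrightarrow> cmod (k l (x - y)) \<le> H" for B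
  proof -
    obtain H where H: "\<And>l y. cmod l \<le> B + \<bar>x\<bar> \<Longrightarrow> \<bar>y\<bar> \<le> B + \<bar>x\<bar> \<Longrightarrow> cmod (k l y) \<le> H"
      using ent_bound [OF assms] by metis
    show ?thesis by (intro exI [of _ H] allI impI H) linarith+
  qed
  moreover have "(\<lambda>y. k l (x - y)) \<in> borel_measurable borel" for l
  proof -
    have [measurable]: "k l \<in> borel_measurable borel" by (rule ent_borel [OF assms])
    show ?thesis by measurable
  qed
  ultimately show ?thesis using assms by (auto simp: ent_def)
qed

lemma ent_source_convolution:
  assumes f: "source L f" and k: "ent k"
  shows "ent (\<lambda>l x. \<integral>y. k l (x - y) * f y \<partial>lborel)"
  unfolding ent_def
proof (intro conjI allI)
  show "(\<lambda>l. \<integral>y. k l (x - y) * f y \<partial>lborel) holomorphic_on UNIV" for x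
    by (rule ent_source_holomorphic [OF f ent_shift_holomorphic [OF k]])
  show "(\<lambda>x. \<integral>y. k l (x - y) * f y \<partial>lborel) \<in> borel_measurable borel" for l
  proof (rule lborel.borel_measurable_lebesgue_integral)
    have [measurable]: "k l \<in> borel_measurable borel" "f \<in> borel_measurable borel"
      by (intro ent_borel k source_borel [OF f])+
    show "(\<lambda>(x, y). k l (x - y) * f y) \<in> borel_measurable (borel \<Otimes>\<^sub>M lborel)" by measurable
  qed
  show "\<exists>H. \<forall>l x. cmod l \<le> B \<longrightarrow> \<bar>x\<bar> \<le> B \<longrightarrow> cmod (\<integral>y. k l (x - y) * f y \<partial>lborel) \<le> H" for B
  proof -
    obtain H where H: "\<And>l y. cmod l \<le> B + \<bar>L\<bar> \<Longrightarrow> \<bar>y\<bar> \<le> B + \<bar>L\<bar> \<Longrightarrow> cmod (k l y) \<le> H"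
      using ent_bound [OF k] by metis
    show ?thesis
      by (intro exI [of _ "H * (\<integral>y. cmod (f y) \<partial>lborel)"] allI impI source_integrable_mult(2) [OF f] H)
         (use ent_shift_holomorphic [OF k] in \<open>auto simp: ent_def\<close>)
  qed
qed

section \<open>Convolution of entire families with the signed measure\<close>

context signed_pair
begin

lemma ent_bmeas: "ent h \<Longrightarrow> bmeas (h l)"
proof -
  assume h: "ent h"
  obtain H where H: "\<And>l' y. cmod l' \<le> max R (cmod l) \<Longrightarrow> \<bar>y\<bar> \<le> max R (cmod l) \<Longrightarrow> cmod (h l' y) \<le> H"
    using ent_bound [OF h] by metis
  show "bmeas (h l)" by (rule bmeasI [of _ H]) (use h H in \<open>auto simp: ent_def\<close>)
qed

lemma ent_I_holomorphic:
  assumes h: "ent h" shows "(\<lambda>l. I (h l)) holomorphic_on UNIV"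
proof (rule holomorphic_on_UNIV_balls)
  fix r :: real
  obtain H where H: "\<And>l y. cmod l \<le> max r R \<Longrightarrow> \<bar>y\<bar> \<le> max r R \<Longrightarrow> cmod (h l y) \<le> H" using ent_bound [OF h] by metis
  show "(\<lambda>l. I (h l)) holomorphic_on ball 0 r"
    by (rule I_holomorphic [where B = H]) (use h H in \<open>auto intro: ent_borel ent_holomorphic\<close>)
qed

lemma ent_I_convolution:
  assumes k: "ent k" and h: "ent h"
  shows "ent (\<lambda>l x. I (\<lambda>y. k l (x - y) * h l y))"
  unfolding ent_def
proof (intro conjI allI)
  show "(\<lambda>l. I (\<lambda>y. k l (x - y) * h l y)) holomorphic_on UNIV" for x
    by (intro ent_I_holomorphic ent_mult ent_shift_holomorphic k h)
  show "(\<lambda>x. I (\<lambda>y. k l (x - y) * h l y)) \<in> borel_measurable borel" for l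
  proof (rule I_measurable)
    have [measurable]: "k l \<in> borel_measurable borel" "h l \<in> borel_measurable borel"
      by (intro ent_borel k h)+
    show "(\<lambda>(x, y). k l (x - y) * h l y) \<in> borel_measurable (borel \<Otimes>\<^sub>M borel)" by measurable
  qed
  show "\<exists>H. \<forall>l x. cmod l \<le> B \<longrightarrow> \<bar>x\<bar> \<le> B \<longrightarrow> cmod (I (\<lambda>y. k l (x - y) * h l y)) \<le> H" for B
  proof -
    obtain H where H: "H \<ge> 0" "\<And>l y. cmod l \<le> B + R \<Longrightarrow> \<bar>y\<bar> \<le> B + R \<Longrightarrow> cmod (k l y) \<le> H"
      using ent_bound [OF k] by metis
    obtain H' where H': "\<And>l y. cmod l \<le> max B R \<Longrightarrow> \<bar>y\<bar> \<le> max B R \<Longrightarrow> cmod (h l y) \<le> H'"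
      using ent_bound [OF h] by metis
    have "cmod (I (\<lambda>y. k l (x - y) * h l y)) \<le> mass * (H * H')" if "cmod l \<le> B" "\<bar>x\<bar> \<le> B" for l x
    proof (rule norm_I_le)
      fix y :: real assume "\<bar>y\<bar> \<le> R"
      then show "cmod (k l (x - y) * h l y) \<le> H * H'"
        unfolding norm_mult using that R_pos H(1) by (intro mult_mono H H') auto
    qed
    then show ?thesis by blast
  qed
qed

lemma continuous_I_convolution:
  assumes k: "continuous_on UNIV k" and h: "bmeas h"
  shows "continuous_on UNIV (\<lambda>x. I (\<lambda>y. k (x - y) * h y))"
proof -
  have "isCont (\<lambda>x. I (\<lambda>y. k (x - y) * h y)) x" for x
    unfolding continuous_at_sequentially comp_def
  proof (intro allI impI)
    fix X assume X: "X \<longlonglongrightarrow> x"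
    obtain N where N: "\<And>n. \<bar>X n\<bar> \<le> N"
      using convergent_imp_Bseq [OF convergentI [OF X]] by (auto simp: Bseq_def)
    obtain A where A: "A \<ge> 0" "\<And>t. \<bar>t\<bar> \<le> N + R \<Longrightarrow> cmod (k t) \<le> A"
      using continuous_bounded_on_interval [OF k] by blast
    obtain B where B: "\<And>y. \<bar>y\<bar> \<le> R \<Longrightarrow> cmod (h y) \<le> B" using h bmeas_def by blast
    have [measurable]: "k \<in> borel_measurable borel" by (rule continuous_UNIV_borel [OF k])
    have [measurable]: "h \<in> borel_measurable borel" using h by measurable
    show "(\<lambda>n. I (\<lambda>y. k (X n - y) * h y)) \<longlonglongrightarrow> I (\<lambda>y. k (x - y) * h y)"
    proof (rule I_lim [where B = "A * B"])
      show "cmod (k (X n - y) * h y) \<le> A * B" if "\<bar>y\<bar> \<le> R" for n y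
      proof -
        have "\<bar>X n - y\<bar> \<le> N + R" using N [of n] that by linarith
        then show ?thesis unfolding norm_mult using A B [OF that] by (intro mult_mono) auto
      qed
      show "(\<lambda>n. k (X n - y) * h y) \<longlonglongrightarrow> k (x - y) * h y" for y
      proof -
        have "isCont k (x - y)" using k by (simp add: continuous_on_eq_continuous_at)
        then have "(\<lambda>n. k (X n - y)) \<longlonglongrightarrow> k (x - y)"
          by (rule isCont_tendsto_compose) (intro tendsto_intros X)
        then show ?thesis by (intro tendsto_intros)
      qed
    qed measurable
  qed
  then show ?thesis by (simp add: continuous_on_eq_continuous_at)
qed

subsection \<open>The Volterra equation\<close>

text \<open>
  The weight \<open>wt\<close> makes the Volterra operator a contraction: its kernel vanishes on the
  diagonal, so that \<open>t e\<^bsup>- mass t\<^esup> \<le> 1 / (2 mass)\<close> absorbs the total mass, and atoms of the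
  measure do no harm.
\<close>

definition Kop :: "complex \<Rightarrow> (real \<Rightarrow> complex) \<Rightarrow> real \<Rightarrow> complex" where
  "Kop l h x = I (\<lambda>y. Sp l (x - y) * h y)"

definition It :: "complex \<Rightarrow> (real \<Rightarrow> complex) \<Rightarrow> nat \<Rightarrow> real \<Rightarrow> complex" where
  "It l h n = (Kop l ^^ n) h"

definition Vol :: "complex \<Rightarrow> (real \<Rightarrow> complex) \<Rightarrow> real \<Rightarrow> complex" where
  "Vol l h x = (\<Sum>n. It l h n x)"

definition wt :: "complex \<Rightarrow> real \<Rightarrow> real" where
  "wt l x = exp ((\<bar>Im l\<bar> + mass) * max 0 (x + R))"

lemma It_0 [simp]: "It l h 0 = h" and It_Suc [simp]: "It l h (Suc n) = Kop l (It l h n)"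
  by (simp_all add: It_def)

lemma wt_ge_1: "wt l x \<ge> 1"
  using mass_pos by (simp add: wt_def)

lemma continuous_Kop: "bmeas h \<Longrightarrow> continuous_on UNIV (Kop l h)"
  unfolding Kop_def by (intro continuous_I_convolution continuous_Sp)

lemma continuous_It: "continuous_on UNIV h \<Longrightarrow> continuous_on UNIV (It l h n)"
  by (induction n) (auto intro: continuous_Kop bmeas_continuous)

lemma bmeas_Sp: "bmeas (\<lambda>y. Sp l (x - y))"
  by (intro bmeas_continuous continuous_on_compose2 [OF continuous_Sp] continuous_intros) auto

lemma Kop_bound:
  assumes "H \<ge> 0" "\<And>y. \<bar>y\<bar> \<le> R \<Longrightarrow> cmod (h y) \<le> H * wt l y"
  shows "cmod (Kop l h x) \<le> H / 2 * wt l x"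
proof -
  have "cmod (Sp l (x - y) * h y) \<le> H * wt l x / (2 * mass)" if y: "\<bar>y\<bar> \<le> R" for y
  proof (cases "x \<le> y")
    case True
    then have "Sp l (x - y) = 0" by (simp add: Sp_def max_def)
    then show ?thesis using assms(1) mass_pos wt_ge_1 [of l x] by simp
  next
    case False
    define t where "t = x - y"
    have t: "t > 0" "x = y + t" "y + R \<ge> 0" using False y by (auto simp: t_def)
    \<comment> \<open>This is exp s >= 1 + s + s^2/2 >= 2 s, where the last inequality is (s - 1)^2
      >= 0.\<close>
    have "2 * (mass * t) \<le> exp (mass * t)"
    proof -
      have "0 \<le> (mass * t - 1)\<^sup>2" by simp
      then have "2 * (mass * t) \<le> 1 + mass * t + (mass * t)\<^sup>2 / 2 + (mass * t)\<^sup>2 / 2 - mass * t"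
        by (simp add: power2_eq_square algebra_simps)
      moreover have "2 * s \<le> 1 + s + s\<^sup>2 / 2" for s :: real
        using zero_le_power2 [of "s - 1"] by (simp add: power2_eq_square algebra_simps)
      ultimately show ?thesis
        using exp_lower_Taylor_quadratic [of "mass * t"] mass_pos t by (meson less_imp_le mult_nonneg_nonneg order_trans)
    qed
    then have te: "t \<le> exp (mass * t) / (2 * mass)" using mass_pos by (simp add: field_simps)
    have "cmod (Sp l t * h y) \<le> (t * exp (\<bar>Im l\<bar> * t)) * (H * wt l y)"
      unfolding norm_mult using norm_Sp_le [of l t] t by (intro mult_mono assms y) auto
    also have "\<dots> \<le> ((exp (mass * t) / (2 * mass)) * exp (\<bar>Im l\<bar> * t)) * (H * wt l y)"
      using te assms(1) wt_ge_1 [of l y] by (intro mult_right_mono) auto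
    also have "\<dots> = H * (exp (mass * t) * exp (\<bar>Im l\<bar> * t) * wt l y) / (2 * mass)" by simp
    \<comment> \<open>Since y + R is nonnegative and x = y + t, the exponents of the weight simply
      add.\<close>
    also have "exp (mass * t) * exp (\<bar>Im l\<bar> * t) * wt l y = wt l x"
      using t by (simp add: wt_def exp_add [symmetric] algebra_simps)
    finally show ?thesis by (simp add: t_def)
  qed
  then have "cmod (Kop l h x) \<le> mass * (H * wt l x / (2 * mass))"
    unfolding Kop_def by (rule norm_I_le)
  then show ?thesis using mass_pos by simp
qed

text \<open>The inhomogeneity is controlled on [-R, R] alone. The Volterra operator sees its
  argument only there and returns a bound at every point, so the estimate on the whole line begins
  with the first iterate.\<close>

lemma It_bound:
  assumes "H \<ge> 0" "\<And>y. \<bar>y\<bar> \<le> R \<Longrightarrow> cmod (h y) \<le> H"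
  shows "\<bar>y\<bar> \<le> R \<Longrightarrow> cmod (It l h n y) \<le> H / 2 ^ n * wt l y"
    and "cmod (It l h (Suc n) x) \<le> H / 2 ^ Suc n * wt l x"
proof -
  have 1: "cmod (It l h n y) \<le> H / 2 ^ n * wt l y" if "\<bar>y\<bar> \<le> R" for n y
    using that
  proof (induction n arbitrary: y)
    case 0
    then show ?case using assms(2) [OF 0] mult_left_mono [OF wt_ge_1 assms(1), of l y] by simp
  next
    case (Suc n)
    have "cmod (Kop l (It l h n) y) \<le> (H / 2 ^ n) / 2 * wt l y"
      by (rule Kop_bound) (use assms Suc.IH in auto)
    then show ?case by (simp add: mult.commute)
  qed
  then show "\<bar>y\<bar> \<le> R \<Longrightarrow> cmod (It l h n y) \<le> H / 2 ^ n * wt l y" .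
  have "cmod (Kop l (It l h n) x) \<le> (H / 2 ^ n) / 2 * wt l x"
    by (rule Kop_bound) (use assms 1 in auto)
  then show "cmod (It l h (Suc n) x) \<le> H / 2 ^ Suc n * wt l x" by (simp add: mult.commute)
qed

lemma It_bound':
  assumes "H \<ge> 0" "\<And>y. \<bar>y\<bar> \<le> R \<Longrightarrow> cmod (h y) \<le> H"
  shows "cmod (It l h n x) \<le> (cmod (h x) + H * wt l x) * (1/2) ^ n"
proof (cases n)
  case 0
  then show ?thesis using assms(1) wt_ge_1 [of l x] by simp
next
  case (Suc m)
  have "cmod (It l h n x) \<le> (H * wt l x) * (1/2) ^ n"
    using It_bound(2) [OF assms, where n = m and x = x and l = l] by (simp add: Suc power_divide)
  also have "\<dots> \<le> (cmod (h x) + H * wt l x) * (1/2) ^ n"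
    by (intro mult_right_mono) auto
  finally show ?thesis .
qed

lemma bmeas_obtain:
  assumes "bmeas h" obtains H where "H \<ge> 0" "\<And>y. \<bar>y\<bar> \<le> R \<Longrightarrow> cmod (h y) \<le> H"
proof -
  obtain H where "\<And>y. \<bar>y\<bar> \<le> R \<Longrightarrow> cmod (h y) \<le> H" using assms bmeas_def by blast
  then show ?thesis by (intro that [of "\<bar>H\<bar>"]) (auto intro!: order_trans [OF _ abs_ge_self])
qed

lemma summable_It: "bmeas h \<Longrightarrow> summable (\<lambda>n. cmod (It l h n x))"
proof -
  assume "bmeas h"
  then obtain H where H: "H \<ge> 0" "\<And>y. \<bar>y\<bar> \<le> R \<Longrightarrow> cmod (h y) \<le> H" by (rule bmeas_obtain) blast
  show ?thesis
    by (rule summable_comparison_test' [of "\<lambda>n. (cmod (h x) + H * wt l x) * (1/2) ^ n" 0])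
       (auto intro: It_bound' H summable_mult summable_geometric)
qed

lemma Vol_sums: "bmeas h \<Longrightarrow> (\<lambda>n. It l h n x) sums Vol l h x"
  unfolding Vol_def by (rule summable_sums [OF summable_norm_cancel [OF summable_It]])

lemma Vol_bound:
  assumes "bmeas h" "H \<ge> 0" "\<And>y. \<bar>y\<bar> \<le> R \<Longrightarrow> cmod (h y) \<le> H"
  shows "cmod (Vol l h x) \<le> 2 * (cmod (h x) + H * wt l x)"
proof -
  have s: "summable (\<lambda>n. (cmod (h x) + H * wt l x) * (1/2) ^ n)"
    by (intro summable_mult summable_geometric) auto
  have "cmod (Vol l h x) \<le> (\<Sum>n. cmod (It l h n x))"
    unfolding Vol_def by (intro summable_norm summable_It assms)
  also have "\<dots> \<le> (\<Sum>n. (cmod (h x) + H * wt l x) * (1/2) ^ n)"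
    by (intro suminf_le It_bound' summable_It s assms)
  also have "\<dots> = 2 * (cmod (h x) + H * wt l x)"
    by (subst suminf_mult) (auto simp: suminf_geometric)
  finally show ?thesis .
qed

lemma Vol_partial_bound:
  assumes "bmeas h" "H \<ge> 0" "\<And>y. \<bar>y\<bar> \<le> R \<Longrightarrow> cmod (h y) \<le> H"
  shows "cmod (\<Sum>n<N. It l h n x) \<le> 2 * (cmod (h x) + H * wt l x)"
proof -
  have s: "summable (\<lambda>n. (cmod (h x) + H * wt l x) * (1/2) ^ n)"
    by (intro summable_mult summable_geometric) auto
  have "cmod (\<Sum>n<N. It l h n x) \<le> (\<Sum>n<N. (cmod (h x) + H * wt l x) * (1/2) ^ n)"
    by (intro order_trans [OF norm_sum] sum_mono It_bound' assms)
  also have "\<dots> \<le> (\<Sum>n. (cmod (h x) + H * wt l x) * (1/2) ^ n)"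
    using assms(2) wt_ge_1 [of l x] by (intro sum_le_suminf s) auto
  also have "\<dots> = 2 * (cmod (h x) + H * wt l x)"
    by (subst suminf_mult) (auto simp: suminf_geometric)
  finally show ?thesis .
qed

lemma Kop_add: "bmeas h \<Longrightarrow> bmeas g \<Longrightarrow> Kop l (\<lambda>y. h y + g y) x = Kop l h x + Kop l g x"
  unfolding Kop_def distrib_left by (intro I_add bmeas_mult bmeas_Sp)

lemma Kop_cmult: "Kop l (\<lambda>y. c * h y) x = c * Kop l h x"
  unfolding Kop_def I_cmult [symmetric] by (simp add: mult_ac)

lemma Kop_sum:
  assumes "\<And>n. bmeas (h n)"
  shows "bmeas (\<lambda>y. \<Sum>n<N. h n y) \<and> Kop l (\<lambda>y. \<Sum>n<(N::nat). h n y) x = (\<Sum>n<N. Kop l (h n) x)"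
proof (induction N)
  case 0
  then show ?case by (simp add: bmeas_const Kop_def)
next
  case (Suc N)
  then show ?case using assms by (simp add: Kop_add bmeas_add)
qed

lemma Vol_borel:
  assumes "continuous_on UNIV h" shows "Vol l h \<in> borel_measurable borel"
proof (rule borel_measurable_LIMSEQ_metric [where f = "\<lambda>N x. \<Sum>n<N. It l h n x"])
  show "(\<lambda>x. \<Sum>n<N. It l h n x) \<in> borel_measurable borel" for N
    by (intro continuous_UNIV_borel continuous_on_sum continuous_It assms)
  show "(\<lambda>N. \<Sum>n<N. It l h n x) \<longlonglongrightarrow> Vol l h x" for x
    using Vol_sums [OF bmeas_continuous [OF assms]] by (simp add: sums_def)
qed

lemma bmeas_Vol:
  assumes h: "continuous_on UNIV h" shows "bmeas (Vol l h)"
proof -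
  obtain H where H: "H \<ge> 0" "\<And>y. \<bar>y\<bar> \<le> R \<Longrightarrow> cmod (h y) \<le> H"
    using bmeas_obtain [OF bmeas_continuous [OF h]] by blast
  show ?thesis
  proof (rule bmeasI [OF Vol_borel [OF h]])
    fix y :: real assume y: "\<bar>y\<bar> \<le> R"
    have "wt l y \<le> wt l R" using y mass_pos by (auto simp: wt_def intro!: mult_left_mono)
    then show "cmod (Vol l h y) \<le> 2 * (H + H * wt l R)"
      using H y by (intro order_trans [OF Vol_bound [OF bmeas_continuous [OF h] H]] mult_left_mono add_mono) auto
  qed
qed

text \<open>The Volterra operator may be applied to the Neumann series term by term: the partial
  sums are uniformly bounded on [-R, R], so dominated convergence applies to \<open>I\<close>. The
  result is the series shifted by one.\<close>

lemma Vol_eq: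
  assumes h: "continuous_on UNIV h"
  shows "Vol l h x = h x + Kop l (Vol l h) x"
proof -
  obtain H where H: "H \<ge> 0" "\<And>y. \<bar>y\<bar> \<le> R \<Longrightarrow> cmod (h y) \<le> H"
    using bmeas_obtain [OF bmeas_continuous [OF h]] by blast
  have bI: "bmeas (It l h n)" for n by (intro bmeas_continuous continuous_It h)
  obtain S where S: "S \<ge> 0" "\<And>y. \<bar>y\<bar> \<le> R \<Longrightarrow> cmod (Sp l (x - y)) \<le> S" using bmeas_obtain [OF bmeas_Sp] by blast
  have "(\<lambda>N. Kop l (\<lambda>y. \<Sum>n<N. It l h n y) x) \<longlonglongrightarrow> Kop l (Vol l h) x"
    unfolding Kop_def
  proof (rule I_lim [where B = "S * (2 * (H + H * wt l R))"])
    show "(\<lambda>y. Sp l (x - y) * (\<Sum>n<N. It l h n y)) \<in> borel_measurable borel" for N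
      using bmeas_borel [OF bI] by measurable
    show "(\<lambda>y. Sp l (x - y) * Vol l h y) \<in> borel_measurable borel"
      using Vol_borel [OF h, of l] by measurable
    show "cmod (Sp l (x - y) * (\<Sum>n<N. It l h n y)) \<le> S * (2 * (H + H * wt l R))" if y: "\<bar>y\<bar> \<le> R" for N y
    proof -
      have "wt l y \<le> wt l R" using y mass_pos by (auto simp: wt_def intro!: mult_left_mono)
      then have "cmod (\<Sum>n<N. It l h n y) \<le> 2 * (H + H * wt l R)"
        using H y by (intro order_trans [OF Vol_partial_bound [OF bmeas_continuous [OF h] H]] mult_left_mono add_mono) auto
      then show ?thesis unfolding norm_mult using S y by (intro mult_mono) auto
    qed
    show "(\<lambda>N. Sp l (x - y) * (\<Sum>n<N. It l h n y)) \<longlonglongrightarrow> Sp l (x - y) * Vol l h y" for y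
      using Vol_sums [OF bmeas_continuous [OF h], of l y] unfolding sums_def by (rule tendsto_mult_left)
  qed
  then have "(\<lambda>N. \<Sum>n<N. It l h (Suc n) x) \<longlonglongrightarrow> Kop l (Vol l h) x"
    by (simp add: Kop_sum [OF bI])
  then have "(\<lambda>n. It l h (Suc n) x) sums Kop l (Vol l h) x" by (simp add: sums_def)
  then have "(\<lambda>n. It l h n x) sums (Kop l (Vol l h) x + It l h 0 x)"
    by (rule sums_Suc_iff [of "\<lambda>n. It l h n x", THEN iffD1])
  then show ?thesis using Vol_sums [OF bmeas_continuous [OF h], of l x] by (simp add: sums_iff add.commute)
qed

lemma continuous_Vol:
  assumes "continuous_on UNIV h" shows "continuous_on UNIV (Vol l h)"
proof -
  have eq: "Vol l h = (\<lambda>x. h x + Kop l (Vol l h) x)" using Vol_eq [OF assms] by blast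
  show ?thesis by (subst eq) (intro continuous_intros assms continuous_Kop bmeas_Vol)
qed

lemma It_linear:
  assumes "continuous_on UNIV h" "continuous_on UNIV g"
  shows "It l (\<lambda>x. c * h x + g x) n = (\<lambda>x. c * It l h n x + It l g n x)"
proof (induction n)
  case (Suc n)
  have "bmeas (It l h n)" "bmeas (It l g n)" by (auto intro: bmeas_continuous continuous_It assms)
  then show ?case using Suc by (auto simp: Kop_add Kop_cmult bmeas_cmult)
qed simp

lemma Vol_linear:
  assumes "continuous_on UNIV h" "continuous_on UNIV g"
  shows "Vol l (\<lambda>x. c * h x + g x) x = c * Vol l h x + Vol l g x"
proof -
  have "(\<lambda>n. It l (\<lambda>x. c * h x + g x) n x) sums (c * Vol l h x + Vol l g x)"
    unfolding It_linear [OF assms] by (intro sums_add sums_mult Vol_sums bmeas_continuous assms)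
  then show ?thesis by (simp add: Vol_def sums_iff)
qed

text \<open>Needed for a source to the right of the measure: its causal response has not yet begun
  on [-R, R], so the potential does not scatter it there.\<close>

lemma Vol_vanish:
  assumes h: "continuous_on UNIV h" "\<And>y. \<bar>y\<bar> \<le> R \<Longrightarrow> h y = 0"
  shows "\<bar>y\<bar> \<le> R \<Longrightarrow> Vol l h y = 0"
  using Vol_bound [OF bmeas_continuous [OF h(1)], of 0 l y] h(2) by simp

text \<open>Weight and inhomogeneity are bounded uniformly for bounded parameters, so the geometric
  majorant of the Neumann series is locally uniform and the M-test transfers holomorphy to the
  sum.\<close>

lemma ent_Vol:
  assumes h: "ent h" "\<And>l. continuous_on UNIV (h l)"
  shows "ent (\<lambda>l. Vol l (h l))"
proof -
  have eI: "ent (\<lambda>l. It l (h l) n)" for n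
  proof (induction n)
    case (Suc n)
    from ent_I_convolution [OF ent_Sp Suc] show ?case by (simp add: Kop_def)
  qed (use h in simp)
  have wtb: "wt l x \<le> exp ((B + mass) * (B + R))" if "cmod l \<le> B" "\<bar>x\<bar> \<le> B" for l x B
    unfolding wt_def using that abs_Im_le_cmod [of l] mass_pos R_pos by (auto intro!: mult_mono)
  have unif: "\<exists>C\<ge>0. \<forall>l x n. cmod l \<le> B \<longrightarrow> \<bar>x\<bar> \<le> B \<longrightarrow> cmod (It l (h l) n x) \<le> C * (1/2) ^ n \<and> cmod (Vol l (h l) x) \<le> 2 * C" for B
  proof -
    obtain H where H: "H \<ge> 0" "\<And>l y. cmod l \<le> max B R \<Longrightarrow> \<bar>y\<bar> \<le> max B R \<Longrightarrow> cmod (h l y) \<le> H"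
      using ent_bound [OF h(1)] by metis
    define C where "C = H + H * exp ((B + mass) * (B + R))"
    have "cmod (It l (h l) n x) \<le> C * (1/2) ^ n \<and> cmod (Vol l (h l) x) \<le> 2 * C" if l: "cmod l \<le> B" "\<bar>x\<bar> \<le> B" for l x n
    proof -
      have le: "cmod (h l x) + H * wt l x \<le> C"
        unfolding C_def using l H wtb by (intro add_mono mult_left_mono) auto
      have Hl: "\<bar>y\<bar> \<le> R \<Longrightarrow> cmod (h l y) \<le> H" for y using H l by auto
      show ?thesis
      proof
        show "cmod (It l (h l) n x) \<le> C * (1/2) ^ n"
          by (rule order_trans [OF It_bound' [of H "h l", OF H(1) Hl] mult_right_mono [OF le, of "(1/2) ^ n"]]) auto
        show "cmod (Vol l (h l) x) \<le> 2 * C"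
        proof -
          have "cmod (Vol l (h l) x) \<le> 2 * (cmod (h l x) + H * wt l x)"
            by (rule Vol_bound [OF bmeas_continuous [OF h(2)] H(1)]) (rule Hl)
          also have "\<dots> \<le> 2 * C" using le by (intro mult_left_mono) auto
          finally show ?thesis .
        qed
      qed
    qed
    moreover have "C \<ge> 0" using H(1) by (simp add: C_def)
    ultimately show ?thesis by blast
  qed
  show ?thesis
    unfolding ent_def
  proof (intro conjI allI)
    show "Vol l (h l) \<in> borel_measurable borel" for l by (rule Vol_borel [OF h(2)])
    show "\<exists>H. \<forall>l y. cmod l \<le> B \<longrightarrow> \<bar>y\<bar> \<le> B \<longrightarrow> cmod (Vol l (h l) y) \<le> H" for B using unif by metis
    show "(\<lambda>l. Vol l (h l) x) holomorphic_on UNIV" for x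
    proof (rule holomorphic_uniform_sequence [where f = "\<lambda>N l. \<Sum>n<N. It l (h l) n x"])
      show "(\<lambda>l. \<Sum>n<N. It l (h l) n x) holomorphic_on UNIV" for N
        by (intro holomorphic_on_sum ent_holomorphic eI)
      fix l0 :: complex
      define B where "B = cmod l0 + 1 + \<bar>x\<bar>"
      obtain C where C: "\<And>l x n. cmod l \<le> B \<Longrightarrow> \<bar>x\<bar> \<le> B \<Longrightarrow> cmod (It l (h l) n x) \<le> C * (1/2) ^ n"
        using unif by meson
      have "uniform_limit (cball l0 1) (\<lambda>N l. \<Sum>n<N. It l (h l) n x) (\<lambda>l. Vol l (h l) x) sequentially"
        unfolding Vol_def
      proof (rule Weierstrass_m_test)
        show "norm (It l (h l) n x) \<le> C * (1/2) ^ n" if "l \<in> cball l0 1" for n l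
        proof (rule C)
          show "cmod l \<le> B" using that norm_triangle_ineq2 [of l l0] by (simp add: B_def dist_norm norm_minus_commute)
        qed (simp add: B_def)
        show "summable (\<lambda>n. C * (1/2) ^ n)" by (intro summable_mult summable_geometric) auto
      qed
      then show "\<exists>d>0. cball l0 d \<subseteq> UNIV \<and> uniform_limit (cball l0 d) (\<lambda>N l. \<Sum>n<N. It l (h l) n x) (\<lambda>l. Vol l (h l) x) sequentially"
        by (intro exI [of _ 1]) auto
    qed simp
  qed
qed

end

section \<open>Solutions of the equation with a source\<close>

text \<open>A member of an entire family, regarded as a constant family; this makes the facts about
  families available at a fixed parameter.\<close>

lemma ent_freeze: "ent h \<Longrightarrow> ent (\<lambda>_. h l)"
proof -
  assume h: "ent h"
  have "\<exists>H. \<forall>y. \<bar>y\<bar> \<le> B \<longrightarrow> cmod (h l y) \<le> H" for B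
  proof -
    obtain H where "\<And>l' y. cmod l' \<le> max B (cmod l) \<Longrightarrow> \<bar>y\<bar> \<le> max B (cmod l) \<Longrightarrow> cmod (h l' y) \<le> H"
      using ent_bound [OF h] by metis
    then show ?thesis by (intro exI [of _ H]) auto
  qed
  then show ?thesis using h unfolding ent_def by auto
qed

lemma ent_loc_integrable: "ent h \<Longrightarrow> loc_integrable (h l)"
  using ent_freeze [of h l] unfolding ent_def
  by (intro loc_integrable_bounded) (auto, metis norm_zero zero_le_numeral abs_ge_zero norm_ge_zero order_refl linear order_trans)

lemma exp_integral_deriv:
  fixes c :: complex
  assumes t: "test_function \<phi>"
  shows "(\<integral>x. exp (c * of_real x) * vderiv \<phi> x \<partial>lborel) = - c * (\<integral>x. exp (c * of_real x) * \<phi> x \<partial>lborel)"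
proof -
  note t' = test_function_vderiv [OF t]
  obtain A where A: "A > 0" "\<And>x. \<bar>x\<bar> > A \<Longrightarrow> \<phi> x = 0" using t test_function_support by blast
  note A' = vanishing_vderiv [of A \<phi>, OF A(2)]
  have ec: "continuous_on UNIV (\<lambda>x. exp (c * complex_of_real x))" by (intro continuous_intros)
  have "(\<integral>x. exp (c * of_real x) * vderiv \<phi> x + c * exp (c * of_real x) * \<phi> x \<partial>lborel) = 0"
  proof (rule ftc_line [of "\<lambda>x. exp (c * of_real x) * \<phi> x" _ A])
    show "((\<lambda>x. exp (c * of_real x) * \<phi> x) has_vector_derivative
        exp (c * of_real x) * vderiv \<phi> x + c * exp (c * of_real x) * \<phi> x) (at x)" for x
      by (intro has_vector_derivative_mult has_vector_derivative_exp_linear test_function_deriv t)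
    show "continuous_on UNIV (\<lambda>x. exp (c * of_real x) * vderiv \<phi> x + c * exp (c * of_real x) * \<phi> x)"
      by (intro continuous_intros test_function_continuous t t')
  qed (use A A' in auto)
  moreover have "integrable lborel (\<lambda>x. exp (c * of_real x) * vderiv \<phi> x)"
    by (intro integrable_loc_integrable_test loc_integrable_continuous ec t')
  moreover have "integrable lborel (\<lambda>x. c * (exp (c * of_real x) * \<phi> x))"
    by (intro integrable_mult_right integrable_loc_integrable_test loc_integrable_continuous ec t)
  ultimately show ?thesis by (simp add: mult.assoc eq_neg_iff_add_eq_0)
qed

lemma Sp_shift: "Sp l (x - y) = indicator {y<..} x *\<^sub>R Sk l (x - y)"
  by (auto simp: Sp_def indicator_def max_def)

lemma Cp_shift: "Cp l (x - y) = indicator {y<..} x *\<^sub>R cos (l * of_real (x - y))"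
  by (auto simp: Cp_def indicator_def)

text \<open>There is no boundary term at \<open>y\<close>, because \<open>Sk\<close> vanishes at 0;
  hence the weak derivative of the kernel carries no point mass.\<close>

lemma Sp_integral_deriv:
  assumes t: "test_function \<phi>"
  shows "(\<integral>x. Sp l (x - y) * vderiv \<phi> x \<partial>lborel) = - (\<integral>x. Cp l (x - y) * \<phi> x \<partial>lborel)"
proof -
  note t' = test_function_vderiv [OF t]
  obtain A where A: "A > 0" "\<And>x. \<bar>x\<bar> > A \<Longrightarrow> \<phi> x = 0" using t test_function_support by blast
  note A' = vanishing_vderiv [of A \<phi>, OF A(2)]
  have c: "continuous_on UNIV (\<lambda>x. Sk l (x - y))" "continuous_on UNIV (\<lambda>x. cos (l * of_real (x - y)))"
    by (intro continuous_on_compose2 [OF continuous_Sk [of UNIV]] continuous_intros; auto)+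
  have "(\<integral>x. indicator {y<..} x *\<^sub>R (Sk l (x - y) * vderiv \<phi> x + cos (l * of_real (x - y)) * \<phi> x) \<partial>lborel)
      = - (Sk l (y - y) * \<phi> y)"
  proof (rule ftc_right [of "\<lambda>x. Sk l (x - y) * \<phi> x" _ A])
    show "((\<lambda>x. Sk l (x - y) * \<phi> x) has_vector_derivative
        Sk l (x - y) * vderiv \<phi> x + cos (l * of_real (x - y)) * \<phi> x) (at x)" for x
      by (intro has_vector_derivative_mult Sk_deriv test_function_deriv t)
    show "continuous_on UNIV (\<lambda>x. Sk l (x - y) * vderiv \<phi> x + cos (l * of_real (x - y)) * \<phi> x)"
      by (intro continuous_intros test_function_continuous t t' c)
  qed (use A A' in auto)
  moreover have "integrable lborel (\<lambda>x. indicator {y<..} x *\<^sub>R (Sk l (x - y) * vderiv \<phi> x))"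
    by (intro integrable_mult_indicator integrable_loc_integrable_test loc_integrable_continuous c t') auto
  moreover have "integrable lborel (\<lambda>x. indicator {y<..} x *\<^sub>R (cos (l * of_real (x - y)) * \<phi> x))"
    by (intro integrable_mult_indicator integrable_loc_integrable_test loc_integrable_continuous c t) auto
  ultimately show ?thesis
    by (simp add: Sp_shift Cp_shift scaleR_right_distrib eq_neg_iff_add_eq_0)
qed

text \<open>The boundary term at \<open>y\<close> is cos 0 = 1 times the test function, the weak
  form of the kernel being a fundamental solution.\<close>

lemma Sp_integral_deriv2:
  assumes t: "test_function \<phi>"
  shows "(\<integral>x. Sp l (x - y) * (vderiv (vderiv \<phi>) x + l\<^sup>2 * \<phi> x) \<partial>lborel) = \<phi> y"
proof -
  note t' = test_function_vderiv [OF t] note t'' = test_function_vderiv [OF t']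
  obtain A where A: "A > 0" "\<And>x. \<bar>x\<bar> > A \<Longrightarrow> \<phi> x = 0" using t test_function_support by blast
  note A' = vanishing_vderiv [of A \<phi>, OF A(2)] note A'' = vanishing_vderiv [of A "vderiv \<phi>", OF A']
  have c: "continuous_on UNIV (\<lambda>x. Sk l (x - y))"
    by (intro continuous_on_compose2 [OF continuous_Sk [of UNIV]] continuous_intros; auto)
  have "(\<integral>x. indicator {y<..} x *\<^sub>R (Sk l (x - y) * (vderiv (vderiv \<phi>) x + l\<^sup>2 * \<phi> x)) \<partial>lborel)
      = - (Sk l (y - y) * vderiv \<phi> y - cos (l * of_real (y - y)) * \<phi> y)"
  proof (rule ftc_right [of "\<lambda>x. Sk l (x - y) * vderiv \<phi> x - cos (l * of_real (x - y)) * \<phi> x" _ A])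
    fix x
    have "((\<lambda>x. Sk l (x - y) * vderiv \<phi> x - cos (l * of_real (x - y)) * \<phi> x) has_vector_derivative
        (Sk l (x - y) * vderiv (vderiv \<phi>) x + cos (l * of_real (x - y)) * vderiv \<phi> x) -
        (cos (l * of_real (x - y)) * vderiv \<phi> x + - (l\<^sup>2 * Sk l (x - y)) * \<phi> x)) (at x)"
      by (intro has_vector_derivative_diff has_vector_derivative_mult Sk_deriv cos_deriv test_function_deriv t t')
    then show "((\<lambda>x. Sk l (x - y) * vderiv \<phi> x - cos (l * of_real (x - y)) * \<phi> x) has_vector_derivative
        Sk l (x - y) * (vderiv (vderiv \<phi>) x + l\<^sup>2 * \<phi> x)) (at x)"
      by (simp add: algebra_simps)
    show "continuous_on UNIV (\<lambda>x. Sk l (x - y) * (vderiv (vderiv \<phi>) x + l\<^sup>2 * \<phi> x))"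
      by (intro continuous_intros test_function_continuous t t'' c)
  qed (use A A' A'' in auto)
  then show ?thesis by (simp add: Sp_shift)
qed

lemma source_fubini:
  assumes f: "source L f" and k: "ent k" and t: "test_function \<phi>"
  shows "(\<integral>x. (\<integral>y. k l (x - y) * f y \<partial>lborel) * \<phi> x \<partial>lborel) = (\<integral>y. (\<integral>x. k l (x - y) * \<phi> x \<partial>lborel) * f y \<partial>lborel)"
proof -
  obtain A B where A: "A > 0" "B > 0" "\<And>x. norm (\<phi> x) \<le> B * indicator {-A..A} x"
    using test_function_dominated [OF t] by metis
  have [measurable]: "k l \<in> borel_measurable borel" by (rule ent_borel [OF k])
  obtain H where H: "H \<ge> 0" "\<And>l' y. cmod l' \<le> A + \<bar>L\<bar> + cmod l \<Longrightarrow> \<bar>y\<bar> \<le> A + \<bar>L\<bar> + cmod l \<Longrightarrow> cmod (k l' y) \<le> H"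
    using ent_bound [OF k] by metis
  show ?thesis
  proof (rule fubini_kernel [where D = "H * B" and A = A])
    show "cmod (k l (x - y) * \<phi> x * f y) \<le> H * B * indicator {- A..A} x * cmod (f y)" for x y
    proof (cases "\<bar>y\<bar> \<le> L \<and> x \<in> {-A..A}")
      case True
      then have "\<bar>x\<bar> \<le> A" by auto
      then have "\<bar>x - y\<bar> \<le> A + \<bar>L\<bar> + cmod l" "cmod l \<le> A + \<bar>L\<bar> + cmod l"
        using True A(1) norm_ge_zero [of l] by linarith+
      then have "cmod (k l (x - y)) * cmod (\<phi> x) \<le> H * B"
        using True A(3) [of x] H(1) by (intro mult_mono H) auto
      then show ?thesis using True by (simp add: norm_mult mult_right_mono)
    next
      case False
      then show ?thesis using f A(3) [of x] by (auto simp: source_def)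
    qed
  qed (use f t lborel.sigma_finite_measure_axioms in \<open>auto simp: source_def intro: test_function_borel\<close>)
qed

context signed_pair
begin

lemma I_conv_fubini:
  assumes u: "continuous_on UNIV u" and k: "ent k" and t: "test_function \<phi>"
  shows "(\<integral>x. I (\<lambda>y. k l (x - y) * u y) * \<phi> x \<partial>lborel) = I (\<lambda>y. (\<integral>x. k l (x - y) * \<phi> x \<partial>lborel) * u y)"
proof -
  obtain A B where A: "A > 0" "B > 0" "\<And>x. norm (\<phi> x) \<le> B * indicator {-A..A} x"
    using test_function_dominated [OF t] by metis
  have [measurable]: "k l \<in> borel_measurable borel" by (rule ent_borel [OF k])
  have [measurable]: "u \<in> borel_measurable borel" by (rule continuous_UNIV_borel [OF u])
  obtain H where H: "H \<ge> 0" "\<And>l' y. cmod l' \<le> A + R + cmod l \<Longrightarrow> \<bar>y\<bar> \<le> A + R + cmod l \<Longrightarrow> cmod (k l' y) \<le> H"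
    using ent_bound [OF k] by metis
  obtain H' where H': "H' \<ge> 0" "\<And>y. \<bar>y\<bar> \<le> R \<Longrightarrow> cmod (u y) \<le> H'" using bmeas_obtain [OF bmeas_continuous [OF u]] by blast
  have "(\<integral>x. I (\<lambda>y. k l (x - y) * u y) * \<phi> x \<partial>lborel) = I (\<lambda>y. \<integral>x. k l (x - y) * u y * \<phi> x \<partial>lborel)"
  proof (rule I_fubini [OF _ _ A(3), where B = "H * H'"])
    show "cmod (k l (x - y) * u y) \<le> H * H'" if "\<bar>x\<bar> \<le> A" "\<bar>y\<bar> \<le> R" for x y
    proof -
      have "\<bar>x - y\<bar> \<le> A + R + cmod l" "cmod l \<le> A + R + cmod l"
        using that A(1) R_pos norm_ge_zero [of l] by linarith+
      then show ?thesis unfolding norm_mult using that H(1) by (intro mult_mono H H') auto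
    qed
    show "(\<lambda>(x, y). k l (x - y) * u y) \<in> borel_measurable (borel \<Otimes>\<^sub>M borel)" by measurable
  qed (use t A in \<open>auto intro: test_function_borel\<close>)
  also have "(\<lambda>y. \<integral>x. k l (x - y) * u y * \<phi> x \<partial>lborel) = (\<lambda>y. (\<integral>x. k l (x - y) * \<phi> x \<partial>lborel) * u y)"
    by (subst integral_mult_left_zero [symmetric]) (simp add: mult_ac)
  finally show ?thesis .
qed

text \<open>Variation of constants for u'' + l^2 u = V u - f: a free wave with amplitude
  \<open>c\<close>, alone present on the far left, plus the causal response to the right-hand side.
  Solutions of the equation are obtained as fixed points, \<open>sol l c u f\<close> =
  \<open>u\<close>.\<close>

definition sol :: "complex \<Rightarrow> complex \<Rightarrow> (real \<Rightarrow> complex) \<Rightarrow> (real \<Rightarrow> complex) \<Rightarrow> real \<Rightarrow> complex" where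
  "sol l c u f x = c * exp (- \<i> * l * of_real x) + I (\<lambda>y. Sp l (x - y) * u y) - (\<integral>y. Sp l (x - y) * f y \<partial>lborel)"

definition sol1 :: "complex \<Rightarrow> complex \<Rightarrow> (real \<Rightarrow> complex) \<Rightarrow> (real \<Rightarrow> complex) \<Rightarrow> real \<Rightarrow> complex" where
  "sol1 l c u f x = - \<i> * l * c * exp (- \<i> * l * of_real x) + I (\<lambda>y. Cp l (x - y) * u y) - (\<integral>y. Cp l (x - y) * f y \<partial>lborel)"

lemma sol_parts:
  assumes u: "continuous_on UNIV u" and f: "source L f" and k: "ent k"
  shows "loc_integrable (\<lambda>x. c * exp (- \<i> * l * of_real x))"
    "loc_integrable (\<lambda>x. I (\<lambda>y. k l (x - y) * u y))"
    "loc_integrable (\<lambda>x. \<integral>y. k l (x - y) * f y \<partial>lborel)"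
  using ent_loc_integrable [OF ent_I_convolution [OF k ent_continuous [OF u]]]
    ent_loc_integrable [OF ent_source_convolution [OF f k]]
  by (auto intro!: loc_integrable_continuous continuous_intros)

lemma sol_loc_integrable:
  assumes "continuous_on UNIV u" "source L f"
  shows "loc_integrable (sol l c u f)" "loc_integrable (sol1 l c u f)"
proof -
  note parts = sol_parts [OF assms]
  have "loc_integrable (\<lambda>x. c * exp (- \<i> * l * of_real x) + I (\<lambda>y. Sp l (x - y) * u y) - (\<integral>y. Sp l (x - y) * f y \<partial>lborel))"
    by (intro loc_integrable_add loc_integrable_diff parts [OF ent_Sp])
  then show "loc_integrable (sol l c u f)" by (simp add: sol_def [abs_def])
  have "loc_integrable (\<lambda>x. (- \<i> * l * c) * exp (- \<i> * l * of_real x) + I (\<lambda>y. Cp l (x - y) * u y) - (\<integral>y. Cp l (x - y) * f y \<partial>lborel))"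
    by (intro loc_integrable_add loc_integrable_diff parts [OF ent_Cp])
  then show "loc_integrable (sol1 l c u f)" by (simp add: sol1_def [abs_def])
qed

lemma parts_integral:
  assumes u: "continuous_on UNIV u" and f: "source L f" and k: "ent k" and t: "test_function \<phi>"
  shows "(\<integral>x. (c * exp (- \<i> * l * of_real x) + I (\<lambda>y. k l (x - y) * u y) - (\<integral>y. k l (x - y) * f y \<partial>lborel)) * \<phi> x \<partial>lborel)
    = c * (\<integral>x. exp (- \<i> * l * of_real x) * \<phi> x \<partial>lborel) + I (\<lambda>y. (\<integral>x. k l (x - y) * \<phi> x \<partial>lborel) * u y)
      - (\<integral>y. (\<integral>x. k l (x - y) * \<phi> x \<partial>lborel) * f y \<partial>lborel)"
  using integrable_loc_integrable_test [OF sol_parts(1) [OF u f k, of c l] t]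
    integrable_loc_integrable_test [OF sol_parts(2) [OF u f k, of l] t]
    integrable_loc_integrable_test [OF sol_parts(3) [OF u f k, of l] t]
  by (simp add: distrib_right left_diff_distrib I_conv_fubini [OF u k t, symmetric]
      source_fubini [OF f k t, symmetric] mult.assoc)

lemma sol_weak_deriv:
  assumes u: "continuous_on UNIV u" and f: "source L f" and t: "test_function \<phi>"
  shows "(\<integral>x. sol l c u f x * vderiv \<phi> x \<partial>lborel) = - (\<integral>x. sol1 l c u f x * \<phi> x \<partial>lborel)"
proof -
  note t' = test_function_vderiv [OF t]
  have I_neg: "I (\<lambda>y. - k y * u y) = - I (\<lambda>y. k y * u y)" for k
    using I_cmult [of "-1" "\<lambda>y. k y * u y"] by (simp add: mult.assoc)
  show ?thesis
    unfolding sol_def sol1_def parts_integral [OF u f ent_Sp t'] parts_integral [OF u f ent_Cp t]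
      Sp_integral_deriv [OF t] exp_integral_deriv [OF t] I_neg
    by (simp add: algebra_simps)
qed

text \<open>Here \<open>u\<close> need not be a fixed point: the potential acts on \<open>u\<close>,
  the free operator on \<open>sol l c u f\<close>. This freedom is used when an eigenfunction is
  compared with the outgoing function that it generates.\<close>

lemma sol_equation:
  assumes u: "continuous_on UNIV u" and f: "source L f" and t: "test_function \<phi>"
  shows "- (\<integral>x. sol l c u f x * vderiv (vderiv \<phi>) x \<partial>lborel) + I (\<lambda>y. u y * \<phi> y)
    = l\<^sup>2 * (\<integral>x. sol l c u f x * \<phi> x \<partial>lborel) + (\<integral>x. f x * \<phi> x \<partial>lborel)"
proof -
  note t' = test_function_vderiv [OF t] note t'' = test_function_vderiv [OF t']
  define \<theta> where "\<theta> x = vderiv (vderiv \<phi>) x + l\<^sup>2 * \<phi> x" for x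
  have t\<theta>: "test_function \<theta>" unfolding \<theta>_def by (intro test_function_add test_function_cmult t t'')
  note li = sol_loc_integrable(1) [OF u f, of l c]
  have "(\<integral>x. exp (- \<i> * l * of_real x) * \<theta> x \<partial>lborel)
      = (\<integral>x. exp (- \<i> * l * of_real x) * vderiv (vderiv \<phi>) x \<partial>lborel)
        + l\<^sup>2 * (\<integral>x. exp (- \<i> * l * of_real x) * \<phi> x \<partial>lborel)"
  proof -
    have e: "loc_integrable (\<lambda>x. exp (- \<i> * l * of_real x))"
      by (intro loc_integrable_continuous continuous_intros)
    have "(\<lambda>x. exp (- \<i> * l * of_real x) * \<theta> x) = (\<lambda>x. exp (- \<i> * l * of_real x) * vderiv (vderiv \<phi>) x
        + l\<^sup>2 * (exp (- \<i> * l * of_real x) * \<phi> x))" by (simp add: \<theta>_def algebra_simps)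
    moreover note Bochner_Integration.integral_add [OF integrable_loc_integrable_test [OF e t'']
        integrable_mult_right [OF integrable_loc_integrable_test [OF e t], of "l\<^sup>2"]]
    ultimately show ?thesis by (simp only: integral_mult_right_zero)
  qed
  also have "\<dots> = 0"
  proof -
    have "\<i> * l * (\<i> * l * X) + l\<^sup>2 * X = 0" for X
    proof -
      have "\<i> * l * (\<i> * l * X) = (\<i> * \<i>) * (l\<^sup>2 * X)" by (simp add: power2_eq_square mult_ac)
      then show ?thesis by simp
    qed
    then show ?thesis unfolding exp_integral_deriv [OF t'] exp_integral_deriv [OF t] by simp
  qed
  finally have e0: "(\<integral>x. exp (- \<i> * l * of_real x) * \<theta> x \<partial>lborel) = 0" .
  have S: "(\<integral>x. Sp l (x - y) * \<theta> x \<partial>lborel) = \<phi> y" for y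
    unfolding \<theta>_def by (rule Sp_integral_deriv2 [OF t])
  have "(\<integral>x. sol l c u f x * \<theta> x \<partial>lborel) = I (\<lambda>y. \<phi> y * u y) - (\<integral>y. \<phi> y * f y \<partial>lborel)"
    unfolding sol_def parts_integral [OF u f ent_Sp t\<theta>] e0 S by simp
  moreover have "(\<integral>x. sol l c u f x * \<theta> x \<partial>lborel) = (\<integral>x. sol l c u f x * vderiv (vderiv \<phi>) x \<partial>lborel)
      + l\<^sup>2 * (\<integral>x. sol l c u f x * \<phi> x \<partial>lborel)"
  proof -
    have "(\<lambda>x. sol l c u f x * \<theta> x) = (\<lambda>x. sol l c u f x * vderiv (vderiv \<phi>) x
        + l\<^sup>2 * (sol l c u f x * \<phi> x))" by (simp add: \<theta>_def algebra_simps)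
    moreover note Bochner_Integration.integral_add [OF integrable_loc_integrable_test [OF li t'']
        integrable_mult_right [OF integrable_loc_integrable_test [OF li t], of "l\<^sup>2"]]
    ultimately show ?thesis by (simp only: integral_mult_right_zero)
  qed
  ultimately show ?thesis by (simp add: mult.commute algebra_simps)
qed

subsection \<open>Outgoing solutions\<close>

text \<open>To the right of all supports \<open>Sp\<close> splits into two exponentials, and the
  condition says that the coefficient of exp(-i l x) in \<open>sol\<close> vanishes there. It is
  multiplied out by 2 i l, so it makes sense at l = 0.\<close>

definition outgoing :: "complex \<Rightarrow> complex \<Rightarrow> (real \<Rightarrow> complex) \<Rightarrow> (real \<Rightarrow> complex) \<Rightarrow> bool" where
  "outgoing l c u f \<longleftrightarrow>
     2 * \<i> * l * c = I (\<lambda>y. exp (\<i> * l * of_real y) * u y) - (\<integral>y. exp (\<i> * l * of_real y) * f y \<partial>lborel)"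

text \<open>A multiple of exp(-i l x) whose coefficient is the right combination of moments of
  \<open>u\<close> and \<open>f\<close> can be absorbed into the convolution kernel.\<close>

lemma conv_split:
  assumes u: "continuous_on UNIV u" and f: "source L f" and k: "ent k" and g: "ent g"
    and eq: "\<And>t. g l t = d * exp (- \<i> * l * of_real t) + k l t"
    and c: "c' = d * (I (\<lambda>y. exp (\<i> * l * of_real y) * u y) - (\<integral>y. exp (\<i> * l * of_real y) * f y \<partial>lborel))"
  shows "c' * exp (- \<i> * l * of_real x) + I (\<lambda>y. k l (x - y) * u y) - (\<integral>y. k l (x - y) * f y \<partial>lborel)
    = I (\<lambda>y. g l (x - y) * u y) - (\<integral>y. g l (x - y) * f y \<partial>lborel)"
proof -
  define e where "e y = d * exp (- \<i> * l * of_real x) * exp (\<i> * l * of_real y)" for y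
  have ge: "g l (x - y) = e y + k l (x - y)" for y
    unfolding eq e_def by (simp add: exp_add [symmetric] algebra_simps)
  have ek: "ent (\<lambda>_ y. k l (x - y))" by (rule ent_freeze [OF ent_shift_holomorphic [OF k]])
  have ec: "continuous_on UNIV e" unfolding e_def by (intro continuous_intros)
  have "I (\<lambda>y. g l (x - y) * u y) = I (\<lambda>y. e y * u y) + I (\<lambda>y. k l (x - y) * u y)"
    unfolding ge distrib_right
    by (intro I_add bmeas_mult bmeas_continuous u ec ent_bmeas [OF ek])
  moreover have "I (\<lambda>y. e y * u y) = d * exp (- \<i> * l * of_real x) * I (\<lambda>y. exp (\<i> * l * of_real y) * u y)"
    unfolding e_def mult.assoc I_cmult ..
  moreover have "(\<integral>y. g l (x - y) * f y \<partial>lborel) = (\<integral>y. e y * f y \<partial>lborel) + (\<integral>y. k l (x - y) * f y \<partial>lborel)"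
  proof -
    obtain H1 where "\<And>y. \<bar>y\<bar> \<le> L \<Longrightarrow> cmod (e y) \<le> H1" using continuous_bounded_on_interval [OF ec] by blast
    then have i1: "integrable lborel (\<lambda>y. e y * f y)"
      by (intro source_integrable_mult [OF f] continuous_UNIV_borel ec)
    obtain H2 where "\<And>l' y. cmod l' \<le> max 0 L \<Longrightarrow> \<bar>y\<bar> \<le> max 0 L \<Longrightarrow> cmod (k l (x - y)) \<le> H2" using ent_bound [OF ek] by metis
    from this [of 0] have i2: "integrable lborel (\<lambda>y. k l (x - y) * f y)"
      by (intro source_integrable_mult(1) [OF f, where B = H2]) (auto intro: ent_borel [OF ek])
    show ?thesis unfolding ge distrib_right using i1 i2 by simp
  qed
  moreover have "(\<integral>y. e y * f y \<partial>lborel) = d * exp (- \<i> * l * of_real x) * (\<integral>y. exp (\<i> * l * of_real y) * f y \<partial>lborel)"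
    unfolding e_def mult.assoc integral_mult_right_zero ..
  ultimately show ?thesis unfolding c by (simp add: algebra_simps)
qed

text \<open>On both supports |x - y| is at least |x| - L, so decay of the kernel passes to the
  convolution at the price of the factor exp(a L).\<close>

lemma conv_decay:
  assumes u: "continuous_on UNIV u" and f: "source L f" and g: "g \<in> borel_measurable borel"
    and gb: "\<And>t. cmod (g t) \<le> D * exp (- a * \<bar>t\<bar>)" and "a > 0" "L \<ge> R"
  obtains C where "C \<ge> 0" "\<And>x. cmod (I (\<lambda>y. g (x - y) * u y) - (\<integral>y. g (x - y) * f y \<partial>lborel)) \<le> C * exp (- a * \<bar>x\<bar>)"
proof -
  obtain H' where H': "H' \<ge> 0" "\<And>y. \<bar>y\<bar> \<le> R \<Longrightarrow> cmod (u y) \<le> H'" using bmeas_obtain [OF bmeas_continuous [OF u]] by blast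
  have D: "D \<ge> 0" using order_trans [OF norm_ge_zero gb [of 0]] by simp
  define E where "E x = D * exp (a * L) * exp (- a * \<bar>x\<bar>)" for x
  have g_le: "cmod (g (x - y)) \<le> E x" if "\<bar>y\<bar> \<le> L" for x y
  proof -
    have "- a * \<bar>x - y\<bar> \<le> a * L + - a * \<bar>x\<bar>"
    proof -
      have "\<bar>x\<bar> \<le> \<bar>x - y\<bar> + L" using that by linarith
      from mult_left_mono [OF this, of a] \<open>a > 0\<close> show ?thesis by (simp add: distrib_left)
    qed
    then have "D * exp (- a * \<bar>x - y\<bar>) \<le> D * exp (a * L + - a * \<bar>x\<bar>)" using D by (intro mult_left_mono) auto
    then show ?thesis using gb [of "x - y"] unfolding E_def exp_add by linarith
  qed
  have E0: "E x \<ge> 0" for x using D by (simp add: E_def)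
  define C where "C = (mass * H' + (\<integral>y. cmod (f y) \<partial>lborel)) * (D * exp (a * L))"
  show ?thesis
  proof (rule that [of C])
    show "C \<ge> 0" using mass_pos H'(1) D by (simp add: C_def)
    fix x
    have 1: "cmod (I (\<lambda>y. g (x - y) * u y)) \<le> mass * (E x * H')"
      using g_le H' E0 \<open>L \<ge> R\<close> by (intro norm_I_le) (auto simp: norm_mult intro!: mult_mono)
    have [measurable]: "g \<in> borel_measurable borel" by fact
    have "cmod (\<integral>y. g (x - y) * f y \<partial>lborel) \<le> E x * (\<integral>y. cmod (f y) \<partial>lborel)"
      by (intro source_integrable_mult(2) [OF f] g_le) measurable
    with 1 have "cmod (I (\<lambda>y. g (x - y) * u y) - (\<integral>y. g (x - y) * f y \<partial>lborel)) \<le>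
        mass * (E x * H') + E x * (\<integral>y. cmod (f y) \<partial>lborel)"
      by (intro order_trans [OF norm_triangle_ineq4] add_mono)
    then show "cmod (I (\<lambda>y. g (x - y) * u y) - (\<integral>y. g (x - y) * f y \<partial>lborel)) \<le> C * exp (- a * \<bar>x\<bar>)"
      by (simp add: C_def E_def algebra_simps)
  qed
qed

text \<open>
  For \<open>Im l > 0\<close> the functions \<open>G\<close>, \<open>G1\<close> are the decaying fundamental solution
  \<open>e\<^bsup>i l |t|\<^esup> / (2 i l)\<close> and its derivative.
\<close>

definition G :: "complex \<Rightarrow> real \<Rightarrow> complex" where
  "G l t = 1 / (2 * \<i> * l) * exp (- \<i> * l * of_real t) + Sp l t"

definition G1 :: "complex \<Rightarrow> real \<Rightarrow> complex" where
  "G1 l t = - 1 / 2 * exp (- \<i> * l * of_real t) + Cp l t"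

lemma G_eq:
  assumes "l \<noteq> 0" shows "G l t = exp (\<i> * l * of_real \<bar>t\<bar>) / (2 * \<i> * l)"
proof (cases "t > 0")
  case True
  have "Sp l t = sin (l * of_real t) / l" using mult_Sk [of l t] True assms by (simp add: Sp_def field_simps)
  then show ?thesis using assms True by (simp add: G_def sin_exp_eq field_simps)
qed (use assms in \<open>simp add: G_def Sp_def max_def field_simps\<close>)

lemma norm_G: "l \<noteq> 0 \<Longrightarrow> cmod (G l t) = 1 / (2 * cmod l) * exp (- Im l * \<bar>t\<bar>)"
  by (simp add: G_eq norm_divide norm_mult norm_exp_eq_Re)

lemma norm_G1: "cmod (G1 l t) \<le> 1 / 2 * exp (- Im l * \<bar>t\<bar>)"
proof (cases "t > 0")
  case True
  then have eq: "G1 l t = 1 / 2 * exp (\<i> * l * of_real \<bar>t\<bar>)" by (simp add: G1_def Cp_def cos_exp_eq field_simps)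
  show ?thesis unfolding eq by (simp add: norm_mult norm_exp_eq_Re)
qed (simp add: G1_def Cp_def norm_mult norm_exp_eq_Re)

lemma ent_G: "ent (\<lambda>_. G l)" "ent (\<lambda>_. G1 l)"
  unfolding G_def G1_def
  by (intro ent_add ent_freeze [OF ent_Sp] ent_freeze [OF ent_Cp] ent_continuous continuous_intros)+

text \<open>The outgoing condition fixes exactly the amplitude \<open>c\<close> that merges the free
  wave into the kernel. The Volterra representation thereby turns into the Lippmann-Schwinger one,
  with exp(i l |t|)/(2 i l) in place of the causal kernel.\<close>

lemma outgoing_sol:
  assumes u: "continuous_on UNIV u" and f: "source L f" and out: "outgoing l c u f" and l: "l \<noteq> 0"
  shows "sol l c u f x = I (\<lambda>y. G l (x - y) * u y) - (\<integral>y. G l (x - y) * f y \<partial>lborel)"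
    "sol1 l c u f x = I (\<lambda>y. G1 l (x - y) * u y) - (\<integral>y. G1 l (x - y) * f y \<partial>lborel)"
proof -
  note out' = out [unfolded outgoing_def]
  show "sol l c u f x = I (\<lambda>y. G l (x - y) * u y) - (\<integral>y. G l (x - y) * f y \<partial>lborel)"
    unfolding sol_def
  proof (rule conv_split [where k = "\<lambda>_. Sp l" and g = "\<lambda>_. G l" and d = "1 / (2 * \<i> * l)" and l = l, OF u f])
    show "c = 1 / (2 * \<i> * l) * (I (\<lambda>y. exp (\<i> * l * of_real y) * u y) - (\<integral>y. exp (\<i> * l * of_real y) * f y \<partial>lborel))"
      unfolding out' [symmetric] using l by simp
  qed (auto simp: G_def intro: ent_G ent_freeze [OF ent_Sp])
  show "sol1 l c u f x = I (\<lambda>y. G1 l (x - y) * u y) - (\<integral>y. G1 l (x - y) * f y \<partial>lborel)"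
    unfolding sol1_def
  proof (rule conv_split [where k = "\<lambda>_. Cp l" and g = "\<lambda>_. G1 l" and d = "- 1 / 2" and l = l, OF u f])
    show "- \<i> * l * c = - 1 / 2 * (I (\<lambda>y. exp (\<i> * l * of_real y) * u y) - (\<integral>y. exp (\<i> * l * of_real y) * f y \<partial>lborel))"
      unfolding out' [symmetric] by simp
  qed (auto simp: G1_def intro: ent_G ent_freeze [OF ent_Cp])
qed

end

section \<open>The domain of the operator\<close>

lemma integrable_exp_abs:
  assumes "a > 0" shows "integrable lborel (\<lambda>x::real. exp (- a * \<bar>x\<bar>))"
proof -
  have "(\<lambda>x::real. exp (- a * x)) absolutely_integrable_on {0..}"
    by (intro nonnegative_absolutely_integrable_1 integrable_on_exp_minus_to_infinity assms) auto
  then have 1: "integrable lborel (\<lambda>x. indicator {0..} x *\<^sub>R exp (- a * x))"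
    unfolding set_integrable_def by (subst (asm) integrable_completion) auto
  from lborel_integrable_real_affine [OF this, of "-1" 0]
  have 2: "integrable lborel (\<lambda>x. indicator {0..} (- x) *\<^sub>R exp (a * x))" by simp
  show ?thesis
  proof (rule Bochner_Integration.integrable_bound [OF Bochner_Integration.integrable_add [OF 1 2]])
    show "AE x in lborel. norm (exp (- a * \<bar>x\<bar>)) \<le> norm (indicator {0..} x *\<^sub>R exp (- a * x) + indicator {0..} (- x) *\<^sub>R exp (a * x))"
      by (intro AE_I2) (auto simp: indicator_def)
  qed measurable
qed

lemma L2_exp_decay:
  assumes [measurable]: "f \<in> borel_measurable borel" and "a > 0" and f: "\<And>x. cmod (f x) \<le> C * exp (- a * \<bar>x\<bar>)"
  shows "f \<in> L2"
proof -
  have "integrable lborel (\<lambda>x::real. C\<^sup>2 * exp (- (2 * a) * \<bar>x\<bar>))"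
    using \<open>a > 0\<close> by (intro integrable_mult_right integrable_exp_abs) auto
  then have "integrable lborel (\<lambda>x. (cmod (f x))\<^sup>2)"
  proof (rule Bochner_Integration.integrable_bound)
    show "AE x in lborel. norm ((cmod (f x))\<^sup>2) \<le> norm (C\<^sup>2 * exp (- (2 * a) * \<bar>x\<bar>))"
    proof (intro AE_I2)
      fix x
      have "(cmod (f x))\<^sup>2 \<le> (C * exp (- a * \<bar>x\<bar>))\<^sup>2" by (intro power_mono f) auto
      also have "\<dots> = C\<^sup>2 * exp (- (2 * a) * \<bar>x\<bar>)"
        by (simp add: power_mult_distrib exp_double [symmetric] mult.assoc)
      finally show "norm ((cmod (f x))\<^sup>2) \<le> norm (C\<^sup>2 * exp (- (2 * a) * \<bar>x\<bar>))" by simp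
    qed
  qed auto
  then show ?thesis by (simp add: L2_def)
qed

text \<open>The hypothesis is the weak form of v' = a v, so v exp(-a x) is a constant
  \<open>k\<close>. On the half-line where this exponential has modulus at most 1, |v| is at least
  |k|, which contradicts square-integrability unless \<open>k\<close> is 0.\<close>

lemma (in bump) weak_exp_zero:
  assumes v: "v \<in> L2"
    and eq: "\<And>\<phi>. test_function \<phi> \<Longrightarrow> (\<integral>x. v x * vderiv \<phi> x \<partial>lborel) = - a * (\<integral>x. v x * \<phi> x \<partial>lborel)"
  shows "ae_eq v (\<lambda>_. 0)"
proof -
  define e where "e x = exp (- a * complex_of_real x)" for x
  have ec: "continuous_on UNIV e" unfolding e_def by (intro continuous_intros)
  obtain k where k: "ae_eq (\<lambda>x. v x * e x) (\<lambda>_. k)"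
  proof (rule du_bois_reymond)
    show "loc_integrable (\<lambda>x. v x * e x)" by (intro loc_integrable_mult L2_loc_integrable v ec)
    fix \<phi> :: "real \<Rightarrow> complex" assume t: "test_function \<phi>"
    have te: "test_function (\<lambda>x. e x * \<phi> x)"
      unfolding e_def by (intro test_function_smooth_mult smooth_exp t)
    have te': "test_function (\<lambda>x. e x * vderiv \<phi> x)"
      unfolding e_def by (intro test_function_smooth_mult smooth_exp test_function_vderiv t)
    have "vderiv (\<lambda>x. e x * \<phi> x) = (\<lambda>x. e x * vderiv \<phi> x + (- a * e x) * \<phi> x)"
      unfolding e_def
      by (intro vderiv_eq has_vector_derivative_mult has_vector_derivative_exp_linear test_function_deriv t)
    with eq [OF te] have "(\<integral>x. v x * (e x * vderiv \<phi> x + (- a * e x) * \<phi> x) \<partial>lborel) = - a * (\<integral>x. v x * (e x * \<phi> x) \<partial>lborel)"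
      by simp
    moreover have "(\<lambda>x. v x * (e x * vderiv \<phi> x + (- a * e x) * \<phi> x)) =
        (\<lambda>x. v x * (e x * vderiv \<phi> x) + - a * (v x * (e x * \<phi> x)))" by (simp add: algebra_simps)
    moreover note Bochner_Integration.integral_add [OF L2_integrable_mult [OF v L2_test_function [OF te']]
        integrable_mult_right [OF L2_integrable_mult [OF v L2_test_function [OF te]], of "- a"]]
    ultimately show "(\<integral>x. v x * e x * vderiv \<phi> x \<partial>lborel) = 0"
      by (simp add: mult.assoc)
  qed
  have "k = 0"
  proof (rule ccontr)
    assume "k \<noteq> 0"
    define s :: real where "s = (if Re a \<ge> 0 then 1 else - 1)"
    define Q where "Q = (\<integral>x. (cmod (v x))\<^sup>2 \<partial>lborel)"
    have "(cmod k)\<^sup>2 * real n \<le> Q" for n :: nat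
    proof -
      define J where "J = (if Re a \<ge> 0 then {0..real n} else {- real n..0})"
      have "(cmod k)\<^sup>2 * real n = (\<integral>x. (cmod k)\<^sup>2 * indicator J x \<partial>lborel)"
        by (simp add: J_def)
      also have "\<dots> \<le> Q"
        unfolding Q_def
      proof (rule integral_mono_AE)
        show "integrable lborel (\<lambda>x. (cmod k)\<^sup>2 * indicator J x :: real)"
          by (intro integrable_mult_right) (auto simp: J_def emeasure_lborel_Icc_eq)
        show "integrable lborel (\<lambda>x. (cmod (v x))\<^sup>2)" by (rule L2_integrable [OF v])
        show "AE x in lborel. (cmod k)\<^sup>2 * indicator J x \<le> (cmod (v x))\<^sup>2"
          using k unfolding ae_eq_def
        proof eventually_elim
          case (elim x)
          show ?case
          proof (cases "x \<in> J")
            case True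
            then have "0 \<le> Re a * x"
              by (auto simp: J_def zero_le_mult_iff split: if_splits)
            then have "cmod (e x) \<le> 1" by (simp add: e_def norm_exp_eq_Re)
            then have "cmod k \<le> cmod (v x)"
              using mult_left_mono [of "cmod (e x)" 1 "cmod (v x)"] elim by (simp add: norm_mult [symmetric])
            then show ?thesis using True by (simp add: power_mono)
          qed simp
        qed
      qed
      finally show ?thesis .
    qed
    moreover obtain n :: nat where "Q / (cmod k)\<^sup>2 < real n" using reals_Archimedean2 by blast
    then have "Q < (cmod k)\<^sup>2 * real n" using \<open>k \<noteq> 0\<close> by (simp add: divide_less_eq mult.commute)
    ultimately show False by (meson not_le)
  qed
  with k show ?thesis unfolding ae_eq_def by (auto elim!: eventually_mono simp: e_def)
qed

section \<open>Invariance of norms and domain under change of representative\<close>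

lemma sobolev_norm_cong:
  assumes "ae_eq u v" "u \<in> L2" "v \<in> L2" shows "sobolev_norm k u = sobolev_norm k v"
proof -
  have "has_weak_deriv j u = has_weak_deriv j v" for j by (rule has_weak_deriv_cong [OF assms])
  then show ?thesis by (simp add: sobolev_norm_def sobolev_def weak_deriv_def)
qed

lemma schrodinger_dist_cong:
  assumes "ae_eq u v" "u \<in> L2" "v \<in> L2" "test_function \<phi>"
  shows "schrodinger_dist V u \<phi> = schrodinger_dist V v \<phi>"
proof -
  have "(\<integral>x. u x * nderiv 2 \<phi> x \<partial>lborel) = (\<integral>x. v x * nderiv 2 \<phi> x \<partial>lborel)"
    using assms by (intro ae_eq_integral_mult) (auto intro!: L2_borel test_function_borel test_function_vderiv)
  then show ?thesis using cont_rep_cong [OF assms(1)] by (simp add: schrodinger_dist_def)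
qed

lemma has_schrodinger_cong:
  assumes "ae_eq u v" "u \<in> L2" "v \<in> L2"
  shows "has_schrodinger V u = has_schrodinger V v"
  using schrodinger_dist_cong [OF assms] by (auto simp: has_schrodinger_def fun_eq_iff)

lemma op_domain_cong:
  assumes "ae_eq u v" "u \<in> L2" "v \<in> L2"
  shows "u \<in> op_domain V \<longleftrightarrow> v \<in> op_domain V"
proof -
  have "has_weak_deriv j u = has_weak_deriv j v" for j by (rule has_weak_deriv_cong [OF assms])
  then show ?thesis using has_schrodinger_cong [OF assms]
    by (simp add: op_domain_def sobolev_def weak_deriv_def)
qed

lemma graph_norm_cong:
  assumes "ae_eq u v" "u \<in> L2" "v \<in> L2"
  shows "graph_norm V u = graph_norm V v"
  using op_domain_cong [OF assms] has_schrodinger_cong [OF assms] L2_norm_cong [OF assms(1)] assms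
  by (simp add: graph_norm_def schrodinger_def L2_borel)

lemma op_domain_L2: "u \<in> op_domain V \<Longrightarrow> u \<in> L2"
  unfolding op_domain_def sobolev_def has_weak_deriv_def by blast

context bump
begin

lemma has_schrodinger_unique: "has_schrodinger V u g \<Longrightarrow> has_schrodinger V u g' \<Longrightarrow> ae_eq g g'"
  by (intro variations_eq L2_loc_integrable) (auto simp: has_schrodinger_def)

lemma schrodinger_ae:
  assumes "has_schrodinger V u g"
  shows "has_schrodinger V u (schrodinger V u)" "ae_eq (schrodinger V u) g"
proof -
  show "has_schrodinger V u (schrodinger V u)"
    unfolding schrodinger_def using assms by (rule someI [where P = "has_schrodinger V u"])
  then show "ae_eq (schrodinger V u) g" using assms by (rule has_schrodinger_unique)
qed

end

lemma continuous_source_convolution: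
  assumes f: "source L f" and k: "continuous_on UNIV k"
  shows "continuous_on UNIV (\<lambda>x. \<integral>y. k (x - y) * f y \<partial>lborel)"
proof -
  have "isCont (\<lambda>x. \<integral>y. k (x - y) * f y \<partial>lborel) x" for x
    unfolding continuous_at_sequentially comp_def
  proof (intro allI impI)
    fix X assume X: "X \<longlonglongrightarrow> x"
    obtain N where N: "\<And>n. \<bar>X n\<bar> \<le> N"
      using convergent_imp_Bseq [OF convergentI [OF X]] by (auto simp: Bseq_def)
    obtain A where A: "\<And>t. \<bar>t\<bar> \<le> N + \<bar>L\<bar> \<Longrightarrow> cmod (k t) \<le> A"
    proof -
      have "bounded (k ` {-(N + \<bar>L\<bar>)..N + \<bar>L\<bar>})"
        by (intro compact_imp_bounded compact_continuous_image continuous_on_subset [OF k]) auto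
      then obtain A where "\<And>t. t \<in> {-(N + \<bar>L\<bar>)..N + \<bar>L\<bar>} \<Longrightarrow> cmod (k t) \<le> A" unfolding bounded_iff by blast
      then show ?thesis by (intro that [of A]) (auto simp: abs_le_iff)
    qed
    have [measurable]: "k \<in> borel_measurable borel" by (rule continuous_UNIV_borel [OF k])
    have [measurable]: "f \<in> borel_measurable borel" by (rule source_borel [OF f])
    show "(\<lambda>n. \<integral>y. k (X n - y) * f y \<partial>lborel) \<longlonglongrightarrow> (\<integral>y. k (x - y) * f y \<partial>lborel)"
    proof (rule integral_dominated_convergence)
      show "integrable lborel (\<lambda>y. A * cmod (f y))"
        using f by (intro integrable_mult_right integrable_norm) (simp add: source_def)
      show "AE y in lborel. norm (k (X n - y) * f y) \<le> A * cmod (f y)" for n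
      proof (intro AE_I2)
        fix y show "norm (k (X n - y) * f y) \<le> A * cmod (f y)"
        proof (cases "\<bar>y\<bar> \<le> L")
          case True
          then have "\<bar>X n - y\<bar> \<le> N + \<bar>L\<bar>" using N [of n] by linarith
          from A [OF this] show ?thesis by (simp add: norm_mult mult_right_mono)
        qed (use f in \<open>simp add: source_def\<close>)
      qed
      show "AE y in lborel. (\<lambda>n. k (X n - y) * f y) \<longlonglongrightarrow> k (x - y) * f y"
      proof (intro AE_I2)
        fix y
        have "isCont k (x - y)" using k by (simp add: continuous_on_eq_continuous_at)
        then have "(\<lambda>n. k (X n - y)) \<longlonglongrightarrow> k (x - y)"
          by (rule isCont_tendsto_compose) (intro tendsto_intros X)
        then show "(\<lambda>n. k (X n - y) * f y) \<longlonglongrightarrow> k (x - y) * f y" by (intro tendsto_intros)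
      qed
    qed measurable
  qed
  then show ?thesis by (simp add: continuous_on_eq_continuous_at)
qed

lemma source_0: "source L (\<lambda>_. 0)" by (simp add: source_def)

section \<open>The operator domain through explicit witnesses\<close>

locale schrodinger_op = signed_pair m1 m2 R + bump \<psi>
  for m1 m2 :: "real measure" and R :: real and \<psi> :: "real \<Rightarrow> real" +
  fixes V :: "real set \<Rightarrow> real"
  assumes V_eq: "signed_integral V f = I f"
begin

text \<open>A continuous representative \<open>u\<close> together with its weak derivative
  \<open>u1\<close> and the image \<open>u2\<close> under the operator. It fixes by name what the
  definitions of the domain and its norms obtain by choice.\<close>

definition Hdata :: "(real \<Rightarrow> complex) \<Rightarrow> (real \<Rightarrow> complex) \<Rightarrow> (real \<Rightarrow> complex) \<Rightarrow> bool" where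
  "Hdata u u1 u2 \<longleftrightarrow> continuous_on UNIV u \<and> bounded (range u) \<and> u \<in> L2 \<and> u1 \<in> L2 \<and> ess_bounded u1 \<and> u2 \<in> L2 \<and>
     (\<forall>\<phi>. test_function \<phi> \<longrightarrow> (\<integral>x. u x * vderiv \<phi> x \<partial>lborel) = - (\<integral>x. u1 x * \<phi> x \<partial>lborel)) \<and>
     (\<forall>\<phi>. test_function \<phi> \<longrightarrow>
        - (\<integral>x. u x * vderiv (vderiv \<phi>) x \<partial>lborel) + I (\<lambda>x. u x * \<phi> x) = (\<integral>x. u2 x * \<phi> x \<partial>lborel))"

lemma Hdata_has_weak_deriv: "Hdata u u1 u2 \<Longrightarrow> has_weak_deriv 1 u u1"
  by (auto simp: Hdata_def has_weak_deriv_def)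

lemma Hdata_cont_rep: "Hdata u u1 u2 \<Longrightarrow> cont_rep u = u"
  by (intro cont_rep_eq) (auto simp: Hdata_def)

lemma Hdata_has_schrodinger: "Hdata u u1 u2 \<Longrightarrow> has_schrodinger V u u2"
  using Hdata_cont_rep [of u u1 u2] by (auto simp: Hdata_def has_schrodinger_def schrodinger_dist_def V_eq)

lemma ess_bounded_cong:
  "ess_bounded f \<Longrightarrow> ae_eq g f \<Longrightarrow> g \<in> borel_measurable borel \<Longrightarrow> ess_bounded g"
proof -
  assume f: "ess_bounded f" "ae_eq g f" and g: "g \<in> borel_measurable borel"
  then obtain B where "AE x in lborel. cmod (f x) \<le> B" by (auto simp: ess_bounded_def)
  then have "AE x in lborel. cmod (g x) \<le> B"
    using f(2) unfolding ae_eq_def by eventually_elim simp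
  with g show ?thesis by (auto simp: ess_bounded_def)
qed

lemma Hdata_op_domain:
  assumes "Hdata u u1 u2" shows "u \<in> op_domain V"
proof -
  note w = Hdata_has_weak_deriv [OF assms]
  have "ess_bounded (weak_deriv 1 u)"
  proof (rule ess_bounded_cong)
    show "ess_bounded u1" using assms by (simp add: Hdata_def)
    show "ae_eq (weak_deriv 1 u) u1" by (rule weak_deriv_ae [OF w])
    show "weak_deriv 1 u \<in> borel_measurable borel"
      by (rule L2_borel) (use weak_deriv_ae(1) [OF w] in \<open>simp only: has_weak_deriv_def\<close>)
  qed
  moreover have "u \<in> sobolev 1"
    using w has_weak_deriv_0 [of u] assms unfolding sobolev_def Hdata_def by (auto simp: le_Suc_eq)
  ultimately show ?thesis using Hdata_has_schrodinger [OF assms] by (auto simp: op_domain_def)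
qed

lemma L2_norm_schrodinger:
  assumes "Hdata u u1 u2" shows "L2_norm (schrodinger V u) = L2_norm u2"
  using schrodinger_ae [OF Hdata_has_schrodinger [OF assms]] assms
  by (intro L2_norm_cong) (auto simp: Hdata_def has_schrodinger_def intro: L2_borel)

lemma graph_norm_Hdata:
  assumes "Hdata u u1 u2" shows "graph_norm V u = ennreal (sqrt ((L2_norm u2)\<^sup>2 + (L2_norm u)\<^sup>2))"
  using Hdata_op_domain [OF assms] by (simp add: graph_norm_def L2_norm_schrodinger [OF assms])

lemma sobolev_norm_Hdata:
  assumes "Hdata u u1 u2"
  shows "sobolev_norm 0 u = ennreal (L2_norm u)"
    "sobolev_norm 1 u = ennreal (sqrt ((L2_norm u)\<^sup>2 + (L2_norm u1)\<^sup>2))"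
proof -
  have u: "u \<in> L2" using assms by (simp add: Hdata_def)
  have 0: "L2_norm (weak_deriv 0 u) = L2_norm u" by (rule L2_norm_weak_deriv [OF has_weak_deriv_0 [OF u]])
  have 1: "L2_norm (weak_deriv 1 u) = L2_norm u1" by (rule L2_norm_weak_deriv [OF Hdata_has_weak_deriv [OF assms]])
  have "u \<in> sobolev 1" "u \<in> sobolev 0"
    using Hdata_op_domain [OF assms] has_weak_deriv_0 [OF u] by (auto simp: op_domain_def sobolev_def)
  moreover have "L2_norm u \<ge> 0" by (simp add: L2_norm_def)
  ultimately show "sobolev_norm 0 u = ennreal (L2_norm u)"
    "sobolev_norm 1 u = ennreal (sqrt ((L2_norm u)\<^sup>2 + (L2_norm u1)\<^sup>2))"
    using 0 1 by (auto simp: sobolev_norm_def)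
qed

lemma Hdata_linear:
  assumes "Hdata u u1 u2" "Hdata v v1 v2"
  shows "Hdata (\<lambda>x. c * u x + v x) (\<lambda>x. c * u1 x + v1 x) (\<lambda>x. c * u2 x + v2 x)"
  unfolding Hdata_def
proof (intro conjI allI impI)
  note A = assms [unfolded Hdata_def]
  have L: "u \<in> L2" "u1 \<in> L2" "u2 \<in> L2" "v \<in> L2" "v1 \<in> L2" "v2 \<in> L2" using A by auto
  have [simp]: "integrable lborel (\<lambda>x. h x * \<phi> x)" if "test_function \<phi>" "h \<in> L2" for h \<phi> :: "real \<Rightarrow> complex"
    by (rule L2_integrable_mult [OF that(2) L2_test_function [OF that(1)]])
  have lin: "(\<integral>x. (c * h x + k x) * \<phi> x \<partial>lborel) = c * (\<integral>x. h x * \<phi> x \<partial>lborel) + (\<integral>x. k x * \<phi> x \<partial>lborel)"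
    if "test_function \<phi>" "h \<in> L2" "k \<in> L2" for h k \<phi> :: "real \<Rightarrow> complex"
    using that by (simp add: distrib_right mult.assoc)
  show "continuous_on UNIV (\<lambda>x. c * u x + v x)" using A by (intro continuous_intros) auto
  show "bounded (range (\<lambda>x. c * u x + v x))"
  proof -
    obtain B where B: "\<And>x. cmod (u x) \<le> B" using A by (auto simp: bounded_iff)
    obtain D where D: "\<And>x. cmod (v x) \<le> D" using A by (auto simp: bounded_iff)
    have "cmod (c * u x + v x) \<le> cmod c * B + D" for x
      by (intro norm_triangle_mono) (auto simp: norm_mult B D mult_left_mono)
    then show ?thesis by (auto simp: bounded_iff)
  qed
  show "(\<lambda>x. c * u x + v x) \<in> L2" "(\<lambda>x. c * u1 x + v1 x) \<in> L2" "(\<lambda>x. c * u2 x + v2 x) \<in> L2"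
    by (intro L2_add L2_cmult L)+
  show "ess_bounded (\<lambda>x. c * u1 x + v1 x)"
  proof -
    obtain B where B: "AE x in lborel. cmod (u1 x) \<le> B" using A by (auto simp: ess_bounded_def)
    obtain D where D: "AE x in lborel. cmod (v1 x) \<le> D" using A by (auto simp: ess_bounded_def)
    have "AE x in lborel. cmod (c * u1 x + v1 x) \<le> cmod c * B + D"
      using B D by eventually_elim (intro norm_triangle_mono, auto simp: norm_mult mult_left_mono)
    moreover have "(\<lambda>x. c * u1 x + v1 x) \<in> borel_measurable borel"
      by (intro L2_borel L2_add L2_cmult L)
    ultimately show ?thesis by (auto simp: ess_bounded_def)
  qed
  fix \<phi> :: "real \<Rightarrow> complex" assume t: "test_function \<phi>"
  note t' = test_function_vderiv [OF t] note t'' = test_function_vderiv [OF t']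
  show "(\<integral>x. (c * u x + v x) * vderiv \<phi> x \<partial>lborel) = - (\<integral>x. (c * u1 x + v1 x) * \<phi> x \<partial>lborel)"
  proof -
    have a: "(\<integral>x. u x * vderiv \<phi> x \<partial>lborel) = - (\<integral>x. u1 x * \<phi> x \<partial>lborel)"
      "(\<integral>x. v x * vderiv \<phi> x \<partial>lborel) = - (\<integral>x. v1 x * \<phi> x \<partial>lborel)" using A t by blast+
    show ?thesis unfolding lin [OF t' L(1,4)] lin [OF t L(2,5)] a by simp
  qed
  have bm: "bmeas (\<lambda>x. u x * \<phi> x)" "bmeas (\<lambda>x. v x * \<phi> x)"
    using A by (auto intro!: bmeas_continuous continuous_on_mult [OF _ test_function_continuous [OF t]])
  have "I (\<lambda>x. (c * u x + v x) * \<phi> x) = c * I (\<lambda>x. u x * \<phi> x) + I (\<lambda>x. v x * \<phi> x)"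
    using I_add [OF bmeas_cmult [OF bm(1), of c] bm(2)] I_cmult [of c "\<lambda>x. u x * \<phi> x"]
    by (simp add: distrib_right mult.assoc)
  then show "- (\<integral>x. (c * u x + v x) * vderiv (vderiv \<phi>) x \<partial>lborel) + I (\<lambda>x. (c * u x + v x) * \<phi> x) =
      (\<integral>x. (c * u2 x + v2 x) * \<phi> x \<partial>lborel)"
  proof -
    have a: "(\<integral>x. u2 x * \<phi> x \<partial>lborel) = - (\<integral>x. u x * vderiv (vderiv \<phi>) x \<partial>lborel) + I (\<lambda>x. u x * \<phi> x)"
      "(\<integral>x. v2 x * \<phi> x \<partial>lborel) = - (\<integral>x. v x * vderiv (vderiv \<phi>) x \<partial>lborel) + I (\<lambda>x. v x * \<phi> x)"
      using A t by metis+
    assume I: "I (\<lambda>x. (c * u x + v x) * \<phi> x) = c * I (\<lambda>x. u x * \<phi> x) + I (\<lambda>x. v x * \<phi> x)"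
    show ?thesis unfolding lin [OF t'' L(1,4)] lin [OF t L(3,6)] a I by (simp add: algebra_simps)
  qed
qed

lemma Hdata_cong2:
  assumes "Hdata u u1 u2" "ae_eq u2 g" "g \<in> L2" shows "Hdata u u1 g"
proof -
  have "(\<integral>x. u2 x * \<phi> x \<partial>lborel) = (\<integral>x. g x * \<phi> x \<partial>lborel)" if "test_function \<phi>" for \<phi>
    using assms that by (intro ae_eq_integral_mult) (auto simp: Hdata_def intro: L2_borel test_function_borel)
  then show ?thesis using assms by (auto simp: Hdata_def)
qed

text \<open>Converse to \<open>Hdata_op_domain\<close> after passing to the continuous
  representative, which exists by the Sobolev embedding.\<close>

lemma op_domain_Hdata:
  assumes u: "u \<in> op_domain V"
  obtains w where "ae_eq w u" "Hdata w (weak_deriv 1 u) (schrodinger V u)"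
proof -
  obtain v g where v: "has_weak_deriv 1 u v" and g: "has_schrodinger V u g" and eb: "ess_bounded (weak_deriv 1 u)"
    using u by (auto simp: op_domain_def sobolev_def)
  note v' = weak_deriv_ae(1) [OF v] note g' = schrodinger_ae(1) [OF g]
  obtain w where w: "continuous_on UNIV w" "bounded (range w)" "ae_eq w u" by (rule sobolev_embedding [OF v])
  have uL: "u \<in> L2" by (rule op_domain_L2 [OF u])
  have wb: "w \<in> borel_measurable borel" by (rule continuous_UNIV_borel [OF w(1)])
  have wL: "w \<in> L2"
  proof -
    have "integrable lborel (\<lambda>x. (cmod (w x))\<^sup>2)"
      by (rule integrable_cong_AE_imp [OF L2_integrable [OF uL]])
        (use w(3) wb in \<open>auto simp: ae_eq_def elim!: eventually_mono\<close>)
    then show ?thesis using wb by (simp add: L2_def)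
  qed
  have cr: "cont_rep u = w" by (rule cont_rep_eq [OF w])
  have int: "(\<integral>x. w x * \<phi> x \<partial>lborel) = (\<integral>x. u x * \<phi> x \<partial>lborel)" if "test_function \<phi>" for \<phi>
    using that uL wb by (intro ae_eq_integral_mult w) (auto intro: L2_borel test_function_borel)
  have "Hdata w (weak_deriv 1 u) (schrodinger V u)"
    using w v' g' eb wL int unfolding Hdata_def has_weak_deriv_def has_schrodinger_def schrodinger_dist_def
    by (simp add: V_eq cr test_function_vderiv)
  with w(3) show ?thesis by (rule that)
qed

lemma op_eigenvalue_Hdata:
  "op_eigenvalue V z \<longleftrightarrow> (\<exists>w w1. Hdata w w1 (\<lambda>x. z * w x) \<and> \<not> ae_eq w (\<lambda>_. 0))"
proof
  assume "op_eigenvalue V z"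
  then obtain u where u: "u \<in> op_domain V" "\<not> ae_eq u (\<lambda>x. 0)" "ae_eq (schrodinger V u) (\<lambda>x. z * u x)"
    by (auto simp: op_eigenvalue_def)
  obtain w where w: "ae_eq w u" "Hdata w (weak_deriv 1 u) (schrodinger V u)" by (rule op_domain_Hdata [OF u(1)])
  have "ae_eq (schrodinger V u) (\<lambda>x. z * w x)"
    using u(3) w(1) unfolding ae_eq_def by eventually_elim auto
  then have "Hdata w (weak_deriv 1 u) (\<lambda>x. z * w x)"
    using w(2) by (intro Hdata_cong2 [OF w(2)] L2_cmult) (auto simp: Hdata_def)
  then show "\<exists>w w1. Hdata w w1 (\<lambda>x. z * w x) \<and> \<not> ae_eq w (\<lambda>_. 0)"
    using u(2) w(1) ae_eq_sym ae_eq_trans by blast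
next
  assume "\<exists>w w1. Hdata w w1 (\<lambda>x. z * w x) \<and> \<not> ae_eq w (\<lambda>_. 0)"
  then obtain w w1 where w: "Hdata w w1 (\<lambda>x. z * w x)" "\<not> ae_eq w (\<lambda>_. 0)" by blast
  then show "op_eigenvalue V z"
    unfolding op_eigenvalue_def using Hdata_op_domain [OF w(1)] schrodinger_ae(2) [OF Hdata_has_schrodinger [OF w(1)]] by blast
qed

text \<open>Two solutions of the resolvent equation differ by an element of the kernel of H - z,
  which is trivial since z is not an eigenvalue. So the \<open>SOME\<close> in
  \<open>resolvent\<close> agrees almost everywhere with any solution at hand.\<close>

lemma resolvent_eq:
  assumes ne: "\<not> op_eigenvalue V z" and w: "Hdata w w1 (\<lambda>x. z * w x + f x)"
  shows "ae_eq (resolvent V z f) w" "resolvent V z f \<in> op_domain V"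
proof -
  define u where "u = resolvent V z f"
  have "w \<in> op_domain V \<and> ae_eq (\<lambda>x. schrodinger V w x - z * w x) f"
    using Hdata_op_domain [OF w] schrodinger_ae(2) [OF Hdata_has_schrodinger [OF w]]
    by (auto simp: ae_eq_def elim!: eventually_mono)
  then have u: "u \<in> op_domain V \<and> ae_eq (\<lambda>x. schrodinger V u x - z * u x) f"
    unfolding u_def resolvent_def
    by (rule someI [where P = "\<lambda>u. u \<in> op_domain V \<and> ae_eq (\<lambda>x. schrodinger V u x - z * u x) f"])
  then show "resolvent V z f \<in> op_domain V" by (simp add: u_def)
  obtain v where v: "ae_eq v u" "Hdata v (weak_deriv 1 u) (schrodinger V u)" using u op_domain_Hdata by blast
  define d where "d x = - 1 * w x + v x" for x
  have d: "Hdata d (\<lambda>x. - 1 * w1 x + weak_deriv 1 u x) (\<lambda>x. - 1 * (z * w x + f x) + schrodinger V u x)"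
    unfolding d_def by (rule Hdata_linear [OF w v(2)])
  moreover have "ae_eq (\<lambda>x. - 1 * (z * w x + f x) + schrodinger V u x) (\<lambda>x. z * d x)"
    using u v(1) unfolding ae_eq_def d_def by (auto elim!: eventually_elim2 simp: algebra_simps)
  ultimately have "Hdata d (\<lambda>x. - 1 * w1 x + weak_deriv 1 u x) (\<lambda>x. z * d x)"
    by (intro Hdata_cong2 [OF d] L2_cmult) (auto simp: Hdata_def)
  then have "ae_eq d (\<lambda>_. 0)" using ne op_eigenvalue_Hdata by blast
  then show "ae_eq (resolvent V z f) w"
    using v(1) unfolding u_def [symmetric] ae_eq_def d_def by eventually_elim auto
qed

section \<open>Outgoing solutions in the upper half-plane and absence of distant eigenvalues\<close>

lemma continuous_sol:
  assumes "continuous_on UNIV u" "source L f" shows "continuous_on UNIV (sol l c u f)"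
  unfolding sol_def
  by (intro continuous_intros continuous_I_convolution continuous_source_convolution [OF assms(2)]
      continuous_Sp bmeas_continuous assms)

lemma outgoing_L2:
  assumes u: "continuous_on UNIV u" and f: "source L f" and out: "outgoing l c u f" and l: "Im l > 0" and "L \<ge> R"
  shows "bounded (range (sol l c u f))" "sol l c u f \<in> L2" "sol1 l c u f \<in> L2" "ess_bounded (sol1 l c u f)"
proof -
  have l0: "l \<noteq> 0" using l by auto
  have b: "sol l c u f \<in> borel_measurable borel" "sol1 l c u f \<in> borel_measurable borel"
    using sol_loc_integrable [OF u f] by (auto intro: loc_integrable_borel)
  obtain C where C: "C \<ge> 0" "\<And>x. cmod (sol l c u f x) \<le> C * exp (- Im l * \<bar>x\<bar>)"
    using conv_decay [OF u f ent_borel [OF ent_G(1)] eq_refl [OF norm_G [OF l0]] l \<open>L \<ge> R\<close>]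
    unfolding outgoing_sol(1) [OF u f out l0] by blast
  obtain D where D: "D \<ge> 0" "\<And>x. cmod (sol1 l c u f x) \<le> D * exp (- Im l * \<bar>x\<bar>)"
    using conv_decay [OF u f ent_borel [OF ent_G(2)] norm_G1 l \<open>L \<ge> R\<close>]
    unfolding outgoing_sol(2) [OF u f out l0] by blast
  have le: "exp (- Im l * \<bar>x\<bar>) \<le> 1" for x using l by simp
  show "sol l c u f \<in> L2" by (rule L2_exp_decay [OF b(1) l C(2)])
  show "sol1 l c u f \<in> L2" by (rule L2_exp_decay [OF b(2) l D(2)])
  have "cmod (sol l c u f x) \<le> C" for x
    using C(2) [of x] mult_left_mono [OF le C(1), of x] by linarith
  then show "bounded (range (sol l c u f))" by (auto simp: bounded_iff)
  have "cmod (sol1 l c u f x) \<le> D" for x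
    using D(2) [of x] mult_left_mono [OF le D(1), of x] by linarith
  then show "ess_bounded (sol1 l c u f)" using b by (auto simp: ess_bounded_def)
qed

text \<open>In the upper half-plane the outgoing kernel decays exponentially, which puts an outgoing
  fixed point and its derivative into L2.\<close>

lemma outgoing_Hdata:
  assumes u: "continuous_on UNIV u" and f: "source L f" "f \<in> L2" and out: "outgoing l c u f" and l: "Im l > 0" and "L \<ge> R"
    and eqn: "\<And>x. sol l c u f x = u x"
  shows "Hdata u (sol1 l c u f) (\<lambda>x. l\<^sup>2 * u x + f x)"
proof -
  have eq: "sol l c u f = u" using eqn by blast
  note o = outgoing_L2 [OF u f(1) out l \<open>L \<ge> R\<close>, unfolded eq]
  have li: "integrable lborel (\<lambda>x. u x * \<phi> x)" "integrable lborel (\<lambda>x. f x * \<phi> x)" if "test_function \<phi>" for \<phi>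
    using that o f by (auto intro!: L2_integrable_mult L2_test_function)
  show ?thesis
    unfolding Hdata_def
    using u o sol_weak_deriv [OF u f(1), of _ l c, unfolded eq] sol_equation [OF u f(1), of _ l c, unfolded eq]
    by (auto intro!: L2_add L2_cmult f simp: distrib_right mult.assoc li)
qed

text \<open>An eigenfunction satisfies the Lippmann-Schwinger equation, whose kernel is at most
  1/(2|l|) in modulus; for |l| > mass this is a contraction, so the eigenfunction is zero. The lemma
  supplies a nonempty open set on which the continuation is tied to the true resolvent.\<close>

lemma not_op_eigenvalue:
  assumes l: "Im l > 0" "cmod l > mass" shows "\<not> op_eigenvalue V (l\<^sup>2)"
proof
  assume "op_eigenvalue V (l\<^sup>2)"
  then obtain w w1 where w: "Hdata w w1 (\<lambda>x. l\<^sup>2 * w x)" and nz: "\<not> ae_eq w (\<lambda>_. 0)"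
    using op_eigenvalue_Hdata by blast
  note W = w [unfolded Hdata_def]
  have wc: "continuous_on UNIV w" using W by auto
  have l0: "l \<noteq> 0" using l by auto
  \<comment> \<open>This amplitude makes \<open>sol l c w\<close> outgoing. It remains to show that
    the function \<open>q\<close> so generated is the eigenfunction \<open>w\<close> itself.\<close>
  define c where "c = I (\<lambda>y. exp (\<i> * l * of_real y) * w y) / (2 * \<i> * l)"
  have out: "outgoing l c w (\<lambda>_. 0)" using l0 by (simp add: outgoing_def c_def)
  define q where "q = sol l c w (\<lambda>_. 0)"
  define q1 where "q1 = sol1 l c w (\<lambda>_. 0)"
  note o = outgoing_L2 [OF wc source_0 out l(1) order_refl, folded q_def q1_def]
  define d where "d x = w x - q x" for x
  define d1 where "d1 x = w1 x - q1 x" for x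
  have dL: "d \<in> L2" "d1 \<in> L2" unfolding d_def d1_def using W o by (auto intro: L2_diff)
  have int: "integrable lborel (\<lambda>x. h x * \<phi> x)" if "test_function \<phi>" "h \<in> L2" for h \<phi> :: "real \<Rightarrow> complex"
    by (rule L2_integrable_mult [OF that(2) L2_test_function [OF that(1)]])
  have weak: "(\<integral>x. d x * vderiv \<phi> x \<partial>lborel) = - (\<integral>x. d1 x * \<phi> x \<partial>lborel)" if t: "test_function \<phi>" for \<phi>
    using W o t sol_weak_deriv [OF wc source_0 t, of l c, folded q_def q1_def]
    by (simp add: d_def d1_def left_diff_distrib int test_function_vderiv)
  have eqn: "(\<integral>x. d1 x * vderiv \<phi> x \<partial>lborel) = l\<^sup>2 * (\<integral>x. d x * \<phi> x \<partial>lborel)" if t: "test_function \<phi>" for \<phi>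
  proof -
    note t' = test_function_vderiv [OF t] note t'' = test_function_vderiv [OF t']
    have 1: "- (\<integral>x. w x * vderiv (vderiv \<phi>) x \<partial>lborel) + I (\<lambda>x. w x * \<phi> x) = l\<^sup>2 * (\<integral>x. w x * \<phi> x \<partial>lborel)"
      using W t by (simp add: mult.assoc)
    have 2: "- (\<integral>x. q x * vderiv (vderiv \<phi>) x \<partial>lborel) + I (\<lambda>x. w x * \<phi> x) = l\<^sup>2 * (\<integral>x. q x * \<phi> x \<partial>lborel)"
      using sol_equation [OF wc source_0 t, of l c, folded q_def] by simp
    have "(\<integral>x. d1 x * vderiv \<phi> x \<partial>lborel) = - (\<integral>x. d x * vderiv (vderiv \<phi>) x \<partial>lborel)"
      using weak [OF t'] by simp
    also have "\<dots> = l\<^sup>2 * (\<integral>x. d x * \<phi> x \<partial>lborel)"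
    proof -
      have wq: "w \<in> L2" "q \<in> L2" using W o by auto
      have "(\<integral>x. d x * \<theta> x \<partial>lborel) = (\<integral>x. w x * \<theta> x \<partial>lborel) - (\<integral>x. q x * \<theta> x \<partial>lborel)"
        if "test_function \<theta>" for \<theta>
        unfolding d_def left_diff_distrib by (intro Bochner_Integration.integral_diff int that wq)
      note D = this
      show ?thesis unfolding D [OF t''] D [OF t] right_diff_distrib 1 [symmetric] 2 [symmetric] by simp
    qed
    finally show ?thesis .
  qed
  \<comment> \<open>The difference d = w - q is in L2 and solves -d'' = l^2 d weakly. For each root
    s of s^2 = -l^2 the combination d' + s d satisfies a first-order equation and vanishes;
    subtracting the two cases leaves 2 i l d = 0.\<close>
  have v0: "ae_eq (\<lambda>x. d1 x + s * d x) (\<lambda>_. 0)" if s: "s * s = - l\<^sup>2" for s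
  proof (rule weak_exp_zero [where a = s])
    show "(\<lambda>x. d1 x + s * d x) \<in> L2" by (intro L2_add L2_cmult dL)
    fix \<phi> :: "real \<Rightarrow> complex" assume t: "test_function \<phi>"
    note t' = test_function_vderiv [OF t]
    have lin: "(\<integral>x. (d1 x + s * d x) * \<phi> x \<partial>lborel) = (\<integral>x. d1 x * \<phi> x \<partial>lborel) + s * (\<integral>x. d x * \<phi> x \<partial>lborel)"
      if "test_function \<phi>" for \<phi>
      using that dL by (simp add: distrib_right mult.assoc int)
    have l2: "l\<^sup>2 = - (s * s)" using s by simp
    show "(\<integral>x. (d1 x + s * d x) * vderiv \<phi> x \<partial>lborel) = - s * (\<integral>x. (d1 x + s * d x) * \<phi> x \<partial>lborel)"
      unfolding lin [OF t] lin [OF t'] eqn [OF t] weak [OF t] l2 by (simp add: algebra_simps)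
  qed
  have sq: "\<i> * l * (\<i> * l) = - l\<^sup>2" "(- (\<i> * l)) * (- (\<i> * l)) = - l\<^sup>2"
  proof -
    have "\<i> * l * (\<i> * l) = (\<i> * \<i>) * (l * l)" by (simp only: mult_ac)
    then show "\<i> * l * (\<i> * l) = - l\<^sup>2" by (simp add: power2_eq_square)
    then show "(- (\<i> * l)) * (- (\<i> * l)) = - l\<^sup>2" by (simp only: minus_mult_minus)
  qed
  have "ae_eq w q"
    using v0 [OF sq(1)] v0 [OF sq(2)] unfolding ae_eq_def
  proof eventually_elim
    case (elim x)
    have "2 * (\<i> * l) * d x = (d1 x + \<i> * l * d x) - (d1 x + - (\<i> * l) * d x)" by (simp add: algebra_simps)
    also have "\<dots> = 0" unfolding elim by simp
    finally have "2 * (\<i> * l) * d x = 0" .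
    then show ?case using l0 by (simp add: d_def)
  qed
  then have wq: "w = q"
    by (intro ae_eq_continuous_imp_eq wc) (simp_all add: q_def continuous_sol [OF wc source_0])
  obtain B where B: "B \<ge> 0" "\<And>y. \<bar>y\<bar> \<le> R \<Longrightarrow> cmod (w y) \<le> B"
    using bmeas_obtain [OF bmeas_continuous [OF wc]] by blast
  \<comment> \<open>A bound on [-R, R] returns halved, and on the whole line, because mass/(2|l|) is
    at most 1/2. Iteration forces \<open>w\<close> to be 0.\<close>
  have half: "cmod (w x) \<le> B' / 2" if B': "\<And>y. \<bar>y\<bar> \<le> R \<Longrightarrow> cmod (w y) \<le> B'" for B' x
  proof -
    have "B' \<ge> 0" using order_trans [OF norm_ge_zero B' [of 0]] R_pos by simp
    have "cmod (w x) = cmod (I (\<lambda>y. G l (x - y) * w y))"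
    proof -
      have "w x = q x" by (rule fun_cong [OF wq])
      also have "\<dots> = I (\<lambda>y. G l (x - y) * w y)"
        unfolding q_def outgoing_sol(1) [OF wc source_0 out l0] by simp
      finally show ?thesis by (rule arg_cong)
    qed
    also have "\<dots> \<le> mass * (1 / (2 * cmod l) * B')"
    proof (rule norm_I_le)
      fix y :: real assume y: "\<bar>y\<bar> \<le> R"
      have "1 / (2 * cmod l) * exp (- Im l * \<bar>x - y\<bar>) \<le> 1 / (2 * cmod l) * 1"
        using l by (intro mult_left_mono) auto
      then show "cmod (G l (x - y) * w y) \<le> 1 / (2 * cmod l) * B'"
        unfolding norm_mult norm_G [OF l0] using B' [OF y] by (intro mult_mono) auto
    qed
    also have "\<dots> = (mass / cmod l) * B' / 2" by simp
    also have "\<dots> \<le> 1 * B' / 2"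
    proof -
      have "mass / cmod l \<le> 1" using l(2) mass_pos by (subst divide_le_eq_1_pos) linarith+
      then show ?thesis using \<open>B' \<ge> 0\<close> by (intro divide_right_mono mult_right_mono) auto
    qed
    finally show ?thesis by simp
  qed
  have "cmod (w x) \<le> B / 2 ^ Suc n" for n x
  proof (induction n arbitrary: x)
    case 0
    then show ?case using half [OF B(2)] by simp
  next
    case (Suc n)
    show ?case using half [of "B / 2 ^ Suc n" x] Suc by (simp add: mult.commute)
  qed
  moreover have "(\<lambda>n. B / 2 ^ Suc n) \<longlonglongrightarrow> 0" by real_asymp
  ultimately have "cmod (w x) \<le> 0" for x by (meson LIMSEQ_le_const)
  then have "w = (\<lambda>_. 0)" by auto
  with nz show False by simp
qed

end

section \<open>The Jost solution and the outgoing solution\<close>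

context signed_pair
begin

text \<open>
  \<open>em\<close> is the Jost solution equal to \<open>e\<^bsup>- i l x\<^esup>\<close> on the left of the support of the measure and
  \<open>pv\<close> the particular solution vanishing on the left; \<open>Wr\<close> is the Wronskian of the two Jost
  solutions, so that \<open>bu f l / Wr l = pv f l + (Nf f l / Wr l) em l\<close> is outgoing on both sides.
\<close>

definition em :: "complex \<Rightarrow> real \<Rightarrow> complex" where
  "em l = Vol l (\<lambda>x. exp (- \<i> * l * of_real x))"

definition pv :: "(real \<Rightarrow> complex) \<Rightarrow> complex \<Rightarrow> real \<Rightarrow> complex" where
  "pv f l = Vol l (\<lambda>x. - (\<integral>y. Sp l (x - y) * f y \<partial>lborel))"

definition Wr :: "complex \<Rightarrow> complex" where
  "Wr l = 2 * \<i> * l - I (\<lambda>y. exp (\<i> * l * of_real y) * em l y)"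

definition Nf :: "(real \<Rightarrow> complex) \<Rightarrow> complex \<Rightarrow> complex" where
  "Nf f l = I (\<lambda>y. exp (\<i> * l * of_real y) * pv f l y) - (\<integral>y. exp (\<i> * l * of_real y) * f y \<partial>lborel)"

definition bu :: "(real \<Rightarrow> complex) \<Rightarrow> complex \<Rightarrow> real \<Rightarrow> complex" where
  "bu f l x = Wr l * pv f l x + Nf f l * em l x"

text \<open>The derivative of \<open>bu\<close> through its integral representation. The source is
  multiplied by \<open>Wr l\<close> because \<open>bu\<close> is the outgoing solution with the
  denominator cleared, which keeps the family entire.\<close>

definition bu1 :: "(real \<Rightarrow> complex) \<Rightarrow> complex \<Rightarrow> real \<Rightarrow> complex" where
  "bu1 f l = sol1 l (Nf f l) (bu f l) (\<lambda>y. Wr l * f y)"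

lemma continuous_e: "continuous_on UNIV (\<lambda>x. exp (c * l * complex_of_real x))"
  by (intro continuous_intros)

lemma continuous_hf: "source L f \<Longrightarrow> continuous_on UNIV (\<lambda>x. - (\<integral>y. Sp l (x - y) * f y \<partial>lborel))"
  by (intro continuous_intros continuous_source_convolution continuous_Sp)

lemma continuous_em: "continuous_on UNIV (em l)"
  unfolding em_def by (intro continuous_Vol continuous_e)

lemma continuous_pv: "source L f \<Longrightarrow> continuous_on UNIV (pv f l)"
  unfolding pv_def by (intro continuous_Vol continuous_hf)

lemma continuous_bu: "source L f \<Longrightarrow> continuous_on UNIV (bu f l)"
  unfolding bu_def by (intro continuous_intros continuous_em continuous_pv)

lemma ent_cmult_scalar: "ent h \<Longrightarrow> ent (\<lambda>l x. c * h l x)"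
  by (intro ent_mult ent_continuous continuous_intros)

lemma ent_em: "ent em"
  unfolding em_def by (intro ent_Vol ent_exp continuous_e)

lemma ent_pv: "source L f \<Longrightarrow> ent (pv f)"
  unfolding pv_def
  using ent_Vol [OF ent_cmult_scalar [OF ent_source_convolution [OF _ ent_Sp], of L f "-1"]] continuous_hf [of L f]
  by simp

lemma Wr_holomorphic: "Wr holomorphic_on A"
proof -
  have "Wr holomorphic_on UNIV"
    unfolding Wr_def [abs_def]
    by (intro holomorphic_intros ent_I_holomorphic ent_mult ent_exp ent_em)
  then show ?thesis by (rule holomorphic_on_subset) simp
qed

lemma Nf_holomorphic: "source L f \<Longrightarrow> Nf f holomorphic_on UNIV"
  unfolding Nf_def [abs_def]
  by (intro holomorphic_intros ent_I_holomorphic ent_mult ent_exp ent_pv ent_source_holomorphic)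

lemma ent_bu: "source L f \<Longrightarrow> ent (bu f)"
  unfolding bu_def [abs_def]
  by (intro ent_add ent_mult ent_scalar [OF Wr_holomorphic] ent_scalar [OF Nf_holomorphic] ent_em ent_pv)

lemma ent_bu1:
  assumes f: "source L f" shows "ent (bu1 f)"
proof -
  have "bu1 f = (\<lambda>l x. (- \<i> * l * Nf f l) * exp (- \<i> * l * of_real x) + I (\<lambda>y. Cp l (x - y) * bu f l y)
      + (- Wr l) * (\<integral>y. Cp l (x - y) * f y \<partial>lborel))"
    unfolding bu1_def [abs_def] sol1_def by (simp add: mult.left_commute [of _ "Wr _"])
  moreover have "ent (\<lambda>l x. (- \<i> * l * Nf f l) * exp (- \<i> * l * of_real x) + I (\<lambda>y. Cp l (x - y) * bu f l y)
      + (- Wr l) * (\<integral>y. Cp l (x - y) * f y \<partial>lborel))"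
    by (intro ent_add ent_mult [OF ent_scalar] holomorphic_intros Nf_holomorphic [OF f] Wr_holomorphic ent_exp
        ent_I_convolution ent_Cp ent_bu [OF f] ent_source_convolution [OF f])
  ultimately show ?thesis by simp
qed

lemma em_eq: "em l x = exp (- \<i> * l * of_real x) + I (\<lambda>y. Sp l (x - y) * em l y)"
  using Vol_eq [OF continuous_e [of "- \<i>" l], of l x] by (simp add: em_def Kop_def)

lemma pv_eq:
  "source L f \<Longrightarrow> pv f l x = - (\<integral>y. Sp l (x - y) * f y \<partial>lborel) + I (\<lambda>y. Sp l (x - y) * pv f l y)"
  using Vol_eq [OF continuous_hf [of L f l], of l x] by (simp add: pv_def Kop_def)

lemma I_bu:
  assumes f: "source L f" and k: "bmeas k"
  shows "I (\<lambda>y. k y * bu f l y) = Wr l * I (\<lambda>y. k y * pv f l y) + Nf f l * I (\<lambda>y. k y * em l y)"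
proof -
  have "I (\<lambda>y. k y * bu f l y) = I (\<lambda>y. Wr l * (k y * pv f l y) + Nf f l * (k y * em l y))"
    by (simp add: bu_def algebra_simps)
  also have "\<dots> = I (\<lambda>y. Wr l * (k y * pv f l y)) + I (\<lambda>y. Nf f l * (k y * em l y))"
    by (intro I_add bmeas_cmult bmeas_mult k bmeas_continuous continuous_em continuous_pv [OF f])
  finally show ?thesis by (simp only: I_cmult)
qed

lemma em_sol: "sol l 1 (em l) (\<lambda>_. 0) x = em l x"
  using em_eq [of l x] by (simp add: sol_def)

lemma bu_sol:
  assumes f: "source L f" shows "sol l (Nf f l) (bu f l) (\<lambda>y. Wr l * f y) x = bu f l x"
proof -
  have "(\<integral>y. Sp l (x - y) * (Wr l * f y) \<partial>lborel) = Wr l * (\<integral>y. Sp l (x - y) * f y \<partial>lborel)"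
    by (subst integral_mult_right_zero [symmetric]) (simp add: mult_ac)
  note m = this
  have Ip: "I (\<lambda>y. Sp l (x - y) * pv f l y) = pv f l x + (\<integral>y. Sp l (x - y) * f y \<partial>lborel)"
    using pv_eq [OF f, of l x] by simp
  have Ie: "I (\<lambda>y. Sp l (x - y) * em l y) = em l x - exp (- \<i> * l * of_real x)"
    using em_eq [of l x] by simp
  show ?thesis
    unfolding sol_def I_bu [OF f bmeas_Sp] m Ip Ie
    by (simp add: bu_def algebra_simps)
qed

text \<open>The defect in the outgoing condition is \<open>Wr l\<close> for the Jost solution and
  \<open>- Nf f l\<close> for the particular solution, so the coefficients in \<open>bu\<close> make
  the two defects cancel.\<close>

lemma bu_outgoing:
  assumes f: "source L f" shows "outgoing l (Nf f l) (bu f l) (\<lambda>y. Wr l * f y)"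
proof -
  have "(\<integral>y. exp (\<i> * l * of_real y) * (Wr l * f y) \<partial>lborel) = Wr l * (\<integral>y. exp (\<i> * l * of_real y) * f y \<partial>lborel)"
    by (subst integral_mult_right_zero [symmetric]) (simp add: mult_ac)
  note m = this
  have Ie: "I (\<lambda>y. exp (\<i> * l * of_real y) * em l y) = 2 * \<i> * l - Wr l" by (simp add: Wr_def)
  have Ip: "I (\<lambda>y. exp (\<i> * l * of_real y) * pv f l y) = Nf f l + (\<integral>y. exp (\<i> * l * of_real y) * f y \<partial>lborel)"
    by (simp add: Nf_def)
  show ?thesis
    unfolding outgoing_def I_bu [OF f bmeas_continuous [OF continuous_e]] m Ie Ip by (simp add: algebra_simps)
qed

lemma em_outgoing: "Wr l = 0 \<Longrightarrow> outgoing l 1 (em l) (\<lambda>_. 0)"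
  by (simp add: outgoing_def Wr_def)

lemma em_left:
  assumes "x \<le> - R" shows "em l x = exp (- \<i> * l * of_real x)"
proof -
  have "I (\<lambda>y. Sp l (x - y) * em l y) = I (\<lambda>_. 0)"
  proof (rule I_cong)
    show "(\<lambda>y. Sp l (x - y) * em l y) \<in> borel_measurable borel"
      by (intro bmeas_borel bmeas_mult bmeas_Sp bmeas_continuous continuous_em)
    show "Sp l (x - y) * em l y = 0" if "\<bar>y\<bar> \<le> R" for y
    proof -
      have "x - y \<le> 0" using that assms by linarith
      then show ?thesis by (simp add: Sp_def)
    qed
  qed simp
  then show ?thesis by (simp add: em_eq [of l x])
qed

lemma pv_linear:
  assumes f: "source L f" and g: "source L g"
  shows "pv (\<lambda>x. c * f x + g x) l x = c * pv f l x + pv g l x"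
proof -
  have "(\<integral>y. Sp l (x - y) * (c * f y + g y) \<partial>lborel) = c * (\<integral>y. Sp l (x - y) * f y \<partial>lborel) + (\<integral>y. Sp l (x - y) * g y \<partial>lborel)" for x
  proof -
    have i: "integrable lborel (\<lambda>y. Sp l (x - y) * f y)" if f: "source L f" for f
    proof -
      have c: "continuous_on UNIV (\<lambda>y. Sp l (x - y))"
        by (intro continuous_on_compose2 [OF continuous_Sp] continuous_intros) auto
      obtain B where "\<And>y. \<bar>y\<bar> \<le> L \<Longrightarrow> cmod (Sp l (x - y)) \<le> B" using continuous_bounded_on_interval [OF c] by blast
      then show ?thesis by (intro source_integrable_mult [OF f]) (auto intro: continuous_UNIV_borel [OF c])
    qed
    have "(\<lambda>y. Sp l (x - y) * (c * f y + g y)) = (\<lambda>y. c * (Sp l (x - y) * f y) + Sp l (x - y) * g y)"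
      by (simp add: algebra_simps)
    then show ?thesis using i [OF f] i [OF g] by simp
  qed
  then have "(\<lambda>x. - (\<integral>y. Sp l (x - y) * (c * f y + g y) \<partial>lborel)) =
      (\<lambda>x. c * (- (\<integral>y. Sp l (x - y) * f y \<partial>lborel)) + - (\<integral>y. Sp l (x - y) * g y \<partial>lborel))" by simp
  then show ?thesis
    unfolding pv_def by (simp only: Vol_linear [OF continuous_hf [OF f] continuous_hf [OF g]])
qed

lemma source_integral_linear:
  assumes f: "source L f" and g: "source L g" and k: "ent (\<lambda>_. k)"
  shows "(\<integral>y. k y * (c * f y + g y) \<partial>lborel) = c * (\<integral>y. k y * f y \<partial>lborel) + (\<integral>y. k y * g y \<partial>lborel)"
proof -
  have i: "integrable lborel (\<lambda>y. k y * f y)" if f: "source L f" for f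
  proof -
    obtain B where "\<And>l' y. cmod l' \<le> max L 0 \<Longrightarrow> \<bar>y\<bar> \<le> max L 0 \<Longrightarrow> cmod (k y) \<le> B" using ent_bound [OF k] by metis
    from this [of 0] show ?thesis by (intro source_integrable_mult(1) [OF f, of _ B]) (auto intro: ent_borel [OF k])
  qed
  have "(\<lambda>y. k y * (c * f y + g y)) = (\<lambda>y. c * (k y * f y) + k y * g y)"
    by (simp add: algebra_simps)
  then show ?thesis using i [OF f] i [OF g] by simp
qed

lemma Nf_linear:
  assumes f: "source L f" and g: "source L g"
  shows "Nf (\<lambda>x. c * f x + g x) l = c * Nf f l + Nf g l"
proof -
  have "I (\<lambda>y. exp (\<i> * l * of_real y) * pv (\<lambda>x. c * f x + g x) l y) =
      I (\<lambda>y. c * (exp (\<i> * l * of_real y) * pv f l y) + exp (\<i> * l * of_real y) * pv g l y)"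
    unfolding pv_linear [OF f g] by (simp add: algebra_simps)
  also have "\<dots> = I (\<lambda>y. c * (exp (\<i> * l * of_real y) * pv f l y)) + I (\<lambda>y. exp (\<i> * l * of_real y) * pv g l y)"
    by (intro I_add bmeas_cmult bmeas_mult bmeas_continuous continuous_e continuous_pv [OF f] continuous_pv [OF g])
  finally show ?thesis
    unfolding Nf_def I_cmult source_integral_linear [OF f g ent_continuous [OF continuous_e]]
    by (simp add: algebra_simps)
qed

lemma bu_linear:
  assumes "source L f" "source L g"
  shows "bu (\<lambda>x. c * f x + g x) l x = c * bu f l x + bu g l x"
  unfolding bu_def pv_linear [OF assms] Nf_linear [OF assms] by (simp add: algebra_simps)

lemma bu_cong:
  assumes "ae_eq f g" "f \<in> borel_measurable borel" "g \<in> borel_measurable borel"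
  shows "bu f = bu g" "bu1 f = bu1 g"
proof -
  have eq: "(\<integral>y. k y * f y \<partial>lborel) = (\<integral>y. k y * g y \<partial>lborel)" if "k \<in> borel_measurable borel" for k
    using ae_eq_integral_mult [OF assms that] by (simp add: mult.commute)
  have [measurable]: "(\<lambda>y. exp (\<i> * l * complex_of_real y)) \<in> borel_measurable borel" for l
    by (intro continuous_UNIV_borel continuous_e)
  have pv: "pv f = pv g" unfolding pv_def by (subst eq) auto
  moreover have Nf: "Nf f = Nf g" unfolding Nf_def [abs_def] pv by (subst eq) auto
  ultimately show bu: "bu f = bu g" unfolding bu_def [abs_def] by simp
  have m: "(\<integral>y. Cp l (x - y) * (Wr l * h y) \<partial>lborel) = Wr l * (\<integral>y. Cp l (x - y) * h y \<partial>lborel)" for h x l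
    by (subst integral_mult_right_zero [symmetric]) (simp add: mult_ac)
  have "(\<integral>y. Cp l (x - y) * f y \<partial>lborel) = (\<integral>y. Cp l (x - y) * g y \<partial>lborel)" for x l by (rule eq) simp
  then show "bu1 f = bu1 g" unfolding bu1_def [abs_def] sol1_def m bu Nf by simp
qed

subsection \<open>The Wronskian on the real axis\<close>

lemma Wr_real_nonzero:
  fixes k :: real
  assumes "k \<noteq> 0" shows "Wr (of_real k) \<noteq> 0"
proof
  assume W: "Wr (of_real k) = 0"
  define l where "l = complex_of_real k"
  define u where "u = em l"
  have uc: "continuous_on UNIV u" unfolding u_def by (rule continuous_em)
  have l0: "l \<noteq> 0" using assms by (simp add: l_def)
  have u: "u x = I (\<lambda>y. G l (x - y) * u y)" for x
  proof -
    have o: "outgoing l 1 u (\<lambda>_. 0)" using em_outgoing [OF W] by (simp add: l_def u_def)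
    show ?thesis using outgoing_sol(1) [OF uc source_0 o l0, of x] em_sol [of l x] by (simp add: u_def)
  qed
  \<comment> \<open>For real l the outgoing kernel splits into the real even part S(x - y) and -i
    cos(k (x - y))/(2 k), and the latter is a sum of two products by the addition theorem for
    cosine.\<close>
  define S where "S t = complex_of_real (sin (k * \<bar>t\<bar>) / (2 * k))" for t
  define c where "c t = complex_of_real (cos (k * t))" for t
  define s where "s t = complex_of_real (sin (k * t))" for t
  have cont: "continuous_on UNIV S" "continuous_on UNIV c" "continuous_on UNIV s"
    unfolding S_def c_def s_def by (intro continuous_intros; simp add: assms)+
  have ub: "bmeas u" "bmeas (\<lambda>x. cnj (u x))"
    by (auto intro!: bmeas_continuous continuous_intros uc)
  have G: "G l (x - y) = S (x - y) - \<i> / (2 * l) * (c x * c y + s x * s y)" for x y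
  proof -
    have "exp (\<i> * l * of_real \<bar>x - y\<bar>) = cos (l * of_real \<bar>x - y\<bar>) + \<i> * sin (l * of_real \<bar>x - y\<bar>)"
      by (simp add: exp_Euler mult.assoc)
    also have "cos (l * of_real \<bar>x - y\<bar>) = of_real (cos (k * \<bar>x - y\<bar>))" by (simp add: l_def cos_of_real [symmetric])
    also have "cos (k * \<bar>x - y\<bar>) = cos (k * x - k * y)"
      by (cases "x \<ge> y") (simp_all add: algebra_simps cos_diff)
    also have "sin (l * of_real \<bar>x - y\<bar>) = of_real (sin (k * \<bar>x - y\<bar>))" by (simp add: l_def sin_of_real [symmetric])
    finally show ?thesis
      unfolding G_eq [OF l0] S_def c_def s_def cos_diff using assms by (simp add: l_def field_simps)
  qed
  define a where "a = I (\<lambda>y. c y * u y)"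
  define b where "b = I (\<lambda>y. s y * u y)"
  define A where "A x = I (\<lambda>y. S (x - y) * u y)" for x
  have bm: "bmeas (\<lambda>y. S (x - y))" for x
    by (intro bmeas_continuous continuous_on_compose2 [OF cont(1)] continuous_intros) auto
  have Ac: "continuous_on UNIV A" unfolding A_def by (intro continuous_I_convolution cont ub)
  have u2: "u x = A x - \<i> / (2 * l) * (c x * a + s x * b)" for x
  proof -
    have "u x = I (\<lambda>y. S (x - y) * u y - \<i> / (2 * l) * (c x * (c y * u y) + s x * (s y * u y)))"
      by (subst u, subst G) (simp add: algebra_simps)
    also have "\<dots> = A x - I (\<lambda>y. \<i> / (2 * l) * (c x * (c y * u y) + s x * (s y * u y)))"
      unfolding A_def
      by (intro I_diff bmeas_mult bm ub bmeas_cmult bmeas_add bmeas_continuous [OF cont(2)] bmeas_continuous [OF cont(3)])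
    also have "I (\<lambda>y. \<i> / (2 * l) * (c x * (c y * u y) + s x * (s y * u y))) = \<i> / (2 * l) * (c x * a + s x * b)"
      unfolding I_cmult a_def b_def
      by (subst I_add) (auto intro!: bmeas_continuous continuous_on_mult continuous_on_const uc cont simp: I_cmult)
    finally show ?thesis .
  qed
  \<comment> \<open>The real even kernel paired with the conjugate of \<open>u\<close> and with
    \<open>u\<close>. Exchanging the two integrations yields the conjugate, so the value is
    real.\<close>
  define J where "J = I (\<lambda>x. cnj (u x) * A x)"
  have J_real: "cnj J = J"
  proof -
    have "J = I (\<lambda>x. I (\<lambda>y. cnj (u x) * (S (x - y) * u y)))"
      unfolding J_def A_def I_cmult ..
    also have "\<dots> = I (\<lambda>y. I (\<lambda>x. cnj (u x) * (S (x - y) * u y)))"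
    proof -
      have [measurable]: "u \<in> borel_measurable borel" "(\<lambda>x. cnj (u x)) \<in> borel_measurable borel" "S \<in> borel_measurable borel"
        using ub cont by (auto simp: bmeas_def continuous_UNIV_borel)
      obtain B where B: "B \<ge> 0" "\<And>y. \<bar>y\<bar> \<le> R \<Longrightarrow> cmod (u y) \<le> B" using bmeas_obtain [OF ub(1)] by blast
      obtain D where D: "D \<ge> 0" "\<And>y. \<bar>y\<bar> \<le> 2 * R \<Longrightarrow> cmod (S y) \<le> D"
        using continuous_bounded_on_interval [OF cont(1)] by blast
      show ?thesis
      proof (rule I_swap [where B = "B * (D * B)"])
        show "(\<lambda>(x, y). cnj (u x) * (S (x - y) * u y)) \<in> borel_measurable (borel \<Otimes>\<^sub>M borel)" by measurable
        show "cmod (cnj (u x) * (S (x - y) * u y)) \<le> B * (D * B)" if "\<bar>x\<bar> \<le> R" "\<bar>y\<bar> \<le> R" for x y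
        proof -
          have "\<bar>x - y\<bar> \<le> 2 * R" using that by linarith
          then show ?thesis using that B D by (auto simp: norm_mult intro!: mult_mono)
        qed
      qed
    qed
    also have "\<dots> = I (\<lambda>y. cnj (cnj (u y) * A y))"
    proof (intro arg_cong [where f = I] ext)
      fix y
      have "S (x - y) = cnj (S (y - x))" for x by (simp add: S_def abs_minus_commute)
      then have "I (\<lambda>x. cnj (u x) * (S (x - y) * u y)) = I (\<lambda>x. u y * cnj (S (y - x) * u x))"
        by (simp add: mult_ac)
      then show "I (\<lambda>x. cnj (u x) * (S (x - y) * u y)) = cnj (cnj (u y) * A y)"
        unfolding I_cmult I_cnj A_def by simp
    qed
    also have "\<dots> = cnj J" unfolding I_cnj J_def ..
    finally show ?thesis ..
  qed
  have N_real: "cnj (I (\<lambda>x. cnj (u x) * u x)) = I (\<lambda>x. cnj (u x) * u x)"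
    unfolding I_cnj [symmetric] by (simp add: mult.commute)
  have "I (\<lambda>x. cnj (u x) * u x) = I (\<lambda>x. cnj (u x) * A x - \<i> / (2 * l) * (a * cnj (c x * u x) + b * cnj (s x * u x)))"
    by (subst (2) u2) (simp add: c_def s_def algebra_simps)
  also have "\<dots> = J - I (\<lambda>x. \<i> / (2 * l) * (a * cnj (c x * u x) + b * cnj (s x * u x)))"
    unfolding J_def
    by (intro I_diff bmeas_mult bmeas_add bmeas_const bmeas_continuous continuous_intros uc cont Ac)
  also have "I (\<lambda>x. \<i> / (2 * l) * (a * cnj (c x * u x) + b * cnj (s x * u x))) = \<i> / (2 * l) * (a * cnj a + b * cnj b)"
    unfolding I_cmult
    by (subst I_add) (auto intro!: bmeas_continuous continuous_intros uc cont simp del: complex_cnj_mult simp: I_cmult I_cnj a_def b_def)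
  finally have eq: "I (\<lambda>x. cnj (u x) * u x) = J - \<i> / (2 * l) * (a * cnj a + b * cnj b)" .
  have real: "a * cnj a + b * cnj b = complex_of_real ((cmod a)\<^sup>2 + (cmod b)\<^sup>2)"
    by (simp only: of_real_add complex_norm_square)
  \<comment> \<open>The left side and \<open>J\<close> are real, so the remaining term, i/(2k) times
    a sum of squares, must vanish: both moments \<open>a\<close> and \<open>b\<close> are 0.\<close>
  have "Im (I (\<lambda>x. cnj (u x) * u x)) = 0" "Im J = 0" using N_real J_real by (auto simp: complex_eq_iff)
  then have "Im (\<i> / (2 * l) * complex_of_real ((cmod a)\<^sup>2 + (cmod b)\<^sup>2)) = 0" using eq real by simp
  then have "((cmod a)\<^sup>2 + (cmod b)\<^sup>2) / (2 * k) = 0" by (simp add: l_def)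
  then have "(cmod a)\<^sup>2 + (cmod b)\<^sup>2 = 0" using assms by simp
  then have ab: "a = 0" "b = 0" by (auto simp: sum_power2_eq_zero_iff)
  \<comment> \<open>At a zero of the Wronskian the integral of exp(i l y) u equals 2 i l, while the
    Euler formula makes it a + i b = 0.\<close>
  have "2 * \<i> * l = I (\<lambda>y. exp (\<i> * l * of_real y) * u y)" using W by (simp add: Wr_def l_def u_def)
  also have "\<dots> = I (\<lambda>y. c y * u y + \<i> * (s y * u y))"
  proof -
    have "exp (\<i> * l * of_real y) = c y + \<i> * s y" for y
      by (simp add: exp_Euler mult.assoc c_def s_def l_def cos_of_real [symmetric] sin_of_real [symmetric])
    then show ?thesis by (simp add: algebra_simps)
  qed
  also have "\<dots> = a + \<i> * b"
    by (subst I_add) (auto intro!: bmeas_continuous continuous_on_mult continuous_on_const uc cont simp: I_cmult a_def b_def)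
  finally show False using ab l0 by simp
qed

subsection \<open>Estimates in a strip\<close>

text \<open>The estimates of \<open>pv\<close> and \<open>Nf\<close> keep a bound \<open>s\<close>
  on the causal kernel as a parameter. A crude constant serves for local bounds in l, whereas a
  multiple of 1/|l| yields the decay in the strip. The range 2 L covers x - y for x and y in
  [-L, L].\<close>

lemma strip_bounds:
  assumes "L \<ge> R" "b \<ge> 0"
  obtains K where "K \<ge> 1"
    "\<And>l x. \<bar>Im l\<bar> \<le> b \<Longrightarrow> \<bar>x\<bar> \<le> L \<Longrightarrow> cmod (em l x) \<le> K"
    "\<And>l. \<bar>Im l\<bar> \<le> b \<Longrightarrow> cmod (Wr l - 2 * \<i> * l) \<le> K"
    "\<And>l x f s. \<bar>Im l\<bar> \<le> b \<Longrightarrow> \<bar>x\<bar> \<le> L \<Longrightarrow> source L f \<Longrightarrow> (\<And>t. \<bar>t\<bar> \<le> 2 * L \<Longrightarrow> cmod (Sp l t) \<le> s) \<Longrightarrow>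
       cmod (pv f l x) \<le> K * s * (\<integral>y. cmod (f y) \<partial>lborel)"
    "\<And>l f s. \<bar>Im l\<bar> \<le> b \<Longrightarrow> source L f \<Longrightarrow> (\<And>t. \<bar>t\<bar> \<le> 2 * L \<Longrightarrow> cmod (Sp l t) \<le> s) \<Longrightarrow>
       cmod (Nf f l) \<le> K * (1 + s) * (\<integral>y. cmod (f y) \<partial>lborel)"
proof -
  have L: "L > 0" using assms R_pos by simp
  \<comment> \<open>\<open>X\<close> bounds the exponentials exp(i l y) and exp(-i l y) on [-L, L]
    and \<open>Q\<close> bounds the Volterra weight there, uniformly in the strip.\<close>
  define X where "X = exp (b * L)"
  define Q where "Q = exp ((b + mass) * (L + R))"
  have Q1: "Q \<ge> 1" using mass_pos L R_pos assms by (simp add: Q_def)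
  have wtQ: "wt l x \<le> Q" if "\<bar>Im l\<bar> \<le> b" "\<bar>x\<bar> \<le> L" for l x
    unfolding wt_def Q_def using that mass_pos L R_pos by (auto intro!: mult_mono)
  have e1: "cmod (exp (\<i> * l * of_real y)) \<le> X" "cmod (exp (- \<i> * l * of_real y)) \<le> X"
    if "\<bar>Im l\<bar> \<le> b" "\<bar>y\<bar> \<le> L" for l y
  proof -
    have "\<bar>Im l * y\<bar> \<le> b * L" unfolding abs_mult using that by (intro mult_mono) auto
    then show "cmod (exp (\<i> * l * of_real y)) \<le> X" "cmod (exp (- \<i> * l * of_real y)) \<le> X"
      by (auto simp: norm_exp_eq_Re abs_le_iff X_def)
  qed
  define E where "E = 2 * (X + X * Q)"
  have em: "cmod (em l x) \<le> E" if "\<bar>Im l\<bar> \<le> b" "\<bar>x\<bar> \<le> L" for l x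
  proof -
    have "cmod (em l x) \<le> 2 * (cmod (exp (- \<i> * l * of_real x)) + X * wt l x)"
      unfolding em_def
    proof (rule Vol_bound [OF bmeas_continuous [OF continuous_e]])
      show "cmod (exp (- \<i> * l * of_real y)) \<le> X" if "\<bar>y\<bar> \<le> R" for y
        using \<open>\<bar>Im l\<bar> \<le> b\<close> that assms by (intro e1(2)) auto
    qed (simp add: X_def)
    also have "\<dots> \<le> E" unfolding E_def using that by (intro mult_left_mono add_mono e1(2) wtQ) (auto simp: X_def)
    finally show ?thesis .
  qed
  have E0: "E \<ge> 0" using Q1 by (simp add: E_def X_def)
  define P where "P = 2 * (1 + Q)"
  have P0: "P \<ge> 0" using Q1 by (simp add: P_def)
  have pv: "cmod (pv f l x) \<le> P * s * (\<integral>y. cmod (f y) \<partial>lborel)"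
    if l: "\<bar>Im l\<bar> \<le> b" and x: "\<bar>x\<bar> \<le> L" and f: "source L f" and s: "\<And>t. \<bar>t\<bar> \<le> 2 * L \<Longrightarrow> cmod (Sp l t) \<le> s" for l x f s
  proof -
    define F where "F = s * (\<integral>y. cmod (f y) \<partial>lborel)"
    have "s \<ge> 0" using order_trans [OF norm_ge_zero s [of 0]] L by simp
    then have F0: "F \<ge> 0" by (simp add: F_def)
    have h: "cmod (- (\<integral>y. Sp l (x - y) * f y \<partial>lborel)) \<le> F" if "\<bar>x\<bar> \<le> L" for x
      unfolding F_def norm_minus_cancel
      by (intro source_integrable_mult(2) [OF f] s) (use that in auto)
    have "cmod (pv f l x) \<le> 2 * (cmod (- (\<integral>y. Sp l (x - y) * f y \<partial>lborel)) + F * wt l x)"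
      unfolding pv_def
      by (rule Vol_bound [OF bmeas_continuous [OF continuous_hf [OF f]] F0]) (use h assms in auto)
    also have "\<dots> \<le> 2 * (F + F * Q)" using x l F0 by (intro mult_left_mono add_mono h wtQ) auto
    also have "\<dots> = P * s * (\<integral>y. cmod (f y) \<partial>lborel)" by (simp add: P_def F_def algebra_simps)
    finally show ?thesis .
  qed
  define K where "K = 1 + E + P + mass * (X * E) + mass * (X * P) + X"
  have X0: "X \<ge> 0" by (simp add: X_def)
  have le: "E \<le> K" "P \<le> K" "mass * (X * E) \<le> K" "1 \<le> K" "mass * (X * P) \<le> K" "X \<le> K"
    unfolding K_def using E0 P0 mass_pos X0 mult_nonneg_nonneg [of mass "X * E"] mult_nonneg_nonneg [of mass "X * P"]
      mult_nonneg_nonneg [of X E] mult_nonneg_nonneg [of X P] by linarith+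
  show ?thesis
  proof (rule that [of K])
    show "cmod (em l x) \<le> K" if "\<bar>Im l\<bar> \<le> b" "\<bar>x\<bar> \<le> L" for l x using em [OF that] le by simp
    show "cmod (Wr l - 2 * \<i> * l) \<le> K" if l: "\<bar>Im l\<bar> \<le> b" for l
    proof -
      have "cmod (I (\<lambda>y. exp (\<i> * l * of_real y) * em l y)) \<le> mass * (X * E)"
      proof (rule norm_I_le)
        fix y :: real assume "\<bar>y\<bar> \<le> R"
        then have "\<bar>y\<bar> \<le> L" using assms by simp
        then show "cmod (exp (\<i> * l * of_real y) * em l y) \<le> X * E"
          unfolding norm_mult by (intro mult_mono e1(1) em l X0) auto
      qed
      then show ?thesis using le by (simp add: Wr_def)
    qed
    show "cmod (pv f l x) \<le> K * s * (\<integral>y. cmod (f y) \<partial>lborel)"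
      if l: "\<bar>Im l\<bar> \<le> b" and x: "\<bar>x\<bar> \<le> L" and f: "source L f" and s: "\<And>t. \<bar>t\<bar> \<le> 2 * L \<Longrightarrow> cmod (Sp l t) \<le> s" for l x f s
    proof -
      have "s \<ge> 0" using order_trans [OF norm_ge_zero s [of 0]] L by simp
      have "cmod (pv f l x) \<le> P * s * (\<integral>y. cmod (f y) \<partial>lborel)" by (rule pv [OF l x f s])
      also have "\<dots> \<le> K * s * (\<integral>y. cmod (f y) \<partial>lborel)" using \<open>s \<ge> 0\<close> le by (intro mult_right_mono) auto
      finally show ?thesis .
    qed
    show "cmod (Nf f l) \<le> K * (1 + s) * (\<integral>y. cmod (f y) \<partial>lborel)"
      if l: "\<bar>Im l\<bar> \<le> b" and f: "source L f" and s: "\<And>t. \<bar>t\<bar> \<le> 2 * L \<Longrightarrow> cmod (Sp l t) \<le> s" for l f s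
    proof -
      define N where "N = (\<integral>y. cmod (f y) \<partial>lborel)"
      have N: "N \<ge> 0" by (simp add: N_def)
      have "s \<ge> 0" using order_trans [OF norm_ge_zero s [of 0]] L by simp
      have 1: "cmod (I (\<lambda>y. exp (\<i> * l * of_real y) * pv f l y)) \<le> mass * (X * (P * s * N))"
      proof (rule norm_I_le)
        fix y :: real assume "\<bar>y\<bar> \<le> R"
        then have y: "\<bar>y\<bar> \<le> L" using assms by simp
        show "cmod (exp (\<i> * l * of_real y) * pv f l y) \<le> X * (P * s * N)"
          unfolding norm_mult N_def by (rule mult_mono [OF e1(1) [OF l y] pv [OF l y f s] X0 norm_ge_zero])
      qed
      have 2: "cmod (\<integral>y. exp (\<i> * l * of_real y) * f y \<partial>lborel) \<le> X * N"
        unfolding N_def by (intro source_integrable_mult(2) [OF f] e1(1) l continuous_UNIV_borel continuous_e)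
      have "cmod (Nf f l) \<le> mass * (X * (P * s * N)) + X * N"
        unfolding Nf_def by (rule order_trans [OF norm_triangle_ineq4 add_mono [OF 1 2]])
      also have "\<dots> = (mass * (X * P)) * (s * N) + X * N" by (simp add: mult_ac)
      also have "\<dots> \<le> K * (s * N) + K * N"
        using N \<open>s \<ge> 0\<close> by (intro add_mono mult_right_mono le) auto
      also have "\<dots> = K * (1 + s) * N" by (simp add: algebra_simps)
      finally show ?thesis by (simp add: N_def)
    qed
  qed (use le in auto)
qed

lemma sol1_bound:
  assumes "L \<ge> R" "b \<ge> 0" and l: "\<bar>Im l\<bar> \<le> b" and x: "\<bar>x\<bar> \<le> L" and f: "source L f"
    and u: "\<And>y. \<bar>y\<bar> \<le> R \<Longrightarrow> cmod (u y) \<le> U"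
  shows "cmod (sol1 l c u f x) \<le> exp (2 * b * L) * (cmod l * cmod c + mass * U + (\<integral>y. cmod (f y) \<partial>lborel))"
proof -
  have L: "L > 0" using assms R_pos by simp
  have U: "U \<ge> 0" using order_trans [OF norm_ge_zero u [of 0]] R_pos by simp
  have "\<bar>Im l * x\<bar> \<le> b * L" unfolding abs_mult using l x assms by (intro mult_mono) auto
  then have "Im l * x \<le> 2 * b * L" using L \<open>b \<ge> 0\<close> by (simp add: mult.assoc abs_le_iff)
  then have e: "cmod (exp (- \<i> * l * of_real x)) \<le> exp (2 * b * L)" by (simp add: norm_exp_eq_Re)
  have C: "cmod (Cp l (x - y)) \<le> exp (2 * b * L)" if "\<bar>y\<bar> \<le> L" for y
  proof -
    have "\<bar>Im l\<bar> * max 0 (x - y) \<le> b * (2 * L)" using that l x L assms by (intro mult_mono) auto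
    then show ?thesis by (intro order_trans [OF norm_Cp_le]) (simp add: mult_ac)
  qed
  have 1: "cmod (- \<i> * l * c * exp (- \<i> * l * of_real x)) \<le> (cmod l * cmod c) * exp (2 * b * L)"
    using e by (simp add: norm_mult mult_left_mono)
  have 2: "cmod (I (\<lambda>y. Cp l (x - y) * u y)) \<le> mass * (exp (2 * b * L) * U)"
  proof (rule norm_I_le)
    fix y :: real assume y: "\<bar>y\<bar> \<le> R"
    then show "cmod (Cp l (x - y) * u y) \<le> exp (2 * b * L) * U"
      unfolding norm_mult using assms(1) U by (intro mult_mono C u) auto
  qed
  have 3: "cmod (\<integral>y. Cp l (x - y) * f y \<partial>lborel) \<le> exp (2 * b * L) * (\<integral>y. cmod (f y) \<partial>lborel)"
    by (intro source_integrable_mult(2) [OF f] C) measurable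
  have "cmod (sol1 l c u f x) \<le> (cmod l * cmod c) * exp (2 * b * L) + mass * (exp (2 * b * L) * U)
      + exp (2 * b * L) * (\<integral>y. cmod (f y) \<partial>lborel)"
    unfolding sol1_def
    by (rule order_trans [OF norm_triangle_ineq4 add_mono [OF order_trans [OF norm_triangle_ineq add_mono [OF 1 2]] 3]])
  then show ?thesis by (simp add: algebra_simps)
qed

text \<open>The bound is linear in |l|, as division by \<open>Wr\<close> has to gain a factor 1/|l|.
  For |Re l| at least K the term 2 i l dominates the bounded correction; in between, compactness is
  combined with the absence of real zeros.\<close>

lemma Wr_lower_bound:
  assumes "\<mu> > 0"
  obtains c \<epsilon> where "c > 0" "0 < \<epsilon>" "\<epsilon> \<le> 1" "\<And>l. \<bar>Re l\<bar> \<ge> \<mu> \<Longrightarrow> \<bar>Im l\<bar> \<le> \<epsilon> \<Longrightarrow> c * cmod l \<le> cmod (Wr l)"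
proof -
  obtain K where K: "K \<ge> 1" "\<And>l. \<bar>Im l\<bar> \<le> 1 \<Longrightarrow> cmod (Wr l - 2 * \<i> * l) \<le> K"
    using strip_bounds [OF order_refl zero_le_one] by metis
  have large: "1 * cmod l \<le> cmod (Wr l)" if "\<bar>Im l\<bar> \<le> 1" "\<bar>Re l\<bar> \<ge> K" for l
  proof -
    have "cmod (2 * \<i> * l) \<le> cmod (Wr l) + cmod (Wr l - 2 * \<i> * l)"
      by (metis norm_triangle_sub norm_minus_commute)
    then have "2 * cmod l \<le> cmod (Wr l) + K" using K(2) [OF that(1)] by (simp add: norm_mult)
    moreover have "K \<le> cmod l" using that abs_Re_le_cmod [of l] by linarith
    ultimately show ?thesis by linarith
  qed
  define S where "S e = {l. \<bar>Im l\<bar> \<le> e \<and> \<mu> \<le> \<bar>Re l\<bar> \<and> \<bar>Re l\<bar> \<le> K}" for e :: real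
  have S_compact: "compact (S e)" for e
  proof -
    have "closed (S e)" unfolding S_def by (intro closed_Collect_conj closed_Collect_le continuous_intros)
    moreover have "bounded (S e)"
    proof -
      have "cmod l \<le> K + e" if "l \<in> S e" for l
        using that cmod_le [of l] by (simp add: S_def)
      then show ?thesis by (auto simp: bounded_iff)
    qed
    ultimately show ?thesis by (simp add: compact_eq_bounded_closed)
  qed
  have Wc: "continuous_on A Wr" for A by (rule holomorphic_on_imp_continuous_on [OF Wr_holomorphic])
  \<comment> \<open>The zeros in \<open>S 1\<close> form a compact set without real points. If there
    are any, half the smallest |Im| among them is an admissible height.\<close>
  obtain \<epsilon> where \<epsilon>: "0 < \<epsilon>" "\<epsilon> \<le> 1" "\<And>l. l \<in> S \<epsilon> \<Longrightarrow> Wr l \<noteq> 0"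
  proof (cases "\<exists>l\<in>S 1. Wr l = 0")
    case False
    then show ?thesis by (intro that [of 1]) auto
  next
    case True
    define Z where "Z = {l \<in> S 1. Wr l = 0}"
    have Z1: "compact Z"
    proof -
      have "closed {l. Wr l = 0}" by (intro closed_Collect_eq Wc continuous_intros)
      moreover have "Z = S 1 \<inter> {l. Wr l = 0}" by (auto simp: Z_def)
      ultimately show ?thesis using S_compact by (simp add: compact_Int_closed)
    qed
    have Z2: "Z \<noteq> {}" using True by (auto simp: Z_def)
    have Z3: "continuous_on Z (\<lambda>l. \<bar>Im l\<bar>)" by (intro continuous_intros)
    obtain z where z: "z \<in> Z" "\<And>l. l \<in> Z \<Longrightarrow> \<bar>Im z\<bar> \<le> \<bar>Im l\<bar>"
      using continuous_attains_inf [OF Z1 Z2 Z3] by blast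
    have "Im z \<noteq> 0"
    proof
      assume "Im z = 0"
      then have "z = of_real (Re z)" by (simp add: complex_eq_iff)
      moreover have "Re z \<noteq> 0" using z(1) assms by (auto simp: Z_def S_def)
      ultimately show False using Wr_real_nonzero z(1) unfolding Z_def by (metis (mono_tags, lifting) mem_Collect_eq)
    qed
    moreover have "\<bar>Im z\<bar> \<le> 1" using z(1) by (simp add: Z_def S_def)
    ultimately show ?thesis
    proof (intro that [of "\<bar>Im z\<bar> / 2"])
      fix l assume l: "l \<in> S (\<bar>Im z\<bar> / 2)"
      show "Wr l \<noteq> 0"
      proof
        assume "Wr l = 0"
        then have "l \<in> Z" using l \<open>\<bar>Im z\<bar> \<le> 1\<close> by (auto simp: Z_def S_def)
        then show False using z(2) [of l] l \<open>Im z \<noteq> 0\<close> by (auto simp: S_def)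
      qed
    qed auto
  qed
  obtain m where m: "m > 0" "\<And>l. l \<in> S \<epsilon> \<Longrightarrow> m \<le> cmod (Wr l)"
  proof (cases "S \<epsilon> = {}")
    case True
    then show ?thesis by (intro that [of 1]) auto
  next
    case False
    have "continuous_on (S \<epsilon>) (\<lambda>l. cmod (Wr l))" by (intro continuous_intros Wc)
    then obtain z where "z \<in> S \<epsilon>" "\<And>l. l \<in> S \<epsilon> \<Longrightarrow> cmod (Wr z) \<le> cmod (Wr l)"
      using continuous_attains_inf [OF S_compact False] by blast
    then show ?thesis using \<epsilon>(3) by (intro that [of "cmod (Wr z)"]) auto
  qed
  \<comment> \<open>On \<open>S \<epsilon>\<close> the modulus of l is at most K + 1, which converts
    the constant lower bound \<open>m\<close> into one that is linear in |l|.\<close>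
  show ?thesis
  proof (rule that [of "min 1 (m / (K + 1))" \<epsilon>])
    show "min 1 (m / (K + 1)) > 0" using m(1) K(1) by simp
    fix l assume l: "\<bar>Re l\<bar> \<ge> \<mu>" "\<bar>Im l\<bar> \<le> \<epsilon>"
    show "min 1 (m / (K + 1)) * cmod l \<le> cmod (Wr l)"
    proof (cases "\<bar>Re l\<bar> \<ge> K")
      case True
      have "min 1 (m / (K + 1)) * cmod l \<le> 1 * cmod l" by (intro mult_right_mono) auto
      also have "\<dots> \<le> cmod (Wr l)" by (rule large) (use l \<epsilon> True in auto)
      finally show ?thesis .
    next
      case False
      then have "l \<in> S \<epsilon>" using l by (simp add: S_def)
      have "cmod l \<le> K + 1" using cmod_le [of l] False l(2) \<epsilon>(2) by linarith
      then have "min 1 (m / (K + 1)) * cmod l \<le> m / (K + 1) * (K + 1)"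
        using m(1) K(1) by (intro mult_mono) auto
      also have "\<dots> = m" using K(1) by simp
      finally show ?thesis using m(2) [OF \<open>l \<in> S \<epsilon>\<close>] by linarith
    qed
  qed (use \<epsilon> in auto)
qed

end

section \<open>The cut-off family\<close>

lemma vderiv_mult:
  fixes f g :: "real \<Rightarrow> complex"
  assumes "smooth f" "smooth g" shows "vderiv (\<lambda>x. f x * g x) = (\<lambda>x. f x * vderiv g x + vderiv f x * g x)"
  using assms by (intro vderiv_eq has_vector_derivative_mult smooth_imp_deriv)

lemma vderiv_add:
  assumes "smooth f" "smooth g" shows "vderiv (\<lambda>x. f x + g x) = (\<lambda>x. vderiv f x + vderiv g x)"
  using assms by (intro vderiv_eq has_vector_derivative_add smooth_imp_deriv)

section \<open>Norm bounds from pointwise domination on a bounded interval\<close>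

lemma L2_norm_nonneg: "L2_norm f \<ge> 0" by (simp add: L2_norm_def)

lemma L2_norm_square: "(L2_norm f)\<^sup>2 = (\<integral>x. (cmod (f x))\<^sup>2 \<partial>lborel)"
  by (simp add: L2_norm_def)

lemma L2_dominated:
  assumes g: "g \<in> L2" "L2_norm g \<le> 1" and [measurable]: "h \<in> borel_measurable borel" and "C \<ge> 0" "L \<ge> 0"
    and h: "\<And>x. cmod (h x) \<le> C * (1 + cmod (g x)) * indicator {-L..L} x"
  shows "h \<in> L2" "L2_norm h \<le> C * (2 * L + 2)"
proof -
  have [measurable]: "g \<in> borel_measurable borel" using g by measurable
  define k where "k x = C\<^sup>2 * (2 * indicator {-L..L} x + 2 * (cmod (g x))\<^sup>2)" for x :: real
  have i: "integrable lborel (indicator {-L..L} :: real \<Rightarrow> real)" by (auto simp: emeasure_lborel_Icc_eq)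
  have ik: "integrable lborel k"
    unfolding k_def by (intro integrable_mult_right Bochner_Integration.integrable_add i L2_integrable g)
  have le: "(cmod (h x))\<^sup>2 \<le> k x" for x
  proof -
    have "(cmod (h x))\<^sup>2 \<le> (C * (1 + cmod (g x)) * indicator {-L..L} x)\<^sup>2" by (intro power_mono h) auto
    also have "\<dots> \<le> k x"
    proof -
      have "(1 + cmod (g x))\<^sup>2 \<le> 2 + 2 * (cmod (g x))\<^sup>2"
        using two_mult_le_squares [of 1 "cmod (g x)"] by (simp add: power2_sum)
      then have "C\<^sup>2 * (1 + cmod (g x))\<^sup>2 \<le> C\<^sup>2 * (2 + 2 * (cmod (g x))\<^sup>2)" by (intro mult_left_mono) auto
      then show ?thesis by (auto simp: k_def power_mult_distrib indicator_def)
    qed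
    finally show ?thesis .
  qed
  have ih: "integrable lborel (\<lambda>x. (cmod (h x))\<^sup>2)"
    by (rule Bochner_Integration.integrable_bound [OF ik]) (auto intro!: AE_I2 order_trans [OF le abs_ge_self])
  then show "h \<in> L2" by (simp add: L2_def)
  have "(L2_norm h)\<^sup>2 \<le> (\<integral>x. k x \<partial>lborel)"
    unfolding L2_norm_square by (intro integral_mono ih ik le)
  also have "\<dots> = C\<^sup>2 * (2 * (2 * L) + 2 * (L2_norm g)\<^sup>2)"
    unfolding k_def L2_norm_square using i L2_integrable [OF g(1)] \<open>L \<ge> 0\<close>
    by (simp add: emeasure_lborel_Icc_eq)
  also have "\<dots> \<le> C\<^sup>2 * (2 * L + 2)\<^sup>2"
  proof (rule mult_left_mono)
    have "(L2_norm g)\<^sup>2 \<le> 1" using g(2) L2_norm_nonneg by (simp add: power_le_one)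
    moreover have "(2 * L + 2)\<^sup>2 = 4 * L\<^sup>2 + 8 * L + 4" by (simp add: power2_eq_square algebra_simps)
    ultimately show "2 * (2 * L) + 2 * (L2_norm g)\<^sup>2 \<le> (2 * L + 2)\<^sup>2"
      using \<open>L \<ge> 0\<close> zero_le_power2 [of L] by linarith
  qed simp
  finally have "(L2_norm h)\<^sup>2 \<le> (C * (2 * L + 2))\<^sup>2" by (simp only: power_mult_distrib)
  then show "L2_norm h \<le> C * (2 * L + 2)" 
    by (rule power2_le_imp_le) (use \<open>C \<ge> 0\<close> \<open>L \<ge> 0\<close> in simp)
qed

text \<open>On [-L, L] one has |g| <= 1 + |g|^2, which integrates to at most 2 L + 1.\<close>

lemma source_L1_bound:
  assumes g: "g \<in> L2" "L2_norm g \<le> 1" and f: "source L f" and "L \<ge> 0" and le: "\<And>x. cmod (f x) \<le> cmod (g x)"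
  shows "(\<integral>x. cmod (f x) \<partial>lborel) \<le> 2 * L + 1"
proof -
  have i: "integrable lborel (indicator {-L..L} :: real \<Rightarrow> real)" by (auto simp: emeasure_lborel_Icc_eq)
  have "(\<integral>x. cmod (f x) \<partial>lborel) \<le> (\<integral>x. indicator {-L..L} x + (cmod (g x))\<^sup>2 \<partial>lborel)"
  proof (rule integral_mono)
    show "integrable lborel (\<lambda>x. cmod (f x))" using f by (simp add: source_def)
    show "integrable lborel (\<lambda>x. indicator {-L..L} x + (cmod (g x))\<^sup>2)"
      by (intro Bochner_Integration.integrable_add i L2_integrable g)
    fix x
    show "cmod (f x) \<le> indicator {-L..L} x + (cmod (g x))\<^sup>2"
    proof (cases "x \<in> {-L..L}")
      case True
      have "cmod (g x) \<le> 1 + (cmod (g x))\<^sup>2"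
        using two_mult_le_squares [of "cmod (g x)" 1] norm_ge_zero [of "g x"] by (simp, linarith)
      then show ?thesis using True le [of x] by simp
    next
      case False
      then have "f x = 0" using f by (auto simp: source_def abs_le_iff)
      then show ?thesis by simp
    qed
  qed
  also have "\<dots> = 2 * L + (L2_norm g)\<^sup>2"
    unfolding L2_norm_square using i L2_integrable [OF g(1)] \<open>L \<ge> 0\<close> by simp
  also have "\<dots> \<le> 2 * L + 1" using g(2) L2_norm_nonneg by (simp add: power_le_one)
  finally show ?thesis .
qed

text \<open>[-L, L] contains the support of the cutoff, and the cutoff is 1 on [-R1, R1]. The gap
  between R and R1 leaves room for a source that misses the measure but is not altered by the
  cutoff.\<close>

locale cutoff_op = schrodinger_op m1 m2 R \<psi> V
  for m1 m2 :: "real measure" and R :: real and \<psi> :: "real \<Rightarrow> real" and V :: "real set \<Rightarrow> real" +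
  fixes L R1 :: real
  assumes R_less: "R < R1" "R1 < L" and psi_support: "\<And>x. \<bar>x\<bar> > L \<Longrightarrow> \<psi> x = 0"
    and psi_one: "\<And>x. \<bar>x\<bar> \<le> R1 \<Longrightarrow> \<psi> x = 1" and psi_le: "\<And>x. \<psi> x \<le> 1"
begin

definition \<psi>c :: "real \<Rightarrow> complex" where "\<psi>c x = of_real (\<psi> x)"

definition cut :: "(real \<Rightarrow> complex) \<Rightarrow> real \<Rightarrow> complex" where "cut g x = \<psi>c x * g x"

text \<open>The cut-off resolvent applied to \<open>g\<close>, multiplied by the Wronskian: an
  entire family, defined in the lower half-plane as well.\<close>

definition ub :: "complex \<Rightarrow> (real \<Rightarrow> complex) \<Rightarrow> real \<Rightarrow> complex" where
  "ub l g x = \<psi>c x * bu (cut g) l x"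

definition ub1 :: "complex \<Rightarrow> (real \<Rightarrow> complex) \<Rightarrow> real \<Rightarrow> complex" where
  "ub1 l g x = \<psi>c x * bu1 (cut g) l x + vderiv \<psi>c x * bu (cut g) l x"

text \<open>The operator applied to the cut-off solution: chi H w - 2 chi' w' - chi'' w, with H w =
  l^2 w + Wr g on the support of the cutoff, where g stands for the cut-off source.\<close>

definition ub2 :: "complex \<Rightarrow> (real \<Rightarrow> complex) \<Rightarrow> real \<Rightarrow> complex" where
  "ub2 l g x = \<psi>c x * (l\<^sup>2 * bu (cut g) l x + Wr l * cut g x) - 2 * (vderiv \<psi>c x * bu1 (cut g) l x)
     - vderiv (vderiv \<psi>c) x * bu (cut g) l x"

lemma L_pos: "L > 0" and R_le_L: "R \<le> L" using R_less R_pos by auto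

lemma chi_test: "test_function \<psi>c"
  unfolding \<psi>c_def [abs_def] by (rule test_function_of_real [OF bump_test])

lemma chi_support: "\<bar>x\<bar> > L \<Longrightarrow> \<psi>c x = 0"
  by (simp add: \<psi>c_def psi_support)

lemma norm_chi: "cmod (\<psi>c x) \<le> 1"
  using bump_nonneg [of x] psi_le [of x] by (simp add: \<psi>c_def)

lemma chi_bounds:
  obtains D where "D \<ge> 1" "\<And>x. cmod (\<psi>c x) \<le> D * indicator {-L..L} x"
    "\<And>x. cmod (vderiv \<psi>c x) \<le> D * indicator {-L..L} x" "\<And>x. cmod (vderiv (vderiv \<psi>c) x) \<le> D * indicator {-L..L} x"
proof -
  obtain B where B: "\<And>x. cmod (vderiv \<psi>c x) \<le> B" using test_function_bounded [OF test_function_vderiv [OF chi_test]] by metis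
  obtain B' where B': "\<And>x. cmod (vderiv (vderiv \<psi>c) x) \<le> B'"
    using test_function_bounded [OF test_function_vderiv [OF test_function_vderiv [OF chi_test]]] by metis
  note s = chi_support vanishing_vderiv [of L \<psi>c, OF chi_support]
  note s' = vanishing_vderiv [of L "vderiv \<psi>c", OF s(2)]
  define D where "D = 1 + \<bar>B\<bar> + \<bar>B'\<bar>"
  have *: "cmod (h x) \<le> D * indicator {-L..L} x" if "\<And>x. \<bar>x\<bar> > L \<Longrightarrow> h x = 0" "cmod (h x) \<le> D" for h :: "real \<Rightarrow> complex" and x
    using that by (cases "x \<in> {-L..L}") (auto simp: abs_le_iff not_le)
  show ?thesis
  proof (rule that [of D])
    show "cmod (\<psi>c x) \<le> D * indicator {-L..L} x" for x
      by (rule * [OF s(1)]) (use norm_chi [of x] in \<open>auto simp: D_def\<close>)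
    show "cmod (vderiv \<psi>c x) \<le> D * indicator {-L..L} x" for x
      by (rule * [OF s(2)]) (use B [of x] in \<open>auto simp: D_def\<close>)
    show "cmod (vderiv (vderiv \<psi>c) x) \<le> D * indicator {-L..L} x" for x
      by (rule * [OF s']) (use B' [of x] in \<open>auto simp: D_def\<close>)
  qed (simp add: D_def)
qed

lemma cut_source:
  assumes "g \<in> L2" shows "source L (cut g)"
proof -
  have "integrable lborel (\<lambda>x. \<psi>c x * g x)"
    by (intro L2_integrable_mult L2_test_function chi_test assms)
  then show ?thesis
    using assms L2_borel [OF assms] test_function_borel [OF chi_test]
    by (auto simp: source_def cut_def [abs_def] chi_support)
qed

lemma cut_L2: "g \<in> L2 \<Longrightarrow> cut g \<in> L2"
  unfolding cut_def [abs_def] by (intro L2_bounded_mult [of _ _ 1] test_function_borel chi_test norm_chi)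

lemma cut_le: "cmod (cut g x) \<le> cmod (g x)"
  using mult_right_mono [OF norm_chi [of x], of "cmod (g x)"] by (simp add: cut_def norm_mult)

text \<open>Holds at every l, as the cutoff confines the solution to a bounded interval however it
  grows. The weak equation of the solution is tested against the cutoff times the test
  function.\<close>

lemma cutoff_Hdata:
  assumes g: "g \<in> L2"
  shows "Hdata (ub l g) (ub1 l g) (ub2 l g)"
proof -
  define f where "f = cut g"
  have f: "source L f" "f \<in> L2" unfolding f_def by (intro cut_source cut_L2 g)+
  define w where "w = bu f l" define w1 where "w1 = bu1 f l"
  have wc: "continuous_on UNIV w" unfolding w_def by (rule continuous_bu [OF f(1)])
  have lw: "loc_integrable w" by (rule loc_integrable_continuous [OF wc])
  have e1: "ent (\<lambda>_. w1)" unfolding w1_def by (rule ent_freeze [OF ent_bu1 [OF f(1)]])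
  have lw1: "loc_integrable w1" by (rule ent_loc_integrable [OF e1])
  have lf: "loc_integrable f" by (rule L2_loc_integrable [OF f(2)])
  have [measurable]: "w \<in> borel_measurable borel" "w1 \<in> borel_measurable borel" "f \<in> borel_measurable borel"
    using lw lw1 lf by (auto intro: loc_integrable_borel)
  note c = chi_test note c' = test_function_vderiv [OF c] note c'' = test_function_vderiv [OF c']
  have [measurable]: "\<psi>c \<in> borel_measurable borel" "vderiv \<psi>c \<in> borel_measurable borel" "vderiv (vderiv \<psi>c) \<in> borel_measurable borel"
    by (intro test_function_borel c c' c'')+
  obtain D where D: "D \<ge> 1" "\<And>x. cmod (\<psi>c x) \<le> D * indicator {-L..L} x"
    "\<And>x. cmod (vderiv \<psi>c x) \<le> D * indicator {-L..L} x" "\<And>x. cmod (vderiv (vderiv \<psi>c) x) \<le> D * indicator {-L..L} x"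
    using chi_bounds by metis
  obtain B where B: "B \<ge> 0" "\<And>x. \<bar>x\<bar> \<le> L \<Longrightarrow> cmod (w x) \<le> B" using continuous_bounded_on_interval [OF wc] by blast
  obtain B1 where B1: "B1 \<ge> 0" "\<And>x. \<bar>x\<bar> \<le> L \<Longrightarrow> cmod (w1 x) \<le> B1"
    using ent_bound [OF e1, of L] L_pos by (metis norm_zero less_imp_le)
  have bd: "cmod (h x * k x) \<le> D * M * indicator {-L..L} x"
    if "\<And>x. cmod (h x) \<le> D * indicator {-L..L} x" "\<And>x. \<bar>x\<bar> \<le> L \<Longrightarrow> cmod (k x) \<le> M" "M \<ge> 0" for h k :: "real \<Rightarrow> complex" and M x
  proof (cases "x \<in> {-L..L}")
    case True
    then have "cmod (h x) * cmod (k x) \<le> D * M" using that(1) [of x] that(2) [of x] \<open>M \<ge> 0\<close> D(1) by (intro mult_mono) auto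
    then show ?thesis using True by (simp add: norm_mult)
  next
    case False
    then show ?thesis using that(1) [of x] by simp
  qed
  have L2p: "(\<lambda>x. \<psi>c x * w x) \<in> L2" "(\<lambda>x. \<psi>c x * w1 x) \<in> L2" "(\<lambda>x. vderiv \<psi>c x * w x) \<in> L2"
    "(\<lambda>x. vderiv \<psi>c x * w1 x) \<in> L2" "(\<lambda>x. vderiv (vderiv \<psi>c) x * w x) \<in> L2"
    by (rule L2_bounded_support, measurable, rule bd; fact D B B1)+
  have L2f: "(\<lambda>x. \<psi>c x * f x) \<in> L2" by (intro L2_bounded_mult [of _ _ 1] f norm_chi) measurable
  have ub: "ub l g = (\<lambda>x. \<psi>c x * w x)" "ub1 l g = (\<lambda>x. \<psi>c x * w1 x + vderiv \<psi>c x * w x)"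
    "ub2 l g = (\<lambda>x. (l\<^sup>2 * (\<psi>c x * w x) + Wr l * (\<psi>c x * f x)) - 2 * (vderiv \<psi>c x * w1 x) - vderiv (vderiv \<psi>c) x * w x)"
    by (auto simp: ub_def ub1_def ub2_def f_def w_def w1_def algebra_simps)
  have eqw: "sol l (Nf f l) w (\<lambda>y. Wr l * f y) = w"
    unfolding w_def using bu_sol [OF f(1), of l] by blast
  have eqw1: "sol1 l (Nf f l) w (\<lambda>y. Wr l * f y) = w1" by (simp add: w_def w1_def bu1_def)
  have sW: "source L (\<lambda>y. Wr l * f y)" using f(1) by (auto simp: source_def)
  have D1: "(\<integral>x. w x * vderiv \<phi> x \<partial>lborel) = - (\<integral>x. w1 x * \<phi> x \<partial>lborel)" if "test_function \<phi>" for \<phi>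
    using sol_weak_deriv [OF wc sW that, of l "Nf f l"] by (simp only: eqw eqw1)
  have D2: "- (\<integral>x. w x * vderiv (vderiv \<phi>) x \<partial>lborel) + I (\<lambda>y. w y * \<phi> y)
    = l\<^sup>2 * (\<integral>x. w x * \<phi> x \<partial>lborel) + (\<integral>x. Wr l * f x * \<phi> x \<partial>lborel)" if "test_function \<phi>" for \<phi>
    using sol_equation [OF wc sW that, of l "Nf f l"] by (simp only: eqw)
  show ?thesis
    unfolding ub Hdata_def
  proof (intro conjI allI impI)
    show "continuous_on UNIV (\<lambda>x. \<psi>c x * w x)" by (intro continuous_intros test_function_continuous c wc)
    have p1: "cmod (\<psi>c x * w x) \<le> D * B * indicator {-L..L} x" for x by (rule bd; fact D B)
    have p2: "cmod (\<psi>c x * w1 x) \<le> D * B1 * indicator {-L..L} x" for x by (rule bd; fact D B1)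
    have p3: "cmod (vderiv \<psi>c x * w x) \<le> D * B * indicator {-L..L} x" for x by (rule bd; fact D B)
    have "cmod (\<psi>c x * w x) \<le> D * B" for x
      using p1 [of x] B(1) D(1) by (auto simp: indicator_def split: if_splits intro: order_trans)
    then show "bounded (range (\<lambda>x. \<psi>c x * w x))" by (auto simp: bounded_iff)
    show "(\<lambda>x. \<psi>c x * w x) \<in> L2" "(\<lambda>x. \<psi>c x * w1 x + vderiv \<psi>c x * w x) \<in> L2" by (intro L2_add L2p)+
    show "ess_bounded (\<lambda>x. \<psi>c x * w1 x + vderiv \<psi>c x * w x)"
      unfolding ess_bounded_def
    proof
      have "cmod (\<psi>c x * w1 x + vderiv \<psi>c x * w x) \<le> D * B1 + D * B" for x
        using p2 [of x] p3 [of x] B(1) B1(1) D(1)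
        by (intro norm_triangle_mono) (auto simp: indicator_def split: if_splits intro: order_trans)
      then show "\<exists>B. AE x in lborel. cmod (\<psi>c x * w1 x + vderiv \<psi>c x * w x) \<le> B" by blast
    qed measurable
    show "(\<lambda>x. (l\<^sup>2 * (\<psi>c x * w x) + Wr l * (\<psi>c x * f x)) - 2 * (vderiv \<psi>c x * w1 x) - vderiv (vderiv \<psi>c) x * w x) \<in> L2"
      by (intro L2_add L2_diff L2_cmult L2p L2f)
    fix \<phi> :: "real \<Rightarrow> complex" assume t: "test_function \<phi>"
    note t' = test_function_vderiv [OF t] note t'' = test_function_vderiv [OF t']
    have tt: "test_function (\<lambda>x. \<psi>c x * \<phi> x)" "test_function (\<lambda>x. vderiv \<psi>c x * \<phi> x)" "test_function (\<lambda>x. vderiv (vderiv \<psi>c) x * \<phi> x)"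
      by (intro test_function_mult c c' c'' t)+
    have s: "smooth \<psi>c" "smooth (vderiv \<psi>c)" "smooth \<phi>" "smooth (vderiv \<phi>)"
      using c c' t t' by (auto intro: test_function_smooth)
    have d1: "vderiv (\<lambda>x. \<psi>c x * \<phi> x) = (\<lambda>x. \<psi>c x * vderiv \<phi> x + vderiv \<psi>c x * \<phi> x)" by (rule vderiv_mult [OF s(1,3)])
    have d2: "vderiv (vderiv (\<lambda>x. \<psi>c x * \<phi> x)) = (\<lambda>x. \<psi>c x * vderiv (vderiv \<phi>) x + vderiv \<psi>c x * vderiv \<phi> x
        + (vderiv \<psi>c x * vderiv \<phi> x + vderiv (vderiv \<psi>c) x * \<phi> x))"
      unfolding d1 by (subst vderiv_add) (auto simp: vderiv_mult s smooth_mult)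
    have d3: "vderiv (\<lambda>x. vderiv \<psi>c x * \<phi> x) = (\<lambda>x. vderiv \<psi>c x * vderiv \<phi> x + vderiv (vderiv \<psi>c) x * \<phi> x)"
      by (rule vderiv_mult [OF s(2,3)])
    have it: "integrable lborel (\<lambda>x. h x * k x)" if "loc_integrable h" "test_function k" for h k
      using that by (rule integrable_loc_integrable_test)
    have tm: "test_function (\<lambda>x. \<psi>c x * vderiv \<phi> x)" by (intro test_function_mult c t')
    have "(\<integral>x. w x * vderiv (\<lambda>x. \<psi>c x * \<phi> x) x \<partial>lborel) =
        (\<integral>x. w x * (\<psi>c x * vderiv \<phi> x) \<partial>lborel) + (\<integral>x. w x * (vderiv \<psi>c x * \<phi> x) \<partial>lborel)"
      unfolding d1 distrib_left by (intro Bochner_Integration.integral_add it lw tm tt)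
    with D1 [OF tt(1)] have a1: "(\<integral>x. w x * (\<psi>c x * vderiv \<phi> x) \<partial>lborel) =
        - (\<integral>x. w1 x * (\<psi>c x * \<phi> x) \<partial>lborel) - (\<integral>x. w x * (vderiv \<psi>c x * \<phi> x) \<partial>lborel)" by (simp add: algebra_simps)
    have "(\<integral>x. (\<psi>c x * w1 x + vderiv \<psi>c x * w x) * \<phi> x \<partial>lborel) =
        (\<integral>x. w1 x * (\<psi>c x * \<phi> x) + w x * (vderiv \<psi>c x * \<phi> x) \<partial>lborel)" by (simp add: algebra_simps)
    also have "\<dots> = (\<integral>x. w1 x * (\<psi>c x * \<phi> x) \<partial>lborel) + (\<integral>x. w x * (vderiv \<psi>c x * \<phi> x) \<partial>lborel)"
      by (intro Bochner_Integration.integral_add it lw lw1 tt)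
    finally show "(\<integral>x. \<psi>c x * w x * vderiv \<phi> x \<partial>lborel) = - (\<integral>x. (\<psi>c x * w1 x + vderiv \<psi>c x * w x) * \<phi> x \<partial>lborel)"
      using a1 by (simp add: mult_ac)
    have tm'': "test_function (\<lambda>x. \<psi>c x * vderiv (vderiv \<phi>) x)" by (intro test_function_mult c t'')
    \<comment> \<open>With p the test function, (chi p)'' is written as chi p'' + 2 (chi' p)' -
      chi'' p. In this form the first-order term falls on the weak derivative of \<open>w\<close>,
      so only \<open>w\<close> and \<open>w1\<close> themselves occur.\<close>
    have "(\<integral>x. w x * vderiv (vderiv (\<lambda>x. \<psi>c x * \<phi> x)) x \<partial>lborel) =
        (\<integral>x. w x * (\<psi>c x * vderiv (vderiv \<phi>) x) + (2 * (w x * vderiv (\<lambda>x. vderiv \<psi>c x * \<phi> x) x) - w x * (vderiv (vderiv \<psi>c) x * \<phi> x)) \<partial>lborel)"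
      unfolding d2 d3 by (simp add: algebra_simps)
    also have "\<dots> = (\<integral>x. w x * (\<psi>c x * vderiv (vderiv \<phi>) x) \<partial>lborel) +
        ((\<integral>x. 2 * (w x * vderiv (\<lambda>x. vderiv \<psi>c x * \<phi> x) x) \<partial>lborel) - (\<integral>x. w x * (vderiv (vderiv \<psi>c) x * \<phi> x) \<partial>lborel))"
      by (subst Bochner_Integration.integral_add Bochner_Integration.integral_diff;
          (intro Bochner_Integration.integrable_diff integrable_mult_right it lw tm'' tt test_function_vderiv)?)+ simp
    also have "(\<integral>x. 2 * (w x * vderiv (\<lambda>x. vderiv \<psi>c x * \<phi> x) x) \<partial>lborel) = - 2 * (\<integral>x. w1 x * (vderiv \<psi>c x * \<phi> x) \<partial>lborel)"
      using D1 [OF tt(2)] by simp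
    finally have a2: "(\<integral>x. w x * vderiv (vderiv (\<lambda>x. \<psi>c x * \<phi> x)) x \<partial>lborel) =
        (\<integral>x. w x * (\<psi>c x * vderiv (vderiv \<phi>) x) \<partial>lborel) - 2 * (\<integral>x. w1 x * (vderiv \<psi>c x * \<phi> x) \<partial>lborel)
        - (\<integral>x. w x * (vderiv (vderiv \<psi>c) x * \<phi> x) \<partial>lborel)" by simp
    have a3: "(\<integral>x. Wr l * f x * (\<psi>c x * \<phi> x) \<partial>lborel) = Wr l * (\<integral>x. f x * (\<psi>c x * \<phi> x) \<partial>lborel)"
      by (simp add: mult.assoc)
    have "(\<integral>x. ((l\<^sup>2 * (\<psi>c x * w x) + Wr l * (\<psi>c x * f x)) - 2 * (vderiv \<psi>c x * w1 x) - vderiv (vderiv \<psi>c) x * w x) * \<phi> x \<partial>lborel)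
       = (\<integral>x. l\<^sup>2 * (w x * (\<psi>c x * \<phi> x)) + Wr l * (f x * (\<psi>c x * \<phi> x)) - 2 * (w1 x * (vderiv \<psi>c x * \<phi> x)) - w x * (vderiv (vderiv \<psi>c) x * \<phi> x) \<partial>lborel)"
      by (simp add: algebra_simps)
    also have "\<dots> = l\<^sup>2 * (\<integral>x. w x * (\<psi>c x * \<phi> x) \<partial>lborel) + Wr l * (\<integral>x. f x * (\<psi>c x * \<phi> x) \<partial>lborel)
        - 2 * (\<integral>x. w1 x * (vderiv \<psi>c x * \<phi> x) \<partial>lborel) - (\<integral>x. w x * (vderiv (vderiv \<psi>c) x * \<phi> x) \<partial>lborel)"
      using it [OF lw tt(1)] it [OF lf tt(1)] it [OF lw1 tt(2)] it [OF lw tt(3)] by simp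
    also have "\<dots> = - (\<integral>x. w x * (\<psi>c x * vderiv (vderiv \<phi>) x) \<partial>lborel) + I (\<lambda>y. w y * (\<psi>c y * \<phi> y))"
      using D2 [OF tt(1)] unfolding a2 a3 by (simp add: algebra_simps)
    finally show "- (\<integral>x. \<psi>c x * w x * vderiv (vderiv \<phi>) x \<partial>lborel) + I (\<lambda>x. \<psi>c x * w x * \<phi> x) =
       (\<integral>x. ((l\<^sup>2 * (\<psi>c x * w x) + Wr l * (\<psi>c x * f x)) - 2 * (vderiv \<psi>c x * w1 x) - vderiv (vderiv \<psi>c) x * w x) * \<phi> x \<partial>lborel)"
      by (simp add: mult_ac)
  qed
qed

lemma cut_linear: "cut (\<lambda>x. c * f x + g x) = (\<lambda>x. c * cut f x + cut g x)"
  by (auto simp: cut_def algebra_simps)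

lemma ub_linear:
  assumes "f \<in> L2" "g \<in> L2"
  shows "ub l (\<lambda>x. c * f x + g x) x = c * ub l f x + ub l g x"
  unfolding ub_def cut_linear bu_linear [OF cut_source [OF assms(1)] cut_source [OF assms(2)]]
  by (simp add: algebra_simps)

lemma ub_cong:
  assumes "ae_eq f g" "f \<in> L2" "g \<in> L2" shows "ub l f = ub l g"
proof -
  have "ae_eq (cut f) (cut g)" using assms(1) unfolding ae_eq_def cut_def by eventually_elim simp
  from bu_cong(1) [OF this] assms show ?thesis
    using cut_source [THEN source_borel] by (simp add: ub_def [abs_def])
qed

lemma ub_holomorphic:
  assumes "g \<in> L2"
  shows "(\<lambda>l. ub l g x) holomorphic_on A" "(\<lambda>l. ub1 l g x) holomorphic_on A" "(\<lambda>l. ub2 l g x) holomorphic_on A"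
  unfolding ub_def ub1_def ub2_def
  by (intro holomorphic_intros ent_holomorphic ent_bu [OF cut_source [OF assms]] ent_bu1 [OF cut_source [OF assms]]
      Wr_holomorphic)+

text \<open>The scalar \<open>k\<close> enters through the products with \<open>bu\<close>,
  \<open>bu1\<close> and \<open>Wr\<close> only. For k = 1/Wr the bounds can thus use the
  cancellation of \<open>Wr\<close>, while for a bounded factor they are read off directly.\<close>

lemma ub_pointwise:
  assumes D: "D \<ge> 1" "\<And>x. cmod (\<psi>c x) \<le> D * indicator {-L..L} x"
    "\<And>x. cmod (vderiv \<psi>c x) \<le> D * indicator {-L..L} x" "\<And>x. cmod (vderiv (vderiv \<psi>c) x) \<le> D * indicator {-L..L} x"
    and b: "b \<ge> 0" "\<And>x. \<bar>x\<bar> \<le> L \<Longrightarrow> cmod (k * bu (cut g) l x) \<le> b"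
    and b1: "b1 \<ge> 0" "\<And>x. \<bar>x\<bar> \<le> L \<Longrightarrow> cmod (k * bu1 (cut g) l x) \<le> b1"
    and W: "cmod (k * Wr l) \<le> W"
  shows "cmod (k * ub l g x) \<le> D * b * indicator {-L..L} x"
    "cmod (k * ub1 l g x) \<le> D * (b1 + b) * indicator {-L..L} x"
    "cmod (k * ub2 l g x) \<le> D * ((cmod l)\<^sup>2 * b + W + 2 * b1 + b) * (1 + cmod (g x)) * indicator {-L..L} x"
proof -
  show "cmod (k * ub l g x) \<le> D * b * indicator {-L..L} x"
    "cmod (k * ub1 l g x) \<le> D * (b1 + b) * indicator {-L..L} x"
    "cmod (k * ub2 l g x) \<le> D * ((cmod l)\<^sup>2 * b + W + 2 * b1 + b) * (1 + cmod (g x)) * indicator {-L..L} x"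
  proof (atomize (full), cases "x \<in> {-L..L}")
    case True
    then have x: "\<bar>x\<bar> \<le> L" by auto
    define p where "p = k * bu (cut g) l x" define q where "q = k * bu1 (cut g) l x"
    have p: "cmod p \<le> b" and q: "cmod q \<le> b1" unfolding p_def q_def by (intro b b1 x)+
    have d: "cmod (\<psi>c x) \<le> D" "cmod (vderiv \<psi>c x) \<le> D" "cmod (vderiv (vderiv \<psi>c) x) \<le> D"
      using D(2-4) [of x] True by simp_all
    have W0: "W \<ge> 0" using W norm_ge_zero order_trans by blast
    have 1: "cmod (\<psi>c x * p) \<le> D * b" unfolding norm_mult using d p D(1) by (intro mult_mono) auto
    have 2: "cmod (\<psi>c x * q) \<le> D * b1" unfolding norm_mult using d q D(1) by (intro mult_mono) auto
    have 3: "cmod (vderiv \<psi>c x * p) \<le> D * b" unfolding norm_mult using d p D(1) by (intro mult_mono) auto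
    have 4: "cmod (vderiv \<psi>c x * q) \<le> D * b1" unfolding norm_mult using d q D(1) by (intro mult_mono) auto
    have 5: "cmod (vderiv (vderiv \<psi>c) x * p) \<le> D * b" unfolding norm_mult using d p D(1) by (intro mult_mono) auto
    have 6: "cmod (\<psi>c x * (k * Wr l * cut g x)) \<le> D * (W * cmod (g x))"
      unfolding norm_mult [of "\<psi>c x"] norm_mult [of "k * Wr l"] using d D(1) W W0
      by (intro mult_mono cut_le) auto
    have "k * ub l g x = \<psi>c x * p" by (simp add: ub_def p_def)
    moreover have "k * ub1 l g x = \<psi>c x * q + vderiv \<psi>c x * p" by (simp add: ub1_def p_def q_def algebra_simps)
    moreover have "k * ub2 l g x = l\<^sup>2 * (\<psi>c x * p) + \<psi>c x * (k * Wr l * cut g x) - 2 * (vderiv \<psi>c x * q) - vderiv (vderiv \<psi>c) x * p"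
      by (simp add: ub2_def p_def q_def algebra_simps)
    moreover have "cmod (\<psi>c x * q + vderiv \<psi>c x * p) \<le> D * (b1 + b)"
      using norm_triangle_mono [OF 2 3] by (simp add: algebra_simps)
    moreover have "cmod (l\<^sup>2 * (\<psi>c x * p) + \<psi>c x * (k * Wr l * cut g x) - 2 * (vderiv \<psi>c x * q) - vderiv (vderiv \<psi>c) x * p)
        \<le> D * ((cmod l)\<^sup>2 * b + W + 2 * b1 + b) * (1 + cmod (g x))"
    proof -
      have "cmod (l\<^sup>2 * (\<psi>c x * p) + \<psi>c x * (k * Wr l * cut g x) - 2 * (vderiv \<psi>c x * q) - vderiv (vderiv \<psi>c) x * p)
          \<le> cmod (l\<^sup>2 * (\<psi>c x * p)) + cmod (\<psi>c x * (k * Wr l * cut g x)) + cmod (2 * (vderiv \<psi>c x * q)) + cmod (vderiv (vderiv \<psi>c) x * p)"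
        by (intro order_trans [OF norm_triangle_ineq4] add_right_mono order_trans [OF norm_triangle_ineq4] norm_triangle_ineq)
      also have "\<dots> \<le> (cmod l)\<^sup>2 * (D * b) + D * (W * cmod (g x)) + 2 * (D * b1) + D * b"
        using 4 by (intro add_mono 5 6) (auto simp: norm_mult [of "l\<^sup>2"] norm_power norm_mult [of 2] intro!: mult_left_mono 1)
      also have "\<dots> \<le> D * ((cmod l)\<^sup>2 * b + W + 2 * b1 + b) * (1 + cmod (g x))"
      proof -
        have "0 \<le> D * W" "0 \<le> D * ((cmod l)\<^sup>2 * b + 2 * b1 + b) * cmod (g x)"
          using D(1) W0 b(1) b1(1) by (auto intro!: mult_nonneg_nonneg add_nonneg_nonneg)
        then show ?thesis by (simp add: algebra_simps)
      qed
      finally show ?thesis .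
    qed
    ultimately show "cmod (k * ub l g x) \<le> D * b * indicator {-L..L} x \<and>
      cmod (k * ub1 l g x) \<le> D * (b1 + b) * indicator {-L..L} x \<and>
      cmod (k * ub2 l g x) \<le> D * ((cmod l)\<^sup>2 * b + W + 2 * b1 + b) * (1 + cmod (g x)) * indicator {-L..L} x"
      using True 1 by simp
  next
    case False
    then have "\<psi>c x = 0" "vderiv \<psi>c x = 0" "vderiv (vderiv \<psi>c) x = 0" using D(2-4) [of x] by auto
    then show "cmod (k * ub l g x) \<le> D * b * indicator {-L..L} x \<and>
      cmod (k * ub1 l g x) \<le> D * (b1 + b) * indicator {-L..L} x \<and>
      cmod (k * ub2 l g x) \<le> D * ((cmod l)\<^sup>2 * b + W + 2 * b1 + b) * (1 + cmod (g x)) * indicator {-L..L} x"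
      using False by (auto simp: ub_def ub1_def ub2_def indicator_def)
  qed
qed

text \<open>Uniformity over the unit ball of \<open>L2\<close> and over l in a disc is the input for
  holomorphy in operator norm. The kernel bound 2 L exp(2 L B) is crude but finite at l = 0.\<close>

lemma ub_local_bound:
  assumes "B \<ge> 0"
  obtains C where "C \<ge> 0"
    "\<And>l g x k. cmod l \<le> B \<Longrightarrow> g \<in> L2 \<Longrightarrow> L2_norm g \<le> 1 \<Longrightarrow> cmod k \<le> B \<Longrightarrow>
       cmod (k * ub l g x) \<le> C * indicator {-L..L} x \<and>
       cmod (k * ub1 l g x) \<le> C * indicator {-L..L} x \<and>
       cmod (k * ub2 l g x) \<le> C * (1 + cmod (g x)) * indicator {-L..L} x"
proof -
  obtain D where D: "D \<ge> 1" "\<And>x. cmod (\<psi>c x) \<le> D * indicator {-L..L} x"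
    "\<And>x. cmod (vderiv \<psi>c x) \<le> D * indicator {-L..L} x" "\<And>x. cmod (vderiv (vderiv \<psi>c) x) \<le> D * indicator {-L..L} x"
    using chi_bounds by metis
  show ?thesis
  proof (rule strip_bounds [OF R_le_L \<open>B \<ge> 0\<close>])
  fix K assume K: "K \<ge> 1"
    "\<And>l x. \<bar>Im l\<bar> \<le> B \<Longrightarrow> \<bar>x\<bar> \<le> L \<Longrightarrow> cmod (em l x) \<le> K"
    "\<And>l. \<bar>Im l\<bar> \<le> B \<Longrightarrow> cmod (Wr l - 2 * \<i> * l) \<le> K"
    "\<And>l x f s. \<bar>Im l\<bar> \<le> B \<Longrightarrow> \<bar>x\<bar> \<le> L \<Longrightarrow> source L f \<Longrightarrow> (\<And>t. \<bar>t\<bar> \<le> 2 * L \<Longrightarrow> cmod (Sp l t) \<le> s) \<Longrightarrow>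
       cmod (pv f l x) \<le> K * s * (\<integral>y. cmod (f y) \<partial>lborel)"
    "\<And>l f s. \<bar>Im l\<bar> \<le> B \<Longrightarrow> source L f \<Longrightarrow> (\<And>t. \<bar>t\<bar> \<le> 2 * L \<Longrightarrow> cmod (Sp l t) \<le> s) \<Longrightarrow>
       cmod (Nf f l) \<le> K * (1 + s) * (\<integral>y. cmod (f y) \<partial>lborel)"
  define s where "s = 2 * L * exp (B * (2 * L))"
  have s0: "s \<ge> 0" using L_pos by (simp add: s_def)
  define N where "N = 2 * L + 1"
  have N0: "N \<ge> 0" using L_pos by (simp add: N_def)
  define w where "w = 2 * B + K"
  have w0: "w \<ge> 0" using \<open>B \<ge> 0\<close> K(1) by (simp add: w_def)
  define b where "b = w * (K * s * N) + K * (1 + s) * N * K"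
  have b0: "b \<ge> 0" using w0 K(1) s0 N0 by (simp add: b_def)
  define b1 where "b1 = exp (2 * B * L) * (B * (K * (1 + s) * N) + mass * b + w * N)"
  have b10: "b1 \<ge> 0" using w0 K(1) s0 N0 b0 mass_pos \<open>B \<ge> 0\<close> by (simp add: b1_def)
  define C where "C = D * (B\<^sup>2 * (B * b) + B * w + 2 * (B * b1) + B * b)"
  have C0: "C \<ge> 0" using D(1) b0 b10 w0 \<open>B \<ge> 0\<close> by (simp add: C_def)
  show ?thesis
  proof (rule that [OF C0])
    fix l g x k
    assume l: "cmod l \<le> B" and g: "g \<in> L2" "L2_norm g \<le> 1" and k: "cmod k \<le> B"
    have Im: "\<bar>Im l\<bar> \<le> B" using l abs_Im_le_cmod order_trans by blast
    define f where "f = cut g"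
    have f: "source L f" unfolding f_def by (rule cut_source [OF g(1)])
    have fN: "(\<integral>y. cmod (f y) \<partial>lborel) \<le> N"
      unfolding N_def f_def using L_pos by (intro source_L1_bound [OF g cut_source [OF g(1)]] cut_le) auto
    have S: "cmod (Sp l t) \<le> s" if "\<bar>t\<bar> \<le> 2 * L" for t
    proof -
      have "\<bar>Im l\<bar> * max 0 t \<le> B * (2 * L)" using that Im L_pos by (intro mult_mono) auto
      then have "max 0 t * exp (\<bar>Im l\<bar> * max 0 t) \<le> 2 * L * exp (B * (2 * L))"
        using that L_pos by (intro mult_mono) auto
      then show ?thesis unfolding s_def by (rule order_trans [OF norm_Sp_le])
    qed
    have W: "cmod (Wr l) \<le> w"
    proof -
      have "cmod (Wr l) \<le> cmod (2 * \<i> * l) + cmod (Wr l - 2 * \<i> * l)" by (metis norm_triangle_sub)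
      then show ?thesis using K(3) [OF Im] l by (simp add: w_def norm_mult)
    qed
    have Nf: "cmod (Nf f l) \<le> K * (1 + s) * N"
      by (rule order_trans [OF K(5) [OF Im f S] mult_left_mono [OF fN]]) (use K(1) s0 in auto)
    have bu: "cmod (bu f l x) \<le> b" if x: "\<bar>x\<bar> \<le> L" for x
    proof -
      have "cmod (pv f l x) \<le> K * s * N"
        by (rule order_trans [OF K(4) [OF Im x f S] mult_left_mono [OF fN]]) (use K(1) s0 in auto)
      then have "cmod (Wr l * pv f l x) \<le> w * (K * s * N)" unfolding norm_mult using W w0 by (intro mult_mono) auto
      moreover have "cmod (Nf f l * em l x) \<le> K * (1 + s) * N * K"
        unfolding norm_mult using Nf K(2) [OF Im x] K(1) s0 N0 by (intro mult_mono) auto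
      ultimately show ?thesis unfolding bu_def b_def by (rule norm_triangle_mono)
    qed
    have sW: "source L (\<lambda>y. Wr l * f y)" using f by (auto simp: source_def)
    have bu1: "cmod (bu1 f l x) \<le> b1" if x: "\<bar>x\<bar> \<le> L" for x
    proof -
      have "(\<integral>y. cmod (Wr l * f y) \<partial>lborel) = cmod (Wr l) * (\<integral>y. cmod (f y) \<partial>lborel)" by (simp add: norm_mult)
      also have "\<dots> \<le> w * N" using W fN w0 by (intro mult_mono) auto
      finally have 1: "(\<integral>y. cmod (Wr l * f y) \<partial>lborel) \<le> w * N" .
      have "cmod (bu1 f l x) \<le> exp (2 * B * L) * (cmod l * cmod (Nf f l) + mass * b + (\<integral>y. cmod (Wr l * f y) \<partial>lborel))"
        unfolding bu1_def by (rule sol1_bound [OF R_le_L \<open>B \<ge> 0\<close> Im x sW bu]) (use R_le_L in auto)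
      also have "\<dots> \<le> b1"
        unfolding b1_def using l Nf 1 \<open>B \<ge> 0\<close> by (intro mult_left_mono add_mono mult_mono order_refl) auto
      finally show ?thesis .
    qed
    have kb: "cmod (k * z) \<le> B * M" if "cmod z \<le> M" for z M
      unfolding norm_mult using k that \<open>B \<ge> 0\<close> by (intro mult_mono) auto
    have "B * b \<ge> 0" "B * b1 \<ge> 0" using b0 b10 \<open>B \<ge> 0\<close> by auto
    note P = ub_pointwise [OF D this(1) kb [OF bu [unfolded f_def]] this(2) kb [OF bu1 [unfolded f_def]] kb [OF W], of x]
    have nn: "0 \<le> B\<^sup>2 * (B * b)" "0 \<le> B * w" using b0 w0 \<open>B \<ge> 0\<close> by auto
    have l2: "(cmod l)\<^sup>2 * (B * b) \<le> B\<^sup>2 * (B * b)" using l b0 \<open>B \<ge> 0\<close> by (intro mult_right_mono power_mono) auto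
    have "D * (B * b) \<le> C" "D * (B * b1 + B * b) \<le> C" "D * ((cmod l)\<^sup>2 * (B * b) + B * w + 2 * (B * b1) + B * b) \<le> C"
      unfolding C_def using D(1) nn l2 \<open>B * b \<ge> 0\<close> \<open>B * b1 \<ge> 0\<close> by (auto intro!: mult_left_mono)
    note c = this
    show "cmod (k * ub l g x) \<le> C * indicator {-L..L} x \<and>
       cmod (k * ub1 l g x) \<le> C * indicator {-L..L} x \<and>
       cmod (k * ub2 l g x) \<le> C * (1 + cmod (g x)) * indicator {-L..L} x"
    proof (intro conjI)
      show "cmod (k * ub l g x) \<le> C * indicator {-L..L} x"
        by (rule order_trans [OF P(1) mult_right_mono [OF c(1)]]) auto
      show "cmod (k * ub1 l g x) \<le> C * indicator {-L..L} x"
        by (rule order_trans [OF P(2) mult_right_mono [OF c(2)]]) auto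
      show "cmod (k * ub2 l g x) \<le> C * (1 + cmod (g x)) * indicator {-L..L} x"
        by (rule order_trans [OF P(3) mult_right_mono [OF mult_right_mono [OF c(3)]]]) auto
    qed
  qed
  qed
qed

end

section \<open>Holomorphy in operator norm with values in the domain\<close>

context cutoff_op
begin

lemma Hdata_zero: "Hdata (\<lambda>_. 0) (\<lambda>_. 0) (\<lambda>_. 0)"
  by (auto simp: Hdata_def L2_zero ess_bounded_def)

lemma Hdata_cmult: "Hdata u u1 u2 \<Longrightarrow> Hdata (\<lambda>x. c * u x) (\<lambda>x. c * u1 x) (\<lambda>x. c * u2 x)"
  using Hdata_linear [OF _ Hdata_zero, of u u1 u2 c] by simp

text \<open>Closedness of the domain under dominated pointwise limits. It is applied to difference
  quotients in l, so that the derivative of the family again takes values in the domain. Continuity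
  of the limit does not follow from domination and is supplied separately.\<close>

lemma Hdata_limit:
  assumes H: "\<And>n. Hdata (u n) (u1 n) (u2 n)" and g: "g \<in> L2" "L2_norm g \<le> 1" and "C \<ge> 0"
    and u: "\<And>n x. cmod (u n x) \<le> C * indicator {-L..L} x"
    and u1: "\<And>n x. cmod (u1 n x) \<le> C * indicator {-L..L} x"
    and u2: "\<And>n x. cmod (u2 n x) \<le> C * (1 + cmod (g x)) * indicator {-L..L} x"
    and v: "\<And>x. (\<lambda>n. u n x) \<longlonglongrightarrow> v x" and v1: "\<And>x. (\<lambda>n. u1 n x) \<longlonglongrightarrow> v1 x" and v2: "\<And>x. (\<lambda>n. u2 n x) \<longlonglongrightarrow> v2 x"
    and cont: "continuous_on UNIV v"
  shows "Hdata v v1 v2"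
proof -
  note A = H [unfolded Hdata_def]
  have um: "u n \<in> borel_measurable borel" "u1 n \<in> borel_measurable borel" "u2 n \<in> borel_measurable borel" for n
    using A [of n] by (auto intro: L2_borel)
  have vm: "v \<in> borel_measurable borel" "v1 \<in> borel_measurable borel" "v2 \<in> borel_measurable borel"
    by (rule borel_measurable_LIMSEQ_metric, rule um, rule v v1 v2)+
  have le: "C * indicator {-L..L} x \<le> C * (1 + cmod (g x)) * indicator {-L..L} x" for x :: real
    using \<open>C \<ge> 0\<close> by (auto simp: indicator_def mult_left_mono algebra_simps)
  have vb: "cmod (v x) \<le> C * indicator {-L..L} x" "cmod (v1 x) \<le> C * indicator {-L..L} x"
    "cmod (v2 x) \<le> C * (1 + cmod (g x)) * indicator {-L..L} x" for x
    by (rule LIMSEQ_le_const2 [OF tendsto_norm [OF v]], use u in blast)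
       (rule LIMSEQ_le_const2 [OF tendsto_norm [OF v1]], use u1 in blast,
        rule LIMSEQ_le_const2 [OF tendsto_norm [OF v2]], use u2 in blast)
  have C1: "C * indicator {-L..L} x \<le> C" for x :: real using \<open>C \<ge> 0\<close> by (simp add: indicator_def)
  define G where "G x = complex_of_real (C * (1 + cmod (g x)) * indicator {-L..L} x)" for x
  have [measurable]: "g \<in> borel_measurable borel" using g by measurable
  have G: "G \<in> L2"
  proof (rule L2_dominated(1) [OF g _ \<open>C \<ge> 0\<close> less_imp_le [OF L_pos]])
    show "G \<in> borel_measurable borel" unfolding G_def by measurable
    show "cmod (G x) \<le> C * (1 + cmod (g x)) * indicator {-L..L} x" for x
      unfolding G_def norm_of_real using \<open>C \<ge> 0\<close> by simp
  qed
  have lim: "(\<lambda>n. \<integral>x. h n x * \<phi> x \<partial>lborel) \<longlonglongrightarrow> (\<integral>x. k x * \<phi> x \<partial>lborel)"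
    if t: "test_function \<phi>" and h: "\<And>n. h n \<in> borel_measurable borel" "k \<in> borel_measurable borel"
      "\<And>n x. cmod (h n x) \<le> C * (1 + cmod (g x)) * indicator {-L..L} x" "\<And>x. (\<lambda>n. h n x) \<longlonglongrightarrow> k x"
    for h k \<phi>
  proof (rule integral_dominated_convergence)
    have [measurable]: "\<phi> \<in> borel_measurable borel" by (rule test_function_borel [OF t])
    note [measurable] = h(1,2)
    show "integrable lborel (\<lambda>x. norm (G x * \<phi> x))"
      by (intro integrable_norm L2_integrable_mult G L2_test_function t)
    show "AE x in lborel. norm (h n x * \<phi> x) \<le> norm (G x * \<phi> x)" for n
    proof (intro AE_I2)
      fix x
      have "cmod (h n x) \<le> cmod (G x)"
        unfolding G_def norm_of_real using h(3) [of n x] by linarith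
      then show "norm (h n x * \<phi> x) \<le> norm (G x * \<phi> x)" by (simp add: norm_mult mult_right_mono)
    qed
    show "AE x in lborel. (\<lambda>n. h n x * \<phi> x) \<longlonglongrightarrow> k x * \<phi> x" by (intro AE_I2 tendsto_intros h)
    show "(\<lambda>x. k x * \<phi> x) \<in> borel_measurable lborel" "(\<lambda>x. h n x * \<phi> x) \<in> borel_measurable lborel" for n
      by measurable
  qed
  note limu = lim [OF _ um(1) vm(1) order_trans [OF u le] v]
  note limu1 = lim [OF _ um(2) vm(2) order_trans [OF u1 le] v1]
  note limu2 = lim [OF _ um(3) vm(3) u2 v2]
  show ?thesis
    unfolding Hdata_def
  proof (intro conjI allI impI cont)
    show "bounded (range v)" using order_trans [OF vb(1) C1] by (auto simp: bounded_iff)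
    show "v \<in> L2" "v1 \<in> L2" by (rule L2_bounded_support [OF vm(1) vb(1)] L2_bounded_support [OF vm(2) vb(2)])+
    show "ess_bounded v1" using order_trans [OF vb(2) C1] vm(2) by (auto simp: ess_bounded_def)
    show "v2 \<in> L2" by (rule L2_dominated [OF g vm(3) \<open>C \<ge> 0\<close> less_imp_le [OF L_pos] vb(3)])
    fix \<phi> :: "real \<Rightarrow> complex" assume t: "test_function \<phi>"
    note t' = test_function_vderiv [OF t] note t'' = test_function_vderiv [OF t']
    have "(\<lambda>n. \<integral>x. u n x * vderiv \<phi> x \<partial>lborel) = (\<lambda>n. - (\<integral>x. u1 n x * \<phi> x \<partial>lborel))" using A t by blast
    with limu [OF t'] tendsto_minus [OF limu1 [OF t]]
    show "(\<integral>x. v x * vderiv \<phi> x \<partial>lborel) = - (\<integral>x. v1 x * \<phi> x \<partial>lborel)" by (simp add: LIMSEQ_unique)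
    obtain B where B: "B > 0" "\<And>x. cmod (\<phi> x) \<le> B" using test_function_bounded [OF t] by metis
    have "(\<lambda>n. I (\<lambda>x. u n x * \<phi> x)) \<longlonglongrightarrow> I (\<lambda>x. v x * \<phi> x)"
    proof (rule I_lim [where B = "C * B"])
      have [measurable]: "\<phi> \<in> borel_measurable borel" by (rule test_function_borel [OF t])
      note [measurable] = um vm
      show "(\<lambda>x. u n x * \<phi> x) \<in> borel_measurable borel" "(\<lambda>x. v x * \<phi> x) \<in> borel_measurable borel" for n by measurable
      show "cmod (u n y * \<phi> y) \<le> C * B" for n y
        unfolding norm_mult using B \<open>C \<ge> 0\<close> order_trans [OF u C1] by (intro mult_mono) auto
      show "(\<lambda>n. u n y * \<phi> y) \<longlonglongrightarrow> v y * \<phi> y" for y by (intro tendsto_intros v)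
    qed
    from tendsto_add [OF tendsto_minus [OF limu [OF t'']] this]
    have "(\<lambda>n. \<integral>x. u2 n x * \<phi> x \<partial>lborel) \<longlonglongrightarrow> - (\<integral>x. v x * vderiv (vderiv \<phi>) x \<partial>lborel) + I (\<lambda>x. v x * \<phi> x)"
      using A t by simp
    with limu2 [OF t] show "- (\<integral>x. v x * vderiv (vderiv \<phi>) x \<partial>lborel) + I (\<lambda>x. v x * \<phi> x) = (\<integral>x. v2 x * \<phi> x \<partial>lborel)"
      by (simp add: LIMSEQ_unique)
  qed
qed

lemma graph_norm_dominated:
  assumes H: "Hdata u u1 u2" and g: "g \<in> L2" "L2_norm g \<le> 1" and "C \<ge> 0"
    and u: "\<And>x. cmod (u x) \<le> C * indicator {-L..L} x"
    and u2: "\<And>x. cmod (u2 x) \<le> C * (1 + cmod (g x)) * indicator {-L..L} x"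
  shows "graph_norm V u \<le> ennreal (2 * C * (2 * L + 2))"
proof -
  have le: "C * indicator {-L..L} x \<le> C * (1 + cmod (g x)) * indicator {-L..L} x" for x :: real
    using \<open>C \<ge> 0\<close> by (auto simp: indicator_def mult_left_mono algebra_simps)
  have m: "u \<in> borel_measurable borel" "u2 \<in> borel_measurable borel" using H by (auto simp: Hdata_def intro: L2_borel)
  have 1: "L2_norm u \<le> C * (2 * L + 2)"
    by (rule L2_dominated(2) [OF g m(1) \<open>C \<ge> 0\<close> less_imp_le [OF L_pos] order_trans [OF u le]])
  have 2: "L2_norm u2 \<le> C * (2 * L + 2)"
    by (rule L2_dominated(2) [OF g m(2) \<open>C \<ge> 0\<close> less_imp_le [OF L_pos] u2])
  have "sqrt ((L2_norm u2)\<^sup>2 + (L2_norm u)\<^sup>2) \<le> L2_norm u2 + L2_norm u"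
    using L2_norm_nonneg by (intro sqrt_sum_squares_le_sum) auto
  then show ?thesis unfolding graph_norm_Hdata [OF H] using 1 2 by (intro ennreal_leI) simp
qed

text \<open>At each x the three functions \<open>ub\<close>, \<open>ub1\<close>, \<open>ub2\<close>
  are holomorphic in l. Cauchy estimates at fixed x bound the Taylor remainder by the same
  dominating functions times |w - w0|, and integration gives the bound in graph norm, uniformly over
  the unit ball. The factor \<open>k\<close> later becomes 1/Wr, the inverse of the cofactor at a
  zero, or 1.\<close>

lemma holomorphic_family_ub:
  assumes k: "k holomorphic_on ball z r"
  shows "holomorphic_family (graph_norm V) (ball z r) (\<lambda>l g x. k l * ub l g x)"
  unfolding holomorphic_family_def
proof
  fix w0 assume w0: "w0 \<in> ball z r"
  obtain \<rho> where \<rho>: "\<rho> > 0" "cball w0 \<rho> \<subseteq> ball z r" using w0 by (meson open_ball open_contains_cball)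
  have "bounded (k ` cball w0 \<rho>)"
    by (intro compact_imp_bounded compact_continuous_image holomorphic_on_imp_continuous_on
        holomorphic_on_subset [OF k \<rho>(2)]) auto
  then obtain M where M: "\<And>l. l \<in> cball w0 \<rho> \<Longrightarrow> cmod (k l) \<le> M" unfolding bounded_iff by blast
  define B where "B = \<bar>M\<bar> + cmod w0 + \<rho>"
  have "B \<ge> 0" using \<rho>(1) by (simp add: B_def)
  obtain C where C: "C \<ge> 0"
    "\<And>l g x k. cmod l \<le> B \<Longrightarrow> g \<in> L2 \<Longrightarrow> L2_norm g \<le> 1 \<Longrightarrow> cmod k \<le> B \<Longrightarrow>
       cmod (k * ub l g x) \<le> C * indicator {-L..L} x \<and>
       cmod (k * ub1 l g x) \<le> C * indicator {-L..L} x \<and>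
       cmod (k * ub2 l g x) \<le> C * (1 + cmod (g x)) * indicator {-L..L} x"
    using ub_local_bound [OF \<open>B \<ge> 0\<close>] by blast
  have lB: "cmod l \<le> B" "cmod (k l) \<le> B" if "l \<in> ball w0 \<rho>" for l
  proof -
    have "cmod l \<le> cmod w0 + cmod (l - w0)" by (metis norm_triangle_sub)
    then show "cmod l \<le> B" using that by (simp add: B_def dist_norm norm_minus_commute)
    have "cmod (k l) \<le> M" using M [of l] that by simp
    then show "cmod (k l) \<le> B" using \<rho>(1) norm_ge_zero [of w0] unfolding B_def by linarith
  qed
  define S where "S x = C * indicator {-L..L} x" for x :: real
  define S2 where "S2 g x = C * (1 + cmod (g x)) * indicator {-L..L} x" for g and x :: real
  have bd: "cmod (k l * ub l g x) \<le> S x" "cmod (k l * ub1 l g x) \<le> S x" "cmod (k l * ub2 l g x) \<le> S2 g x"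
    if "l \<in> ball w0 \<rho>" "g \<in> L2" "L2_norm g \<le> 1" for l g x
    using C(2) [OF lB(1) [OF that(1)] that(2,3) lB(2) [OF that(1)], of x] by (auto simp: S_def S2_def)
  have k': "k holomorphic_on ball w0 \<rho>" using \<rho>(2) by (intro holomorphic_on_subset [OF k]) auto
  have hol: "(\<lambda>l. k l * ub l g x) holomorphic_on ball w0 \<rho>" "(\<lambda>l. k l * ub1 l g x) holomorphic_on ball w0 \<rho>"
    "(\<lambda>l. k l * ub2 l g x) holomorphic_on ball w0 \<rho>" if "g \<in> L2" for g x
    by (intro holomorphic_on_mult k' ub_holomorphic that)+
  \<comment> \<open>The candidate for the operator derivative, taken pointwise in x, with its
    companions for the first derivative and the image under the operator.\<close>
  define T' where "T' g x = deriv (\<lambda>l. k l * ub l g x) w0" for g x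
  define T1' where "T1' g x = deriv (\<lambda>l. k l * ub1 l g x) w0" for g x
  define T2' where "T2' g x = deriv (\<lambda>l. k l * ub2 l g x) w0" for g x
  have HT: "Hdata (\<lambda>x. k l * ub l g x) (\<lambda>x. k l * ub1 l g x) (\<lambda>x. k l * ub2 l g x)" if "g \<in> L2" for l g
    by (rule Hdata_cmult [OF cutoff_Hdata [OF that]])
  have HQ: "Hdata (\<lambda>x. (k w * ub w g x - k w0 * ub w0 g x) / (w - w0))
      (\<lambda>x. (k w * ub1 w g x - k w0 * ub1 w0 g x) / (w - w0)) (\<lambda>x. (k w * ub2 w g x - k w0 * ub2 w0 g x) / (w - w0))"
    if g: "g \<in> L2" for w g
    using Hdata_cmult [OF Hdata_linear [OF HT [OF g, of w0] HT [OF g, of w], of "-1"], of "1 / (w - w0)"] by simp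
  have Qb: "cmod ((k w * ub w g x - k w0 * ub w0 g x) / (w - w0)) \<le> 4 / \<rho> * S x"
    "cmod ((k w * ub1 w g x - k w0 * ub1 w0 g x) / (w - w0)) \<le> 4 / \<rho> * S x"
    "cmod ((k w * ub2 w g x - k w0 * ub2 w0 g x) / (w - w0)) \<le> 4 / \<rho> * S2 g x"
    if g: "g \<in> L2" "L2_norm g \<le> 1" and w: "w \<in> ball w0 (\<rho>/2)" "w \<noteq> w0" for w g x
  proof -
    have q: "cmod ((h w - h w0) / (w - w0)) \<le> 4 / \<rho> * M"
      if "h holomorphic_on ball w0 \<rho>" "\<And>l. l \<in> ball w0 \<rho> \<Longrightarrow> cmod (h l) \<le> M" for h M
      using holomorphic_lipschitz [OF that w(1) \<rho>(1)] w(2) by (simp add: norm_divide divide_le_eq)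
    show "cmod ((k w * ub w g x - k w0 * ub w0 g x) / (w - w0)) \<le> 4 / \<rho> * S x"
      by (rule q [OF hol(1) [OF g(1)]]) (rule bd(1) [OF _ g])
    show "cmod ((k w * ub1 w g x - k w0 * ub1 w0 g x) / (w - w0)) \<le> 4 / \<rho> * S x"
      by (rule q [OF hol(2) [OF g(1)]]) (rule bd(2) [OF _ g])
    show "cmod ((k w * ub2 w g x - k w0 * ub2 w0 g x) / (w - w0)) \<le> 4 / \<rho> * S2 g x"
      by (rule q [OF hol(3) [OF g(1)]]) (rule bd(3) [OF _ g])
  qed
  have Qd: "cmod ((k w * ub w g x - k w0 * ub w0 g x) / (w - w0) - T' g x) \<le> 32 / \<rho>\<^sup>2 * cmod (w - w0) * S x"
    "cmod ((k w * ub1 w g x - k w0 * ub1 w0 g x) / (w - w0) - T1' g x) \<le> 32 / \<rho>\<^sup>2 * cmod (w - w0) * S x"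
    "cmod ((k w * ub2 w g x - k w0 * ub2 w0 g x) / (w - w0) - T2' g x) \<le> 32 / \<rho>\<^sup>2 * cmod (w - w0) * S2 g x"
    if g: "g \<in> L2" "L2_norm g \<le> 1" and w: "w \<in> ball w0 (\<rho>/4)" "w \<noteq> w0" for w g x
  proof -
    have q: "cmod ((h w - h w0) / (w - w0) - deriv h w0) \<le> 32 / \<rho>\<^sup>2 * cmod (w - w0) * M"
      if "h holomorphic_on ball w0 \<rho>" "\<And>l. l \<in> ball w0 \<rho> \<Longrightarrow> cmod (h l) \<le> M" for h M
      using holomorphic_quotient_bound [OF that w \<rho>(1)] by (simp add: mult_ac)
    show "cmod ((k w * ub w g x - k w0 * ub w0 g x) / (w - w0) - T' g x) \<le> 32 / \<rho>\<^sup>2 * cmod (w - w0) * S x"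
      unfolding T'_def by (rule q [OF hol(1) [OF g(1)]]) (rule bd(1) [OF _ g])
    show "cmod ((k w * ub1 w g x - k w0 * ub1 w0 g x) / (w - w0) - T1' g x) \<le> 32 / \<rho>\<^sup>2 * cmod (w - w0) * S x"
      unfolding T1'_def by (rule q [OF hol(2) [OF g(1)]]) (rule bd(2) [OF _ g])
    show "cmod ((k w * ub2 w g x - k w0 * ub2 w0 g x) / (w - w0) - T2' g x) \<le> 32 / \<rho>\<^sup>2 * cmod (w - w0) * S2 g x"
      unfolding T2'_def by (rule q [OF hol(3) [OF g(1)]]) (rule bd(3) [OF _ g])
  qed
  \<comment> \<open>Any sequence tending to \<open>w0\<close> through the quarter ball would do; it
    realizes the pointwise derivatives as limits of difference quotients.\<close>
  define X where "X n = w0 + of_real (\<rho> / (8 * real (Suc n)))" for n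
  have Xw: "cmod (X n - w0) = \<rho> / (8 * real (Suc n))" for n
    using \<rho>(1) by (simp add: X_def norm_divide norm_mult del: of_nat_Suc)
  have X: "X n \<noteq> w0" "X n \<in> ball w0 (\<rho>/4)" "X n \<in> ball w0 (\<rho>/2)" for n
  proof -
    have "4 < 8 * real (Suc n)" by simp
    with \<rho>(1) have "\<rho> / (8 * real (Suc n)) < \<rho> / 4" by (intro divide_strict_left_mono) auto
    moreover have "\<rho> / (8 * real (Suc n)) > 0" using \<rho>(1) by (intro divide_pos_pos) auto
    ultimately show "X n \<noteq> w0" "X n \<in> ball w0 (\<rho>/4)" "X n \<in> ball w0 (\<rho>/2)"
      using Xw [of n] \<rho>(1) by (auto simp: dist_norm norm_minus_commute)
  qed
  have X0: "(\<lambda>n. 32 / \<rho>\<^sup>2 * cmod (X n - w0) * c) \<longlonglongrightarrow> 0" for c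
    unfolding Xw by real_asymp
  have S_le: "S x \<le> C" "S x \<ge> 0" for x using C(1) by (auto simp: S_def indicator_def)
  have HT': "Hdata (T' g) (T1' g) (T2' g)" if g: "g \<in> L2" "L2_norm g \<le> 1" for g
  proof (rule Hdata_limit [OF HQ [OF g(1), of "X _"] g, where C = "4 / \<rho> * C"])
    show "4 / \<rho> * C \<ge> 0" using \<rho>(1) C(1) by simp
    show "cmod ((k (X n) * ub (X n) g x - k w0 * ub w0 g x) / (X n - w0)) \<le> 4 / \<rho> * C * indicator {-L..L} x"
      "cmod ((k (X n) * ub1 (X n) g x - k w0 * ub1 w0 g x) / (X n - w0)) \<le> 4 / \<rho> * C * indicator {-L..L} x"
      "cmod ((k (X n) * ub2 (X n) g x - k w0 * ub2 w0 g x) / (X n - w0)) \<le> 4 / \<rho> * C * (1 + cmod (g x)) * indicator {-L..L} x" for n x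
      using Qb [OF g X(3,1), of n x] by (simp_all add: S_def S2_def mult.assoc)
    show "(\<lambda>n. (k (X n) * ub (X n) g x - k w0 * ub w0 g x) / (X n - w0)) \<longlonglongrightarrow> T' g x" for x
      by (rule Lim_transform [OF _ Lim_null_comparison [OF always_eventually X0], OF tendsto_const])
         (use Qd(1) [OF g X(2,1)] in \<open>auto simp: norm_minus_commute\<close>)
    show "(\<lambda>n. (k (X n) * ub1 (X n) g x - k w0 * ub1 w0 g x) / (X n - w0)) \<longlonglongrightarrow> T1' g x" for x
      by (rule Lim_transform [OF _ Lim_null_comparison [OF always_eventually X0], OF tendsto_const])
         (use Qd(2) [OF g X(2,1)] in \<open>auto simp: norm_minus_commute\<close>)
    show "(\<lambda>n. (k (X n) * ub2 (X n) g x - k w0 * ub2 w0 g x) / (X n - w0)) \<longlonglongrightarrow> T2' g x" for x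
      by (rule Lim_transform [OF _ Lim_null_comparison [OF always_eventually X0], OF tendsto_const])
         (use Qd(3) [OF g X(2,1)] in \<open>auto simp: norm_minus_commute\<close>)
    \<comment> \<open>The Taylor remainder is bounded uniformly in x by a multiple of |X n - w0|, so
      the continuous difference quotients converge uniformly.\<close>
    show "continuous_on UNIV (T' g)"
    proof (rule uniform_limit_theorem [where F = sequentially])
      show "\<forall>\<^sub>F n in sequentially. continuous_on UNIV (\<lambda>x. (k (X n) * ub (X n) g x - k w0 * ub w0 g x) / (X n - w0))"
        using HQ [OF g(1)] by (auto simp: Hdata_def)
      show "uniform_limit UNIV (\<lambda>n x. (k (X n) * ub (X n) g x - k w0 * ub w0 g x) / (X n - w0)) (T' g) sequentially"
      proof (rule uniform_limitI)
        fix e :: real assume "e > 0"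
        with X0 [of C] have "\<forall>\<^sub>F n in sequentially. 32 / \<rho>\<^sup>2 * cmod (X n - w0) * C < e"
          by (rule order_tendstoD)
        then show "\<forall>\<^sub>F n in sequentially. \<forall>x\<in>UNIV. dist ((k (X n) * ub (X n) g x - k w0 * ub w0 g x) / (X n - w0)) (T' g x) < e"
        proof eventually_elim
          case (elim n)
          have "32 / \<rho>\<^sup>2 * cmod (X n - w0) * S x \<le> 32 / \<rho>\<^sup>2 * cmod (X n - w0) * C" for x
            by (intro mult_left_mono S_le) auto
          then show ?case using Qd(1) [OF g X(2,1)] elim unfolding dist_norm by (meson le_less_trans order_trans UNIV_I)
        qed
      qed
    qed simp
  qed
  have T'b: "cmod (T' g x) \<le> 4 / \<rho> * C * indicator {-L..L} x" "cmod (T2' g x) \<le> 4 / \<rho> * C * (1 + cmod (g x)) * indicator {-L..L} x"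
    if g: "g \<in> L2" "L2_norm g \<le> 1" for g x
  proof -
    have w0: "w0 \<in> ball w0 (\<rho>/2)" using \<rho>(1) by simp
    have "cmod (T' g x) \<le> 4 * S x / \<rho>"
      unfolding T'_def by (rule holomorphic_deriv_bound [OF hol(1) [OF g(1)] _ w0 \<rho>(1)]) (rule bd(1) [OF _ g])
    then show "cmod (T' g x) \<le> 4 / \<rho> * C * indicator {-L..L} x" by (simp add: S_def mult.assoc)
    have "cmod (T2' g x) \<le> 4 * S2 g x / \<rho>"
      unfolding T2'_def by (rule holomorphic_deriv_bound [OF hol(3) [OF g(1)] _ w0 \<rho>(1)]) (rule bd(3) [OF _ g])
    then show "cmod (T2' g x) \<le> 4 / \<rho> * C * (1 + cmod (g x)) * indicator {-L..L} x" by (simp add: S2_def mult.assoc)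
  qed
  have op_le: "op_norm (graph_norm V) Z \<le> ennreal (2 * c * (2 * L + 2))"
    if "c \<ge> 0" "\<And>g. g \<in> L2 \<Longrightarrow> L2_norm g \<le> 1 \<Longrightarrow> \<exists>u1 u2. Hdata (Z g) u1 u2 \<and>
         (\<forall>x. cmod (Z g x) \<le> c * indicator {-L..L} x) \<and> (\<forall>x. cmod (u2 x) \<le> c * (1 + cmod (g x)) * indicator {-L..L} x)" for Z c
    unfolding op_norm_def
  proof (rule SUP_least)
    fix g assume "g \<in> {f \<in> L2. L2_norm f \<le> 1}"
    then have g: "g \<in> L2" "L2_norm g \<le> 1" by auto
    with that(2) obtain u1 u2 where "Hdata (Z g) u1 u2" "\<And>x. cmod (Z g x) \<le> c * indicator {-L..L} x"
      "\<And>x. cmod (u2 x) \<le> c * (1 + cmod (g x)) * indicator {-L..L} x" by blast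
    then show "graph_norm V (Z g) \<le> ennreal (2 * c * (2 * L + 2))"
      by (intro graph_norm_dominated [OF _ g that(1)])
  qed
  have "bounded_op (graph_norm V) (\<lambda>g x. k w0 * ub w0 g x)"
    unfolding bounded_op_def
  proof (intro conjI ballI allI impI)
    fix f g :: "real \<Rightarrow> complex" and c assume fg: "f \<in> L2" "g \<in> L2"
    show "ae_eq (\<lambda>x. k w0 * ub w0 f x) (\<lambda>x. k w0 * ub w0 g x)" if "ae_eq f g"
      unfolding ub_cong [OF that fg] by simp
    show "ae_eq (\<lambda>x. k w0 * ub w0 (\<lambda>x. c * f x + g x) x) (\<lambda>x. c * (k w0 * ub w0 f x) + k w0 * ub w0 g x)"
      unfolding ub_linear [OF fg] by (simp add: algebra_simps)
  next
    have "op_norm (graph_norm V) (\<lambda>g x. k w0 * ub w0 g x) \<le> ennreal (2 * C * (2 * L + 2))"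
    proof (rule op_le [OF C(1)])
      fix g assume g: "g \<in> L2" "L2_norm g \<le> 1"
      have "w0 \<in> ball w0 \<rho>" using \<rho>(1) by simp
      with HT [OF g(1), of w0] bd(1,3) [OF this g]
      show "\<exists>u1 u2. Hdata (\<lambda>x. k w0 * ub w0 g x) u1 u2 \<and> (\<forall>x. cmod (k w0 * ub w0 g x) \<le> C * indicator {-L..L} x) \<and>
          (\<forall>x. cmod (u2 x) \<le> C * (1 + cmod (g x)) * indicator {-L..L} x)"
        unfolding S_def S2_def by blast
    qed
    then show "op_norm (graph_norm V) (\<lambda>g x. k w0 * ub w0 g x) < \<infinity>" by (simp add: le_less_trans)
  qed
  moreover have "bounded_op (graph_norm V) T'"
    unfolding bounded_op_def
  proof (intro conjI ballI allI impI)
    fix f g :: "real \<Rightarrow> complex" and c assume fg: "f \<in> L2" "g \<in> L2"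
    show "ae_eq (T' f) (T' g)" if "ae_eq f g"
    proof -
      have "T' f = T' g" unfolding T'_def using ub_cong [OF that fg] by simp
      then show ?thesis by simp
    qed
    have "T' (\<lambda>x. c * f x + g x) x = c * T' f x + T' g x" for x
    proof -
      have d: "(\<lambda>l. k l * ub l h x) field_differentiable at w0" if "h \<in> L2" for h
        by (rule holomorphic_on_imp_differentiable_at [OF hol(1) [OF that]]) (use \<rho>(1) in auto)
      have "(\<lambda>l. k l * ub l (\<lambda>x. c * f x + g x) x) = (\<lambda>l. c * (k l * ub l f x) + k l * ub l g x)"
        unfolding ub_linear [OF fg] by (simp add: algebra_simps)
      then show ?thesis unfolding T'_def using d [OF fg(1)] d [OF fg(2)]
        by (simp add: deriv_add deriv_cmult field_differentiable_mult)
    qed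
    then have "T' (\<lambda>x. c * f x + g x) = (\<lambda>x. c * T' f x + T' g x)" by blast
    then show "ae_eq (T' (\<lambda>x. c * f x + g x)) (\<lambda>x. c * T' f x + T' g x)" by simp
  next
    have "op_norm (graph_norm V) T' \<le> ennreal (2 * (4 / \<rho> * C) * (2 * L + 2))"
    proof (rule op_le)
      show "0 \<le> 4 / \<rho> * C" using C(1) \<rho>(1) by simp
      fix g assume g: "g \<in> L2" "L2_norm g \<le> 1"
      show "\<exists>u1 u2. Hdata (T' g) u1 u2 \<and> (\<forall>x. cmod (T' g x) \<le> 4 / \<rho> * C * indicator {-L..L} x) \<and>
          (\<forall>x. cmod (u2 x) \<le> 4 / \<rho> * C * (1 + cmod (g x)) * indicator {-L..L} x)"
        using HT' [OF g] T'b [OF g] by blast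
    qed
    then show "op_norm (graph_norm V) T' < \<infinity>" by (simp add: le_less_trans)
  qed
  moreover have "((\<lambda>w. op_norm (graph_norm V) (\<lambda>g x. (k w * ub w g x - k w0 * ub w0 g x) / (w - w0) - T' g x)) \<longlongrightarrow> 0) (at w0 within ball z r)"
  proof (rule tendsto_sandwich [where f = "\<lambda>_. 0"
        and h = "\<lambda>w. ennreal (2 * (32 / \<rho>\<^sup>2 * cmod (w - w0) * C) * (2 * L + 2))"])
    have "((\<lambda>w. 2 * (32 / \<rho>\<^sup>2 * cmod (w - w0) * C) * (2 * L + 2)) \<longlongrightarrow> 2 * (32 / \<rho>\<^sup>2 * cmod (w0 - w0) * C) * (2 * L + 2)) (at w0 within ball z r)"
      by (intro tendsto_intros)
    then have "((\<lambda>w. ennreal (2 * (32 / \<rho>\<^sup>2 * cmod (w - w0) * C) * (2 * L + 2))) \<longlongrightarrow> ennreal 0) (at w0 within ball z r)"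
      by (intro tendsto_ennrealI) simp
    then show "((\<lambda>w. ennreal (2 * (32 / \<rho>\<^sup>2 * cmod (w - w0) * C) * (2 * L + 2))) \<longlongrightarrow> 0) (at w0 within ball z r)" by simp
    have "\<forall>\<^sub>F w in at w0 within ball z r. w \<in> ball w0 (\<rho>/4) \<and> w \<noteq> w0"
      unfolding eventually_at_filter
      using eventually_nhds_in_open [of "ball w0 (\<rho>/4)" w0] \<rho>(1) by (auto elim: eventually_mono)
    then show "\<forall>\<^sub>F w in at w0 within ball z r. op_norm (graph_norm V) (\<lambda>g x. (k w * ub w g x - k w0 * ub w0 g x) / (w - w0) - T' g x)
        \<le> ennreal (2 * (32 / \<rho>\<^sup>2 * cmod (w - w0) * C) * (2 * L + 2))"
    proof eventually_elim
      case (elim w)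
      show ?case
      proof (rule op_le)
        show "0 \<le> 32 / \<rho>\<^sup>2 * cmod (w - w0) * C" using C(1) by simp
        fix g assume g: "g \<in> L2" "L2_norm g \<le> 1"
        have "Hdata (\<lambda>x. (k w * ub w g x - k w0 * ub w0 g x) / (w - w0) - T' g x)
            (\<lambda>x. (k w * ub1 w g x - k w0 * ub1 w0 g x) / (w - w0) - T1' g x)
            (\<lambda>x. (k w * ub2 w g x - k w0 * ub2 w0 g x) / (w - w0) - T2' g x)"
          using Hdata_linear [OF HT' [OF g] HQ [OF g(1), of w], of "-1"] by simp
        then show "\<exists>u1 u2. Hdata (\<lambda>x. (k w * ub w g x - k w0 * ub w0 g x) / (w - w0) - T' g x) u1 u2 \<and>
           (\<forall>x. cmod ((k w * ub w g x - k w0 * ub w0 g x) / (w - w0) - T' g x) \<le> 32 / \<rho>\<^sup>2 * cmod (w - w0) * C * indicator {-L..L} x) \<and>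
           (\<forall>x. cmod (u2 x) \<le> 32 / \<rho>\<^sup>2 * cmod (w - w0) * C * (1 + cmod (g x)) * indicator {-L..L} x)"
          using Qd(1,3) [OF g, of w] elim unfolding S_def S2_def mult.assoc by blast
      qed
    qed
  qed (auto intro: always_eventually)
  ultimately show "bounded_op (graph_norm V) (\<lambda>g x. k w0 * ub w0 g x) \<and>
    (\<exists>A'. bounded_op (graph_norm V) A' \<and>
      ((\<lambda>w. op_norm (graph_norm V) (\<lambda>f x. (k w * ub w f x - k w0 * ub w0 f x) / (w - w0) - A' f x)) \<longlongrightarrow> 0) (at w0 within ball z r))"
    by blast
qed

subsection \<open>The meromorphic continuation\<close>

text \<open>At a zero of \<open>Wr\<close> the convention inverse 0 = 0 gives the value 0, which is
  harmless because the value of a meromorphic family at a pole is arbitrary.\<close>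

definition A0 :: "complex \<Rightarrow> operator" where "A0 l g x = inverse (Wr l) * ub l g x"

lemma A0_regular:
  assumes "Wr z \<noteq> 0" shows "regular_at (graph_norm V) A0 z"
proof -
  have "open {l. Wr l \<noteq> 0}"
    by (intro open_Collect_neq holomorphic_on_imp_continuous_on [OF Wr_holomorphic] continuous_intros)
  then obtain r where r: "r > 0" "ball z r \<subseteq> {l. Wr l \<noteq> 0}" 
    using openE [of "{l. Wr l \<noteq> 0}" z] assms by blast
  have "(\<lambda>l. inverse (Wr l)) holomorphic_on ball z r"
    using r(2) by (intro holomorphic_on_inverse Wr_holomorphic) auto
  from holomorphic_family_ub [OF this] have "holomorphic_family (graph_norm V) (ball z r) A0"
    by (simp add: A0_def [abs_def])
  with r(1) show ?thesis unfolding regular_at_def by blast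
qed

text \<open>At a zero of \<open>Wr\<close> only the term \<open>Nf f z * em z\<close> survives; a source on the right of the support makes it nonzero.\<close>

lemma ub_nonzero:
  assumes W: "Wr z = 0"
  obtains g where "g \<in> L2" "\<not> ae_eq (ub z g) (\<lambda>_. 0)"
proof -
  \<comment> \<open>The source sits in the gap where the cutoff is 1 and the measure has no mass.
    Its phase cancels exp(i z y), so its moment is the length R1 - R, which is nonzero.\<close>
  define g where "g y = indicator {R<..<R1} y * exp (- \<i> * z * of_real y)" for y
  have em: "continuous_on UNIV (\<lambda>y. exp (- \<i> * z * complex_of_real y))" by (rule continuous_e)
  have [measurable]: "(\<lambda>y. exp (- \<i> * z * complex_of_real y)) \<in> borel_measurable borel" by (rule continuous_UNIV_borel [OF em])
  have gm [measurable]: "g \<in> borel_measurable borel" unfolding g_def by measurable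
  obtain B where B: "B \<ge> 0" "\<And>y. \<bar>y\<bar> \<le> L \<Longrightarrow> cmod (exp (- \<i> * z * complex_of_real y)) \<le> B"
    using continuous_bounded_on_interval [OF em] by blast
  have gL: "g \<in> L2"
  proof (rule L2_bounded_support [OF gm])
    fix x
    show "cmod (g x) \<le> B * indicator {-L..L} x"
    proof (cases "x \<in> {R<..<R1}")
      case True
      then have "x \<in> {-L..L}" "\<bar>x\<bar> \<le> L" using R_less R_pos by auto
      then show ?thesis using True B(2) [of x] by (simp add: g_def norm_mult)
    qed (use B(1) in \<open>simp add: g_def\<close>)
  qed
  have cg: "cut g = g"
    using psi_one R_pos by (auto simp: cut_def g_def \<psi>c_def fun_eq_iff indicator_def)
  have sg: "source L g" using cut_source [OF gL] by (simp add: cg)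
  have "- (\<integral>y. Sp z (x - y) * g y \<partial>lborel) = 0" if "\<bar>x\<bar> \<le> R" for x
  proof -
    have "Sp z (x - y) * g y = 0" for y using that by (auto simp: g_def Sp_def indicator_def max_def)
    then show ?thesis unfolding \<open>\<And>y. Sp z (x - y) * g y = 0\<close> by simp
  qed
  then have pv0: "pv g z y = 0" if "\<bar>y\<bar> \<le> R" for y
    unfolding pv_def using Vol_vanish [OF continuous_hf [OF sg]] that by blast
  have "I (\<lambda>y. exp (\<i> * z * of_real y) * pv g z y) = I (\<lambda>_. 0)"
    by (rule I_cong) (auto simp: pv0 intro!: continuous_UNIV_borel continuous_on_mult continuous_e continuous_pv [OF sg])
  moreover have "(\<integral>y. exp (\<i> * z * of_real y) * g y \<partial>lborel) = of_real (R1 - R)"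
  proof -
    have "exp (\<i> * z * of_real y) * g y = of_real (indicator {R<..<R1} y)" for y
      by (simp add: g_def indicator_def exp_add [symmetric])
    then show ?thesis using R_less by simp
  qed
  ultimately have N: "Nf g z = - of_real (R1 - R)" by (simp add: Nf_def)
  \<comment> \<open>At -R1, left of the measure and inside the region where the cutoff is 1, the
    Jost solution is a plain exponential and hence nonzero.\<close>
  have "ub z g (- R1) \<noteq> 0"
    using R_less R_pos N W psi_one [of "- R1"] em_left [of "- R1" z]
    by (simp add: ub_def cg bu_def \<psi>c_def)
  moreover have "continuous_on UNIV (ub z g)" using cutoff_Hdata [OF gL] by (simp add: Hdata_def)
  ultimately have "\<not> ae_eq (ub z g) (\<lambda>_. 0)"
    using ae_eq_continuous_imp_eq [of "ub z g" "\<lambda>_. 0"] by auto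
  with gL show ?thesis by (rule that)
qed

text \<open>Writing Wr = (w - z)^n h with h nonvanishing near z, the numerator family is
  \<open>ub\<close> divided by h; its value at z is nonzero by \<open>ub_nonzero\<close>. A zero of
  finite order exists because \<open>Wr\<close> vanishes at z but not at 1.\<close>

lemma A0_pole:
  assumes W: "Wr z = 0" shows "pole_at (graph_norm V) A0 z"
proof -
  have "\<not> Wr constant_on UNIV"
    using W Wr_real_nonzero [of 1] by (metis UNIV_I constant_on_def zero_neq_one)
  then obtain h r n where n: "0 < (n::nat)" and r: "0 < r" and h: "h holomorphic_on ball z r"
    "\<And>w. w \<in> ball z r \<Longrightarrow> Wr w = (w - z) ^ n * h w" "\<And>w. w \<in> ball z r \<Longrightarrow> h w \<noteq> 0"
    using holomorphic_factor_zero_nonconstant [OF Wr_holomorphic open_UNIV connected_UNIV UNIV_I W] by metis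
  have "(\<lambda>l. inverse (h l)) holomorphic_on ball z r" using h by (intro holomorphic_on_inverse) auto
  note fam = holomorphic_family_ub [OF this]
  obtain g where g: "g \<in> L2" "\<not> ae_eq (ub z g) (\<lambda>_. 0)" by (rule ub_nonzero [OF W])
  have "\<not> ae_eq (\<lambda>x. inverse (h z) * ub z g x) (\<lambda>_. 0)"
    using g(2) h(3) [of z] r by (simp add: ae_eq_def)
  then have "\<not> (\<forall>f\<in>L2. ae_eq (\<lambda>x. inverse (h z) * ub z f x) (\<lambda>x. 0))" using g(1) by blast
  moreover have "\<forall>w\<in>ball z r - {z}. \<forall>f\<in>L2. ae_eq (A0 w f) (\<lambda>x. inverse (h w) * ub w f x / (w - z) ^ n)"
    using h(2) by (auto simp: A0_def [abs_def] field_simps)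
  ultimately show ?thesis unfolding pole_at_def using fam r n by blast
qed

lemma A0_meromorphic: "meromorphic_family (graph_norm V) A0"
  unfolding meromorphic_family_def using A0_regular A0_pole by blast

text \<open>At a zero of \<open>Wr\<close> the Jost solution is itself outgoing. In the upper
  half-plane it then decays on both sides and is an eigenfunction.\<close>

lemma Wr_nonzero:
  assumes l: "Im l > 0" and ne: "\<not> op_eigenvalue V (l\<^sup>2)" shows "Wr l \<noteq> 0"
proof
  assume W: "Wr l = 0"
  have "Hdata (em l) (sol1 l 1 (em l) (\<lambda>_. 0)) (\<lambda>x. l\<^sup>2 * em l x + 0)"
    by (rule outgoing_Hdata [OF continuous_em source_0 L2_zero em_outgoing [OF W] l order_refl em_sol])
  moreover have "\<not> ae_eq (em l) (\<lambda>_. 0)"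
    using ae_eq_continuous_imp_eq [OF continuous_em [of l], of "\<lambda>_. 0"] em_left [of "- R" l] by auto
  ultimately show False using ne op_eigenvalue_Hdata by auto
qed

text \<open>Dividing the outgoing solution by the Wronskian gives a solution in the domain with
  source \<open>cut g\<close>, which the resolvent must reproduce.\<close>

lemma A0_resolvent:
  fixes g :: "real \<Rightarrow> complex"
  assumes l: "Im l > 0" and ne: "\<not> op_eigenvalue V (l\<^sup>2)" and g: "g \<in> L2"
  shows "ae_eq (A0 l g) (\<lambda>x. \<psi> x * resolvent V (l\<^sup>2) (\<lambda>y. \<psi> y * g y) x)"
proof -
  note W = Wr_nonzero [OF l ne]
  have f: "source L (cut g)" "cut g \<in> L2" by (intro cut_source cut_L2 g)+
  have sW: "source L (\<lambda>y. Wr l * cut g y)" using f(1) by (auto simp: source_def)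
  have H: "Hdata (bu (cut g) l) (sol1 l (Nf (cut g) l) (bu (cut g) l) (\<lambda>y. Wr l * cut g y)) (\<lambda>x. l\<^sup>2 * bu (cut g) l x + Wr l * cut g x)"
    by (rule outgoing_Hdata [OF continuous_bu [OF f(1)] sW L2_cmult [OF f(2)] bu_outgoing [OF f(1)] l R_le_L bu_sol [OF f(1)]])
  have "Hdata (\<lambda>x. inverse (Wr l) * bu (cut g) l x)
     (\<lambda>x. inverse (Wr l) * sol1 l (Nf (cut g) l) (bu (cut g) l) (\<lambda>y. Wr l * cut g y) x)
     (\<lambda>x. l\<^sup>2 * (inverse (Wr l) * bu (cut g) l x) + cut g x)"
  proof -
    have "(\<lambda>x. inverse (Wr l) * (l\<^sup>2 * bu (cut g) l x + Wr l * cut g x)) = (\<lambda>x. l\<^sup>2 * (inverse (Wr l) * bu (cut g) l x) + cut g x)"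
      using W by (auto simp: field_simps)
    then show "Hdata (\<lambda>x. inverse (Wr l) * bu (cut g) l x)
       (\<lambda>x. inverse (Wr l) * sol1 l (Nf (cut g) l) (bu (cut g) l) (\<lambda>y. Wr l * cut g y) x)
       (\<lambda>x. l\<^sup>2 * (inverse (Wr l) * bu (cut g) l x) + cut g x)"
      using Hdata_cmult [OF H, of "inverse (Wr l)"] by simp
  qed
  from resolvent_eq(1) [OF ne this]
  have "ae_eq (resolvent V (l\<^sup>2) (\<lambda>y. \<psi> y * g y)) (\<lambda>x. inverse (Wr l) * bu (cut g) l x)"
    by (simp add: cut_def [abs_def] \<psi>c_def)
  then show ?thesis unfolding ae_eq_def by (auto elim!: eventually_mono simp: A0_def ub_def \<psi>c_def)
qed

lemma A0_continues: "continues_cutoff_resolvent V \<psi> A0"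
  unfolding continues_cutoff_resolvent_def using A0_meromorphic A0_resolvent by blast

end

section \<open>Uniqueness of the continuation\<close>

text \<open>A pairing estimate that is linear in the norm of \<open>u\<close>, obtained from |g u|
  <= t |g|^2 + |u|^2/t with t the norm of \<open>u\<close>. Only the smallness as \<open>u\<close>
  tends to 0 matters for the limits taken below.\<close>

lemma L2_pairing_bound:
  assumes g: "g \<in> L2" and u: "u \<in> L2"
  shows "cmod (\<integral>x. g x * u x \<partial>lborel) \<le> ((L2_norm g)\<^sup>2 + 1) * L2_norm u"
proof (cases "L2_norm u = 0")
  case True
  then have "(\<integral>x. (cmod (u x))\<^sup>2 \<partial>lborel) = 0" using L2_norm_square [of u] by simp
  then have "AE x in lborel. (cmod (u x))\<^sup>2 = 0"
    using L2_integrable [OF u] by (simp add: integral_nonneg_eq_0_iff_AE)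
  then have "AE x in lborel. g x * u x = 0" by eventually_elim simp
  then have "(\<integral>x. g x * u x \<partial>lborel) = 0" by (rule integral_eq_zero_AE)
  then show ?thesis using True by simp
next
  case False
  define t where "t = L2_norm u"
  have t: "t > 0" using False L2_norm_nonneg [of u] by (simp add: t_def)
  have "cmod (\<integral>x. g x * u x \<partial>lborel) \<le> (\<integral>x. norm (g x * u x) \<partial>lborel)" by (rule integral_norm_bound)
  also have "\<dots> \<le> (\<integral>x. t * (cmod (g x))\<^sup>2 + (1 / t) * (cmod (u x))\<^sup>2 \<partial>lborel)"
  proof (rule integral_mono)
    show "integrable lborel (\<lambda>x. norm (g x * u x))" by (intro integrable_norm L2_integrable_mult g u)
    show "integrable lborel (\<lambda>x. t * (cmod (g x))\<^sup>2 + (1 / t) * (cmod (u x))\<^sup>2)"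
      by (intro Bochner_Integration.integrable_add integrable_mult_right L2_integrable g u)
    fix x
    have "2 * (t * cmod (g x) * cmod (u x)) \<le> (t * cmod (g x))\<^sup>2 + (cmod (u x))\<^sup>2"
      by (rule two_mult_le_squares)
    moreover have "0 \<le> t * cmod (g x) * cmod (u x)" using t by simp
    ultimately have "t * cmod (g x) * cmod (u x) \<le> (t * cmod (g x))\<^sup>2 + (cmod (u x))\<^sup>2" by linarith
    also have "\<dots> = t * (t * (cmod (g x))\<^sup>2 + (1 / t) * (cmod (u x))\<^sup>2)"
      using t by (simp add: power_mult_distrib power2_eq_square algebra_simps)
    finally have "t * (cmod (g x) * cmod (u x)) \<le> t * (t * (cmod (g x))\<^sup>2 + (1 / t) * (cmod (u x))\<^sup>2)" by (simp only: mult.assoc)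
    then show "norm (g x * u x) \<le> t * (cmod (g x))\<^sup>2 + (1 / t) * (cmod (u x))\<^sup>2"
      using t by (simp add: norm_mult)
  qed
  also have "\<dots> = t * (L2_norm g)\<^sup>2 + (1 / t) * (L2_norm u)\<^sup>2"
    unfolding L2_norm_square using L2_integrable [OF g] L2_integrable [OF u] by simp
  also have "\<dots> = ((L2_norm g)\<^sup>2 + 1) * L2_norm u"
    using t by (simp add: t_def power2_eq_square field_simps)
  finally show ?thesis .
qed

text \<open>Pairing \<open>u\<close> with its own complex conjugate gives the squared norm.\<close>

lemma L2_pairing_zero:
  assumes "u \<in> L2" "\<And>g. g \<in> L2 \<Longrightarrow> (\<integral>x. g x * u x \<partial>lborel) = 0"
  shows "ae_eq u (\<lambda>_. 0)"
proof -
  have "(\<integral>x. complex_of_real ((cmod (u x))\<^sup>2) \<partial>lborel) = 0"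
    using assms(2) [OF L2_cnj [OF assms(1)]] by (simp only: complex_norm_square mult.commute)
  then have "(\<integral>x. (cmod (u x))\<^sup>2 \<partial>lborel) = 0" by (simp only: integral_complex_of_real of_real_eq_0_iff)
  then have "AE x in lborel. (cmod (u x))\<^sup>2 = 0"
    using L2_integrable [OF assms(1)] by (simp add: integral_nonneg_eq_0_iff_AE)
  then show ?thesis by (simp add: ae_eq_def)
qed

text \<open>
  The value of a meromorphic family at a pole is arbitrary, hence possibly not measurable, so
  the pairing is taken with a representative.
\<close>

definition pair :: "(real \<Rightarrow> complex) \<Rightarrow> (real \<Rightarrow> complex) \<Rightarrow> complex" where
  "pair g u = (\<integral>x. g x * (SOME h. h \<in> L2 \<and> ae_eq u h) x \<partial>lborel)"

lemma pair_eq: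
  assumes "h \<in> L2" "ae_eq u h" "g \<in> L2" shows "pair g u = (\<integral>x. g x * h x \<partial>lborel)"
proof -
  define k where "k = (SOME h. h \<in> L2 \<and> ae_eq u h)"
  have k: "k \<in> L2" "ae_eq u k"
    using someI [where P = "\<lambda>h. h \<in> L2 \<and> ae_eq u h" and x = h] assms by (auto simp: k_def)
  have "ae_eq k h" using k(2) assms(2) ae_eq_sym ae_eq_trans by blast
  then have "(\<integral>x. k x * g x \<partial>lborel) = (\<integral>x. h x * g x \<partial>lborel)"
    by (intro ae_eq_integral_mult L2_borel k assms)
  then show ?thesis by (simp add: pair_def k_def mult.commute)
qed

lemma L2_norm_cmult: "L2_norm (\<lambda>x. c * f x) = cmod c * L2_norm f"
  by (simp add: L2_norm_def norm_mult power_mult_distrib real_sqrt_mult)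

lemma graph_norm_finite: "graph_norm V u < \<infinity> \<Longrightarrow> u \<in> op_domain V"
  by (auto simp: graph_norm_def split: if_splits)

lemma L2_norm_le_graph_norm: "ennreal (L2_norm u) \<le> graph_norm V u"
  using real_sqrt_le_mono [of "(L2_norm u)\<^sup>2" "(L2_norm (schrodinger V u))\<^sup>2 + (L2_norm u)\<^sup>2"] L2_norm_nonneg [of u]
  by (auto simp: graph_norm_def intro!: ennreal_leI)

lemma op_norm_ge: "f \<in> L2 \<Longrightarrow> L2_norm f \<le> 1 \<Longrightarrow> N (T f) \<le> op_norm N T"
  unfolding op_norm_def by (rule SUP_upper) simp

lemma bounded_op_domain:
  assumes "bounded_op (graph_norm V) T" "f \<in> L2" "L2_norm f \<le> 1"
  shows "T f \<in> op_domain V"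
proof (rule graph_norm_finite)
  show "graph_norm V (T f) < \<infinity>"
  proof (rule le_less_trans [OF op_norm_ge [OF assms(2,3)]])
    show "op_norm (graph_norm V) T < \<infinity>" using assms(1) unfolding bounded_op_def by blast
  qed
qed

text \<open>The graph norm dominates the \<open>L2\<close> norm, so operator differentiability
  implies differentiability of each scalar pairing. The source stays in the unit ball, the set over
  which \<open>op_norm\<close> is formed.\<close>

lemma pairing_holomorphic:
  assumes B: "holomorphic_family (graph_norm V) S B" and S: "open S"
    and f: "f \<in> L2" "L2_norm f \<le> 1" and g: "g \<in> L2"
  shows "(\<lambda>w. \<integral>x. g x * B w f x \<partial>lborel) holomorphic_on S"
proof (rule holomorphic_onI)
  fix z assume z: "z \<in> S"
  obtain A' where A': "bounded_op (graph_norm V) A'"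
    and lim: "((\<lambda>w. op_norm (graph_norm V) (\<lambda>f x. (B w f x - B z f x) / (w - z) - A' f x)) \<longlongrightarrow> 0) (at z within S)"
    using B z unfolding holomorphic_family_def by blast
  have BL: "B w f \<in> L2" if "w \<in> S" for w
  proof -
    have "bounded_op (graph_norm V) (B w)" using B that unfolding holomorphic_family_def by blast
    from op_domain_L2 [OF bounded_op_domain [OF this f]] show ?thesis .
  qed
  have AL: "A' f \<in> L2" by (rule op_domain_L2 [OF bounded_op_domain [OF A' f]])
  define F where "F w = (\<integral>x. g x * B w f x \<partial>lborel)" for w
  define D where "D = (\<integral>x. g x * A' f x \<partial>lborel)"
  define K where "K = (L2_norm g)\<^sup>2 + 1"
  have K: "K > 0" by (simp add: K_def add_nonneg_pos)
  have "((\<lambda>w. (F w - F z) / (w - z)) \<longlongrightarrow> D) (at z within S)"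
  proof (rule tendstoI)
    fix e :: real assume "e > 0"
    then have "0 < ennreal (e / K)" using K by simp
    with lim have "\<forall>\<^sub>F w in at z within S. op_norm (graph_norm V) (\<lambda>f x. (B w f x - B z f x) / (w - z) - A' f x) < ennreal (e / K)"
      by (rule order_tendstoD)
    moreover have "\<forall>\<^sub>F w in at z within S. w \<in> S \<and> w \<noteq> z" by (simp add: eventually_at_filter)
    ultimately show "\<forall>\<^sub>F w in at z within S. dist ((F w - F z) / (w - z)) D < e"
    proof eventually_elim
      case (elim w)
      define u where "u x = (B w f x - B z f x) / (w - z) - A' f x" for x
      have uL: "u \<in> L2"
        unfolding u_def using L2_diff [OF L2_cmult [OF L2_diff [OF BL BL], of w z "1 / (w - z)"] AL] elim z by simp
      have "ennreal (L2_norm u) \<le> graph_norm V u" by (rule L2_norm_le_graph_norm)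
      also have "\<dots> \<le> op_norm (graph_norm V) (\<lambda>f x. (B w f x - B z f x) / (w - z) - A' f x)"
        using op_norm_ge [OF f, of "graph_norm V" "\<lambda>f x. (B w f x - B z f x) / (w - z) - A' f x"] by (simp add: u_def [abs_def])
      also have "\<dots> < ennreal (e / K)" using elim by blast
      finally have "L2_norm u < e / K" using L2_norm_nonneg by (simp add: ennreal_less_iff)
      then have le: "K * L2_norm u < e" using K by (simp add: field_simps)
      have i: "integrable lborel (\<lambda>x. g x * h x)" if "h \<in> L2" for h by (rule L2_integrable_mult [OF g that])
      have "(\<integral>x. g x * u x \<partial>lborel) = (\<integral>x. (g x * B w f x - g x * B z f x) / (w - z) - g x * A' f x \<partial>lborel)"
        by (simp add: u_def algebra_simps diff_divide_distrib)
      also have "\<dots> = (F w - F z) / (w - z) - D"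
        using i [OF BL [of w]] i [OF BL [of z]] i [OF AL] elim z by (simp add: F_def D_def)
      finally have "cmod ((F w - F z) / (w - z) - D) \<le> K * L2_norm u"
        using L2_pairing_bound [OF g uL] by (simp add: K_def)
      then show ?case using le by (simp add: dist_norm)
    qed
  qed
  then show "(\<lambda>w. \<integral>x. g x * B w f x \<partial>lborel) field_differentiable at z within S"
    unfolding field_differentiable_def has_field_derivative_iff F_def [symmetric] by blast
qed

text \<open>
  The set of points near which the two sides agree is open and, by the isolation of zeros, closed.
\<close>

lemma meromorphic_identity:
  fixes F E W :: "complex \<Rightarrow> complex"
  assumes W: "W holomorphic_on UNIV" and E: "E holomorphic_on UNIV"
    and F: "\<And>z. \<exists>r>0. \<exists>n H. H holomorphic_on ball z r \<and> (\<forall>w\<in>ball z r - {z}. F w = H w / (w - z) ^ n)"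
    and U: "open U" "U \<noteq> {}" "\<And>w. w \<in> U \<Longrightarrow> W w * F w = E w"
  shows "eventually (\<lambda>w. W w * F w = E w) (at z)"
proof -
  define P where "P w \<longleftrightarrow> W w * F w = E w" for w
  define S where "S = {z. eventually P (at z)}"
  \<comment> \<open>A property that holds on a punctured disc about z holds near every other point
    of that disc; this gives openness both for agreement and for disagreement.\<close>
  have spread: "\<exists>d>0. \<forall>w\<in>ball z d. eventually Q (at w) \<or> w = z" if ev: "eventually Q (at z)" for Q and z :: complex
  proof -
    obtain d where d: "d > 0" "\<forall>w\<in>UNIV. w \<noteq> z \<and> dist w z < d \<longrightarrow> Q w"
      using ev unfolding eventually_at by blast
    have "eventually Q (at w)" if "w \<in> ball z d" "w \<noteq> z" for w
    proof -
      have "open (ball z d - {z})" by auto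
      then have "eventually (\<lambda>v. v \<in> ball z d - {z}) (at w)" using that by (intro eventually_at_in_open') auto
      then show ?thesis by eventually_elim (use d(2) in \<open>auto simp: dist_commute\<close>)
    qed
    then show ?thesis using d(1) by blast
  qed
  have "open S"
    unfolding open_contains_ball
  proof
    fix z assume z: "z \<in> S"
    then obtain d where "d > 0" "\<forall>w\<in>ball z d. eventually P (at w) \<or> w = z" using spread [of P z] by (auto simp: S_def)
    then show "\<exists>e>0. ball z e \<subseteq> S" using z by (intro exI [of _ d]) (auto simp: S_def)
  qed
  moreover have "open (- S)"
    unfolding open_contains_ball
  proof
    fix z assume z: "z \<in> - S"
    obtain r n H where r: "r > 0" and H: "H holomorphic_on ball z r" "\<And>w. w \<in> ball z r - {z} \<Longrightarrow> F w = H w / (w - z) ^ n"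
      using F by blast
    \<comment> \<open>Multiplication by (w - z)^n clears the possible pole: off z, the zeros of the
      holomorphic \<open>p\<close> are exactly the points of agreement. Either \<open>p\<close>
      vanishes identically or it has no zero in some punctured disc about z.\<close>
    define p where "p w = W w * H w - E w * (w - z) ^ n" for w
    have p: "p holomorphic_on ball z r"
      unfolding p_def by (intro holomorphic_intros H holomorphic_on_subset [OF W] holomorphic_on_subset [OF E]) auto
    have Pp: "P w \<longleftrightarrow> p w = 0" if "w \<in> ball z r - {z}" for w
    proof -
      have "H w = F w * (w - z) ^ n" using H(2) [OF that] that by simp
      then have "p w = (W w * F w - E w) * (w - z) ^ n" by (simp add: p_def algebra_simps)
      then show ?thesis using that by (simp add: P_def)
    qed
    have near: "eventually (\<lambda>w. w \<in> ball z r - {z}) (at z)"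
      using eventually_at_in_open [of "ball z r" z] r by simp
    have "eventually (\<lambda>w. p w \<noteq> 0) (at z)"
    proof (cases "p z = 0")
      case False
      have "isCont p z" using p r by (metis centre_in_ball holomorphic_on_imp_continuous_on continuous_on_interior interior_ball)
      then have "p \<midarrow>z\<rightarrow> p z" by (simp add: isCont_def)
      with False show ?thesis by (rule tendsto_imp_eventually_ne [rotated])
    next
      case True
      obtain w where w: "w \<in> ball z r" "p w \<noteq> 0"
      proof (rule ccontr)
        assume "\<not> thesis"
        with that have "\<And>w. w \<in> ball z r \<Longrightarrow> p w = 0" by blast
        with near Pp have "eventually P (at z)" by (auto elim!: eventually_mono)
        with z show False by (simp add: S_def)
      qed
      then obtain s where "0 < s" "ball z s \<subseteq> ball z r" "\<And>v. v \<in> ball z s - {z} \<Longrightarrow> p v \<noteq> 0"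
        using isolated_zeros [OF p open_ball connected_ball, of z w] True r by (metis centre_in_ball)
      then show ?thesis using eventually_at_in_open [of "ball z s" z] by (auto elim!: eventually_mono)
    qed
    with near have "eventually (\<lambda>w. \<not> P w) (at z)" by eventually_elim (simp add: Pp)
    then obtain d where d: "d > 0" "\<forall>w\<in>ball z d. eventually (\<lambda>w. \<not> P w) (at w) \<or> w = z" using spread by blast
    have "w \<notin> S" if "w \<in> ball z d" for w
    proof
      assume "w \<in> S"
      then have "eventually P (at w)" by (simp add: S_def)
      moreover have "eventually (\<lambda>w. \<not> P w) (at w)" using d(2) that z \<open>w \<in> S\<close> by blast
      ultimately have "eventually (\<lambda>_. False) (at w)" by eventually_elim simp
      then show False by simp
    qed
    then show "\<exists>e>0. ball z e \<subseteq> - S" using d(1) by blast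
  qed
  moreover obtain u where "u \<in> U" using U(2) by blast
  then have "eventually (\<lambda>w. w \<in> U) (at u)" using U(1) by (intro eventually_at_in_open') auto
  then have "eventually P (at u)" unfolding P_def by eventually_elim (rule U(3))
  then have "S \<noteq> {}" by (auto simp: S_def)
  moreover have "connected (UNIV :: complex set)" by (rule connected_UNIV)
  ultimately have "S = UNIV"
    using connectedD [of UNIV S "- S"] by blast
  then have "z \<in> S" by simp
  then show ?thesis unfolding S_def P_def by simp
qed

section \<open>Every continuation coincides with the constructed family off the zeros of the
  Wronskian\<close>

context cutoff_op
begin

text \<open>Pairing with fixed functions reduces the operator statement to scalar meromorphic
  functions, which satisfy Wr F = E near every point by the identity theorem. Where
  \<open>Wr\<close> is nonzero this excludes a pole of the continuation and determines its
  value.\<close>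

lemma continuation_unique:
  assumes A: "continues_cutoff_resolvent V \<psi> A" and W: "Wr z \<noteq> 0"
  shows "regular_at (graph_norm V) A z"
    and "\<And>f. f \<in> L2 \<Longrightarrow> L2_norm f \<le> 1 \<Longrightarrow> ae_eq (A z f) (A0 z f)"
proof -
  have mero: "regular_at (graph_norm V) A z \<or> pole_at (graph_norm V) A z" for z
    using A by (auto simp: continues_cutoff_resolvent_def meromorphic_family_def)
  define F where "F f g w = pair g (A w f)" for f g w
  define E where "E f g w = (\<integral>x. g x * ub w f x \<partial>lborel)" for f g :: "real \<Rightarrow> complex" and w
  have E_hol: "E f g holomorphic_on UNIV" if f: "f \<in> L2" "L2_norm f \<le> 1" and g: "g \<in> L2" for f g
  proof (rule holomorphic_on_UNIV_balls)
    fix r :: real assume "r > 0"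
    have "holomorphic_family (graph_norm V) (ball 0 r) (\<lambda>l g x. 1 * ub l g x)" by (rule holomorphic_family_ub) auto
    then have "holomorphic_family (graph_norm V) (ball 0 r) ub" by simp
    from pairing_holomorphic [OF this open_ball f g] show "E f g holomorphic_on ball 0 r" by (simp add: E_def [abs_def])
  qed
  have fam_L2: "B w f \<in> L2" if "holomorphic_family (graph_norm V) S B" "w \<in> S" "f \<in> L2" "L2_norm f \<le> 1" for B S w f
  proof -
    have "bounded_op (graph_norm V) (B w)" using that(1,2) unfolding holomorphic_family_def by blast
    from op_domain_L2 [OF bounded_op_domain [OF this that(3,4)]] show ?thesis .
  qed
  have F_reg: "F f g w = (\<integral>x. g x * A w f x \<partial>lborel)"
    if "holomorphic_family (graph_norm V) S A" "w \<in> S" "f \<in> L2" "L2_norm f \<le> 1" "g \<in> L2" for S f g w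
    unfolding F_def by (rule pair_eq [OF fam_L2 [OF that(1-4)] ae_eq_refl that(5)])
  have F_pole: "F f g w = (\<integral>x. g x * B w f x \<partial>lborel) / (w - z) ^ n"
    if B: "holomorphic_family (graph_norm V) S B" "w \<in> S" and AB: "ae_eq (A w f) (\<lambda>x. B w f x / (w - z) ^ n)"
      and f: "f \<in> L2" "L2_norm f \<le> 1" "g \<in> L2" for S B f g w z n
  proof -
    have "(\<lambda>x. B w f x / (w - z) ^ n) \<in> L2"
      using L2_cmult [OF fam_L2 [OF B f(1,2)], of "1 / (w - z) ^ n"] by simp
    from pair_eq [OF this AB f(3)] show ?thesis by (simp add: F_def)
  qed
  have F_loc: "\<exists>r>0. \<exists>n H. H holomorphic_on ball z r \<and> (\<forall>w\<in>ball z r - {z}. F f g w = H w / (w - z) ^ n)"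
    if f: "f \<in> L2" "L2_norm f \<le> 1" and g: "g \<in> L2" for f g z
    using mero [of z]
  proof
    assume "regular_at (graph_norm V) A z"
    then obtain r where r: "r > 0" "holomorphic_family (graph_norm V) (ball z r) A" by (auto simp: regular_at_def)
    have "\<forall>w\<in>ball z r - {z}. F f g w = (\<integral>x. g x * A w f x \<partial>lborel) / (w - z) ^ 0"
      using F_reg [OF r(2) _ f g] by simp
    with r(1) pairing_holomorphic [OF r(2) open_ball f g] show ?thesis by blast
  next
    assume "pole_at (graph_norm V) A z"
    then obtain r n B where r: "r > 0" "holomorphic_family (graph_norm V) (ball z r) B"
      and AB: "\<And>w f. w \<in> ball z r - {z} \<Longrightarrow> f \<in> L2 \<Longrightarrow> ae_eq (A w f) (\<lambda>x. B w f x / (w - z) ^ n)"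
      unfolding pole_at_def by blast
    have "\<forall>w\<in>ball z r - {z}. F f g w = (\<integral>x. g x * B w f x \<partial>lborel) / (w - z) ^ n"
      using F_pole [OF r(2) _ AB f g] f by blast
    with r(1) pairing_holomorphic [OF r(2) open_ball f g] show ?thesis by blast
  qed
  \<comment> \<open>On this open set no square is an eigenvalue, so the continuation and
    \<open>A0\<close> both equal the cut-off resolvent there.\<close>
  define U where "U = {w. Im w > 0} \<inter> {w. cmod w > mass}"
  have "open U" unfolding U_def by (intro open_Int open_Collect_less continuous_intros)
  moreover have "U \<noteq> {}"
  proof -
    have "Complex 0 (mass + 1) \<in> U" using mass_pos by (simp add: U_def cmod_def)
    then show ?thesis by blast
  qed
  moreover have U_eq: "Wr w * F f g w = E f g w" if "w \<in> U" and f: "f \<in> L2" and g: "g \<in> L2" for w f g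
  proof -
    have w: "Im w > 0" "\<not> op_eigenvalue V (w\<^sup>2)" using that(1) not_op_eigenvalue by (auto simp: U_def)
    have "ae_eq (A w f) (A0 w f)"
      using A w f A0_resolvent [OF w f] ae_eq_sym ae_eq_trans unfolding continues_cutoff_resolvent_def by blast
    moreover have "A0 w f \<in> L2"
      using cutoff_Hdata [OF f, of w] unfolding A0_def [abs_def] by (intro L2_cmult) (simp add: Hdata_def)
    ultimately have "F f g w = (\<integral>x. g x * A0 w f x \<partial>lborel)" unfolding F_def by (intro pair_eq g)
    also have "\<dots> = inverse (Wr w) * E f g w"
      unfolding E_def A0_def by (subst integral_mult_right_zero [symmetric]) (simp add: mult_ac)
    finally show ?thesis using Wr_nonzero [OF w] by simp
  qed
  ultimately have ident: "eventually (\<lambda>w. Wr w * F f g w = E f g w) (at z)"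
    if "f \<in> L2" "L2_norm f \<le> 1" "g \<in> L2" for f g z
    using meromorphic_identity [OF Wr_holomorphic E_hol [OF that] F_loc [OF that], of U] that by blast
  have E_lim: "E f g \<midarrow>z\<rightarrow> E f g z" if "f \<in> L2" "L2_norm f \<le> 1" "g \<in> L2" for f g
    using holomorphic_on_imp_continuous_on [OF E_hol [OF that]] by (simp add: continuous_on_eq_continuous_at isCont_def)
  have W_lim: "Wr \<midarrow>z\<rightarrow> Wr z"
    using holomorphic_on_imp_continuous_on [OF Wr_holomorphic [of UNIV]] by (simp add: continuous_on_eq_continuous_at isCont_def)
  have hol_lim: "h \<midarrow>z\<rightarrow> h z" if "h holomorphic_on ball z r" "r > 0" for h r
    using holomorphic_on_imp_continuous_on [OF that(1)] that(2)
    by (simp add: continuous_on_eq_continuous_at isCont_def)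
  show reg: "regular_at (graph_norm V) A z"
  proof (rule ccontr)
    assume "\<not> regular_at (graph_norm V) A z"
    then have "pole_at (graph_norm V) A z" using mero by blast
    then obtain r n B where r: "r > 0" "holomorphic_family (graph_norm V) (ball z r) B" and n: "n > (0::nat)"
      and nz: "\<not> (\<forall>f\<in>L2. ae_eq (B z f) (\<lambda>x. 0))"
      and AB: "\<And>w f. w \<in> ball z r - {z} \<Longrightarrow> f \<in> L2 \<Longrightarrow> ae_eq (A w f) (\<lambda>x. B w f x / (w - z) ^ n)"
      unfolding pole_at_def by blast
    have zr: "z \<in> ball z r" using r(1) by simp
    have near: "eventually (\<lambda>w. w \<in> ball z r - {z}) (at z)"
      using eventually_at_in_open [of "ball z r" z] r(1) by simp
    have unit: "ae_eq (B z f) (\<lambda>_. 0)" if f: "f \<in> L2" "L2_norm f \<le> 1" for f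
    proof (rule L2_pairing_zero [OF fam_L2 [OF r(2) zr f]])
      fix g :: "real \<Rightarrow> complex" assume g: "g \<in> L2"
      define H where "H w = (\<integral>x. g x * B w f x \<partial>lborel)" for w
      have "H holomorphic_on ball z r" unfolding H_def by (rule pairing_holomorphic [OF r(2) open_ball f g])
      then have 1: "((\<lambda>w. Wr w * H w) \<longlongrightarrow> Wr z * H z) (at z)" by (intro tendsto_mult W_lim hol_lim [OF _ r(1)])
      have 2: "((\<lambda>w. E f g w * (w - z) ^ n) \<longlongrightarrow> E f g z * (z - z) ^ n) (at z)"
        by (intro tendsto_intros E_lim f g)
      have "eventually (\<lambda>w. Wr w * H w = E f g w * (w - z) ^ n) (at z)"
        using near ident [OF f g]
      proof eventually_elim
        case (elim w)
        have wr: "w \<in> ball z r" "w \<noteq> z" using elim(1) by auto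
        have "F f g w = H w / (w - z) ^ n"
          unfolding H_def by (rule F_pole [OF r(2) wr(1) AB [OF elim(1) f(1)] f g])
        then have "H w = F f g w * (w - z) ^ n" using wr(2) by simp
        then have "Wr w * H w = (Wr w * F f g w) * (w - z) ^ n" by (simp only: mult.assoc)
        then show ?case unfolding elim(2) .
      qed
      \<comment> \<open>As n is positive, the right-hand limit contains the factor (z - z)^n = 0: a
        pole at a point where \<open>Wr\<close> is nonzero would have zero leading
        coefficient.\<close>
      from tendsto_unique [OF at_neq_bot Lim_transform_eventually [OF 1 this] 2] n
      have "Wr z * H z = 0" by simp
      then show "(\<integral>x. g x * B z f x \<partial>lborel) = 0" using W by (simp add: H_def)
    qed
    have bo: "bounded_op (graph_norm V) (B z)" using r(2) zr unfolding holomorphic_family_def by blast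
    have "ae_eq (B z f) (\<lambda>_. 0)" if f: "f \<in> L2" for f
    proof -
      \<comment> \<open>Rescaling into the unit ball, where the vanishing is already known; the
        summand 1 avoids a case distinction for norm 0. Linearity of \<open>B z\<close> carries the
        result back.\<close>
      define c where "c = complex_of_real (1 / (L2_norm f + 1))"
      have c0: "c \<noteq> 0" "cmod c * L2_norm f \<le> 1"
      proof -
        have p: "L2_norm f + 1 > 0" using L2_norm_nonneg [of f] by linarith
        then have "cmod c = 1 / (L2_norm f + 1)" unfolding c_def norm_of_real by simp
        then have e: "cmod c * (L2_norm f + 1) = 1" using p by simp
        then show "c \<noteq> 0" by auto
        show "cmod c * L2_norm f \<le> 1" using e norm_ge_zero [of c] unfolding distrib_left by linarith
      qed
      have "ae_eq (B z (\<lambda>x. c * f x + (\<lambda>_. 0) x)) (\<lambda>x. c * B z f x + B z (\<lambda>_. 0) x)"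
      proof -
        have "\<forall>f\<in>L2. \<forall>g\<in>L2. \<forall>c. ae_eq (B z (\<lambda>x. c * f x + g x)) (\<lambda>x. c * B z f x + B z g x)"
          using bo unfolding bounded_op_def by (elim conjE)
        then show ?thesis using f L2_zero by (elim ballE [of _ _ f] ballE [of _ _ "\<lambda>_. 0"] allE [of _ c]) auto
      qed
      moreover have "ae_eq (B z (\<lambda>x. c * f x + (\<lambda>_. 0) x)) (\<lambda>_. 0)"
        using unit [of "\<lambda>x. c * f x"] L2_cmult [OF f] c0(2) by (simp add: L2_norm_cmult)
      moreover have "ae_eq (B z (\<lambda>_. 0)) (\<lambda>_. 0)"
        by (rule unit [OF L2_zero]) (simp add: L2_norm_def)
      ultimately show ?thesis
        unfolding ae_eq_def by eventually_elim (use c0(1) in auto)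
    qed
    with nz show False by blast
  qed
  then obtain r where r: "r > 0" "holomorphic_family (graph_norm V) (ball z r) A" by (auto simp: regular_at_def)
  have zr: "z \<in> ball z r" using r(1) by simp
  show "ae_eq (A z f) (A0 z f)" if f: "f \<in> L2" "L2_norm f \<le> 1" for f
  proof -
    have L: "A z f \<in> L2" "A0 z f \<in> L2"
      using fam_L2 [OF r(2) zr f] cutoff_Hdata [OF f(1), of z] by (auto simp: A0_def [abs_def] Hdata_def intro: L2_cmult)
    have "ae_eq (\<lambda>x. A z f x - A0 z f x) (\<lambda>_. 0)"
    proof (rule L2_pairing_zero [OF L2_diff [OF L]])
      fix g :: "real \<Rightarrow> complex" assume g: "g \<in> L2"
      define H where "H w = (\<integral>x. g x * A w f x \<partial>lborel)" for w
      have "H holomorphic_on ball z r" unfolding H_def by (rule pairing_holomorphic [OF r(2) open_ball f g])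
      then have 1: "((\<lambda>w. Wr w * H w) \<longlongrightarrow> Wr z * H z) (at z)" by (intro tendsto_mult W_lim hol_lim [OF _ r(1)])
      have near: "eventually (\<lambda>w. w \<in> ball z r) (at z)"
        using r(1) by (intro eventually_at_in_open') auto
      have "eventually (\<lambda>w. Wr w * H w = E f g w) (at z)"
        using near ident [OF f g]
      proof eventually_elim
        case (elim w)
        then show ?case using F_reg [OF r(2) elim(1) f g] by (simp add: H_def)
      qed
      from tendsto_unique [OF at_neq_bot Lim_transform_eventually [OF 1 this] E_lim [OF f g]]
      have "H z = inverse (Wr z) * E f g z" using W by (simp add: field_simps)
      moreover have "(\<integral>x. g x * A0 z f x \<partial>lborel) = inverse (Wr z) * E f g z"
        unfolding E_def A0_def by (subst integral_mult_right_zero [symmetric]) (simp add: mult_ac)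
      ultimately show "(\<integral>x. g x * (A z f x - A0 z f x) \<partial>lborel) = 0"
        using L2_integrable_mult [OF g L(1)] L2_integrable_mult [OF g L(2)] by (simp add: H_def right_diff_distrib)
    qed
    then show ?thesis by (simp add: ae_eq_def)
  qed
qed

section \<open>Quantitative bounds in the strip\<close>

lemma sol1_cmult:
  "k * sol1 l c u f x = sol1 l (k * c) (\<lambda>y. k * u y) (\<lambda>y. k * f y) x"
proof -
  have "I (\<lambda>y. Cp l (x - y) * (k * u y)) = k * I (\<lambda>y. Cp l (x - y) * u y)"
    unfolding I_cmult [symmetric] by (simp add: mult_ac)
  moreover have "(\<integral>y. Cp l (x - y) * (k * f y) \<partial>lborel) = k * (\<integral>y. Cp l (x - y) * f y \<partial>lborel)"
    by (subst integral_mult_right_zero [symmetric]) (simp add: mult_ac)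
  ultimately show ?thesis by (simp add: sol1_def algebra_simps)
qed

text \<open>Dividing by \<open>Wr\<close> before estimating is essential: the solution is then of
  size 1/|l| and its derivative of size 1. Since |Im l| is at most 1, the factor |l| coming from l^2
  u is at most |Re l| + 1.\<close>

lemma strip_estimate:
  assumes "\<mu>0 > 0"
  obtains C \<epsilon> where "C > 0" "\<epsilon> > 0" "\<epsilon> \<le> 1"
    "\<And>l. \<bar>Re l\<bar> \<ge> \<mu>0 \<Longrightarrow> \<bar>Im l\<bar> \<le> \<epsilon> \<Longrightarrow> Wr l \<noteq> 0"
    "\<And>l g. \<bar>Re l\<bar> \<ge> \<mu>0 \<Longrightarrow> \<bar>Im l\<bar> \<le> \<epsilon> \<Longrightarrow> g \<in> L2 \<Longrightarrow> L2_norm g \<le> 1 \<Longrightarrow>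
       \<exists>u1 u2. Hdata (A0 l g) u1 u2 \<and> L2_norm (A0 l g) \<le> C / \<bar>Re l\<bar> \<and> L2_norm u1 \<le> C \<and> L2_norm u2 \<le> C * (\<bar>Re l\<bar> + 1)"
proof -
  obtain c \<epsilon> where c: "c > 0" "0 < \<epsilon>" "\<epsilon> \<le> 1"
    "\<And>l. \<bar>Re l\<bar> \<ge> \<mu>0 \<Longrightarrow> \<bar>Im l\<bar> \<le> \<epsilon> \<Longrightarrow> c * cmod l \<le> cmod (Wr l)"
    using Wr_lower_bound [OF assms] by metis
  obtain D where D: "D \<ge> 1" "\<And>x. cmod (\<psi>c x) \<le> D * indicator {-L..L} x"
    "\<And>x. cmod (vderiv \<psi>c x) \<le> D * indicator {-L..L} x" "\<And>x. cmod (vderiv (vderiv \<psi>c) x) \<le> D * indicator {-L..L} x"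
    using chi_bounds by metis
  show ?thesis
  proof (rule strip_bounds [OF R_le_L zero_le_one])
    fix K :: real assume K: "K \<ge> 1"
      "\<And>l x. \<bar>Im l\<bar> \<le> 1 \<Longrightarrow> \<bar>x\<bar> \<le> L \<Longrightarrow> cmod (em l x) \<le> K"
      "\<And>l. \<bar>Im l\<bar> \<le> 1 \<Longrightarrow> cmod (Wr l - 2 * \<i> * l) \<le> K"
      "\<And>l x f s. \<bar>Im l\<bar> \<le> 1 \<Longrightarrow> \<bar>x\<bar> \<le> L \<Longrightarrow> source L f \<Longrightarrow> (\<And>t. \<bar>t\<bar> \<le> 2 * L \<Longrightarrow> cmod (Sp l t) \<le> s) \<Longrightarrow>
         cmod (pv f l x) \<le> K * s * (\<integral>y. cmod (f y) \<partial>lborel)"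
      "\<And>l f s. \<bar>Im l\<bar> \<le> 1 \<Longrightarrow> source L f \<Longrightarrow> (\<And>t. \<bar>t\<bar> \<le> 2 * L \<Longrightarrow> cmod (Sp l t) \<le> s) \<Longrightarrow>
         cmod (Nf f l) \<le> K * (1 + s) * (\<integral>y. cmod (f y) \<partial>lborel)"
    \<comment> \<open>For |Im l| at most 1 and t at most 2 L the modulus of sin(l t) is bounded by
      \<open>X\<close> on the positive side, so the causal kernel is at most X/|l|.\<close>
    define X where "X = exp (2 * L)"
    have X: "X > 0" by (simp add: X_def)
    define N where "N = 2 * L + 1"
    have N: "N > 0" using L_pos by (simp add: N_def)
    \<comment> \<open>Bounds |l| times the Jost coefficient Nf/Wr: the 1/c comes from the lower
      bound on \<open>Wr\<close>, and 1 + X/\<mu>0 dominates 1 + s for s = X/|l|.\<close>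
    define n where "n = K * (1 + X / \<mu>0) * N / c"
    have n: "n > 0" using K(1) X N c(1) assms by (auto simp: n_def intro!: mult_pos_pos divide_pos_pos add_pos_pos)
    \<comment> \<open>Bounds |l| times the solution on [-L, L]; the two summands come from
      \<open>pv\<close> and from the multiple of \<open>em\<close>.\<close>
    define \<beta> where "\<beta> = K * X * N + n * K"
    have \<beta>: "\<beta> > 0" using K(1) X N n by (auto simp: \<beta>_def intro!: mult_pos_pos add_pos_pos)
    \<comment> \<open>Bounds the derivative on [-L, L] through \<open>sol1_bound\<close> with b = 1,
      whose exponential factor is again \<open>X\<close>. The summand \<open>n\<close> is |l| times
      the Jost coefficient.\<close>
    define \<beta>1 where "\<beta>1 = X * (n + mass * (\<beta> / \<mu>0) + N)"
    have \<beta>1: "\<beta>1 > 0" using X n mass_pos \<beta> N assms by (auto simp: \<beta>1_def intro!: mult_pos_pos divide_pos_pos add_pos_pos)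
    define M where "M = 2 * \<beta> + 1 + 2 * \<beta>1 + \<beta> / \<mu>0"
    have M: "M > 0" "\<beta> \<le> M" "\<beta>1 + \<beta> / \<mu>0 \<le> M"
      using \<beta> \<beta>1 divide_pos_pos [OF \<beta> assms] by (auto simp: M_def)
    define C where "C = D * M * (2 * L + 2)"
    have C: "C > 0" using D(1) M(1) L_pos by (simp add: C_def)
    show ?thesis
    proof (rule that [OF C c(2,3)])
      fix l assume l: "\<bar>Re l\<bar> \<ge> \<mu>0" "\<bar>Im l\<bar> \<le> \<epsilon>"
      have lR: "\<bar>Re l\<bar> \<le> cmod l" by (rule abs_Re_le_cmod)
      have lp: "cmod l > 0" and l\<mu>: "\<mu>0 \<le> cmod l" using lR l assms by linarith+
      have Im: "\<bar>Im l\<bar> \<le> 1" using l c(3) by simp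
      have l1: "cmod l \<le> \<bar>Re l\<bar> + 1" using cmod_le [of l] Im by linarith
      have Wp: "cmod (Wr l) > 0" using c(4) [OF l] mult_pos_pos [OF c(1) lp] by linarith
      then show W0: "Wr l \<noteq> 0" by auto
      have kW: "1 / cmod (Wr l) \<le> 1 / (c * cmod l)"
        using c(4) [OF l] mult_pos_pos [OF Wp mult_pos_pos [OF c(1) lp]] by (intro divide_left_mono) auto
      fix g assume g: "g \<in> L2" "L2_norm g \<le> 1"
      define f where "f = cut g"
      have f: "source L f" unfolding f_def by (rule cut_source [OF g(1)])
      have fN: "(\<integral>y. cmod (f y) \<partial>lborel) \<le> N"
        unfolding N_def f_def using L_pos by (intro source_L1_bound [OF g cut_source [OF g(1)]] cut_le) auto
      have S: "cmod (Sp l t) \<le> X / cmod l" if "\<bar>t\<bar> \<le> 2 * L" for t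
      proof -
        have "\<bar>Im l\<bar> * max 0 t \<le> 1 * (2 * L)" using that Im L_pos by (intro mult_mono) auto
        then have "cmod l * cmod (Sp l t) \<le> X"
          unfolding X_def by (intro order_trans [OF norm_mult_Sp_le]) simp
        then show ?thesis using lp by (simp add: field_simps)
      qed
      define k where "k = inverse (Wr l)"
      have pv: "cmod (pv f l x) \<le> K * X * N / cmod l" if x: "\<bar>x\<bar> \<le> L" for x
      proof -
        have "cmod (pv f l x) \<le> K * (X / cmod l) * (\<integral>y. cmod (f y) \<partial>lborel)" by (rule K(4) [OF Im x f S])
        also have "\<dots> \<le> K * (X / cmod l) * N" using K(1) X lp fN by (intro mult_left_mono) auto
        finally show ?thesis by simp
      qed
      have kN: "cmod (k * Nf f l) \<le> n / cmod l"
      proof -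
        have "cmod (Nf f l) \<le> K * (1 + X / cmod l) * (\<integral>y. cmod (f y) \<partial>lborel)" by (rule K(5) [OF Im f S])
        also have "\<dots> \<le> K * (1 + X / \<mu>0) * N"
        proof -
          have "X / cmod l \<le> X / \<mu>0" using X assms l\<mu> lp by (intro divide_left_mono) auto
          then show ?thesis using K(1) X lp fN N assms by (intro mult_mono) auto
        qed
        finally have "cmod k * cmod (Nf f l) \<le> (1 / (c * cmod l)) * (K * (1 + X / \<mu>0) * N)"
          using kW c(1) lp by (intro mult_mono) (auto simp: k_def norm_inverse divide_inverse)
        then show ?thesis using c(1) lp by (simp add: norm_mult n_def)
      qed
      have kbu: "cmod (k * bu f l x) \<le> \<beta> / cmod l" if x: "\<bar>x\<bar> \<le> L" for x
      proof -
        have "k * bu f l x = pv f l x + (k * Nf f l) * em l x" using W0 by (simp add: bu_def k_def field_simps)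
        moreover have "cmod ((k * Nf f l) * em l x) \<le> (n / cmod l) * K"
          unfolding norm_mult [of "k * Nf f l"] using kN K(2) [OF Im x] K(1) n lp by (intro mult_mono) auto
        ultimately have "cmod (k * bu f l x) \<le> K * X * N / cmod l + (n / cmod l) * K"
          using pv [OF x] by (metis norm_triangle_mono)
        then show ?thesis by (simp add: \<beta>_def add_divide_distrib)
      qed
      have \<beta>l: "\<beta> / cmod l \<le> \<beta> / \<mu>0" using \<beta> assms l\<mu> lp by (intro divide_left_mono) auto
      have kbu1: "cmod (k * bu1 f l x) \<le> \<beta>1" if x: "\<bar>x\<bar> \<le> L" for x
      proof -
        have eq: "(\<lambda>y. k * (Wr l * f y)) = f" using W0 by (simp add: k_def fun_eq_iff)
        have "k * bu1 f l x = sol1 l (k * Nf f l) (\<lambda>y. k * bu f l y) f x"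
          unfolding bu1_def sol1_cmult eq ..
        also have "cmod \<dots> \<le> exp (2 * 1 * L) * (cmod l * cmod (k * Nf f l) + mass * (\<beta> / \<mu>0) + (\<integral>y. cmod (f y) \<partial>lborel))"
          by (rule sol1_bound [OF R_le_L zero_le_one Im x f order_trans [OF kbu \<beta>l]]) (use R_le_L in auto)
        also have "\<dots> \<le> exp (2 * 1 * L) * (n + mass * (\<beta> / \<mu>0) + N)"
        proof -
          have "cmod l * cmod (k * Nf f l) \<le> n" using kN lp by (simp add: field_simps)
          then show ?thesis by (intro mult_left_mono add_mono [OF add_mono [OF _ order_refl] fN]) auto
        qed
        finally show ?thesis by (simp add: \<beta>1_def X_def)
      qed
      have kWr: "cmod (k * Wr l) \<le> 1" using W0 by (simp add: k_def)
      have b0: "\<beta> / cmod l \<ge> 0" "\<beta>1 \<ge> 0" using \<beta> \<beta>1 lp by auto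
      have A0: "A0 l g = (\<lambda>x. k * ub l g x)" by (auto simp: A0_def k_def)
      define u1 where "u1 x = k * ub1 l g x" for x
      define u2 where "u2 x = k * ub2 l g x" for x
      have H: "Hdata (A0 l g) u1 u2"
        unfolding A0 u1_def u2_def by (rule Hdata_cmult [OF cutoff_Hdata [OF g(1)]])
      have P: "cmod (A0 l g x) \<le> D * (\<beta> / cmod l) * indicator {-L..L} x"
        "cmod (u1 x) \<le> D * (\<beta>1 + \<beta> / cmod l) * indicator {-L..L} x"
        "cmod (u2 x) \<le> D * ((cmod l)\<^sup>2 * (\<beta> / cmod l) + 1 + 2 * \<beta>1 + \<beta> / cmod l) * (1 + cmod (g x)) * indicator {-L..L} x" for x
        unfolding A0 u1_def u2_def
        by (rule ub_pointwise [OF D b0(1) kbu [unfolded f_def] b0(2) kbu1 [unfolded f_def] kWr]; assumption)+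
      have le: "c * indicator {-L..L} x \<le> c * (1 + cmod (g x)) * indicator {-L..L} x" if "c \<ge> 0" for c x :: real
        using that by (auto simp: indicator_def mult_left_mono algebra_simps)
      have m: "A0 l g \<in> borel_measurable borel" "u1 \<in> borel_measurable borel" "u2 \<in> borel_measurable borel"
        using H by (auto simp: Hdata_def intro: L2_borel)
      have c1: "D * (\<beta> / cmod l) \<ge> 0" "D * (\<beta>1 + \<beta> / cmod l) \<ge> 0"
        "D * ((cmod l)\<^sup>2 * (\<beta> / cmod l) + 1 + 2 * \<beta>1 + \<beta> / cmod l) \<ge> 0"
        using D(1) \<beta> \<beta>1 by (auto intro!: mult_nonneg_nonneg add_nonneg_nonneg divide_nonneg_nonneg)
      have Lp: "2 * L + 2 > 0" using L_pos by simp
      have "L2_norm (A0 l g) \<le> D * (\<beta> / cmod l) * (2 * L + 2)"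
        by (rule L2_dominated(2) [OF g m(1) c1(1) less_imp_le [OF L_pos] order_trans [OF P(1) le [OF c1(1)]]])
      also have "\<dots> \<le> D * (M / \<bar>Re l\<bar>) * (2 * L + 2)"
      proof -
        have "\<beta> / cmod l \<le> M / \<bar>Re l\<bar>" using M \<beta> lR l assms by (intro frac_le) auto
        then show ?thesis using D(1) Lp by (intro mult_right_mono mult_left_mono) auto
      qed
      also have "\<dots> = C / \<bar>Re l\<bar>" by (simp add: C_def)
      finally have n0: "L2_norm (A0 l g) \<le> C / \<bar>Re l\<bar>" .
      have "L2_norm u1 \<le> D * (\<beta>1 + \<beta> / cmod l) * (2 * L + 2)"
        by (rule L2_dominated(2) [OF g m(2) c1(2) less_imp_le [OF L_pos] order_trans [OF P(2) le [OF c1(2)]]])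
      also have "\<dots> \<le> D * M * (2 * L + 2)"
        using D(1) Lp M(3) \<beta>l by (intro mult_right_mono mult_left_mono) auto
      finally have n1: "L2_norm u1 \<le> C" by (simp add: C_def)
      have "L2_norm u2 \<le> D * ((cmod l)\<^sup>2 * (\<beta> / cmod l) + 1 + 2 * \<beta>1 + \<beta> / cmod l) * (2 * L + 2)"
        by (rule L2_dominated(2) [OF g m(3) c1(3) less_imp_le [OF L_pos] P(3)])
      also have "\<dots> \<le> D * (M * (\<bar>Re l\<bar> + 1)) * (2 * L + 2)"
      proof -
        have "(cmod l)\<^sup>2 * (\<beta> / cmod l) = cmod l * \<beta>" using lp by (simp add: power2_eq_square)
        also have "\<dots> \<le> (\<bar>Re l\<bar> + 1) * \<beta>" using l1 \<beta> by (intro mult_right_mono) auto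
        finally have "(cmod l)\<^sup>2 * (\<beta> / cmod l) + 1 + 2 * \<beta>1 + \<beta> / cmod l \<le> (\<bar>Re l\<bar> + 1) * \<beta> + (1 + 2 * \<beta>1 + \<beta> / \<mu>0) * 1"
          using \<beta>l by simp
        also have "\<dots> \<le> (\<bar>Re l\<bar> + 1) * \<beta> + (1 + 2 * \<beta>1 + \<beta> / \<mu>0) * (\<bar>Re l\<bar> + 1)"
          using \<beta> \<beta>1 assms by (intro add_left_mono mult_left_mono) auto
        also have "\<dots> = (\<beta> + 1 + 2 * \<beta>1 + \<beta> / \<mu>0) * (\<bar>Re l\<bar> + 1)" by (simp add: algebra_simps)
        also have "\<dots> \<le> M * (\<bar>Re l\<bar> + 1)" using \<beta> by (intro mult_right_mono) (auto simp: M_def)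
        finally show ?thesis using D(1) Lp by (intro mult_right_mono mult_left_mono) auto
      qed
      also have "\<dots> = C * (\<bar>Re l\<bar> + 1)" by (simp add: C_def)
      finally have n2: "L2_norm u2 \<le> C * (\<bar>Re l\<bar> + 1)" .
      show "\<exists>u1 u2. Hdata (A0 l g) u1 u2 \<and> L2_norm (A0 l g) \<le> C / \<bar>Re l\<bar> \<and> L2_norm u1 \<le> C \<and> L2_norm u2 \<le> C * (\<bar>Re l\<bar> + 1)"
        using H n0 n1 n2 by blast
    qed
  qed
qed

text \<open>\<open>A0\<close> shows that a continuation exists, so the chosen
  \<open>cutoff_resolvent\<close> is one, and by uniqueness it inherits the strip estimates on the
  unit ball.\<close>

lemma cutoff_resolvent_bounds:
  assumes "\<mu>0 > 0"
  shows "\<exists>C \<epsilon>\<^sub>0 :: real. C > 0 \<and> \<epsilon>\<^sub>0 > 0 \<and>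
    (\<forall>\<mu> :: complex. \<bar>Re \<mu>\<bar> \<ge> \<mu>0 \<and> \<bar>Im \<mu>\<bar> \<le> \<epsilon>\<^sub>0 \<longrightarrow>
       regular_at (graph_norm V) (cutoff_resolvent V \<psi>) \<mu> \<and>
       (\<forall>k\<in>{0, 1::nat}.
          op_norm (sobolev_norm k) (cutoff_resolvent V \<psi> \<mu>)
            \<le> ennreal (C * \<bar>Re \<mu>\<bar> powi (int k - 1))) \<and>
       op_norm (graph_norm V) (cutoff_resolvent V \<psi> \<mu>) \<le> ennreal (C * (\<bar>Re \<mu>\<bar> + 1)))"
proof (rule strip_estimate [OF assms])
  fix C \<epsilon> :: real
  assume C: "C > 0" and \<epsilon>: "\<epsilon> > 0"
    and W: "\<And>l. \<bar>Re l\<bar> \<ge> \<mu>0 \<Longrightarrow> \<bar>Im l\<bar> \<le> \<epsilon> \<Longrightarrow> Wr l \<noteq> 0"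
    and est: "\<And>l g. \<bar>Re l\<bar> \<ge> \<mu>0 \<Longrightarrow> \<bar>Im l\<bar> \<le> \<epsilon> \<Longrightarrow> g \<in> L2 \<Longrightarrow> L2_norm g \<le> 1 \<Longrightarrow>
       \<exists>u1 u2. Hdata (A0 l g) u1 u2 \<and> L2_norm (A0 l g) \<le> C / \<bar>Re l\<bar> \<and> L2_norm u1 \<le> C \<and> L2_norm u2 \<le> C * (\<bar>Re l\<bar> + 1)"
  define A where "A = cutoff_resolvent V \<psi>"
  have A: "continues_cutoff_resolvent V \<psi> A"
    unfolding A_def cutoff_resolvent_def
    by (rule someI [where P = "continues_cutoff_resolvent V \<psi>"], rule A0_continues)
  \<comment> \<open>The additional multiples of C/\<mu>0 absorb the \<open>L2\<close> part of the
    Sobolev and graph norms, which is at most C/|Re l| and hence at most C/\<mu>0.\<close>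
  define C' where "C' = C + C / \<mu>0 + C / \<mu>0"
  have C': "C \<le> C'" "C + C / \<mu>0 \<le> C'" "C' > 0" using C divide_pos_pos [OF C assms] unfolding C'_def by linarith+
  have "regular_at (graph_norm V) A l \<and>
     (\<forall>k\<in>{0, 1::nat}. op_norm (sobolev_norm k) (A l) \<le> ennreal (C' * \<bar>Re l\<bar> powi (int k - 1))) \<and>
     op_norm (graph_norm V) (A l) \<le> ennreal (C' * (\<bar>Re l\<bar> + 1))"
    if l: "\<mu>0 \<le> \<bar>Re l\<bar>" "\<bar>Im l\<bar> \<le> \<epsilon>" for l
  proof -
    note W0 = W [OF l]
    note reg = continuation_unique(1) [OF A W0]
    have Rp: "\<bar>Re l\<bar> > 0" using l assms by linarith
    have bo: "bounded_op (graph_norm V) (A l)"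
      using reg unfolding regular_at_def holomorphic_family_def by (metis centre_in_ball)
    have key: "sobolev_norm 0 (A l g) \<le> ennreal (C' * (1 / \<bar>Re l\<bar>)) \<and> sobolev_norm 1 (A l g) \<le> ennreal C' \<and>
        graph_norm V (A l g) \<le> ennreal (C' * (\<bar>Re l\<bar> + 1))" if g: "g \<in> L2" "L2_norm g \<le> 1" for g
    proof -
      obtain u1 u2 where H: "Hdata (A0 l g) u1 u2" and n: "L2_norm (A0 l g) \<le> C / \<bar>Re l\<bar>" "L2_norm u1 \<le> C" "L2_norm u2 \<le> C * (\<bar>Re l\<bar> + 1)"
        using est [OF l g] by blast
      have eq: "ae_eq (A l g) (A0 l g)" by (rule continuation_unique(2) [OF A W0 g])
      have L: "A l g \<in> L2" "A0 l g \<in> L2"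
        using op_domain_L2 [OF bounded_op_domain [OF bo g]] H by (auto simp: Hdata_def)
      have "C / \<bar>Re l\<bar> \<le> C / \<mu>0" using C assms l by (intro divide_left_mono) auto
      note n' = order_trans [OF n(1) this]
      have sq: "sqrt (a\<^sup>2 + b\<^sup>2) \<le> a + b" if "a \<ge> 0" "b \<ge> 0" for a b :: real
        using that by (rule sqrt_sum_squares_le_sum)
      have "C / \<bar>Re l\<bar> \<le> C' * (1 / \<bar>Re l\<bar>)" using C' Rp by (simp add: divide_right_mono)
      then have 0: "sobolev_norm 0 (A l g) \<le> ennreal (C' * (1 / \<bar>Re l\<bar>))"
        unfolding sobolev_norm_cong [OF eq L] sobolev_norm_Hdata(1) [OF H] using n(1) by (intro ennreal_leI) linarith
      have "sqrt ((L2_norm (A0 l g))\<^sup>2 + (L2_norm u1)\<^sup>2) \<le> C'"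
        using sq [OF L2_norm_nonneg [of "A0 l g"] L2_norm_nonneg [of u1]] n' n(2) C'(2) by linarith
      then have 1: "sobolev_norm 1 (A l g) \<le> ennreal C'"
        unfolding sobolev_norm_cong [OF eq L] sobolev_norm_Hdata(2) [OF H] by (rule ennreal_leI)
      have "C * (\<bar>Re l\<bar> + 1) + C / \<mu>0 \<le> C' * (\<bar>Re l\<bar> + 1)"
      proof -
        have "C / \<mu>0 * 1 \<le> C / \<mu>0 * (\<bar>Re l\<bar> + 1)" using C assms by (intro mult_left_mono) auto
        then have "C * (\<bar>Re l\<bar> + 1) + C / \<mu>0 \<le> (C + C / \<mu>0) * (\<bar>Re l\<bar> + 1)" by (simp add: distrib_right)
        also have "\<dots> \<le> C' * (\<bar>Re l\<bar> + 1)" using C'(2) by (intro mult_right_mono) auto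
        finally show ?thesis .
      qed
      then have "sqrt ((L2_norm u2)\<^sup>2 + (L2_norm (A0 l g))\<^sup>2) \<le> C' * (\<bar>Re l\<bar> + 1)"
        using sq [OF L2_norm_nonneg [of u2] L2_norm_nonneg [of "A0 l g"]] n' n(3) by linarith
      then have 2: "graph_norm V (A l g) \<le> ennreal (C' * (\<bar>Re l\<bar> + 1))"
        unfolding graph_norm_cong [OF eq L] graph_norm_Hdata [OF H] by (rule ennreal_leI)
      show ?thesis using 0 1 2 by blast
    qed
    have "op_norm (sobolev_norm 0) (A l) \<le> ennreal (C' * (1 / \<bar>Re l\<bar>))"
      "op_norm (sobolev_norm 1) (A l) \<le> ennreal C'"
      "op_norm (graph_norm V) (A l) \<le> ennreal (C' * (\<bar>Re l\<bar> + 1))"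
      unfolding op_norm_def using key by (auto intro!: SUP_least)
    then show ?thesis using reg by (simp add: power_int_minus divide_inverse)
  qed
  note bounds = this
  show ?thesis
    unfolding A_def [symmetric]
    by (rule exI [of _ C'], rule exI [of _ \<epsilon>], rule conjI [OF C'(3) conjI [OF \<epsilon>]],
        intro allI impI, elim conjE, rule bounds)
qed

end

theorem theorem1p8:
  fixes V :: "real set \<Rightarrow> real" and R\<^sub>0 \<mu>\<^sub>0 :: real and \<psi> :: "real \<Rightarrow> real"
  assumes "signed_borel_measure V"
    and "R\<^sub>0 > 0"
    and "measure_supported_in V {-R\<^sub>0..R\<^sub>0}"
    and "test_function \<psi>"
    and "range \<psi> \<subseteq> {0..1}"
    and "\<exists>U. open U \<and> {-R\<^sub>0..R\<^sub>0} \<subseteq> U \<and> (\<forall>x\<in>U. \<psi> x = 1)"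
    and "\<mu>\<^sub>0 > 0"
  shows "\<exists>C \<epsilon>\<^sub>0 :: real. C > 0 \<and> \<epsilon>\<^sub>0 > 0 \<and>
    (\<forall>\<mu> :: complex. \<bar>Re \<mu>\<bar> \<ge> \<mu>\<^sub>0 \<and> \<bar>Im \<mu>\<bar> \<le> \<epsilon>\<^sub>0 \<longrightarrow>
       regular_at (graph_norm V) (cutoff_resolvent V \<psi>) \<mu> \<and>
       (\<forall>k\<in>{0, 1::nat}.
          op_norm (sobolev_norm k) (cutoff_resolvent V \<psi> \<mu>)
            \<le> ennreal (C * \<bar>Re \<mu>\<bar> powi (int k - 1))) \<and>
       op_norm (graph_norm V) (cutoff_resolvent V \<psi> \<mu>) \<le> ennreal (C * (\<bar>Re \<mu>\<bar> + 1)))"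
proof -
  obtain U where U: "open U" "{-R\<^sub>0..R\<^sub>0} \<subseteq> U" "\<And>x. x \<in> U \<Longrightarrow> \<psi> x = 1" using assms(6) by blast
  have "compact {-R\<^sub>0..R\<^sub>0}" by simp
  from compact_subset_open_imp_ball_epsilon_subset [OF this U(1,2)]
  obtain e where e: "e > 0" "(\<Union>x\<in>{-R\<^sub>0..R\<^sub>0}. ball x e) \<subseteq> U" by blast
  \<comment> \<open>Half of the margin \<open>e\<close>: strictly beyond the interval that supports
    the measure, yet still inside the set where the cutoff is 1.\<close>
  define R1 where "R1 = R\<^sub>0 + e / 2"
  have one: "\<psi> x = 1" if "\<bar>x\<bar> \<le> R1" for x
  proof (rule U(3))
    \<comment> \<open>The point of the interval nearest to x, at distance at most e/2.\<close>
    define y where "y = max (- R\<^sub>0) (min R\<^sub>0 x)"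
    have "y \<in> {-R\<^sub>0..R\<^sub>0}" "x \<in> ball y e"
      using that assms(2) e(1) by (auto simp: y_def R1_def dist_real_def)
    then show "x \<in> U" using e(2) by blast
  qed
  obtain B where B: "B > 0" "\<And>x. \<bar>x\<bar> > B \<Longrightarrow> \<psi> x = 0" using assms(4) test_function_support by blast
  \<comment> \<open>The summand 1 gives the strict inequality between R1 and L.\<close>
  define L where "L = max B R1 + 1"
  have V': "signed_borel_measure (\<lambda>A. - V A)" "measure_supported_in (\<lambda>A. - V A) {-R\<^sub>0..R\<^sub>0}"
    using assms signed_borel_measure_uminus measure_supported_in_uminus by auto
  have cm: "compact_measure (upper_variation W) R\<^sub>0"
    if "signed_borel_measure W" "measure_supported_in W {-R\<^sub>0..R\<^sub>0}" for W
    unfolding compact_measure_def compact_measure_axioms_def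
    using finite_measure_upper_variation [OF that(1)] upper_variation_support [OF that(2)] assms(2) by simp
  interpret signed_pair "upper_variation V" "upper_variation (\<lambda>A. - V A)" R\<^sub>0
    unfolding signed_pair_def using cm assms V' by blast
  have "bump \<psi>"
    using assms(4,5) one [of 0] assms(2) e(1) by unfold_locales (auto simp: R1_def image_subset_iff)
  then interpret cutoff_op "upper_variation V" "upper_variation (\<lambda>A. - V A)" R\<^sub>0 \<psi> V L R1
  proof (intro cutoff_op.intro schrodinger_op.intro signed_pair_axioms)
    show "schrodinger_op_axioms (upper_variation V) (upper_variation (\<lambda>A. - V A)) V"
      by unfold_locales (simp add: signed_integral_def I_def)
    show "cutoff_op_axioms R\<^sub>0 \<psi> L R1"
      using assms(5) one B e(1) by unfold_locales (auto simp: R1_def L_def image_subset_iff)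
  qed
  show ?thesis by (rule cutoff_resolvent_bounds [OF assms(7)])
qed

end
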